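(* Assume the two-sample network setting described in the context, and apply the following multiple testing procedure at level $0<\alpha<1$: let $R(h)=\sum_{1\le i<j\le p}I(|T_{i,j}|\ge h)$, $\widehat{\mathrm{FDP}}(h)=2q\{1-\Phi(h)\}/\{R(h)\vee1\}$, $\hat h=\inf\{h:0\le h\le(2\log q)^{1/2},\ \widehat{\mathrm{FDP}}(h)\le\alpha\}$ (with $\hat h=(2\log q)^{1/2}$ if this set is empty), and reject $H_{0,i,j}:s_{1,i,j}=s_{2,i,j}$ iff $|T_{i,j}|\ge\hat h$. Let $\mathrm{FDP}=R_0(\hat h)/\{R(\hat h)\vee1\}$ with $R_0(h)=\sum_{(i,j)\in\mathcal{H}_0}I(|T_{i,j}|\ge h)$, and $\mathrm{FDR}=\mathbb{E}(\mathrm{FDP})$. Suppose (A2), (B1), (B2), (B3) hold and one of (C1) and (C2) holds. Then $$\lim_{(n_1,n_2,q)\to\infty}\frac{\mathrm{FDR}}{\alpha q_0/q}=1,\qquad\text{and}\qquad \frac{\mathrm{FDP}}{\alpha q_0/q}\to1\ \text{in probability as }n_1,n_2,q\to\infty.$$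
   Context: Setting: for $d=1,2$, $\boldsymbol{S}_{d,1},\dots,\boldsymbol{S}_{d,n_d}$ are i.i.d. random symmetric $p\times p$ matrices $\boldsymbol{S}_{d,l}=(S_{d,l,i,j})$ with symmetric mean matrix $\boldsymbol{s}_d=(s_{d,i,j})$, and the two samples are independent. Let $n=n_1n_2/(n_1+n_2)$ and assume $n_1\asymp n_2$. Let $q=p(p-1)/2$. Define $\bar S_{d,i,j}=n_d^{-1}\sum_{l}S_{d,l,i,j}$, $V_{d,i,j}=n_d^{-1}\sum_{l}(S_{d,l,i,j}-\bar S_{d,i,j})^2$, $T_{i,j}=(\bar S_{1,i,j}-\bar S_{2,i,j})/(V_{1,i,j}/n_1+V_{2,i,j}/n_2)^{1/2}$ for $1\le i<j\le p$. $\Phi$ is the standard normal CDF. $\mathcal{H}_0=\{(i,j):1\le i<j\le p,\ s_{1,i,j}=s_{2,i,j}\}$ and $q_0=|\mathcal{H}_0|$. Let $\boldsymbol{R}_d=(r_{d,i,j})\in\mathbb{R}^{q\times q}$ be the correlation matrix of $\mathrm{vech}(\boldsymbol{S}_{d,l})$ (the vector of strictly upper-triangular entries, indexed $1,\dots,q$). (A2): $\max_{d=1,2}\max_{1\le i<j\le q}|r_{d,i,j}|<r<1$ for some constant $0<r<1$. For $\xi>0$ and $1\le i\le q$, $\mathcal{A}_i(\xi)=\{j:\max(|r_{1,i,j}|,|r_{2,i,j}|)\ge(\log q)^{-2-\xi}\}$. For $\rho>0$, $\mathcal{S}_\rho=\{(i,j):1\le i<j\le p,\ |s_{1,i,j}-s_{2,i,j}|/\{\mathrm{Var}(S_{1,l,i,j})/n_1+\mathrm{Var}(S_{2,l,i,j})/n_2\}^{1/2}\ge(\log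 q)^{1/2+\rho}\}$. (B1): $|\mathcal{S}_\rho|\ge[1/(\pi^{1/2}\alpha)+\delta](\log q)^{1/2}$ for some constant $\delta>0$ and any sufficiently small constant $\rho>0$. (B2): $\max_{1\le i\le q}|\mathcal{A}_i(\xi)|=o(q^\nu)$ for some constants $\xi>0$ and $0<\nu<(1-r)/(1+r)$, with $r$ from (A2). (B3): $q_0\ge c_1q$ for some constant $c_1>0$. (C1) (sub-Gaussian tail): $\log p=o(n^{1/5})$, and there are constants $\eta>0$, $K>0$ with $\mathbb{E}[\exp\{\eta(S_{d,l,i,j}-s_{d,i,j})^2/\mathrm{Var}(S_{d,l,i,j})\}]\le K$ for all $1\le i<j\le p$, $l$, $d=1,2$. (C2) (polynomial tail): $p\le cn^{\gamma_0}$ for some constants $\gamma_0,c>0$, and there are constants $\epsilon>0$, $K>0$ with $\mathbb{E}\{|(S_{d,l,i,j}-s_{d,i,j})/\mathrm{Var}(S_{d,l,i,j})^{1/2}|^{4\gamma_0+2+\epsilon}\}\le K$ for all $1\le i<j\le p$, $l$, $d=1,2$. *)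

theory Defs
  imports "HOL-Probability.Probability" "HOL-Library.Landau_Symbols"
begin

text \<open>Conventions. A sample X of one problem instance is a function
  X d l \<omega> i j = entry (i,j) of the l-th random matrix of sample d (d = 1,2,
  l = 1..n_d, 1 <= i,j <= p) at outcome \<omega>.
  Pairs (i,j) with 1 <= i < j <= p index the q = p(p-1)/2 hypotheses.\<close>

definition pairs :: "nat \<Rightarrow> (nat \<times> nat) set" where
  "pairs p = {(i, j). 1 \<le> i \<and> i < j \<and> j \<le> p}"

definition qnum :: "nat \<Rightarrow> nat" where
  "qnum p = p * (p - 1) div 2"

definition mean :: "'a measure \<Rightarrow> ('a \<Rightarrow> real) \<Rightarrow> real" where
  "mean M Y = (\<integral>\<omega>. Y \<omega> \<partial>M)"

definition var :: "'a measure \<Rightarrow> ('a \<Rightarrow> real) \<Rightarrow> real" where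
  "var M Y = (\<integral>\<omega>. (Y \<omega> - mean M Y)\<^sup>2 \<partial>M)"

definition corr :: "'a measure \<Rightarrow> ('a \<Rightarrow> real) \<Rightarrow> ('a \<Rightarrow> real) \<Rightarrow> real" where
  "corr M Y Z = (\<integral>\<omega>. (Y \<omega> - mean M Y) * (Z \<omega> - mean M Z) \<partial>M)
                 / sqrt (var M Y * var M Z)"

definition Phi :: "real \<Rightarrow> real" where
  "Phi h = cdf (density lborel std_normal_density) h"

definition mat_space :: "nat \<Rightarrow> ((nat \<times> nat) \<Rightarrow> real) measure" where
  "mat_space p = Pi\<^sub>M ({1..p} \<times> {1..p}) (\<lambda>_. borel)"

definition mat_rv :: "nat \<Rightarrow> (nat \<Rightarrow> nat \<Rightarrow> 'a \<Rightarrow> nat \<Rightarrow> nat \<Rightarrow> real)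
                     \<Rightarrow> nat \<Rightarrow> nat \<Rightarrow> 'a \<Rightarrow> (nat \<times> nat) \<Rightarrow> real" where
  "mat_rv p X d l = (\<lambda>\<omega>. \<lambda>e\<in>{1..p} \<times> {1..p}. X d l \<omega> (fst e) (snd e))"

definition obs_index :: "nat \<Rightarrow> nat \<Rightarrow> (nat \<times> nat) set" where
  "obs_index n1 n2 = {(d, l). (d = 1 \<and> 1 \<le> l \<and> l \<le> n1) \<or> (d = 2 \<and> 1 \<le> l \<and> l \<le> n2)}"

definition nsize :: "nat \<Rightarrow> nat \<Rightarrow> nat \<Rightarrow> nat" where
  "nsize n1 n2 d = (if d = 1 then n1 else n2)"

text \<open>Population quantities (the matrices of a sample are identically distributed,
  so they are computed from the first matrix l = 1).\<close>

definition smean :: "'a measure \<Rightarrow> (nat \<Rightarrow> nat \<Rightarrow> 'a \<Rightarrow> nat \<Rightarrow> nat \<Rightarrow> real)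
                     \<Rightarrow> nat \<Rightarrow> nat \<times> nat \<Rightarrow> real" where
  "smean M X d e = mean M (\<lambda>\<omega>. X d 1 \<omega> (fst e) (snd e))"

definition svar :: "'a measure \<Rightarrow> (nat \<Rightarrow> nat \<Rightarrow> 'a \<Rightarrow> nat \<Rightarrow> nat \<Rightarrow> real)
                     \<Rightarrow> nat \<Rightarrow> nat \<times> nat \<Rightarrow> real" where
  "svar M X d e = var M (\<lambda>\<omega>. X d 1 \<omega> (fst e) (snd e))"

definition rcorr :: "'a measure \<Rightarrow> (nat \<Rightarrow> nat \<Rightarrow> 'a \<Rightarrow> nat \<Rightarrow> nat \<Rightarrow> real)
                     \<Rightarrow> nat \<Rightarrow> nat \<times> nat \<Rightarrow> nat \<times> nat \<Rightarrow> real" where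
  "rcorr M X d e e' = corr M (\<lambda>\<omega>. X d 1 \<omega> (fst e) (snd e)) (\<lambda>\<omega>. X d 1 \<omega> (fst e') (snd e'))"

definition H0 :: "'a measure \<Rightarrow> (nat \<Rightarrow> nat \<Rightarrow> 'a \<Rightarrow> nat \<Rightarrow> nat \<Rightarrow> real) \<Rightarrow> nat
                  \<Rightarrow> (nat \<times> nat) set" where
  "H0 M X p = {e \<in> pairs p. smean M X 1 e = smean M X 2 e}"

definition Aset :: "'a measure \<Rightarrow> (nat \<Rightarrow> nat \<Rightarrow> 'a \<Rightarrow> nat \<Rightarrow> nat \<Rightarrow> real) \<Rightarrow> nat
                  \<Rightarrow> real \<Rightarrow> nat \<times> nat \<Rightarrow> (nat \<times> nat) set" where
  "Aset M X p \<xi> e = {e' \<in> pairs p.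
      max \<bar>rcorr M X 1 e e'\<bar> \<bar>rcorr M X 2 e e'\<bar> \<ge> ln (real (qnum p)) powr (-2 - \<xi>)}"

definition Sset :: "'a measure \<Rightarrow> (nat \<Rightarrow> nat \<Rightarrow> 'a \<Rightarrow> nat \<Rightarrow> nat \<Rightarrow> real) \<Rightarrow> nat
                  \<Rightarrow> nat \<Rightarrow> nat \<Rightarrow> real \<Rightarrow> (nat \<times> nat) set" where
  "Sset M X p n1 n2 \<rho> = {e \<in> pairs p.
      \<bar>smean M X 1 e - smean M X 2 e\<bar> / sqrt (svar M X 1 e / n1 + svar M X 2 e / n2)
        \<ge> ln (real (qnum p)) powr (1/2 + \<rho>)}"

definition Sbar :: "(nat \<Rightarrow> nat \<Rightarrow> 'a \<Rightarrow> nat \<Rightarrow> nat \<Rightarrow> real) \<Rightarrow> nat \<Rightarrow> nat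
                    \<Rightarrow> 'a \<Rightarrow> nat \<times> nat \<Rightarrow> real" where
  "Sbar X nd d \<omega> e = (\<Sum>l = 1..nd. X d l \<omega> (fst e) (snd e)) / real nd"

definition Vhat :: "(nat \<Rightarrow> nat \<Rightarrow> 'a \<Rightarrow> nat \<Rightarrow> nat \<Rightarrow> real) \<Rightarrow> nat \<Rightarrow> nat
                    \<Rightarrow> 'a \<Rightarrow> nat \<times> nat \<Rightarrow> real" where
  "Vhat X nd d \<omega> e = (\<Sum>l = 1..nd. (X d l \<omega> (fst e) (snd e) - Sbar X nd d \<omega> e)\<^sup>2) / real nd"

definition Tstat :: "(nat \<Rightarrow> nat \<Rightarrow> 'a \<Rightarrow> nat \<Rightarrow> nat \<Rightarrow> real) \<Rightarrow> nat \<Rightarrow> nat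
                    \<Rightarrow> 'a \<Rightarrow> nat \<times> nat \<Rightarrow> real" where
  "Tstat X n1 n2 \<omega> e = (Sbar X n1 1 \<omega> e - Sbar X n2 2 \<omega> e)
       / sqrt (Vhat X n1 1 \<omega> e / real n1 + Vhat X n2 2 \<omega> e / real n2)"

definition Rcnt :: "(nat \<times> nat) set \<Rightarrow> (nat \<times> nat \<Rightarrow> real) \<Rightarrow> real \<Rightarrow> nat" where
  "Rcnt E T h = card {e \<in> E. \<bar>T e\<bar> \<ge> h}"

definition FDPhat :: "nat \<Rightarrow> (nat \<times> nat \<Rightarrow> real) \<Rightarrow> real \<Rightarrow> real" where
  "FDPhat p T h = 2 * real (qnum p) * (1 - Phi h) / max (real (Rcnt (pairs p) T h)) 1"

definition hhat :: "nat \<Rightarrow> real \<Rightarrow> (nat \<times> nat \<Rightarrow> real) \<Rightarrow> real" where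
  "hhat p \<alpha> T =
     (let B = {h. 0 \<le> h \<and> h \<le> sqrt (2 * ln (real (qnum p))) \<and> FDPhat p T h \<le> \<alpha>}
      in if B = {} then sqrt (2 * ln (real (qnum p))) else Inf B)"

definition FDP :: "nat \<Rightarrow> (nat \<times> nat) set \<Rightarrow> real \<Rightarrow> (nat \<times> nat \<Rightarrow> real) \<Rightarrow> real" where
  "FDP p N \<alpha> T = real (Rcnt N T (hhat p \<alpha> T)) / max (real (Rcnt (pairs p) T (hhat p \<alpha> T))) 1"

end

theory Submission
  imports Defs "HOL-Real_Asymp.Real_Asymp"
begin

text \<open>
  Write \<open>L = log q\<close> and \<open>G h = 2 (1 - Phi h)\<close>. After truncation and centring, the null statistics
  are uniformly close to standardised sums \<open>W\<close> of independent bounded variables. A Lindeberg replacement in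
  which \<open>Phi\<close> is smoothed by a fourth order spline at scale \<open>w\<close> compares \<open>P (|W| \<ge> h)\<close> with \<open>G h\<close>, and the joint tail
  of two weakly correlated sums with \<open>(G h)\<^sup>2\<close>, up to a relative error \<open>o (1 / L)\<close>; for strongly correlated
  pairs an exponential moment bound suffices. Chebyshev's inequality on a geometric grid of \<open>O (L)\<close> levels
  then shows that the number of null exceedances of \<open>h\<close> is \<open>(1 + o (1)) q0 G h\<close>, uniformly as long as \<open>q G h\<close> is bounded
  below by a sequence tending to infinity. The strong signals of (B1) force at least of the order of \<open>sqrt L\<close>
  rejections, which confines \<open>hhat\<close> to this range; as \<open>q G hhat = \<alpha> R (hhat)\<close> there, FDP is \<open>(1 + o (1)) \<alpha> q0 / q\<close>.
  The Gaussian variables of the Lindeberg argument never appear: they are replaced by the heat flow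
  acting on the smoothed function.
\<close>

section \<open>Gaussian tails\<close>

abbreviation phi :: "real \<Rightarrow> real" where "phi \<equiv> std_normal_density"

lemma phi_eq: "phi x = exp (- x\<^sup>2 / 2) / sqrt (2 * pi)"
  by (simp add: std_normal_density_def)

lemma phi_pos: "0 < phi x"
  by (simp add: phi_eq)

lemma phi_le: "phi x \<le> 1/2"
proof -
  have "sqrt 4 \<le> sqrt (2 * pi)"
    using pi_ge_two by (intro real_sqrt_le_mono) simp
  hence "2 \<le> sqrt (2 * pi)" by simp
  moreover have "exp (- x\<^sup>2 / 2) \<le> 1" by simp
  ultimately have "exp (- x\<^sup>2 / 2) * 2 \<le> 1 * sqrt (2 * pi)"
    by (intro mult_mono) auto
  thus ?thesis unfolding phi_eq
    by (simp add: divide_le_eq)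
qed

lemma DERIV_phi [derivative_intros]:
  "(phi has_real_derivative - x * phi x) (at x)"
proof -
  have "((\<lambda>x. (1 / sqrt (2 * pi)) * exp (- x\<^sup>2 / 2)) has_real_derivative
      (1 / sqrt (2 * pi)) * (- x * exp (- x\<^sup>2 / 2))) (at x)"
    by (rule DERIV_cmult) (auto intro!: derivative_eq_intros)
  thus ?thesis by (simp add: phi_eq[abs_def])
qed

lemma prob_space_std_normal: "prob_space (density lborel phi)"
  by (rule prob_space_normal_density) simp

interpretation std_normal: real_distribution "density lborel phi"
  unfolding real_distribution_def real_distribution_axioms_def
  using prob_space_std_normal by simp

lemma measure_std_normal:
  assumes "A \<in> sets borel"
  shows "measure (density lborel phi) A = (\<integral>x. indicator A x * phi x \<partial>lborel)"
proof -
  have "emeasure (density lborel phi) A = (\<integral>\<^sup>+x. ennreal (indicator A x * phi x) \<partial>lborel)"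
    using assms by (subst emeasure_density) (auto intro!: nn_integral_cong simp: indicator_def)
  also have "\<dots> = ennreal (\<integral>x. indicator A x * phi x \<partial>lborel)"
    using assms integrable_mult_indicator[of A lborel phi] by (intro nn_integral_eq_integral) auto
  finally show ?thesis
    by (simp add: measure_def integral_nonneg_AE)
qed

lemma Phi_diff:
  assumes "a \<le> b"
  shows "Phi b - Phi a = integral {a..b} phi"
proof (cases "a < b")
  case True
  have cont: "continuous_on {a..b} phi"
    by (intro DERIV_continuous_on[of _ phi "\<lambda>x. - x * phi x"] has_field_derivative_at_within[OF DERIV_phi])
  have "Phi b - Phi a = measure (density lborel phi) {a<..b}"
    unfolding Phi_def using std_normal.cdf_diff_eq[OF True] .
  also have "\<dots> = (\<integral>x. indicator {a<..b} x * phi x \<partial>lborel)"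
    by (rule measure_std_normal) simp
  also have "\<dots> = (\<integral>x. indicator {a..b} x * phi x \<partial>lborel)"
    using AE_lborel_singleton[of a]
    by (intro integral_cong_AE) (auto simp: indicator_def)
  also have "\<dots> = integral {a..b} phi"
    using set_borel_integral_eq_integral(2)[OF borel_integrable_atLeastAtMost'[OF cont]]
    by (simp add: set_lebesgue_integral_def)
  finally show ?thesis .
qed (use assms in auto)

lemma DERIV_Phi [derivative_intros]:
  "(Phi has_real_derivative phi x) (at x)"
proof -
  have cont: "continuous_on {x-1..x+1} phi"
    by (intro DERIV_continuous_on[of _ phi "\<lambda>x. - x * phi x"] has_field_derivative_at_within[OF DERIV_phi])
  have "((\<lambda>y. integral {x-1..y} phi) has_real_derivative phi x) (at x within {x-1..x+1})"
    by (rule integral_has_real_derivative[OF cont]) simp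
  hence "((\<lambda>y. Phi (x-1) + integral {x-1..y} phi) has_real_derivative phi x) (at x within {x-1..x+1})"
    by (auto intro!: derivative_eq_intros)
  hence "((\<lambda>y. Phi (x-1) + integral {x-1..y} phi) has_real_derivative phi x) (at x)"
    by (subst (asm) at_within_interior) auto
  moreover have "\<forall>\<^sub>F y in nhds x. y \<in> {x-1<..}"
    by (intro eventually_nhds_in_open) auto
  hence "\<forall>\<^sub>F y in nhds x. Phi (x-1) + integral {x-1..y} phi = Phi y"
  proof eventually_elim
    case (elim y)
    thus ?case using Phi_diff[of "x-1" y] by simp
  qed
  ultimately show ?thesis
    by (subst DERIV_cong_ev[OF refl _ refl, symmetric]) auto
qed

lemma isCont_Phi: "isCont Phi x"
  using DERIV_Phi DERIV_isCont by blast

lemma Phi_strict_mono: "x < y \<Longrightarrow> Phi x < Phi y"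
  by (rule DERIV_pos_imp_increasing) (auto intro!: exI[of _ "phi _"] DERIV_Phi phi_pos)

lemma Phi_mono: "x \<le> y \<Longrightarrow> Phi x \<le> Phi y"
  using Phi_strict_mono[of x y] by (cases "x = y") auto

lemma Phi_pos: "0 < Phi x"
proof -
  have "0 \<le> Phi (x - 1)" unfolding Phi_def by (rule std_normal.cdf_nonneg)
  also have "\<dots> < Phi x" by (rule Phi_strict_mono) simp
  finally show ?thesis .
qed

lemma Phi_less_1: "Phi x < 1"
proof -
  have "Phi x < Phi (x + 1)" by (rule Phi_strict_mono) simp
  also have "\<dots> \<le> 1" unfolding Phi_def by (rule std_normal.cdf_bounded_prob)
  finally show ?thesis .
qed

lemma Phi_minus: "Phi (- x) = 1 - Phi x"
proof -
  have der: "((\<lambda>x. Phi x + Phi (- x)) has_real_derivative 0) (at x)" for x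
    by (auto intro!: derivative_eq_intros DERIV_chain'[OF _ DERIV_Phi] simp: phi_eq)
  have const: "Phi x + Phi (- x) = Phi y + Phi (- y)" for x y
    using DERIV_isconst_all[of "\<lambda>x. Phi x + Phi (- x)" x y] der by auto
  have "((\<lambda>y. Phi y + Phi (- y)) \<longlongrightarrow> 1 + 0) at_top"
  proof (intro tendsto_add)
    show "(Phi \<longlongrightarrow> 1) at_top"
      unfolding Phi_def[abs_def] by (rule std_normal.cdf_lim_at_top_prob)
    have "(Phi \<longlongrightarrow> 0) at_bot"
      unfolding Phi_def[abs_def] by (rule std_normal.cdf_lim_at_bot)
    thus "((\<lambda>y. Phi (- y)) \<longlongrightarrow> 0) at_top"
      by (rule filterlim_compose[OF _ filterlim_uminus_at_bot_at_top])
  qed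
  moreover have "(\<lambda>y. Phi y + Phi (- y)) = (\<lambda>_. Phi x + Phi (- x))"
    using const by auto
  ultimately have "((\<lambda>_::real. Phi x + Phi (- x)) \<longlongrightarrow> 1) at_top" by simp
  hence "Phi x + Phi (- x) = 1" by (simp add: tendsto_const_iff)
  thus ?thesis by simp
qed

lemma Phi_0: "Phi 0 = 1/2"
  using Phi_minus[of 0] by simp

lemma Phi_minus_le_exp:
  assumes "0 \<le> h"
  shows "Phi (- h) \<le> exp (- h\<^sup>2 / 2)"
proof -
  have "Phi (- h) = measure (density lborel phi) {..-h}"
    unfolding Phi_def by (rule cdf_def2)
  also have "\<dots> = (\<integral>x. indicator {..-h} x * phi x \<partial>lborel)"
    by (rule measure_std_normal) simp
  also have "\<dots> \<le> (\<integral>x. exp (- h\<^sup>2 / 2) * normal_density (-h) 1 x \<partial>lborel)"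
  proof (rule integral_mono)
    have "integrable lborel (\<lambda>x. phi x * indicator {..-h} x)"
      by (rule integrable_mult_indicator[of _ lborel phi, unfolded real_scaleR_def mult.commute[of "indicator _ _"]]) auto
    thus "integrable lborel (\<lambda>x. indicator {..-h} x * phi x)"
      by (simp add: mult.commute)
    show "integrable lborel (\<lambda>x. exp (- h\<^sup>2 / 2) * normal_density (-h) 1 x)"
      by auto
    fix x :: real
    show "indicator {..-h} x * phi x \<le> exp (- h\<^sup>2 / 2) * normal_density (-h) 1 x"
    proof (cases "x \<le> - h")
      case True
      have "0 \<le> h * (- h - x)" using assms True by (intro mult_nonneg_nonneg) auto
      hence "exp (- x\<^sup>2 / 2) \<le> exp (- h\<^sup>2 / 2 + - (x + h)\<^sup>2 / 2)"
        by (simp add: power2_eq_square algebra_simps)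
      thus ?thesis using True
        by (simp add: normal_density_def phi_eq divide_right_mono flip: exp_add)
    qed (auto simp: normal_density_def)
  qed
  also have "\<dots> = exp (- h\<^sup>2 / 2)" by simp
  finally show ?thesis .
qed

lemma phi_ge_near:
  assumes "\<bar>t\<bar> \<le> \<bar>z\<bar> + d" "0 \<le> d" "d * \<bar>z\<bar> \<le> 1" "d \<le> 1"
  shows "phi z * exp (-3/2) \<le> phi t"
proof -
  have "t\<^sup>2 \<le> (\<bar>z\<bar> + d)\<^sup>2" using assms(1) by (metis abs_ge_zero abs_le_square_iff abs_of_nonneg add_increasing2 assms(2))
  also have "\<dots> = z\<^sup>2 + 2 * (d * \<bar>z\<bar>) + d * d" by (simp add: power2_eq_square algebra_simps)
  also have "\<dots> \<le> z\<^sup>2 + 2 * 1 + 1 * 1" using assms by (intro add_mono mult_mono) auto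
  finally have "- z\<^sup>2 / 2 + (-3/2) \<le> - t\<^sup>2 / 2" by simp
  hence "exp (- z\<^sup>2 / 2) * exp (-3/2) \<le> exp (- t\<^sup>2 / 2)"
    by (simp flip: exp_add)
  thus ?thesis by (simp add: phi_eq divide_right_mono)
qed

lemma exp_32_le: "exp (3/2::real) \<le> 5"
proof -
  have "exp (3/2::real) = exp (1/8) ^ 12" by (simp flip: exp_of_nat_mult)
  also have "\<dots> \<le> (1 + 1/8 + (1/8)\<^sup>2) ^ 12"
    by (intro power_mono exp_bound) auto
  also have "\<dots> \<le> (5::real)" by (simp add: eval_nat_numeral)
  finally show ?thesis .
qed

lemma Phi_ge_interval:
  assumes "c < z" "\<And>t. c < t \<Longrightarrow> t < z \<Longrightarrow> m \<le> phi t"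
  shows "(z - c) * m \<le> Phi z"
proof -
  obtain t where "c < t" "t < z" "Phi z - Phi c = (z - c) * phi t"
    using MVT2[OF assms(1), of Phi phi] DERIV_Phi by auto
  thus ?thesis using assms Phi_pos[of c]
    by (smt (verit) mult_left_mono)
qed

lemma phi_le_Phi: "phi z \<le> 5 * (1 + max 0 (- z)) * Phi z"
proof (cases "z \<ge> 0")
  case True
  thus ?thesis using phi_le[of z] Phi_mono[of 0 z] Phi_0 by (auto simp: max_def)
next
  case False
  define d where "d = 1 / (1 - z)"
  have d: "0 < d" "d \<le> 1" "d * \<bar>z\<bar> \<le> 1" using False by (auto simp: d_def field_simps)
  have "(z - (z - d)) * (phi z * exp (-3/2)) \<le> Phi z"
  proof (rule Phi_ge_interval)
    fix t assume "z - d < t" "t < z"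
    thus "phi z * exp (-3/2) \<le> phi t"
      using d False by (intro phi_ge_near[where d = d]) auto
  qed (use d in auto)
  hence "d * phi z \<le> exp (3/2) * Phi z"
    by (simp add: exp_minus field_simps)
  also have "\<dots> \<le> 5 * Phi z" using Phi_pos[of z] exp_32_le by (intro mult_right_mono) auto
  finally show ?thesis using False by (simp add: d_def field_simps max_def)
qed

lemma Phi_shift_le:
  assumes "0 \<le> a"
  shows "Phi (z + a) \<le> Phi z * exp (5 * a * (1 + max 0 (- z)))"
proof (cases "a = 0")
  case False
  have der: "((\<lambda>z. ln (Phi z)) has_real_derivative phi x / Phi x) (at x)" for x
    by (auto intro!: derivative_eq_intros DERIV_Phi simp: Phi_pos)
  obtain t where t: "z < t" "t < z + a" "ln (Phi (z + a)) - ln (Phi z) = (z + a - z) * (phi t / Phi t)"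
    using MVT2[of z "z + a" "\<lambda>z. ln (Phi z)" "\<lambda>x. phi x / Phi x"] der assms False by auto
  have "phi t / Phi t \<le> 5 * (1 + max 0 (- t))"
    using phi_le_Phi[of t] Phi_pos[of t] by (simp add: field_simps)
  also have "\<dots> \<le> 5 * (1 + max 0 (- z))" using t by auto
  finally have "a * (phi t / Phi t) \<le> a * (5 * (1 + max 0 (- z)))"
    using assms by (rule mult_left_mono)
  hence "ln (Phi (z + a)) \<le> ln (Phi z) + a * (5 * (1 + max 0 (- z)))"
    using t(3) by simp
  hence "exp (ln (Phi (z + a))) \<le> exp (ln (Phi z) + a * (5 * (1 + max 0 (- z))))"
    by simp
  thus ?thesis by (simp add: exp_add Phi_pos algebra_simps)
qed auto

lemma phi_exp_le_Phi:
  assumes "0 < a" "a \<le> 1"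
  shows "a * phi z * exp (a * max 0 (- z) / 2) \<le> 10 * Phi (z + a)"
proof (cases "z \<ge> 0")
  case True
  have "a * phi z \<le> 1 * (1/2)" using assms phi_le[of z] phi_pos[of z] by (intro mult_mono) auto
  moreover have "max 0 (- z) = 0" using True by simp
  ultimately show ?thesis using True Phi_mono[of 0 "z+a"] Phi_0 assms by simp
next
  case z: False
  define m where "m = phi z * exp (a * (- z) / 2) * exp (-3/2)"
  have "(z + a - (z + a/2)) * m \<le> Phi (z + a)"
  proof (rule Phi_ge_interval)
    fix t assume t: "z + a/2 < t" "t < z + a"
    have t2: "t\<^sup>2 / 2 \<le> z\<^sup>2 / 2 - a * (-z) / 2 + 3/2"
    proof (cases "t \<le> 0")
      case True
      have "t\<^sup>2 \<le> (z + a/2)\<^sup>2" using t True by (auto simp flip: abs_le_square_iff)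
      also have "\<dots> = z\<^sup>2 - a * (-z) + a * a / 4" by (simp add: power2_eq_square algebra_simps)
      also have "a * a \<le> 1 * 1" using assms by (intro mult_mono) auto
      finally show ?thesis by (simp add: field_simps)
    next
      case False
      hence "t\<^sup>2 \<le> 1\<^sup>2" using t z assms by (intro power_mono) auto
      moreover have "a * (-z) \<le> 1 * 1" using False t z assms by (intro mult_mono) auto
      ultimately have "t\<^sup>2 \<le> 1" "a * (-z) \<le> 1" by simp_all
      thus ?thesis using zero_le_power2[of z] by linarith
    qed
    have "m = exp (- z\<^sup>2/2 + a * (-z)/2 + (-3/2)) / sqrt (2*pi)"
      unfolding m_def phi_eq exp_add by simp
    also have "\<dots> \<le> exp (- t\<^sup>2/2) / sqrt (2*pi)"
      using t2 by (intro divide_right_mono) auto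
    finally show "m \<le> phi t" unfolding phi_eq .
  qed (use assms in auto)
  hence "a * phi z * exp (a * (-z) / 2) \<le> 2 * exp (3/2) * Phi (z + a)"
    by (simp add: m_def exp_minus field_simps)
  also have "\<dots> \<le> 2 * 5 * Phi (z + a)"
    using exp_32_le Phi_pos[of "z+a"] by (intro mult_right_mono mult_left_mono) auto
  finally show ?thesis using z by (simp add: max_def)
qed

lemma power_le_exp:
  fixes y :: real assumes "0 \<le> y"
  shows "y ^ n \<le> fact n * exp y"
proof -
  have "(\<Sum>i\<in>{n}. inverse (fact i) * y ^ i) \<le> (\<Sum>i. inverse (fact i) * y ^ i)"
    using summable_exp[of y] assms by (intro sum_le_suminf) auto
  also have "\<dots> = exp y" by (simp add: exp_def scaleR_conv_of_real divide_inverse)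
  finally show ?thesis by (simp add: field_simps)
qed

lemma poly_phi_le_Phi:
  assumes "0 < a" "a \<le> 1"
  shows "(1 + \<bar>z\<bar>) ^ n * phi z \<le> 20 * 2 ^ n * fact n * exp 1 * (1 / a ^ Suc n) * Phi (z + a)"
proof (cases "z \<ge> 0")
  case True
  have "(1 + \<bar>z\<bar>) ^ n \<le> fact n * exp (1 + \<bar>z\<bar>)" by (rule power_le_exp) simp
  hence "(1 + \<bar>z\<bar>) ^ n * phi z \<le> fact n * exp (1 + \<bar>z\<bar>) * phi z"
    using phi_pos[of z] by (intro mult_right_mono) auto
  also have "\<dots> = fact n * (exp (1 + z - z\<^sup>2 / 2) / sqrt (2 * pi))"
    using True by (simp add: phi_eq flip: exp_add)
  also have "\<dots> \<le> fact n * (exp 2 / 1)"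
  proof (intro mult_left_mono frac_le)
    have "0 \<le> (z - 1)\<^sup>2" by simp
    thus "exp (1 + z - z\<^sup>2 / 2) \<le> exp 2" by (simp add: power2_eq_square algebra_simps)
    show "1 \<le> sqrt (2 * pi)" using pi_ge_two by (intro real_le_rsqrt) auto
  qed auto
  also have "\<dots> = fact n * (exp 1 * exp 1)" by (simp flip: exp_add)
  also have "\<dots> \<le> fact n * (exp 1 * 3)" using exp_le by (intro mult_left_mono) auto
  also have "\<dots> \<le> 20 * 1 * fact n * exp 1 * 1 * (1/2)" by simp
  also have "\<dots> \<le> 20 * 2 ^ n * fact n * exp 1 * (1 / a ^ Suc n) * Phi (z + a)"
  proof (intro mult_mono mult_nonneg_nonneg)
    show "1 \<le> 1 / a ^ Suc n" using assms power_le_one[of a "Suc n"] by (simp del: power_Suc)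
    show "1/2 \<le> Phi (z + a)" using Phi_mono[of 0 "z+a"] Phi_0 True assms by simp
  qed (use assms in auto)
  finally show ?thesis .
next
  case False
  have "(a * (1 + \<bar>z\<bar>) / 2) ^ n \<le> fact n * exp (a * (1 + \<bar>z\<bar>) / 2)"
    using assms by (intro power_le_exp) auto
  also have "a * (1 + \<bar>z\<bar>) / 2 \<le> 1 + a * max 0 (-z) / 2"
    using assms False by (simp add: right_diff_distrib max_def)
  hence "fact n * exp (a * (1 + \<bar>z\<bar>) / 2) \<le> fact n * (exp 1 * exp (a * max 0 (-z) / 2))"
    by (simp flip: exp_add)
  finally have *: "(a * (1 + \<bar>z\<bar>)) ^ n \<le> 2 ^ n * fact n * exp 1 * exp (a * max 0 (-z) / 2)"
    by (simp add: power_divide field_simps)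
  have "a ^ Suc n * ((1 + \<bar>z\<bar>) ^ n * phi z) = (a * (1 + \<bar>z\<bar>)) ^ n * (a * phi z)"
    by (simp add: power_mult_distrib)
  also have "\<dots> \<le> (2 ^ n * fact n * exp 1 * exp (a * max 0 (-z) / 2)) * (a * phi z)"
    using * assms phi_pos[of z] by (intro mult_right_mono) auto
  also have "\<dots> = 2 ^ n * fact n * exp 1 * (a * phi z * exp (a * max 0 (-z) / 2))"
    by (simp add: algebra_simps)
  also have "\<dots> \<le> 2 ^ n * fact n * exp 1 * (10 * Phi (z + a))"
    using phi_exp_le_Phi[OF assms] by (intro mult_left_mono) auto
  also have "\<dots> \<le> 20 * 2 ^ n * fact n * exp 1 * Phi (z + a)" using Phi_pos[of "z+a"] by simp
  finally show ?thesis using assms by (simp add: field_simps)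
qed

section \<open>Spline smoothing of the normal distribution function\<close>

definition dff :: "real \<Rightarrow> (real \<Rightarrow> real) \<Rightarrow> real \<Rightarrow> real" where
  "dff w f x = f (x + w) - f x"

lemma dff_Suc: "(dff w ^^ Suc n) f x = (dff w ^^ n) f (x + w) - (dff w ^^ n) f x"
proof -
  have "(dff w ^^ Suc n) f x = dff w ((dff w ^^ n) f) x" by simp
  also have "\<dots> = (dff w ^^ n) f (x + w) - (dff w ^^ n) f x" by (rule dff_def)
  finally show ?thesis .
qed

lemma dff_pow_derivative:
  assumes "\<And>x. (f has_real_derivative f' x) (at x)"
  shows "((dff w ^^ n) f has_real_derivative (dff w ^^ n) f' x) (at x)"
proof (induction n arbitrary: x)
  case (Suc n)
  have "((\<lambda>x. (dff w ^^ n) f (x + w) - (dff w ^^ n) f x) has_real_derivative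
      (dff w ^^ n) f' (x + w) - (dff w ^^ n) f' x) (at x)"
    by (intro DERIV_diff DERIV_shift[THEN iffD1, OF Suc.IH] Suc.IH)
  thus ?case by (simp only: dff_Suc[abs_def])
qed (use assms in auto)

lemma dff_pow_mvt:
  assumes "0 \<le> w" "\<And>i x. i < n \<Longrightarrow> (f i has_real_derivative f (Suc i) x) (at x)"
  shows "\<exists>\<xi>. x \<le> \<xi> \<and> \<xi> \<le> x + real n * w \<and> (dff w ^^ n) (f 0) x = w ^ n * f n \<xi>"
  using assms(2)
proof (induction n arbitrary: f x)
  case 0
  thus ?case by (auto intro!: exI[of _ x])
next
  case (Suc n)
  have der: "((dff w ^^ n) (f 0) has_real_derivative (dff w ^^ n) (f 1) x) (at x)" for x
    using Suc.prems[of 0] by (intro dff_pow_derivative) auto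
  define g where "g = (dff w ^^ n) (f 0)"
  define g' where "g' = (dff w ^^ n) (f 1)"
  have "\<exists>z. x \<le> z \<and> z \<le> x + w \<and> g (x + w) - g x = w * g' z"
  proof (cases "w = 0")
    case False
    hence "x < x + w" using assms(1) by simp
    moreover have "(g has_real_derivative g' y) (at y)" for y
      using der unfolding g_def g'_def .
    ultimately obtain z where "x < z" "z < x + w" "g (x + w) - g x = (x + w - x) * g' z"
      using MVT2[of x "x + w" g g'] by blast
    thus ?thesis by (intro exI[of _ z]) auto
  qed auto
  then obtain z where z: "x \<le> z" "z \<le> x + w" "(dff w ^^ Suc n) (f 0) x = w * (dff w ^^ n) (f 1) z"
    unfolding g_def g'_def dff_Suc by blast
  obtain \<xi> where "z \<le> \<xi>" "\<xi> \<le> z + real n * w" "(dff w ^^ n) (f 1) z = w ^ n * f (Suc n) \<xi>"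
    using Suc.IH[of "\<lambda>i. f (Suc i)" z] Suc.prems by auto
  thus ?case using z by (intro exI[of _ \<xi>]) (auto simp: algebra_simps)
qed

lemma dff_pow_add: "(dff w ^^ n) (\<lambda>x. f x + g x) x = (dff w ^^ n) f x + (dff w ^^ n) g x"
proof -
  have "(dff w ^^ n) (\<lambda>x. f x + g x) = (\<lambda>x. (dff w ^^ n) f x + (dff w ^^ n) g x)"
    by (induction n) (auto simp: dff_def)
  thus ?thesis by simp
qed

lemma dff_pow_cmult: "(dff w ^^ n) (\<lambda>x. c * f x) x = c * (dff w ^^ n) f x"
proof -
  have "(dff w ^^ n) (\<lambda>x. c * f x) = (\<lambda>x. c * (dff w ^^ n) f x)"
    by (induction n) (auto simp: dff_def fun_eq_iff algebra_simps)
  thus ?thesis by simp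
qed

lemma dff_pow_shift: "(dff w ^^ n) (\<lambda>x. f (x + c)) x = (dff w ^^ n) f (x + c)"
proof -
  have "(dff w ^^ n) (\<lambda>x. f (x + c)) = (\<lambda>x. (dff w ^^ n) f (x + c))"
    by (induction n) (auto simp: dff_def fun_eq_iff algebra_simps)
  thus ?thesis by simp
qed

lemma dff_pow_le:
  assumes w: "0 \<le> w"
    and f: "\<And>i x. i < n \<Longrightarrow> (f i has_real_derivative f (Suc i) x) (at x)"
    and g: "\<And>i x. i < n \<Longrightarrow> (g i has_real_derivative g (Suc i) x) (at x)"
    and le: "\<And>x. f n x \<le> g n x"
  shows "(dff w ^^ n) (f 0) x \<le> (dff w ^^ n) (g 0) x"
proof -
  have der: "((\<lambda>x. g i x + (-1) * f i x) has_real_derivative g (Suc i) x + (-1) * f (Suc i) x) (at x)"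
    if "i < n" for i x
    using f[OF that] g[OF that] by (auto intro!: derivative_eq_intros)
  obtain \<xi> where "(dff w ^^ n) (\<lambda>x. g 0 x + (-1) * f 0 x) x = w ^ n * (g n \<xi> + (-1) * f n \<xi>)"
    using dff_pow_mvt[OF w, of n "\<lambda>i x. g i x + (-1) * f i x" x] der by blast
  moreover have "\<dots> \<ge> 0" using w le[of \<xi>] by simp
  ultimately have "0 \<le> (dff w ^^ n) (\<lambda>x. g 0 x + (-1) * f 0 x) x" by simp
  thus ?thesis unfolding dff_pow_add dff_pow_cmult by simp
qed

lemma dff_pow_abs_le:
  assumes w: "0 \<le> w"
    and f: "\<And>i x. i < n \<Longrightarrow> (f i has_real_derivative f (Suc i) x) (at x)"
    and g: "\<And>i x. i < n \<Longrightarrow> (g i has_real_derivative g (Suc i) x) (at x)"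
    and le: "\<And>x. \<bar>f n x\<bar> \<le> g n x"
  shows "\<bar>(dff w ^^ n) (f 0) x\<bar> \<le> (dff w ^^ n) (g 0) x"
proof -
  have "(dff w ^^ n) (f 0) x \<le> (dff w ^^ n) (g 0) x"
    by (rule dff_pow_le[where f = f and g = g, OF w]) (use f g le in \<open>auto simp: abs_le_iff\<close>)
  moreover have "(dff w ^^ n) (\<lambda>x. (-1) * f 0 x) x \<le> (dff w ^^ n) (g 0) x"
  proof (rule dff_pow_le[where f = "\<lambda>i x. (-1) * f i x" and g = g, OF w])
    show "((\<lambda>x. (-1) * f i x) has_real_derivative (-1) * f (Suc i) x) (at x)" if "i < n" for i x
      by (rule DERIV_cmult[OF f[OF that]])
    show "(-1) * f n x \<le> g n x" for x using le[of x] by auto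
  qed (rule g)
  ultimately show ?thesis unfolding dff_pow_cmult by auto
qed

lemma dff_pow_abs_bound:
  assumes "0 \<le> w" "\<And>y. x \<le> y \<Longrightarrow> y \<le> x + real n * w \<Longrightarrow> \<bar>f y\<bar> \<le> B"
  shows "\<bar>(dff w ^^ n) f x\<bar> \<le> 2 ^ n * B"
  using assms(2)
proof (induction n arbitrary: x)
  case (Suc n)
  have "\<bar>(dff w ^^ n) f (x + w)\<bar> \<le> 2 ^ n * B" "\<bar>(dff w ^^ n) f x\<bar> \<le> 2 ^ n * B"
    using assms(1) by (intro Suc.IH Suc.prems; simp add: algebra_simps)+
  thus ?case unfolding dff_Suc by simp
qed simp

text \<open>\<open>J 4 = Phi\<close>, and \<open>J (4 + k)\<close>, \<open>J (4 - k)\<close> are its \<open>k\<close>-fold antiderivative and derivative.\<close>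

fun J :: "nat \<Rightarrow> real \<Rightarrow> real" where
  "J 0 z = (3 * z - z ^ 3) * phi z"
| "J (Suc 0) z = (z\<^sup>2 - 1) * phi z"
| "J (Suc (Suc 0)) z = - z * phi z"
| "J (Suc (Suc (Suc 0))) z = phi z"
| "J (Suc (Suc (Suc (Suc 0)))) z = Phi z"
| "J (Suc (Suc (Suc (Suc (Suc 0))))) z = z * Phi z + phi z"
| "J (Suc (Suc (Suc (Suc (Suc (Suc n)))))) z =
     (z * J (Suc (Suc (Suc (Suc (Suc n))))) z + J (Suc (Suc (Suc (Suc n)))) z) / (real n + 2)"

lemma J_nums:
  "J 0 z = (3 * z - z ^ 3) * phi z" "J 1 z = (z\<^sup>2 - 1) * phi z" "J 2 z = - z * phi z"
  "J 3 z = phi z" "J 4 z = Phi z" "J 5 z = z * Phi z + phi z"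
  "J 6 z = (z * J 5 z + J 4 z) / 2" "J 7 z = (z * J 6 z + J 5 z) / 3" "J 8 z = (z * J 7 z + J 6 z) / 4"
  by (simp_all add: eval_nat_numeral)

lemma J_rec: "(real n + 2 - 4) * J (n + 2) z = z * J (n + 1) z + J n z"
proof -
  have "n = 0 \<or> n = 1 \<or> n = 2 \<or> n = 3 \<or> (\<exists>m. n = m + 4)" by presburger
  then consider "n = 0" | "n = 1" | "n = 2" | "n = 3" | m where "n = m + 4" by blast
  thus ?thesis
  proof cases
    case 5
    have "J (n + 2) z = (z * J (n + 1) z + J n z) / (real m + 2)"
      using 5 by (simp add: eval_nat_numeral)
    thus ?thesis using 5 by (simp add: field_simps)
  qed (simp_all add: eval_nat_numeral algebra_simps)
qed

lemma DERIV_J: "(J (Suc n) has_real_derivative J n z) (at z)"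
proof (induction n arbitrary: z rule: less_induct)
  case (less n)
  have "n = 0 \<or> n = 1 \<or> n = 2 \<or> n = 3 \<or> n = 4 \<or> (\<exists>m. n = m + 5)" by presburger
  then consider "n = 0" | "n = 1" | "n = 2" | "n = 3" | "n = 4" | m where "n = m + 5" by blast
  thus ?case
  proof cases
    case 1
    show ?thesis unfolding 1 J.simps[abs_def]
      by (auto intro!: derivative_eq_intros DERIV_phi simp: algebra_simps power2_eq_square power3_eq_cube)
  next
    case 2
    show ?thesis unfolding 2 One_nat_def J.simps[abs_def]
      by (auto intro!: derivative_eq_intros DERIV_phi simp: algebra_simps power2_eq_square)
  next
    case 3
    show ?thesis unfolding 3 numeral_2_eq_2 J.simps[abs_def]
      by (auto intro!: derivative_eq_intros DERIV_phi)
  next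
    case 4
    show ?thesis unfolding 4 numeral_3_eq_3 J.simps[abs_def]
      by (auto intro!: derivative_eq_intros DERIV_Phi)
  next
    case 5
    have "((\<lambda>z. z * Phi z + phi z) has_real_derivative Phi z) (at z)"
      by (auto intro!: derivative_eq_intros DERIV_Phi DERIV_phi)
    thus ?thesis unfolding 5 by (simp add: eval_nat_numeral)
  next
    case 6
    have "((\<lambda>z. (z * J (m + 5) z + J (m + 4) z) / (real m + 2)) has_real_derivative
       (J (m + 5) z + z * J (m + 4) z + J (m + 3) z) / (real m + 2)) (at z)"
      using less[of "m + 4" z] less[of "m + 3" z] 6
      by (auto intro!: derivative_eq_intros simp: eval_nat_numeral)
    moreover have "(J (m + 5) z + z * J (m + 4) z + J (m + 3) z) / (real m + 2) = J (m + 5) z"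
      using J_rec[of "m + 3" z] by (simp add: field_simps)
    moreover have "J (Suc n) = (\<lambda>z. (z * J (m + 5) z + J (m + 4) z) / (real m + 2))"
      using 6 by (simp add: eval_nat_numeral fun_eq_iff)
    ultimately show ?thesis using 6 by simp
  qed
qed

definition F :: "nat \<Rightarrow> real \<Rightarrow> real \<Rightarrow> real" where
  "F n v z = sqrt v ^ n / v\<^sup>2 * J n (z / sqrt v)"

lemma DERIV_F:
  assumes "0 < v"
  shows "(F (Suc n) v has_real_derivative F n v z) (at z)"
proof -
  have "((\<lambda>z. sqrt v ^ Suc n / v\<^sup>2 * J (Suc n) (z / sqrt v)) has_real_derivative
      sqrt v ^ Suc n / v\<^sup>2 * (J n (z / sqrt v) * (1 / sqrt v))) (at z)"
    by (intro DERIV_cmult DERIV_chain2[OF DERIV_J] DERIV_cdivide DERIV_ident)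
  moreover have "sqrt v ^ Suc n / v\<^sup>2 * (J n (z / sqrt v) * (1 / sqrt v)) = F n v z"
  proof -
    have "sqrt v > 0" using assms by simp
    hence "sqrt v ^ Suc n * (1 / sqrt v) = sqrt v ^ n" by (use assms in simp)
    hence "sqrt v ^ Suc n * (1 / sqrt v) / v\<^sup>2 * J n (z / sqrt v) = sqrt v ^ n / v\<^sup>2 * J n (z / sqrt v)" by simp
    thus ?thesis unfolding F_def by (simp only: times_divide_eq_left times_divide_eq_right divide_divide_eq_left mult_ac)
  qed
  ultimately show ?thesis by (simp add: F_def[abs_def])
qed

lemma DERIV_F_var:
  assumes "0 < v"
  shows "((\<lambda>v. F (n + 2) v z) has_real_derivative F n v z / 2) (at v)"
proof -
  define s where "s = sqrt v"
  have s: "s > 0" "v = s\<^sup>2" using assms by (auto simp: s_def)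
  have J: "(real n + 2 - 4) * J (n + 2) (z / s) = (z / s) * J (n + 1) (z / s) + J n (z / s)"
    by (rule J_rec)
  have 0: "(sqrt has_real_derivative 1 / (2 * s)) (at v)"
    using DERIV_real_sqrt[OF assms] by (simp add: s_def field_simps)
  have 1: "((\<lambda>v. sqrt v ^ (n + 2) / v\<^sup>2) has_real_derivative
     (real (n + 2) * s ^ (n + 1) * (1 / (2 * s)) * v\<^sup>2 - s ^ (n + 2) * (2 * v)) / (v\<^sup>2 * v\<^sup>2)) (at v)"
  proof -
    have a: "((\<lambda>v. sqrt v ^ (n + 2)) has_real_derivative real (n + 2) * s ^ (n + 1) * (1 / (2 * s))) (at v)"
    proof -
      have "n + 2 - Suc 0 = n + 1" by simp
      thus ?thesis using DERIV_power[OF 0, of "n + 2"] unfolding s_def by (simp only: mult_ac)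
    qed
    have b: "((\<lambda>v. v\<^sup>2) has_real_derivative 2 * v) (at v)"
      by (auto intro!: derivative_eq_intros)
    show ?thesis using DERIV_divide[OF a b] assms by (simp add: s_def algebra_simps)
  qed
  have 2: "((\<lambda>v. z / sqrt v) has_real_derivative - z * (1 / (2 * s)) / s\<^sup>2) (at v)"
    using DERIV_divide[OF DERIV_const[of z] 0] assms by (simp add: s_def power2_eq_square)
  have 3: "((\<lambda>v. J (n + 2) (z / sqrt v)) has_real_derivative
      J (n + 1) (z / s) * (- z * (1 / (2 * s)) / s\<^sup>2)) (at v)"
    using DERIV_chain2[OF DERIV_J 2, of "n + 1"] by (simp add: s_def)
  have "((\<lambda>v. F (n + 2) v z) has_real_derivative
     ((real (n + 2) * s ^ (n + 1) * (1 / (2 * s)) * v\<^sup>2 - s ^ (n + 2) * (2 * v)) / (v\<^sup>2 * v\<^sup>2)) * J (n + 2) (z / s)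
     + J (n + 1) (z / s) * (- z * (1 / (2 * s)) / s\<^sup>2) * (s ^ (n + 2) / v\<^sup>2)) (at v)"
    using DERIV_mult[OF 1 3] by (simp add: F_def s_def)
  moreover have "((real (n + 2) * s ^ (n + 1) * (1 / (2 * s)) * v\<^sup>2 - s ^ (n + 2) * (2 * v)) / (v\<^sup>2 * v\<^sup>2)) * J (n + 2) (z / s)
     + J (n + 1) (z / s) * (- z * (1 / (2 * s)) / s\<^sup>2) * (s ^ (n + 2) / v\<^sup>2)
     = s ^ n / v\<^sup>2 / 2 * ((real n + 2 - 4) * J (n + 2) (z / s) - (z / s) * J (n + 1) (z / s))"
    unfolding s(2) using s(1) by (simp add: field_simps power2_eq_square)
  moreover have "\<dots> = F n v z / 2" unfolding J by (simp add: F_def s_def)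
  ultimately show ?thesis by (simp only:)
qed

lemma F_4: "0 < v \<Longrightarrow> F 4 v z = Phi (z / sqrt v)"
proof -
  assume "0 < v"
  hence "sqrt v ^ 4 = v\<^sup>2" by (metis power2_eq_square real_sqrt_pow2 less_imp_le mult_2 numeral_Bit0 power_add)
  thus ?thesis using \<open>0 < v\<close> by (simp add: F_def J_nums)
qed

lemma sqrt_pow_F:
  assumes "0 < v"
  shows "F n v z = J n (z / sqrt v) * sqrt v ^ n / sqrt v ^ 4"
proof -
  have "sqrt v ^ 4 = (sqrt v ^ 2) ^ 2" by (simp flip: power_mult)
  thus ?thesis using assms by (simp add: F_def)
qed

lemma abs_J_le:
  assumes "0 < a" "a \<le> 1" "j \<le> 4"
  shows "\<bar>J (4 - j) z\<bar> \<le> 11520 * exp 1 / a ^ j * Phi (z + a)"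
proof -
  define C :: real where "C = 11520 * exp 1"
  have C: "C \<ge> 1" using exp_ge_add_one_self[of 1] by (simp add: C_def)
  have pw: "1 / a ^ i \<le> 1 / a ^ Suc i" for i
    using assms by (simp add: field_simps)
  have key: "c * (1 + \<bar>z\<bar>) ^ n * phi z \<le> C / a ^ Suc n * Phi (z + a)"
    if "c * (20 * 2 ^ n * fact n) \<le> 11520" "c \<ge> 0" for n and c :: real
  proof -
    have "c * ((1 + \<bar>z\<bar>) ^ n * phi z) \<le> c * (20 * 2 ^ n * fact n * exp 1 * (1 / a ^ Suc n) * Phi (z + a))"
      using that by (intro mult_left_mono poly_phi_le_Phi assms) auto
    also have "\<dots> = (c * (20 * 2 ^ n * fact n)) * (exp 1 * (1 / a ^ Suc n) * Phi (z + a))" by simp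
    also have "\<dots> \<le> 11520 * (exp 1 * (1 / a ^ Suc n) * Phi (z + a))"
      using that assms Phi_pos[of "z + a"] by (intro mult_right_mono) auto
    finally show ?thesis by (simp add: C_def mult.assoc)
  qed
  have "j = 0 \<or> j = 1 \<or> j = 2 \<or> j = 3 \<or> j = 4" using assms by auto
  then consider "j = 0" | "j = 1" | "j = 2" | "j = 3" | "j = 4" by blast
  hence "\<bar>J (4 - j) z\<bar> \<le> C / a ^ j * Phi (z + a)"
  proof cases
    case 1
    have "1 * Phi z \<le> C * Phi (z + a)" using C assms Phi_pos[of z] Phi_mono[of z "z + a"]
      by (intro mult_mono) auto
    thus ?thesis using 1 Phi_pos[of z] by (simp add: J_nums)
  next
    case 2
    thus ?thesis using key[of 1 0] by (simp add: J_nums)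
  next
    case 3
    have "\<bar>z\<bar> * phi z \<le> (1 + \<bar>z\<bar>) * phi z" using phi_pos[of z] by (intro mult_right_mono) auto
    hence "\<bar>z\<bar> * phi z \<le> C / a ^ 2 * Phi (z + a)" using key[of 1 1] by (simp add: power2_eq_square)
    thus ?thesis using 3 key[of 1 1] phi_pos[of z] by (simp add: J_nums abs_mult power2_eq_square)
  next
    case 4
    have "\<bar>z\<^sup>2 - 1\<bar> \<le> z\<^sup>2 + 1" by (auto simp: abs_le_iff)
    also have "\<dots> \<le> (1 + \<bar>z\<bar>)\<^sup>2" by (simp add: power2_eq_square algebra_simps)
    finally have "\<bar>z\<^sup>2 - 1\<bar> * phi z \<le> (1 + \<bar>z\<bar>)\<^sup>2 * phi z" using phi_pos[of z] by (intro mult_right_mono) auto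
    also have "\<dots> \<le> C / a ^ 3 * Phi (z + a)" using key[of 1 2] by (simp add: eval_nat_numeral)
    finally show ?thesis using 4 phi_pos[of z] by (simp add: J_nums abs_mult)
  next
    case 5
    have "\<bar>3 * z - z ^ 3\<bar> \<le> 3 * \<bar>z\<bar> + \<bar>z\<bar> ^ 3"
      using abs_triangle_ineq4[of "3 * z" "z ^ 3"] by (simp add: abs_mult power_abs)
    also have "\<dots> \<le> (1 + \<bar>z\<bar>) ^ 3" by (simp add: power3_eq_cube algebra_simps)
    finally have "\<bar>3 * z - z ^ 3\<bar> * phi z \<le> (1 + \<bar>z\<bar>) ^ 3 * phi z" using phi_pos[of z] by (intro mult_right_mono) auto
    also have "\<dots> \<le> C / a ^ 4 * Phi (z + a)" using key[of 1 3] by (simp add: eval_nat_numeral)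
    finally show ?thesis using 5 phi_pos[of z] by (simp add: J_nums abs_mult)
  qed
  thus ?thesis by (simp add: C_def)
qed

lemma dff4: "(dff w ^^ 4) f x = f (x + 4 * w) - 4 * f (x + 3 * w) + 6 * f (x + 2 * w) - 4 * f (x + w) + f x"
proof -
  have "(dff w ^^ 4) f x = (dff w ^^ Suc (Suc (Suc (Suc 0)))) f x" by (simp add: eval_nat_numeral)
  also have "\<dots> = f (x + 4 * w) - 4 * f (x + 3 * w) + 6 * f (x + 2 * w) - 4 * f (x + w) + f x"
    unfolding dff_Suc by (simp add: algebra_simps)
  finally show ?thesis .
qed

text \<open>\<open>ud 0 w v\<close> is the average of \<open>Phi ((x + t) / sqrt v)\<close> over a spline density on \<open>0 \<le> t \<le> 4 w\<close>;
  \<open>ud j\<close> is its \<open>j\<close>-th derivative. A compactly supported average avoids the logarithmic loss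
  that Gaussian smoothing would cause.\<close>

definition ud :: "nat \<Rightarrow> real \<Rightarrow> real \<Rightarrow> real \<Rightarrow> real" where
  "ud j w v x = (dff w ^^ 4) (F (8 - j) v) x / w ^ 4"

lemma DERIV_ud:
  assumes "0 < v" "j < 8"
  shows "(ud j w v has_real_derivative ud (Suc j) w v x) (at x)"
proof -
  have *: "8 - j = Suc (8 - Suc j)" using assms by simp
  have "((dff w ^^ 4) (F (8 - j) v) has_real_derivative (dff w ^^ 4) (F (8 - Suc j) v) x) (at x)"
    unfolding * by (rule dff_pow_derivative, rule DERIV_F) fact
  thus ?thesis unfolding ud_def[abs_def] by (rule DERIV_cdivide)
qed

lemma DERIV_ud_var:
  assumes "0 < v" "j \<le> 6"
  shows "((\<lambda>v. ud j w v x) has_real_derivative ud (j + 2) w v x / 2) (at v)"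
proof -
  define n where "n = 8 - (j + 2)"
  have n: "8 - j = n + 2" "8 - (j + 2) = n" using assms by (auto simp: n_def)
  note D = DERIV_F_var[OF assms(1), of n]
  have "((\<lambda>v. ud j w v x) has_real_derivative
    (F n v (x + 4 * w) / 2 - 4 * (F n v (x + 3 * w) / 2) + 6 * (F n v (x + 2 * w) / 2)
      - 4 * (F n v (x + w) / 2) + F n v x / 2) / w ^ 4) (at v)"
    unfolding ud_def dff4 n by (intro DERIV_cdivide DERIV_add DERIV_diff DERIV_cmult D)
  moreover have "(F n v (x + 4 * w) / 2 - 4 * (F n v (x + 3 * w) / 2) + 6 * (F n v (x + 2 * w) / 2)
      - 4 * (F n v (x + w) / 2) + F n v x / 2) / w ^ 4 = ud (j + 2) w v x / 2"
    unfolding ud_def dff4 n by (simp add: field_simps)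
  ultimately show ?thesis by (simp only:)
qed

lemma ud_0_mvt:
  assumes "0 < v" "0 < w"
  shows "\<exists>\<xi>. x \<le> \<xi> \<and> \<xi> \<le> x + 4 * w \<and> ud 0 w v x = Phi (\<xi> / sqrt v)"
proof -
  have "\<exists>\<xi>. x \<le> \<xi> \<and> \<xi> \<le> x + real 4 * w \<and> (dff w ^^ 4) (F (8 - 0) v) x = w ^ 4 * F (8 - 4) v \<xi>"
  proof (rule dff_pow_mvt)
    show "(F (8 - i) v has_real_derivative F (8 - Suc i) v x) (at x)" if "i < 4" for i x
    proof -
      have *: "8 - i = Suc (8 - Suc i)" using that by simp
      show ?thesis unfolding * by (rule DERIV_F) fact
    qed
  qed (use assms in auto)
  thus ?thesis using assms by (auto simp: ud_def F_4)
qed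

lemma ud_0_ge: "0 < v \<Longrightarrow> 0 < w \<Longrightarrow> Phi (x / sqrt v) \<le> ud 0 w v x"
  using ud_0_mvt[of v w x] by (auto intro!: Phi_mono divide_right_mono)

lemma ud_0_le: "0 < v \<Longrightarrow> 0 < w \<Longrightarrow> ud 0 w v x \<le> Phi ((x + 4 * w) / sqrt v)"
  using ud_0_mvt[of v w x] by (auto intro!: Phi_mono divide_right_mono)

lemma ud_0_pos: "0 < v \<Longrightarrow> 0 < w \<Longrightarrow> 0 < ud 0 w v x"
  using ud_0_ge[of v w x] Phi_pos[of "x / sqrt v"] by simp

lemma ud_0_le_1: "0 < v \<Longrightarrow> 0 < w \<Longrightarrow> ud 0 w v x \<le> 1"
  using ud_0_le[of v w x] Phi_less_1[of "(x + 4 * w) / sqrt v"] by simp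

lemma dff4_F_abs_le:
  assumes "0 < v" "0 < w" "0 < v'" "j \<le> 4"
    and "\<And>x. \<bar>F (4 - j) v x\<bar> \<le> c * F 4 v' (x + d)"
  shows "\<bar>ud j w v x\<bar> \<le> c * ud 0 w v' (x + d)"
proof -
  have "\<bar>(dff w ^^ 4) (F (8 - j - 0) v) x\<bar> \<le> (dff w ^^ 4) (\<lambda>x. c * F (8 - 0) v' (x + d)) x"
  proof (rule dff_pow_abs_le[where f = "\<lambda>i. F (8 - j - i) v" and g = "\<lambda>i x. c * F (8 - i) v' (x + d)"])
    fix i x assume i: "i < (4::nat)"
    have a: "8 - j - i = Suc (8 - j - Suc i)" "8 - i = Suc (8 - Suc i)" using assms i by auto
    show "(F (8 - j - i) v has_real_derivative F (8 - j - Suc i) v x) (at x)"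
      unfolding a by (rule DERIV_F) fact
    show "((\<lambda>x. c * F (8 - i) v' (x + d)) has_real_derivative c * F (8 - Suc i) v' (x + d)) (at x)"
      unfolding a by (intro DERIV_cmult DERIV_shift[THEN iffD1] DERIV_F assms)
  next
    have "8 - j - 4 = 4 - j" by simp
    thus "\<bar>F (8 - j - 4) v x\<bar> \<le> c * F (8 - 4) v' (x + d)" for x
      using assms(5)[of x] by simp
  qed (use assms in auto)
  also have "\<dots> = c * (dff w ^^ 4) (F 8 v') (x + d)"
    unfolding dff_pow_cmult dff_pow_shift by simp
  finally have "\<bar>(dff w ^^ 4) (F (8 - j) v) x\<bar> / w ^ 4 \<le> c * (dff w ^^ 4) (F 8 v') (x + d) / w ^ 4"
    using assms by (intro divide_right_mono) auto
  thus ?thesis using assms by (simp add: ud_def)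
qed

lemma ud_mono:
  assumes "0 < v" "0 < w" "x \<le> y"
  shows "ud 0 w v x \<le> ud 0 w v y"
proof -
  have "\<bar>ud 0 w v x\<bar> \<le> 1 * ud 0 w v (x + (y - x))"
  proof (rule dff4_F_abs_le)
    show "\<bar>F (4 - 0) v t\<bar> \<le> 1 * F 4 v (t + (y - x))" for t
      using assms Phi_pos[of "t / sqrt v"] by (auto simp: F_4 intro!: Phi_mono divide_right_mono)
  qed (use assms in auto)
  thus ?thesis by simp
qed

lemma ud_var_le:
  assumes "0 < v" "0 < w" "v \<le> v'"
  shows "ud 0 w v x \<le> 2 * ud 0 w v' x"
proof -
  have "\<bar>ud 0 w v x\<bar> \<le> 2 * ud 0 w v' (x + 0)"
  proof (rule dff4_F_abs_le)
    fix t
    have "Phi (t / sqrt v) \<le> 2 * Phi (t / sqrt v')"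
    proof (cases "t \<ge> 0")
      case True
      hence "1/2 \<le> Phi (t / sqrt v')" using Phi_mono[of 0 "t / sqrt v'"] Phi_0 assms by simp
      thus ?thesis using Phi_less_1[of "t / sqrt v"] by simp
    next
      case False
      hence "t / sqrt v \<le> t / sqrt v'"
        using assms by (intro divide_left_mono_neg) auto
      thus ?thesis using Phi_mono Phi_pos[of "t / sqrt v'"] by (smt (verit))
    qed
    thus "\<bar>F (4 - 0) v t\<bar> \<le> 2 * F 4 v' (t + 0)" using assms Phi_pos[of "t / sqrt v"] by (simp add: F_4)
  qed (use assms in auto)
  thus ?thesis by simp
qed

lemma ud_bound_smooth:
  assumes "0 < v" "0 < w" "0 < a" "a \<le> 1" "j \<le> 4"
  shows "\<bar>ud j w v x\<bar> \<le> 11520 * exp 1 / (sqrt v * a) ^ j * ud 0 w v (x + sqrt v * a)"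
proof (rule dff4_F_abs_le)
  fix x
  have s: "sqrt v > 0" using assms by simp
  have "\<bar>F (4 - j) v x\<bar> = \<bar>J (4 - j) (x / sqrt v)\<bar> / sqrt v ^ j"
  proof -
    have "sqrt v ^ 4 = sqrt v ^ (4 - j) * sqrt v ^ j" using assms by (simp flip: power_add)
    thus ?thesis using assms s unfolding sqrt_pow_F[OF assms(1)] by (simp add: abs_mult)
  qed
  also have "\<dots> \<le> (11520 * exp 1 / a ^ j * Phi (x / sqrt v + a)) / sqrt v ^ j"
    using s by (intro divide_right_mono abs_J_le assms) auto
  also have "x / sqrt v + a = (x + sqrt v * a) / sqrt v" using s by (simp add: field_simps)
  finally show "\<bar>F (4 - j) v x\<bar> \<le> 11520 * exp 1 / (sqrt v * a) ^ j * F 4 v (x + sqrt v * a)"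
    using assms by (simp add: F_4 power_mult_distrib mult_ac)
qed (use assms in auto)

lemma ud_bound_spline:
  assumes "0 < v" "0 < w" "j \<le> 4"
  shows "\<bar>ud j w v x\<bar> \<le> (2 / w) ^ j * ud 0 w v (x + 4 * w)"
proof -
  define f where "f = (dff w ^^ (4 - j)) (F (8 - j) v)"
  have f: "\<bar>f y\<bar> \<le> w ^ (4 - j) * Phi ((x + 4 * w) / sqrt v)" if "x \<le> y" "y \<le> x + real j * w" for y
  proof -
    have "\<exists>\<xi>. y \<le> \<xi> \<and> \<xi> \<le> y + real (4 - j) * w \<and> (dff w ^^ (4 - j)) (F (8 - j - 0) v) y = w ^ (4 - j) * F (8 - j - (4 - j)) v \<xi>"
    proof (rule dff_pow_mvt)
      fix i x assume i: "i < 4 - j"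
      have a: "8 - j - i = Suc (8 - j - Suc i)" using assms i by auto
      show "(F (8 - j - i) v has_real_derivative F (8 - j - Suc i) v x) (at x)"
        unfolding a by (rule DERIV_F) fact
    qed (use assms in auto)
    moreover have "8 - j - (4 - j) = 4" using assms by simp
    ultimately obtain \<xi> where xi: "\<xi> \<le> y + real (4 - j) * w" "f y = w ^ (4 - j) * Phi (\<xi> / sqrt v)"
      using assms by (auto simp: f_def F_4)
    have "\<xi> \<le> x + real j * w + real (4 - j) * w" using xi that by simp
    also have "\<dots> = x + 4 * w" using assms by (simp add: of_nat_diff algebra_simps)
    finally have "Phi (\<xi> / sqrt v) \<le> Phi ((x + 4 * w) / sqrt v)"
      using assms by (intro Phi_mono divide_right_mono) auto
    thus ?thesis unfolding xi using assms Phi_pos[of "\<xi> / sqrt v"] by (simp add: abs_mult mult_left_mono)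
  qed
  have "(dff w ^^ 4) (F (8 - j) v) = (dff w ^^ j) f"
    unfolding f_def using assms by (metis funpow_add comp_apply le_add_diff_inverse)
  hence "\<bar>ud j w v x\<bar> = \<bar>(dff w ^^ j) f x\<bar> / w ^ 4" using assms by (simp add: ud_def)
  also have "\<dots> \<le> 2 ^ j * (w ^ (4 - j) * Phi ((x + 4 * w) / sqrt v)) / w ^ 4"
    using assms f by (intro divide_right_mono dff_pow_abs_bound) auto
  also have "\<dots> = (2 / w) ^ j * Phi ((x + 4 * w) / sqrt v)"
  proof -
    have "w ^ 4 = w ^ (4 - j) * w ^ j" using assms by (simp flip: power_add)
    thus ?thesis using assms by (simp add: power_divide)
  qed
  also have "\<dots> \<le> (2 / w) ^ j * ud 0 w v (x + 4 * w)"
    using assms by (intro mult_left_mono ud_0_ge) auto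
  finally show ?thesis .
qed

definition kap :: "real \<Rightarrow> real \<Rightarrow> real \<Rightarrow> real" where
  "kap H w v = H + 2 / sqrt (v + w\<^sup>2)"

definition CU :: real where "CU = 11520 * exp 1 * 16"

lemma CU_ge: "CU \<ge> 1"
  using exp_ge_add_one_self[of 1] by (simp add: CU_def)

lemma ud_bound:
  assumes "0 < v" "0 < w" "1 \<le> H" "4 * w \<le> 1 / H" "j \<le> 4"
  shows "\<bar>ud j w v x\<bar> \<le> CU * kap H w v ^ j * ud 0 w v (x + 1 / H)"
proof (cases "w \<le> sqrt v")
  case True
  define s where "s = sqrt v"
  define a where "a = min 1 (1 / (s * H))"
  have s: "s > 0" "s \<ge> w" using assms True by (auto simp: s_def)
  have a: "0 < a" "a \<le> 1" using s assms by (auto simp: a_def)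
  have sa: "s * a \<le> 1 / H"
  proof -
    have "s * a \<le> s * (1 / (s * H))" using s by (intro mult_left_mono) (auto simp: a_def)
    thus ?thesis using s by simp
  qed
  have k: "1 / (s * a) \<le> kap H w v"
  proof -
    have "1 / (s * a) = max (1 / s) H" using s assms
      by (auto simp: a_def min_def max_def field_simps)
    also have "\<dots> \<le> H + 1 / s" using s assms by simp
    also have "1 / s \<le> 2 / sqrt (v + w\<^sup>2)"
    proof -
      have "w\<^sup>2 \<le> s\<^sup>2" using s assms by (intro power_mono) auto
      hence "v + w\<^sup>2 \<le> (2 * s)\<^sup>2" using assms by (simp add: s_def power_mult_distrib)
      hence "sqrt (v + w\<^sup>2) \<le> 2 * s" using s by (intro real_le_lsqrt) auto
      moreover have "0 < sqrt (v + w\<^sup>2)" using assms by (simp add: add_pos_nonneg)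
      ultimately show ?thesis using s by (simp add: field_simps)
    qed
    finally show ?thesis by (simp add: kap_def)
  qed
  have "\<bar>ud j w v x\<bar> \<le> 11520 * exp 1 * (1 / (s * a)) ^ j * ud 0 w v (x + s * a)"
    using ud_bound_smooth[OF assms(1,2) a assms(5)] by (simp add: s_def power_divide)
  also have "\<dots> \<le> CU * kap H w v ^ j * ud 0 w v (x + 1 / H)"
    using k sa s a assms ud_0_pos[OF assms(1,2)]
    by (intro mult_mono power_mono ud_mono) (auto simp: CU_def kap_def intro!: mult_nonneg_nonneg less_imp_le[OF ud_0_pos])
  finally show ?thesis .
next
  case False
  have k: "1 / w \<le> kap H w v"
  proof -
    have "sqrt v ^ 2 \<le> w\<^sup>2" using False assms by (intro power_mono) auto
    hence "v + w\<^sup>2 \<le> (2 * w)\<^sup>2" using assms by (simp add: power_mult_distrib)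
    hence "sqrt (v + w\<^sup>2) \<le> 2 * w" using assms by (intro real_le_lsqrt) auto
    moreover have "0 < sqrt (v + w\<^sup>2)" using assms by (simp add: add_pos_nonneg)
    ultimately have "1 / w \<le> 2 / sqrt (v + w\<^sup>2)" using assms by (simp add: field_simps)
    thus ?thesis using assms by (simp add: kap_def)
  qed
  have "\<bar>ud j w v x\<bar> \<le> (2 / w) ^ j * ud 0 w v (x + 4 * w)" by (rule ud_bound_spline) (use assms in auto)
  also have "(2 / w) ^ j = 2 ^ j * (1 / w) ^ j" by (simp add: power_divide)
  also have "2 ^ j * (1 / w) ^ j * ud 0 w v (x + 4 * w) \<le> CU * kap H w v ^ j * ud 0 w v (x + 1 / H)"
  proof (intro mult_mono power_mono ud_mono)
    have "(2::real) ^ j \<le> 2 ^ 4" using assms by (intro power_increasing) auto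
    also have "\<dots> \<le> CU" using exp_ge_add_one_self[of 1] by (simp add: CU_def)
    finally show "2 ^ j \<le> CU" .
  qed (use assms k CU_ge in \<open>auto intro!: mult_nonneg_nonneg less_imp_le[OF ud_0_pos] simp: kap_def\<close>)
  finally show ?thesis .
qed

lemma kap_pos: "0 < v \<Longrightarrow> 1 \<le> H \<Longrightarrow> 0 < kap H w v"
  unfolding kap_def by (intro add_pos_nonneg) auto

lemma kap_antimono: "0 < v \<Longrightarrow> v \<le> v' \<Longrightarrow> kap H w v' \<le> kap H w v"
  unfolding kap_def by (intro add_left_mono divide_left_mono) (auto intro!: mult_pos_pos add_pos_nonneg)

lemma kap_le: "0 < v \<Longrightarrow> 0 < w \<Longrightarrow> kap H w v \<le> H + 2 / w"
proof -
  assume "0 < v" "0 < w"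
  hence "w \<le> sqrt (v + w\<^sup>2)" by (intro real_le_rsqrt) auto
  moreover have "0 < sqrt (v + w\<^sup>2)" using \<open>0 < v\<close> by (simp add: add_pos_nonneg)
  ultimately show ?thesis using \<open>0 < w\<close> unfolding kap_def by (intro add_left_mono divide_left_mono mult_pos_pos) auto
qed

context
  fixes H w :: real
  assumes H: "1 \<le> H" and w: "0 < w" "4 * w \<le> 1 / H"
begin

lemma ud_le_dom:
  assumes "0 < v" "v \<le> v'" "j \<le> 4" "x + 1 / H \<le> x'"
  shows "\<bar>ud j w v x\<bar> \<le> 2 * CU * kap H w v ^ j * ud 0 w v' x'"
proof -
  have "\<bar>ud j w v x\<bar> \<le> CU * kap H w v ^ j * ud 0 w v (x + 1 / H)"
    using assms H w by (intro ud_bound) auto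
  also have "\<dots> \<le> CU * kap H w v ^ j * (2 * ud 0 w v' x')"
  proof (intro mult_left_mono)
    have "ud 0 w v (x + 1 / H) \<le> ud 0 w v x'" using assms w by (intro ud_mono) auto
    also have "\<dots> \<le> 2 * ud 0 w v' x'" using assms w by (intro ud_var_le) auto
    finally show "ud 0 w v (x + 1 / H) \<le> 2 * ud 0 w v' x'" .
  qed (use CU_ge kap_pos[OF assms(1) H, of w] in auto)
  finally show ?thesis by simp
qed

lemma ud_taylor_space:
  assumes "0 < v" "v \<le> v'" "\<bar>y\<bar> \<le> 1 / H"
  shows "\<bar>ud 0 w v (x + y) - (ud 0 w v x + y * ud 1 w v x + y\<^sup>2 / 2 * ud 2 w v x)\<bar>
     \<le> (\<bar>y\<bar> * kap H w v) ^ 3 * (2 * CU * ud 0 w v' (x + 2 / H))"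
proof -
  have "\<forall>m t. m < 3 \<and> \<bar>t\<bar> \<le> \<bar>y\<bar> \<longrightarrow> ((\<lambda>t. ud m w v (x + t)) has_real_derivative ud (Suc m) w v (x + t)) (at t)"
  proof (intro allI impI)
    fix m t assume "m < (3::nat) \<and> \<bar>t\<bar> \<le> \<bar>y\<bar>"
    hence "((\<lambda>t. ud m w v (t + x)) has_real_derivative ud (Suc m) w v (t + x)) (at t)"
      using DERIV_shift[THEN iffD1, OF DERIV_ud[OF assms(1), of m w "t + x"]] by simp
    thus "((\<lambda>t. ud m w v (x + t)) has_real_derivative ud (Suc m) w v (x + t)) (at t)"
      by (simp only: add.commute)
  qed
  then obtain t where t: "\<bar>t\<bar> \<le> \<bar>y\<bar>" and eq:
    "ud 0 w v (x + y) = (\<Sum>m<3. ud m w v (x + 0) / fact m * y ^ m) + ud 3 w v (x + t) / fact 3 * y ^ 3"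
    using Maclaurin_bi_le[of "\<lambda>m t. ud m w v (x + t)" "\<lambda>y. ud 0 w v (x + y)" 3 y] by blast
  have "\<bar>ud 3 w v (x + t)\<bar> \<le> 2 * CU * kap H w v ^ 3 * ud 0 w v' (x + 2 / H)"
    using assms t by (intro ud_le_dom) auto
  hence "\<bar>ud 3 w v (x + t) / fact 3 * y ^ 3\<bar> \<le> 2 * CU * kap H w v ^ 3 * ud 0 w v' (x + 2 / H) / fact 3 * \<bar>y\<bar> ^ 3"
    unfolding abs_mult abs_divide power_abs by (intro mult_right_mono divide_right_mono) (auto simp: fact_numeral)
  also have "\<dots> \<le> 2 * CU * kap H w v ^ 3 * ud 0 w v' (x + 2 / H) * \<bar>y\<bar> ^ 3"
    using CU_ge kap_pos[OF assms(1) H, of w] ud_0_pos[of v' w "x + 2 / H"] assms w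
    by (intro mult_right_mono) (auto simp: fact_numeral intro!: mult_nonneg_nonneg)
  finally show ?thesis unfolding eq
    by (simp add: eval_nat_numeral lessThan_Suc algebra_simps)
qed

lemma ud_taylor_var:
  assumes "0 < v" "0 \<le> s"
  shows "\<bar>ud 0 w (v + s) x - (ud 0 w v x + s / 2 * ud 2 w v x)\<bar>
     \<le> (sqrt s * kap H w v) ^ 4 * (2 * CU * ud 0 w (v + s) (x + 2 / H))"
proof (cases "s = 0")
  case False
  define diff where "diff m t = ud (2 * m) w (v + t) x / 2 ^ m" for m t
  have "\<exists>t. 0 < t \<and> t < s \<and> ud 0 w (v + s) x = (\<Sum>m<2. diff m 0 / fact m * s ^ m) + diff 2 t / fact 2 * s ^ 2"
  proof (rule Maclaurin)
    show "\<forall>m t. m < 2 \<and> 0 \<le> t \<and> t \<le> s \<longrightarrow> (diff m has_real_derivative diff (Suc m) t) (at t)"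
    proof (intro allI impI)
      fix m t assume *: "m < (2::nat) \<and> 0 \<le> t \<and> t \<le> s"
      have "((\<lambda>v. ud (2 * m) w v x) has_real_derivative ud (2 * m + 2) w (t + v) x / 2) (at (t + v))"
        using * assms by (intro DERIV_ud_var) auto
      hence "((\<lambda>t. ud (2 * m) w (t + v) x) has_real_derivative ud (2 * m + 2) w (t + v) x / 2) (at t)"
        by (simp only: DERIV_shift)
      hence "((\<lambda>t. ud (2 * m) w (t + v) x / 2 ^ m) has_real_derivative ud (2 * m + 2) w (t + v) x / 2 / 2 ^ m) (at t)"
        by (rule DERIV_cdivide)
      thus "(diff m has_real_derivative diff (Suc m) t) (at t)"
        unfolding diff_def[abs_def] by (simp add: add.commute)
    qed
  qed (use False assms in \<open>auto simp: diff_def[abs_def]\<close>)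
  then obtain t where t: "0 < t" "t < s"
    and eq: "ud 0 w (v + s) x = ud 0 w v x + s / 2 * ud 2 w v x + ud 4 w (v + t) x / 8 * s\<^sup>2"
    by (auto simp: diff_def lessThan_Suc eval_nat_numeral)
  have "\<bar>ud 4 w (v + t) x\<bar> \<le> 2 * CU * kap H w (v + t) ^ 4 * ud 0 w (v + s) (x + 2 / H)"
    using assms t H by (intro ud_le_dom) (auto simp: field_simps)
  also have "\<dots> \<le> 2 * CU * kap H w v ^ 4 * ud 0 w (v + s) (x + 2 / H)"
    using assms t H CU_ge kap_pos[of "v + t" H w] w
    by (intro mult_right_mono mult_left_mono power_mono kap_antimono) (auto intro!: less_imp_le[OF ud_0_pos])
  finally have "\<bar>ud 4 w (v + t) x / 8 * s\<^sup>2\<bar> \<le> 2 * CU * kap H w v ^ 4 * ud 0 w (v + s) (x + 2 / H) / 8 * s\<^sup>2"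
    unfolding abs_mult abs_divide by (intro mult_mono divide_right_mono) auto
  also have "\<dots> \<le> 2 * CU * kap H w v ^ 4 * ud 0 w (v + s) (x + 2 / H) * s\<^sup>2"
    using CU_ge kap_pos[OF assms(1) H, of w] ud_0_pos[of "v + s" w "x + 2 / H"] assms w
    by (intro mult_right_mono) (auto intro!: mult_nonneg_nonneg)
  finally have *: "\<bar>ud 4 w (v + t) x / 8 * s\<^sup>2\<bar> \<le> 2 * CU * kap H w v ^ 4 * ud 0 w (v + s) (x + 2 / H) * s\<^sup>2" .
  have s4: "sqrt s ^ 4 = s\<^sup>2" using assms
    by (metis mult_2 numeral_Bit0 power2_eq_square power_add real_sqrt_pow2)
  show ?thesis unfolding power_mult_distrib s4 using * unfolding eq
    by (simp add: mult_ac)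
qed (use assms in auto)

end

lemma product_expansion:
  fixes U0 p1 p2 r W0 q1 q2 r' M N a b :: real
  assumes "\<bar>U0\<bar> \<le> M" "\<bar>p1\<bar> \<le> a * M" "\<bar>p2\<bar> \<le> a\<^sup>2 * M" "\<bar>r\<bar> \<le> a ^ 3 * M"
    and "\<bar>W0\<bar> \<le> N" "\<bar>q1\<bar> \<le> b * N" "\<bar>q2\<bar> \<le> b\<^sup>2 * N" "\<bar>r'\<bar> \<le> b ^ 3 * N"
    and ab: "0 \<le> a" "a \<le> 1" "0 \<le> b" "b \<le> 1"
  shows "\<bar>(U0 + p1 + p2 + r) * (W0 + q1 + q2 + r')
      - (U0 * W0 + p1 * W0 + U0 * q1 + p2 * W0 + U0 * q2 + p1 * q1)\<bar> \<le> 8 * (a ^ 3 + b ^ 3) * (M * N)"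
proof -
  have M: "0 \<le> M" "0 \<le> N" using assms(1,5) by auto
  have a2: "a\<^sup>2 \<le> 1" "b\<^sup>2 \<le> 1" "a ^ 3 \<le> 1" "b ^ 3 \<le> 1" using ab by (auto intro: power_le_one)
  have m: "x * M \<le> M" if "x \<le> 1" for x using mult_right_mono[OF that M(1)] by simp
  have m': "x * N \<le> N" if "x \<le> 1" for x using mult_right_mono[OF that M(2)] by simp
  have e: "(U0 + p1 + p2 + r) * (W0 + q1 + q2 + r')
      - (U0 * W0 + p1 * W0 + U0 * q1 + p2 * W0 + U0 * q2 + p1 * q1)
     = p1 * q2 + p2 * q1 + p2 * q2 + r * (W0 + q1 + q2 + r') + (U0 + p1 + p2) * r'"
    by (simp add: algebra_simps)
  have "\<bar>W0 + q1 + q2 + r'\<bar> \<le> \<bar>W0\<bar> + \<bar>q1\<bar> + \<bar>q2\<bar> + \<bar>r'\<bar>" by linarith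
  also have "\<dots> \<le> N + N + N + N"
    by (intro add_mono assms(5) order_trans[OF assms(6) m'[OF ab(4)]] order_trans[OF assms(7) m'[OF a2(2)]]
        order_trans[OF assms(8) m'[OF a2(4)]])
  finally have W: "\<bar>W0 + q1 + q2 + r'\<bar> \<le> 4 * N" by simp
  have "\<bar>U0 + p1 + p2\<bar> \<le> \<bar>U0\<bar> + \<bar>p1\<bar> + \<bar>p2\<bar>" by linarith
  also have "\<dots> \<le> M + M + M"
    by (intro add_mono assms(1) order_trans[OF assms(2) m[OF ab(2)]] order_trans[OF assms(3) m[OF a2(1)]])
  finally have U: "\<bar>U0 + p1 + p2\<bar> \<le> 3 * M" by simp
  have "\<bar>p1 * q2 + p2 * q1 + p2 * q2 + r * (W0 + q1 + q2 + r') + (U0 + p1 + p2) * r'\<bar>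
     \<le> \<bar>p1\<bar> * \<bar>q2\<bar> + \<bar>p2\<bar> * \<bar>q1\<bar> + \<bar>p2\<bar> * \<bar>q2\<bar> + \<bar>r\<bar> * \<bar>W0 + q1 + q2 + r'\<bar> + \<bar>U0 + p1 + p2\<bar> * \<bar>r'\<bar>"
    unfolding abs_mult[symmetric] by linarith
  also have "\<dots> \<le> (a * M) * (b\<^sup>2 * N) + (a\<^sup>2 * M) * (b * N) + (a\<^sup>2 * M) * (b\<^sup>2 * N)
      + (a ^ 3 * M) * (4 * N) + (3 * M) * (b ^ 3 * N)"
    by (intro add_mono mult_mono assms W U) (use M ab in auto)
  also have "\<dots> = (a * b\<^sup>2 + a\<^sup>2 * b + a\<^sup>2 * b\<^sup>2 + 4 * a ^ 3 + 3 * b ^ 3) * (M * N)"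
    by (simp add: algebra_simps)
  also have "\<dots> \<le> (8 * (a ^ 3 + b ^ 3)) * (M * N)"
  proof (rule mult_right_mono)
    have 1: "a * b\<^sup>2 \<le> a ^ 3 + b ^ 3"
    proof (cases "a \<le> b")
      case True
      have "a * b\<^sup>2 \<le> b * b\<^sup>2" using True by (intro mult_right_mono) auto
      thus ?thesis using zero_le_power[OF ab(1), of 3] zero_le_power[OF ab(3), of 3]
        by (simp add: power3_eq_cube power2_eq_square mult.assoc)
    next
      case False
      have "a * b\<^sup>2 \<le> a * a\<^sup>2" using False ab by (intro mult_left_mono power_mono) auto
      thus ?thesis using zero_le_power[OF ab(1), of 3] zero_le_power[OF ab(3), of 3]
        by (simp add: power3_eq_cube power2_eq_square mult.assoc)
    qed
    have 2: "a\<^sup>2 * b \<le> a ^ 3 + b ^ 3"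
    proof (cases "a \<le> b")
      case True
      have "a\<^sup>2 * b \<le> b\<^sup>2 * b" using True ab by (intro mult_right_mono power_mono) auto
      thus ?thesis using zero_le_power[OF ab(1), of 3] zero_le_power[OF ab(3), of 3]
        by (simp add: power3_eq_cube power2_eq_square mult.assoc)
    next
      case False
      have "a\<^sup>2 * b \<le> a\<^sup>2 * a" using False by (intro mult_left_mono) auto
      thus ?thesis using zero_le_power[OF ab(1), of 3] zero_le_power[OF ab(3), of 3]
        by (simp add: power3_eq_cube power2_eq_square mult.assoc)
    qed
    have "a\<^sup>2 * b\<^sup>2 \<le> a * b\<^sup>2" using ab by (intro mult_right_mono) (auto simp: power2_eq_square mult_left_le)
    moreover have "X \<le> s + t \<Longrightarrow> Y \<le> s + t \<Longrightarrow> Z \<le> X \<Longrightarrow> 0 \<le> s \<Longrightarrow> 0 \<le> t \<Longrightarrow>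
        X + Y + Z + 4 * s + 3 * t \<le> 8 * (s + t)" for X Y Z s t :: real
      by auto
    ultimately show "a * b\<^sup>2 + a\<^sup>2 * b + a\<^sup>2 * b\<^sup>2 + 4 * a ^ 3 + 3 * b ^ 3 \<le> 8 * (a ^ 3 + b ^ 3)"
      using 1 2 zero_le_power[OF ab(1), of 3] zero_le_power[OF ab(3), of 3] by blast
  qed (use M in auto)
  finally show ?thesis unfolding e .
qed

lemma (in prob_space) indep_factor:
  fixes A B :: "nat \<Rightarrow> 'a \<Rightarrow> real" and f g :: "real \<times> real \<Rightarrow> real"
  assumes ind: "indep_vars (\<lambda>_. borel \<Otimes>\<^sub>M borel) (\<lambda>i om. (A i om, B i om)) {..<N}" and i: "i < N"
    and f [measurable]: "f \<in> borel_measurable (borel \<Otimes>\<^sub>M borel)"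
    and g [measurable]: "g \<in> borel_measurable (borel \<Otimes>\<^sub>M borel)"
    and bf: "integrable M (\<lambda>om. f (A i om, B i om))"
    and bg: "integrable M (\<lambda>om. g (\<Sum>j<i. A j om, \<Sum>j<i. B j om))"
  shows "expectation (\<lambda>om. f (A i om, B i om) * g (\<Sum>j<i. A j om, \<Sum>j<i. B j om))
     = expectation (\<lambda>om. f (A i om, B i om)) * expectation (\<lambda>om. g (\<Sum>j<i. A j om, \<Sum>j<i. B j om))" (is ?eq)
    and "integrable M (\<lambda>om. f (A i om, B i om) * g (\<Sum>j<i. A j om, \<Sum>j<i. B j om))" (is ?int)
proof -
  have "indep_var borel ((\<lambda>h. f (h i)) \<circ> (\<lambda>om. restrict (\<lambda>i. (A i om, B i om)) {i}))
     borel ((\<lambda>h. g (\<Sum>j<i. fst (h j), \<Sum>j<i. snd (h j))) \<circ> (\<lambda>om. restrict (\<lambda>i. (A i om, B i om)) {..<i}))"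
    by (intro indep_var_compose[OF indep_var_restrict[OF ind]]) (use i in auto)
  also have "((\<lambda>h. f (h i)) \<circ> (\<lambda>om. restrict (\<lambda>i. (A i om, B i om)) {i})) = (\<lambda>om. f (A i om, B i om))"
    by auto
  also have "((\<lambda>h. g (\<Sum>j<i. fst (h j), \<Sum>j<i. snd (h j))) \<circ> (\<lambda>om. restrict (\<lambda>i. (A i om, B i om)) {..<i}))
     = (\<lambda>om. g (\<Sum>j<i. A j om, \<Sum>j<i. B j om))"
    by (auto simp: fun_eq_iff)
  finally have *: "indep_var borel (\<lambda>om. f (A i om, B i om)) borel (\<lambda>om. g (\<Sum>j<i. A j om, \<Sum>j<i. B j om))" .
  show ?eq by (rule indep_var_lebesgue_integral[OF * bf bg])
  show ?int by (rule indep_var_integrable[OF * bf bg])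
qed

section \<open>Lindeberg replacement for two correlated sums\<close>

lemma measurable_ud:
  assumes "0 < v" "j < 8"
  shows "ud j w v \<in> borel_measurable borel"
  using DERIV_ud[OF assms] by (intro borel_measurable_continuous_onI DERIV_continuous_on)
    (auto intro: has_field_derivative_at_within)

lemma ud_bounded:
  assumes "0 < v" "0 < w" "1 \<le> H" "4 * w \<le> 1 / H" "j \<le> 4"
  shows "\<bar>ud j w v x\<bar> \<le> CU * kap H w v ^ j"
proof -
  have "\<bar>ud j w v x\<bar> \<le> CU * kap H w v ^ j * ud 0 w v (x + 1 / H)" by (rule ud_bound) fact+
  also have "\<dots> \<le> CU * kap H w v ^ j * 1"
    using CU_ge kap_pos[OF assms(1,3), of w] assms by (intro mult_left_mono ud_0_le_1) auto
  finally show ?thesis by simp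
qed

context
  fixes H w :: real
  assumes H: "1 \<le> H" and w: "0 < w" "4 * w \<le> 1 / H"
begin

definition dom :: "real \<Rightarrow> real \<Rightarrow> real" where
  "dom v x = 2 * CU * ud 0 w v (x + 2 / H)"

lemma dom_nonneg: "0 < v \<Longrightarrow> 0 \<le> dom v x"
  unfolding dom_def using CU_ge w by (intro mult_nonneg_nonneg less_imp_le[OF ud_0_pos]) auto

lemma ud_le_dom2:
  assumes "0 < v" "v \<le> v'" "j \<le> 4"
  shows "\<bar>ud j w v x\<bar> \<le> kap H w v ^ j * dom v' x"
proof -
  have "x + 1 / H \<le> x + 2 / H" using H by (simp add: field_simps)
  from ud_le_dom[OF H w assms this] show ?thesis unfolding dom_def by (simp add: mult_ac)
qed

lemma ud_mult_le:
  assumes "0 < v" "v \<le> v'" "j \<le> 4" "\<bar>c\<bar> \<le> d"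
  shows "\<bar>c * ud j w v x\<bar> \<le> d * kap H w v ^ j * dom v' x"
  unfolding abs_mult mult.assoc using ud_le_dom2[OF assms(1-3)] assms(4) by (intro mult_mono) auto

lemma product_taylor_space:
  assumes v: "0 < v" "v \<le> vs" "0 < v'" "v' \<le> vs'"
    and a: "\<bar>a\<bar> \<le> 1 / H" "\<bar>a\<bar> * kap H w v \<le> 1" and b: "\<bar>b\<bar> \<le> 1 / H" "\<bar>b\<bar> * kap H w v' \<le> 1"
  shows "\<bar>ud 0 w v (s + a) * ud 0 w v' (t + b) -
      (ud 0 w v s * ud 0 w v' t + a * ud 1 w v s * ud 0 w v' t + ud 0 w v s * (b * ud 1 w v' t)
       + a\<^sup>2 / 2 * ud 2 w v s * ud 0 w v' t + ud 0 w v s * (b\<^sup>2 / 2 * ud 2 w v' t)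
       + a * ud 1 w v s * (b * ud 1 w v' t))\<bar>
     \<le> 8 * ((\<bar>a\<bar> * kap H w v) ^ 3 + (\<bar>b\<bar> * kap H w v') ^ 3) * (dom vs s * dom vs' t)"
proof -
  have k: "0 < kap H w v" "0 < kap H w v'" using v H by (auto intro!: kap_pos)
  define ra where "ra = ud 0 w v (s + a) - (ud 0 w v s + a * ud 1 w v s + a\<^sup>2 / 2 * ud 2 w v s)"
  define rb where "rb = ud 0 w v' (t + b) - (ud 0 w v' t + b * ud 1 w v' t + b\<^sup>2 / 2 * ud 2 w v' t)"
  have ra: "\<bar>ra\<bar> \<le> (\<bar>a\<bar> * kap H w v) ^ 3 * dom vs s"
    unfolding ra_def dom_def by (rule ud_taylor_space[OF H w v(1,2) a(1)])
  have rb: "\<bar>rb\<bar> \<le> (\<bar>b\<bar> * kap H w v') ^ 3 * dom vs' t"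
    unfolding rb_def dom_def by (rule ud_taylor_space[OF H w v(3,4) b(1)])
  have p: "\<bar>a * ud 1 w v s\<bar> \<le> \<bar>a\<bar> * kap H w v * dom vs s" "\<bar>b * ud 1 w v' t\<bar> \<le> \<bar>b\<bar> * kap H w v' * dom vs' t"
    using ud_mult_le[OF v(1,2), of 1 a "\<bar>a\<bar>" s] ud_mult_le[OF v(3,4), of 1 b "\<bar>b\<bar>" t] by simp_all
  have q: "\<bar>a\<^sup>2 / 2 * ud 2 w v s\<bar> \<le> (\<bar>a\<bar> * kap H w v)\<^sup>2 * dom vs s"
    "\<bar>b\<^sup>2 / 2 * ud 2 w v' t\<bar> \<le> (\<bar>b\<bar> * kap H w v')\<^sup>2 * dom vs' t"
    using ud_mult_le[OF v(1,2), of 2 "a\<^sup>2 / 2" "\<bar>a\<bar>\<^sup>2" s] ud_mult_le[OF v(3,4), of 2 "b\<^sup>2 / 2" "\<bar>b\<bar>\<^sup>2" t]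
    by (simp_all add: power_mult_distrib)
  have z: "\<bar>ud 0 w v s\<bar> \<le> dom vs s" "\<bar>ud 0 w v' t\<bar> \<le> dom vs' t"
    using ud_le_dom2[OF v(1,2), of 0 s] ud_le_dom2[OF v(3,4), of 0 t] by simp_all
  have e: "ud 0 w v (s + a) = ud 0 w v s + a * ud 1 w v s + a\<^sup>2 / 2 * ud 2 w v s + ra"
    "ud 0 w v' (t + b) = ud 0 w v' t + b * ud 1 w v' t + b\<^sup>2 / 2 * ud 2 w v' t + rb"
    by (simp_all add: ra_def rb_def)
  show ?thesis unfolding e
    by (rule product_expansion[OF z(1) p(1) q(1) ra z(2) p(2) q(2) rb]) (use k a b in auto)
qed

lemma product_taylor_var:
  assumes v: "0 < v" "0 < v'" and s: "0 \<le> va" "0 \<le> vb"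
    and a: "sqrt va * kap H w v \<le> 1" "sqrt vb * kap H w v' \<le> 1"
  shows "\<bar>ud 0 w (v + va) s * ud 0 w (v' + vb) t -
      (ud 0 w v s * ud 0 w v' t + va / 2 * ud 2 w v s * ud 0 w v' t + ud 0 w v s * (vb / 2 * ud 2 w v' t))\<bar>
     \<le> 8 * ((sqrt va * kap H w v) ^ 3 + (sqrt vb * kap H w v') ^ 3) * (dom (v + va) s * dom (v' + vb) t)"
proof -
  have k: "0 < kap H w v" "0 < kap H w v'" using v H by (auto intro!: kap_pos)
  have a0: "0 \<le> sqrt va * kap H w v" "0 \<le> sqrt vb * kap H w v'" using s k by auto
  have vv: "v \<le> v + va" "v' \<le> v' + vb" using s by auto
  have D: "0 \<le> dom (v + va) s" "0 \<le> dom (v' + vb) t" using v s by (auto intro!: dom_nonneg)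
  define ra where "ra = ud 0 w (v + va) s - (ud 0 w v s + va / 2 * ud 2 w v s)"
  define rb where "rb = ud 0 w (v' + vb) t - (ud 0 w v' t + vb / 2 * ud 2 w v' t)"
  have "\<bar>ra\<bar> \<le> (sqrt va * kap H w v) ^ 4 * dom (v + va) s"
    unfolding ra_def dom_def by (rule ud_taylor_var[OF H w v(1) s(1)])
  also have "\<dots> \<le> (sqrt va * kap H w v) ^ 3 * dom (v + va) s"
    using a0(1) a(1) D by (intro mult_right_mono power_decreasing) auto
  finally have ra: "\<bar>ra\<bar> \<le> (sqrt va * kap H w v) ^ 3 * dom (v + va) s" .
  have "\<bar>rb\<bar> \<le> (sqrt vb * kap H w v') ^ 4 * dom (v' + vb) t"
    unfolding rb_def dom_def by (rule ud_taylor_var[OF H w v(2) s(2)])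
  also have "\<dots> \<le> (sqrt vb * kap H w v') ^ 3 * dom (v' + vb) t"
    using a0(2) a(2) D by (intro mult_right_mono power_decreasing) auto
  finally have rb: "\<bar>rb\<bar> \<le> (sqrt vb * kap H w v') ^ 3 * dom (v' + vb) t" .
  have p: "\<bar>0::real\<bar> \<le> sqrt va * kap H w v * dom (v + va) s" "\<bar>0::real\<bar> \<le> sqrt vb * kap H w v' * dom (v' + vb) t"
    using a0 D by auto
  have q: "\<bar>va / 2 * ud 2 w v s\<bar> \<le> (sqrt va * kap H w v)\<^sup>2 * dom (v + va) s"
    "\<bar>vb / 2 * ud 2 w v' t\<bar> \<le> (sqrt vb * kap H w v')\<^sup>2 * dom (v' + vb) t"
    using ud_mult_le[OF v(1) vv(1), of 2 "va / 2" va s] ud_mult_le[OF v(2) vv(2), of 2 "vb / 2" vb t] s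
    by (simp_all add: power_mult_distrib)
  have z: "\<bar>ud 0 w v s\<bar> \<le> dom (v + va) s" "\<bar>ud 0 w v' t\<bar> \<le> dom (v' + vb) t"
    using ud_le_dom2[OF v(1) vv(1), of 0 s] ud_le_dom2[OF v(2) vv(2), of 0 t] by simp_all
  have e: "ud 0 w (v + va) s = ud 0 w v s + 0 + va / 2 * ud 2 w v s + ra"
    "ud 0 w (v' + vb) t = ud 0 w v' t + 0 + vb / 2 * ud 2 w v' t + rb"
    by (simp_all add: ra_def rb_def)
  show ?thesis unfolding e
    using product_expansion[OF z(1) p(1) q(1) ra z(2) p(2) q(2) rb a0(1) a(1) a0(2) a(2)] by simp
qed

end

locale bivariate_sum = prob_space +
  fixes N :: nat and A B :: "nat \<Rightarrow> 'a \<Rightarrow> real" and va vb :: "nat \<Rightarrow> real"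
    and bd \<beta> \<rho> H w vA vB :: real
  assumes ind: "indep_vars (\<lambda>_. borel \<Otimes>\<^sub>M borel) (\<lambda>i om. (A i om, B i om)) {..<N}"
    and bdd: "\<And>i om. i < N \<Longrightarrow> om \<in> space M \<Longrightarrow> \<bar>A i om\<bar> \<le> bd"
      "\<And>i om. i < N \<Longrightarrow> om \<in> space M \<Longrightarrow> \<bar>B i om\<bar> \<le> bd"
    and mean0: "\<And>i. i < N \<Longrightarrow> expectation (A i) = 0" "\<And>i. i < N \<Longrightarrow> expectation (B i) = 0"
    and vars: "\<And>i. i < N \<Longrightarrow> expectation (\<lambda>om. (A i om)\<^sup>2) = va i"
      "\<And>i. i < N \<Longrightarrow> expectation (\<lambda>om. (B i om)\<^sup>2) = vb i"
    and third: "\<And>i. i < N \<Longrightarrow> expectation (\<lambda>om. \<bar>A i om\<bar> ^ 3) \<le> \<beta> * va i"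
      "\<And>i. i < N \<Longrightarrow> expectation (\<lambda>om. \<bar>B i om\<bar> ^ 3) \<le> \<beta> * vb i"
    and sd: "\<And>i. i < N \<Longrightarrow> sqrt (va i) \<le> \<beta>" "\<And>i. i < N \<Longrightarrow> sqrt (vb i) \<le> \<beta>"
    and cov: "\<And>i. i < N \<Longrightarrow> \<bar>expectation (\<lambda>om. A i om * B i om)\<bar> \<le> \<rho> * (sqrt (va i) * sqrt (vb i))"
    and H: "1 \<le> H" and w: "0 < w" "4 * w \<le> 1 / H"
    and bd: "0 \<le> bd" "bd \<le> 1 / H" "bd * (H + 2 / w) \<le> 1" and rho: "0 \<le> \<rho>"
    and vAB: "0 < vA" "0 < vB"
begin

definition SA :: "nat \<Rightarrow> 'a \<Rightarrow> real" where "SA i om = (\<Sum>j<i. A j om)"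
definition SB :: "nat \<Rightarrow> 'a \<Rightarrow> real" where "SB i om = (\<Sum>j<i. B j om)"
definition VA :: "nat \<Rightarrow> real" where "VA i = vA + (\<Sum>j\<in>{i..<N}. va j)"
definition VB :: "nat \<Rightarrow> real" where "VB i = vB + (\<Sum>j\<in>{i..<N}. vb j)"

definition hyb :: "nat \<Rightarrow> real \<Rightarrow> real \<Rightarrow> real" where
  "hyb i x y = expectation (\<lambda>om. ud 0 w (VA i) (SA i om + x) * ud 0 w (VB i) (SB i om + y))"

definition err :: "nat \<Rightarrow> real" where
  "err i = 64 * CU\<^sup>2 * (\<beta> * (va i * kap H w (VA (Suc i)) ^ 3 + vb i * kap H w (VB (Suc i)) ^ 3)
     + \<rho> * (va i * kap H w (VA (Suc i)) ^ 2 + vb i * kap H w (VB (Suc i)) ^ 2))"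

lemma meas_AB [measurable]: "i < N \<Longrightarrow> A i \<in> borel_measurable M" "i < N \<Longrightarrow> B i \<in> borel_measurable M"
proof -
  assume i: "i < N"
  have "random_variable (borel \<Otimes>\<^sub>M borel) (\<lambda>om. (A i om, B i om))"
    using ind i unfolding indep_vars_def by auto
  from measurable_compose[OF this measurable_fst] measurable_compose[OF this measurable_snd]
  show "A i \<in> borel_measurable M" "B i \<in> borel_measurable M" by auto
qed

lemma meas_S [measurable]: "i \<le> N \<Longrightarrow> SA i \<in> borel_measurable M" "i \<le> N \<Longrightarrow> SB i \<in> borel_measurable M"
  unfolding SA_def SB_def by (auto intro!: borel_measurable_sum meas_AB)

lemma va_nonneg: "i < N \<Longrightarrow> 0 \<le> va i" "i < N \<Longrightarrow> 0 \<le> vb i"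
  using vars(1)[of i, symmetric] vars(2)[of i, symmetric] by auto

lemma VA_pos: "0 < VA i" "0 < VB i"
  unfolding VA_def VB_def using vAB va_nonneg by (auto intro!: add_pos_nonneg sum_nonneg)

lemma VA_Suc: "i < N \<Longrightarrow> VA i = VA (Suc i) + va i" "i < N \<Longrightarrow> VB i = VB (Suc i) + vb i"
  unfolding VA_def VB_def by (auto simp: sum.atLeast_Suc_lessThan)

lemma beta_nonneg: "0 < N \<Longrightarrow> 0 \<le> \<beta>"
  using sd(1)[of 0] va_nonneg(1)[of 0] by (smt (verit) real_sqrt_ge_zero)

lemma integrable_bd:
  fixes f :: "'a \<Rightarrow> real"
  assumes "f \<in> borel_measurable M" "\<And>om. om \<in> space M \<Longrightarrow> \<bar>f om\<bar> \<le> C"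
  shows "integrable M f"
  using assms by (intro integrable_const_bound[of _ C] AE_I2) auto

lemma abs_le_square: "\<bar>a\<bar> \<le> c \<Longrightarrow> a\<^sup>2 \<le> c\<^sup>2" for a c :: real
  by (metis abs_ge_zero power2_abs power_mono)

lemma va_le: "i < N \<Longrightarrow> va i \<le> bd\<^sup>2" "i < N \<Longrightarrow> vb i \<le> bd\<^sup>2"
proof -
  assume i: "i < N"
  have "expectation (\<lambda>om. (f om)\<^sup>2) \<le> bd\<^sup>2"
    if [measurable]: "f \<in> borel_measurable M" and f: "\<And>om. om \<in> space M \<Longrightarrow> \<bar>f om\<bar> \<le> bd" for f :: "'a \<Rightarrow> real"
  proof -
    have "integrable M (\<lambda>om. (f om)\<^sup>2)"
      by (rule integrable_bd[where C = "bd\<^sup>2"]) (use abs_le_square[OF f] in auto)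
    hence "expectation (\<lambda>om. (f om)\<^sup>2) \<le> expectation (\<lambda>om. bd\<^sup>2)"
      by (rule integral_mono) (use abs_le_square[OF f] in auto)
    thus ?thesis by (simp add: prob_space)
  qed
  from this[OF meas_AB(1)[OF i] bdd(1)[OF i]] this[OF meas_AB(2)[OF i] bdd(2)[OF i]]
  show "va i \<le> bd\<^sup>2" "vb i \<le> bd\<^sup>2" using vars[OF i] by auto
qed

lemma ud_bd:
  assumes "0 < v" "j \<le> 4"
  shows "\<bar>ud j w v x\<bar> \<le> CU * kap H w v ^ j"
  using assms H w by (intro ud_bounded) auto

lemma step:
  assumes i: "i < N"
  shows "\<bar>hyb (Suc i) x y - hyb i x y\<bar> \<le> err i * hyb i (x + 2 / H) (y + 2 / H)"
proof -
  define v v' kA kB K where "v = VA (Suc i)" and "v' = VB (Suc i)"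
    and "kA = kap H w (VA (Suc i))" and "kB = kap H w (VB (Suc i))" and "K = 2 * CU"
  have v: "0 < v" "0 < v'" "VA i = v + va i" "VB i = v' + vb i"
    unfolding v_def v'_def using VA_pos VA_Suc[OF i] by auto
  note nn = va_nonneg[OF i]
  have vle: "v \<le> VA i" "v' \<le> VB i" using v nn by auto
  have k: "0 < kA" "0 < kB"
    unfolding kA_def kB_def using VA_pos H by (auto intro!: kap_pos)
  have kk: "kA = kap H w v" "kB = kap H w v'" unfolding kA_def kB_def v_def v'_def by auto
  have K: "1 \<le> K" using CU_ge by (simp add: K_def)
  have kle: "kA \<le> H + 2 / w" "kB \<le> H + 2 / w" unfolding kk using kap_le v w by auto
  have bk: "bd * kA \<le> 1" "bd * kB \<le> 1"
    using order_trans[OF mult_left_mono[OF kle(1) bd(1)] bd(3)] order_trans[OF mult_left_mono[OF kle(2) bd(1)] bd(3)] .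
  have sqle: "sqrt (va i) \<le> bd" "sqrt (vb i) \<le> bd"
    using va_le[OF i] bd by (auto intro: real_le_lsqrt)
  define DA where "DA z = ud 0 w (VA i) (z + x + 2 / H)" for z
  define DB where "DB z = ud 0 w (VB i) (z + y + 2 / H)" for z
  have Dpos: "0 < DA z" "0 < DB z" for z unfolding DA_def DB_def using VA_pos w by (auto intro: ud_0_pos)
  define U0 U1 U2 where "U0 z = ud 0 w v (z + x)" and "U1 z = ud 1 w v (z + x)" and "U2 z = ud 2 w v (z + x)" for z
  define W0 W1 W2 where "W0 z = ud 0 w v' (z + y)" and "W1 z = ud 1 w v' (z + y)" and "W2 z = ud 2 w v' (z + y)" for z
  have domA: "dom H w (VA i) (z + x) = K * DA z" "dom H w (VB i) (z + y) = K * DB z" for z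
    unfolding dom_def[OF H w] DA_def DB_def K_def by simp_all
  have U1D: "\<bar>U1 z\<bar> \<le> kA * (K * DA z)" "\<bar>W1 z\<bar> \<le> kB * (K * DB z)" for z
    using ud_le_dom2[OF H w v(1) vle(1), of 1 "z + x"] ud_le_dom2[OF H w v(2) vle(2), of 1 "z + y"]
    unfolding U1_def W1_def domA kk by simp_all
  have ptA: "\<bar>U0 (s + a) * W0 (t + b) - (U0 s * W0 t + a * U1 s * W0 t + U0 s * (b * W1 t)
       + a\<^sup>2 / 2 * U2 s * W0 t + U0 s * (b\<^sup>2 / 2 * W2 t) + a * U1 s * (b * W1 t))\<bar>
     \<le> 8 * ((\<bar>a\<bar> * kA) ^ 3 + (\<bar>b\<bar> * kB) ^ 3) * ((K * DA s) * (K * DB t))"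
    if ab: "\<bar>a\<bar> \<le> bd" "\<bar>b\<bar> \<le> bd" for s t a b
  proof -
    have a1: "\<bar>a\<bar> * kap H w v \<le> 1" "\<bar>b\<bar> * kap H w v' \<le> 1" unfolding kk[symmetric]
      using order_trans[OF mult_right_mono[OF ab(1) less_imp_le[OF k(1)]] bk(1)]
        order_trans[OF mult_right_mono[OF ab(2) less_imp_le[OF k(2)]] bk(2)] .
    have "s + a + x = s + x + a" "t + b + y = t + y + b" by simp_all
    thus ?thesis
      using product_taylor_space[OF H w v(1) vle(1) v(2) vle(2) order_trans[OF ab(1) bd(2)] a1(1)
          order_trans[OF ab(2) bd(2)] a1(2), of "s + x" "t + y"]
      unfolding U0_def U1_def U2_def W0_def W1_def W2_def domA kk by (simp only:)
  qed
  have ptB: "\<bar>ud 0 w (VA i) (s + x) * ud 0 w (VB i) (t + y) - (U0 s * W0 t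
       + va i / 2 * U2 s * W0 t + U0 s * (vb i / 2 * W2 t))\<bar>
     \<le> 8 * ((sqrt (va i) * kA) ^ 3 + (sqrt (vb i) * kB) ^ 3) * ((K * DA s) * (K * DB t))" for s t
  proof -
    have a1: "sqrt (va i) * kap H w v \<le> 1" "sqrt (vb i) * kap H w v' \<le> 1" unfolding kk[symmetric]
      using order_trans[OF mult_right_mono[OF sqle(1) less_imp_le[OF k(1)]] bk(1)]
        order_trans[OF mult_right_mono[OF sqle(2) less_imp_le[OF k(2)]] bk(2)] .
    show ?thesis
      using product_taylor_var[OF H w v(1,2) nn a1, of "s + x" "t + y"]
      unfolding U0_def U2_def W0_def W2_def v(3,4)[symmetric] domA kk[symmetric] by (simp only:)
  qed
  have hi: "hyb i (x + 2 / H) (y + 2 / H) = expectation (\<lambda>om. DA (SA i om) * DB (SB i om))"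
    unfolding hyb_def DA_def DB_def by (simp add: add.assoc)
  have mu: "(\<lambda>z. ud j w r (z + c)) \<in> borel_measurable borel" if "0 < r" "j < 8" for j r c
  proof -
    have [measurable]: "ud j w r \<in> borel_measurable borel" using that by (rule measurable_ud)
    show ?thesis by measurable
  qed
  have [measurable]: "U0 \<in> borel_measurable borel" "U1 \<in> borel_measurable borel" "U2 \<in> borel_measurable borel"
    "W0 \<in> borel_measurable borel" "W1 \<in> borel_measurable borel" "W2 \<in> borel_measurable borel"
    unfolding U0_def[abs_def] U1_def[abs_def] U2_def[abs_def] W0_def[abs_def] W1_def[abs_def] W2_def[abs_def]
    by (intro mu v; simp)+
  have [measurable]: "DA \<in> borel_measurable borel" "DB \<in> borel_measurable borel"
    unfolding DA_def[abs_def] DB_def[abs_def] add.assoc by (intro mu VA_pos; simp)+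
  have [measurable]: "SA i \<in> borel_measurable M" "SB i \<in> borel_measurable M"
      "A i \<in> borel_measurable M" "B i \<in> borel_measurable M" using i by simp_all
  define Cb where "Cb = CU * (1 + kA + kA\<^sup>2) * (1 + kB + kB\<^sup>2)"
  have cc: "CU * 1 \<le> Cb" "CU * kA \<le> Cb" "CU * kA\<^sup>2 \<le> Cb" "CU * kB \<le> Cb" "CU * kB\<^sup>2 \<le> Cb"
    unfolding Cb_def mult.assoc using CU_ge k
    by (intro mult_left_mono; simp add: algebra_simps add_nonneg_nonneg)+
  have Cb: "0 \<le> Cb" using cc(1) CU_ge by simp
  have Ub: "\<bar>U0 s\<bar> \<le> Cb" "\<bar>U1 s\<bar> \<le> Cb" "\<bar>U2 s\<bar> \<le> Cb" for s
    using ud_bd[OF v(1), of 0 "s + x"] ud_bd[OF v(1), of 1 "s + x"] ud_bd[OF v(1), of 2 "s + x"] cc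
    unfolding U0_def U1_def U2_def kk by simp_all
  have Wb: "\<bar>W0 s\<bar> \<le> Cb" "\<bar>W1 s\<bar> \<le> Cb" "\<bar>W2 s\<bar> \<le> Cb" for s
    using ud_bd[OF v(2), of 0 "s + y"] ud_bd[OF v(2), of 1 "s + y"] ud_bd[OF v(2), of 2 "s + y"] cc
    unfolding W0_def W1_def W2_def kk by simp_all
  have Db: "\<bar>DA s\<bar> \<le> 1" "\<bar>DB s\<bar> \<le> 1" for s
    using Dpos[of s] VA_pos[of i] w unfolding DA_def DB_def by (auto intro!: ud_0_le_1)
  have fac: "expectation (\<lambda>om. f (A i om, B i om) * g (SA i om, SB i om))
       = expectation (\<lambda>om. f (A i om, B i om)) * expectation (\<lambda>om. g (SA i om, SB i om))"
      "integrable M (\<lambda>om. f (A i om, B i om) * g (SA i om, SB i om))"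
    if f [measurable]: "f \<in> borel_measurable (borel \<Otimes>\<^sub>M borel)" and g [measurable]: "g \<in> borel_measurable (borel \<Otimes>\<^sub>M borel)"
    and fb: "\<And>a b. \<bar>a\<bar> \<le> bd \<Longrightarrow> \<bar>b\<bar> \<le> bd \<Longrightarrow> \<bar>f (a, b)\<bar> \<le> C" and gb: "\<And>z. \<bar>g z\<bar> \<le> C'"
    for f g :: "real \<times> real \<Rightarrow> real" and C C'
  proof -
    have 1: "integrable M (\<lambda>om. f (A i om, B i om))"
      using i fb bdd[OF i] by (intro integrable_bd[where C = C]) auto
    have 2: "integrable M (\<lambda>om. g (\<Sum>j<i. A j om, \<Sum>j<i. B j om))"
      using i gb by (intro integrable_bd[where C = C']) auto
    show "expectation (\<lambda>om. f (A i om, B i om) * g (SA i om, SB i om))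
       = expectation (\<lambda>om. f (A i om, B i om)) * expectation (\<lambda>om. g (SA i om, SB i om))"
      "integrable M (\<lambda>om. f (A i om, B i om) * g (SA i om, SB i om))"
      using indep_factor[OF ind i f g 1 2] by (auto simp: SA_def SB_def)
  qed
  define c1 where "c1 = expectation (\<lambda>om. A i om * B i om)"
  define EG where "EG = hyb i (x + 2 / H) (y + 2 / H)"
  define g6 where "g6 om = DA (SA i om) * DB (SB i om)" for om
  have EG: "EG = expectation g6" unfolding EG_def hi g6_def ..
  define g5 where "g5 om = U1 (SA i om) * W1 (SB i om)" for om
  define g1 where "g1 om = U1 (SA i om) * W0 (SB i om)" for om
  define g2 where "g2 om = U0 (SA i om) * W1 (SB i om)" for om
  define g3 where "g3 om = U2 (SA i om) * W0 (SB i om) / 2" for om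
  define g4 where "g4 om = U0 (SA i om) * W2 (SB i om) / 2" for om
  have gU: "\<bar>f s * g t\<bar> \<le> Cb * Cb" if "f \<in> {U0, U1, U2}" "g \<in> {W0, W1, W2}" for f g s t
    unfolding abs_mult using that Ub[of s] Wb[of t] Cb by (intro mult_mono) auto
  note A_bd = abs_le_square[where c = bd]
  have iA: "integrable M (A i)" "integrable M (B i)" "integrable M (\<lambda>om. (A i om)\<^sup>2)" "integrable M (\<lambda>om. (B i om)\<^sup>2)"
      "integrable M (\<lambda>om. \<bar>A i om\<bar> ^ 3)" "integrable M (\<lambda>om. \<bar>B i om\<bar> ^ 3)"
  proof -
    show "integrable M (A i)" "integrable M (B i)"
      by (rule integrable_bd[where C = bd]; use i bdd[OF i] in simp)+
    show "integrable M (\<lambda>om. (A i om)\<^sup>2)" "integrable M (\<lambda>om. (B i om)\<^sup>2)"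
      by (rule integrable_bd[where C = "bd\<^sup>2"]; use i bdd[OF i] A_bd in simp)+
    show "integrable M (\<lambda>om. \<bar>A i om\<bar> ^ 3)" "integrable M (\<lambda>om. \<bar>B i om\<bar> ^ 3)"
      by (rule integrable_bd[where C = "bd ^ 3"]; use i bdd[OF i] in \<open>simp add: power_mono\<close>)+
  qed
  have f1: "expectation (\<lambda>om. A i om * g1 om) = 0" "integrable M (\<lambda>om. A i om * g1 om)"
    using fac[of "\<lambda>(a,b). a" "\<lambda>(s,t). U1 s * W0 t" bd "Cb * Cb"] mean0[OF i] gU[of U1 W0]
    unfolding g1_def by auto
  have f2: "expectation (\<lambda>om. B i om * g2 om) = 0" "integrable M (\<lambda>om. B i om * g2 om)"
    using fac[of "\<lambda>(a,b). b" "\<lambda>(s,t). U0 s * W1 t" bd "Cb * Cb"] mean0[OF i] gU[of U0 W1]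
    unfolding g2_def by auto
  have gh: "\<bar>U2 s * W0 t / 2\<bar> \<le> Cb * Cb" "\<bar>U0 s * W2 t / 2\<bar> \<le> Cb * Cb" for s t
    using gU[of U2 W0 s t] gU[of U0 W2 s t] by auto
  have va2: "\<bar>a\<bar> \<le> bd \<Longrightarrow> \<bar>a\<^sup>2 - va i\<bar> \<le> bd\<^sup>2 + va i" "\<bar>a\<bar> \<le> bd \<Longrightarrow> \<bar>a\<^sup>2 - vb i\<bar> \<le> bd\<^sup>2 + vb i" for a
    using A_bd[of a] zero_le_power2[of a] nn by (simp_all add: abs_le_iff)
  have f3: "expectation (\<lambda>om. ((A i om)\<^sup>2 - va i) * g3 om) = 0" "integrable M (\<lambda>om. ((A i om)\<^sup>2 - va i) * g3 om)"
    using fac[of "\<lambda>(a,b). a\<^sup>2 - va i" "\<lambda>(s,t). U2 s * W0 t / 2" "bd\<^sup>2 + va i" "Cb * Cb"] vars[OF i] gh va2 iA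
    unfolding g3_def by (auto simp: prob_space)
  have f4: "expectation (\<lambda>om. ((B i om)\<^sup>2 - vb i) * g4 om) = 0" "integrable M (\<lambda>om. ((B i om)\<^sup>2 - vb i) * g4 om)"
    using fac[of "\<lambda>(a,b). b\<^sup>2 - vb i" "\<lambda>(s,t). U0 s * W2 t / 2" "bd\<^sup>2 + vb i" "Cb * Cb"] vars[OF i] gh va2 iA
    unfolding g4_def by (auto simp: prob_space)
  have ab2: "\<bar>a\<bar> \<le> bd \<Longrightarrow> \<bar>b\<bar> \<le> bd \<Longrightarrow> \<bar>a * b\<bar> \<le> bd * bd" for a b :: real
    unfolding abs_mult using bd by (intro mult_mono) auto
  have f5: "expectation (\<lambda>om. (A i om * B i om) * g5 om) = c1 * expectation g5" "integrable M (\<lambda>om. (A i om * B i om) * g5 om)"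
    using fac[of "\<lambda>(a,b). a * b" "\<lambda>(s,t). U1 s * W1 t" "bd * bd" "Cb * Cb"] ab2 gU[of U1 W1]
    unfolding g5_def c1_def by auto
  have Dbb: "\<bar>DA s * DB t\<bar> \<le> 1 * 1" for s t unfolding abs_mult using Db by (intro mult_mono) auto
  have b3: "\<bar>a\<bar> \<le> bd \<Longrightarrow> \<bar>\<bar>a\<bar> ^ 3\<bar> \<le> bd ^ 3" for a :: real by (auto intro!: power_mono)
  have f6: "expectation (\<lambda>om. \<bar>A i om\<bar> ^ 3 * g6 om) = expectation (\<lambda>om. \<bar>A i om\<bar> ^ 3) * EG" "integrable M (\<lambda>om. \<bar>A i om\<bar> ^ 3 * g6 om)"
    using fac[of "\<lambda>(a,b). \<bar>a\<bar> ^ 3" "\<lambda>(s,t). DA s * DB t" "bd ^ 3" "1 * 1"] Dbb b3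
    unfolding EG g6_def by auto
  have f7: "expectation (\<lambda>om. \<bar>B i om\<bar> ^ 3 * g6 om) = expectation (\<lambda>om. \<bar>B i om\<bar> ^ 3) * EG" "integrable M (\<lambda>om. \<bar>B i om\<bar> ^ 3 * g6 om)"
    using fac[of "\<lambda>(a,b). \<bar>b\<bar> ^ 3" "\<lambda>(s,t). DA s * DB t" "bd ^ 3" "1 * 1"] Dbb b3
    unfolding EG g6_def by auto
  have i6: "integrable M g6" "integrable M g5"
  proof -
    show "integrable M g6" unfolding g6_def[abs_def]
      by (rule integrable_bd[where C = "1 * 1"], measurable) (rule Dbb)
    show "integrable M g5" unfolding g5_def[abs_def]
      by (rule integrable_bd[where C = "Cb * Cb"], measurable) (rule gU; simp)
  qed
  define P where "P om = A i om * g1 om + B i om * g2 om + ((A i om)\<^sup>2 - va i) * g3 om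
     + ((B i om)\<^sup>2 - vb i) * g4 om + (A i om * B i om) * g5 om" for om
  have P: "expectation P = c1 * expectation g5" "integrable M P"
    unfolding P_def[abs_def] using f1 f2 f3 f4 f5 by simp_all
  define s3 where "s3 = sqrt (va i) ^ 3 * kA ^ 3 + sqrt (vb i) ^ 3 * kB ^ 3"
  define Q where "Q om = 8 * K\<^sup>2 * (kA ^ 3 * (\<bar>A i om\<bar> ^ 3 * g6 om) + kB ^ 3 * (\<bar>B i om\<bar> ^ 3 * g6 om) + s3 * g6 om)" for om
  have Q: "expectation Q = 8 * K\<^sup>2 * (kA ^ 3 * expectation (\<lambda>om. \<bar>A i om\<bar> ^ 3) + kB ^ 3 * expectation (\<lambda>om. \<bar>B i om\<bar> ^ 3) + s3) * EG"
    "integrable M Q"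
  proof -
    show "integrable M Q" unfolding Q_def[abs_def] using f6 f7 i6 by simp
    have "expectation Q = 8 * K\<^sup>2 * (kA ^ 3 * (expectation (\<lambda>om. \<bar>A i om\<bar> ^ 3) * EG)
        + kB ^ 3 * (expectation (\<lambda>om. \<bar>B i om\<bar> ^ 3) * EG) + s3 * EG)"
      unfolding Q_def[abs_def] using f6 f7 i6 by (simp add: EG[symmetric])
    also have "\<dots> = 8 * K\<^sup>2 * (kA ^ 3 * expectation (\<lambda>om. \<bar>A i om\<bar> ^ 3) + kB ^ 3 * expectation (\<lambda>om. \<bar>B i om\<bar> ^ 3) + s3) * EG"
      by (simp add: algebra_simps)
    finally show "expectation Q = \<dots>" .
  qed
  define Z where "Z om = ud 0 w (VA (Suc i)) (SA (Suc i) om + x) * ud 0 w (VB (Suc i)) (SB (Suc i) om + y)" for om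
  define Y where "Y om = ud 0 w (VA i) (SA i om + x) * ud 0 w (VB i) (SB i om + y)" for om
  have uu: "\<bar>ud 0 w r s * ud 0 w r' t\<bar> \<le> 1 * 1" if "0 < r" "0 < r'" for r r' s t
    unfolding abs_mult using that w ud_0_pos[of r w s] ud_0_pos[of r' w t] ud_0_le_1[of r w s] ud_0_le_1[of r' w t]
    by (intro mult_mono) auto
  have ZY: "integrable M Z" "integrable M Y"
  proof -
    have [measurable]: "SA i \<in> borel_measurable M" "SB i \<in> borel_measurable M"
      "SA (Suc i) \<in> borel_measurable M" "SB (Suc i) \<in> borel_measurable M" using i by simp_all
    have [measurable]: "ud 0 w (VA j) \<in> borel_measurable borel" "ud 0 w (VB j) \<in> borel_measurable borel" for j
      by (intro measurable_ud VA_pos; simp)+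
    show "integrable M Z" unfolding Z_def[abs_def]
      by (rule integrable_bd[where C = "1 * 1"], measurable) (rule uu; rule VA_pos)
    show "integrable M Y" unfolding Y_def[abs_def]
      by (rule integrable_bd[where C = "1 * 1"], measurable) (rule uu; rule VA_pos)
  qed
  have pt: "\<bar>Z om - Y om - P om\<bar> \<le> Q om" if "om \<in> space M" for om
  proof -
    note a = ptA[OF bdd(1)[OF i that] bdd(2)[OF i that], of "SA i om" "SB i om"]
    note b = ptB[of "SA i om" "SB i om"]
    have Z: "Z om = U0 (SA i om + A i om) * W0 (SB i om + B i om)"
      unfolding Z_def U0_def W0_def v_def v'_def SA_def SB_def by (simp add: algebra_simps)
    have tri: "\<bar>z - e\<bar> \<le> q \<Longrightarrow> \<bar>y - f\<bar> \<le> r \<Longrightarrow> p = e - f \<Longrightarrow> \<bar>z - y - p\<bar> \<le> q + r" for z e q y f r p :: real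
      by auto
    have "\<bar>Z om - Y om - P om\<bar> \<le> 8 * ((\<bar>A i om\<bar> * kA) ^ 3 + (\<bar>B i om\<bar> * kB) ^ 3) * ((K * DA (SA i om)) * (K * DB (SB i om)))
       + 8 * ((sqrt (va i) * kA) ^ 3 + (sqrt (vb i) * kB) ^ 3) * ((K * DA (SA i om)) * (K * DB (SB i om)))"
      using a b unfolding Z[symmetric] Y_def[symmetric]
      by (rule tri) (simp add: P_def g1_def g2_def g3_def g4_def g5_def field_simps)
    also have "\<dots> = Q om"
      unfolding Q_def g6_def s3_def by (simp add: power_mult_distrib power2_eq_square algebra_simps)
    finally show ?thesis .
  qed
  have EG0: "0 \<le> EG" unfolding EG g6_def using Dpos by (intro Bochner_Integration.integral_nonneg) (auto intro!: mult_nonneg_nonneg less_imp_le)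
  have "hyb (Suc i) x y - hyb i x y = expectation (\<lambda>om. Z om - Y om - P om) + expectation P"
    unfolding hyb_def Z_def[symmetric] Y_def[symmetric] using ZY P by simp
  moreover have "\<bar>expectation (\<lambda>om. Z om - Y om - P om)\<bar> \<le> expectation Q"
    using pt ZY P Q by (intro order_trans[OF integral_abs_bound integral_mono]) auto
  moreover have "\<bar>expectation P\<bar> \<le> (\<rho> * (sqrt (va i) * sqrt (vb i))) * (kA * kB * K\<^sup>2 * EG)"
    unfolding P abs_mult
  proof (intro mult_mono)
    show "\<bar>c1\<bar> \<le> \<rho> * (sqrt (va i) * sqrt (vb i))" unfolding c1_def by (rule cov[OF i])
    have "\<bar>expectation g5\<bar> \<le> expectation (\<lambda>om. kA * kB * K\<^sup>2 * g6 om)"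
    proof (intro order_trans[OF integral_abs_bound integral_mono])
      fix om
      have "\<bar>g5 om\<bar> \<le> (kA * (K * DA (SA i om))) * (kB * (K * DB (SB i om)))"
        unfolding g5_def abs_mult
        using k K less_imp_le[OF Dpos(1), of "SA i om"] by (intro mult_mono U1D) auto
      thus "\<bar>g5 om\<bar> \<le> kA * kB * K\<^sup>2 * g6 om" unfolding g6_def by (simp add: power2_eq_square algebra_simps)
    qed (use i6 in auto)
    thus "\<bar>expectation g5\<bar> \<le> kA * kB * K\<^sup>2 * EG" unfolding EG by simp
  qed (use rho nn in auto)
  moreover have "(\<rho> * (sqrt (va i) * sqrt (vb i))) * (kA * kB * K\<^sup>2 * EG) \<le> 16 * K\<^sup>2 * (\<rho> * (va i * kA\<^sup>2 + vb i * kB\<^sup>2)) * EG"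
  proof -
    have "2 * ((sqrt (va i) * kA) * (sqrt (vb i) * kB)) \<le> (sqrt (va i) * kA)\<^sup>2 + (sqrt (vb i) * kB)\<^sup>2"
      using sum_squares_bound[of "sqrt (va i) * kA" "sqrt (vb i) * kB"] by (simp add: mult.assoc)
    also have "\<dots> = va i * kA\<^sup>2 + vb i * kB\<^sup>2" using nn by (simp add: power_mult_distrib)
    finally have "2 * ((sqrt (va i) * kA) * (sqrt (vb i) * kB)) \<le> va i * kA\<^sup>2 + vb i * kB\<^sup>2" .
    moreover have "0 \<le> (sqrt (va i) * kA) * (sqrt (vb i) * kB)" using nn k by (intro mult_nonneg_nonneg) auto
    ultimately have 1: "(sqrt (va i) * kA) * (sqrt (vb i) * kB) \<le> va i * kA\<^sup>2 + vb i * kB\<^sup>2" by linarith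
    have "(\<rho> * (sqrt (va i) * sqrt (vb i))) * (kA * kB * K\<^sup>2 * EG) = (K\<^sup>2 * \<rho> * EG) * ((sqrt (va i) * kA) * (sqrt (vb i) * kB))"
      by (simp add: algebra_simps)
    also have "\<dots> \<le> (K\<^sup>2 * \<rho> * EG) * (va i * kA\<^sup>2 + vb i * kB\<^sup>2)"
      using rho EG0 by (intro mult_left_mono 1) auto
    also have "\<dots> \<le> 16 * ((K\<^sup>2 * \<rho> * EG) * (va i * kA\<^sup>2 + vb i * kB\<^sup>2))"
    proof -
      have "0 \<le> (K\<^sup>2 * \<rho> * EG) * (va i * kA\<^sup>2 + vb i * kB\<^sup>2)" using rho EG0 nn by auto
      thus ?thesis by linarith
    qed
    also have "\<dots> = 16 * K\<^sup>2 * (\<rho> * (va i * kA\<^sup>2 + vb i * kB\<^sup>2)) * EG" by (simp add: algebra_simps)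
    finally show ?thesis .
  qed
  moreover have "expectation Q \<le> 16 * K\<^sup>2 * (\<beta> * (va i * kA ^ 3 + vb i * kB ^ 3)) * EG"
  proof -
    have sq: "sqrt (va i) ^ 3 \<le> \<beta> * va i" "sqrt (vb i) ^ 3 \<le> \<beta> * vb i"
      using mult_right_mono[OF sd(1)[OF i] nn(1)] mult_right_mono[OF sd(2)[OF i] nn(2)] nn
      by (simp_all add: power3_eq_cube mult.commute)
    have "kA ^ 3 * expectation (\<lambda>om. \<bar>A i om\<bar> ^ 3) + kB ^ 3 * expectation (\<lambda>om. \<bar>B i om\<bar> ^ 3) + s3
      \<le> kA ^ 3 * (\<beta> * va i) + kB ^ 3 * (\<beta> * vb i) + ((\<beta> * va i) * kA ^ 3 + (\<beta> * vb i) * kB ^ 3)"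
      unfolding s3_def using third[OF i] sq k by (intro add_mono mult_left_mono mult_right_mono) auto
    also have "\<dots> = 2 * (\<beta> * (va i * kA ^ 3 + vb i * kB ^ 3))" by (simp add: algebra_simps)
    finally have "expectation Q \<le> 8 * K\<^sup>2 * (2 * (\<beta> * (va i * kA ^ 3 + vb i * kB ^ 3))) * EG"
      unfolding Q using EG0 by (intro mult_right_mono mult_left_mono) auto
    thus ?thesis by simp
  qed
  moreover have "d = e + f \<Longrightarrow> \<bar>e\<bar> \<le> q \<Longrightarrow> \<bar>f\<bar> \<le> r \<Longrightarrow> r \<le> r' \<Longrightarrow> q \<le> q' \<Longrightarrow> \<bar>d\<bar> \<le> q' + r'" for d e f q r q' r' :: real
    by auto
  ultimately have "\<bar>hyb (Suc i) x y - hyb i x y\<bar> \<le> 16 * K\<^sup>2 * (\<beta> * (va i * kA ^ 3 + vb i * kB ^ 3)) * EG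
      + 16 * K\<^sup>2 * (\<rho> * (va i * kA\<^sup>2 + vb i * kB\<^sup>2)) * EG"
    by blast
  also have "\<dots> = err i * EG" unfolding err_def K_def kA_def[symmetric] kB_def[symmetric]
    by (simp add: power_mult_distrib algebra_simps)
  finally show ?thesis unfolding EG_def .
qed

end

lemma ud_shift_le:
  assumes "1 \<le> H" "0 < w" "4 * w \<le> 1 / H" "1 \<le> V" "- H \<le> x"
  shows "ud 0 w V (x + 2 / H) \<le> exp 30 * ud 0 w V x"
proof -
  have sV: "1 \<le> sqrt V" using assms by simp
  have V: "0 < V" using assms by simp
  have "ud 0 w V (x + 2 / H) \<le> Phi ((x + 2 / H + 4 * w) / sqrt V)" using V assms by (intro ud_0_le) auto
  also have "\<dots> \<le> Phi (x / sqrt V + 3 / H)"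
  proof (rule Phi_mono)
    have "(2 / H + 4 * w) / sqrt V \<le> (3 / H) / 1" using sV assms by (intro frac_le) auto
    thus "(x + 2 / H + 4 * w) / sqrt V \<le> x / sqrt V + 3 / H" by (simp add: add_divide_distrib)
  qed
  also have "\<dots> \<le> Phi (x / sqrt V) * exp (5 * (3 / H) * (1 + max 0 (- (x / sqrt V))))"
    using assms by (intro Phi_shift_le) auto
  also have "\<dots> \<le> Phi (x / sqrt V) * exp 30"
  proof -
    have "- (x / sqrt V) \<le> H"
    proof -
      have "- x \<le> H * 1" using assms by simp
      also have "\<dots> \<le> H * sqrt V" using sV assms by (intro mult_left_mono) auto
      finally show ?thesis using sV by (simp add: field_simps)
    qed
    hence "5 * (3 / H) * (1 + max 0 (- (x / sqrt V))) \<le> 5 * (3 / H) * (H + H)"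
      using assms by (intro mult_left_mono) auto
    also have "\<dots> = 30" using assms by simp
    finally show ?thesis using Phi_pos[of "x / sqrt V"] by simp
  qed
  also have "\<dots> \<le> ud 0 w V x * exp 30" using V assms by (intro mult_right_mono ud_0_ge) auto
  finally show ?thesis by (simp add: mult.commute)
qed

lemma width_le: "1 \<le> H \<Longrightarrow> 0 < w \<Longrightarrow> 4 * w \<le> 1 / H \<Longrightarrow> w \<le> 1 / 4" for H w :: real
proof -
  assume "1 \<le> H" "0 < w" "4 * w \<le> 1 / H"
  moreover have "1 / H \<le> 1" using \<open>1 \<le> H\<close> by simp
  ultimately show ?thesis by linarith
qed

lemma inv_sqrt_telescope:
  fixes T t :: real
  assumes "0 < T" "0 \<le> t" "t \<le> T"
  shows "t / sqrt T ^ 3 \<le> 4 * (1 / sqrt T - 1 / sqrt (T + t))"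
proof -
  define a b where "a = sqrt T" and "b = sqrt (T + t)"
  have ab: "0 < a" "a \<le> b" "b\<^sup>2 - a\<^sup>2 = t" using assms by (auto simp: a_def b_def)
  have "b\<^sup>2 \<le> 2 * a\<^sup>2" using assms by (simp add: a_def b_def)
  also have "\<dots> \<le> (3/2 * a)\<^sup>2" by (simp add: power_mult_distrib power2_eq_square)
  finally have b2: "b \<le> 3/2 * a" using ab by (meson less_imp_le mult_nonneg_nonneg power2_le_imp_le zero_le_divide_iff zero_le_numeral)
  have "t = (b - a) * (b + a)" using ab(3) by (simp add: power2_eq_square algebra_simps)
  also have "\<dots> \<le> (b - a) * (5/2 * a)" using ab b2 by (intro mult_left_mono) auto
  finally have t: "t \<le> (b - a) * (5/2 * a)" .
  have "t * b \<le> ((b - a) * (5/2 * a)) * (3/2 * a)"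
    using t b2 ab assms by (intro mult_mono) auto
  also have "\<dots> \<le> 4 * (b - a) * a\<^sup>2"
  proof -
    have "0 \<le> (b - a) * a\<^sup>2" using ab by simp
    moreover have "((b - a) * (5/2 * a)) * (3/2 * a) = 15 / 4 * ((b - a) * a\<^sup>2)" by (simp add: power2_eq_square)
    moreover have "4 * (b - a) * a\<^sup>2 = 4 * ((b - a) * a\<^sup>2)" by simp
    ultimately show ?thesis by linarith
  qed
  finally have "t * b \<le> 4 * (b - a) * a\<^sup>2" .
  hence "t \<le> 4 * (b - a) * a\<^sup>2 / b" using ab by (simp add: pos_le_divide_eq)
  hence "t / a ^ 3 \<le> 4 * (b - a) * a\<^sup>2 / b / a ^ 3" using ab by (intro divide_right_mono) auto
  also have "\<dots> = 4 * (1 / a - 1 / b)" using ab by (simp add: field_simps power2_eq_square power3_eq_cube)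
  finally show ?thesis by (simp add: a_def b_def)
qed

lemma ln_telescope:
  fixes T t :: real
  assumes "0 < T" "0 \<le> t" "t \<le> T"
  shows "t / T \<le> 2 * (ln (T + t) - ln T)"
proof -
  define u where "u = t / T"
  have u: "0 \<le> u" "u \<le> 1" using assms by (auto simp: u_def)
  have "u - u\<^sup>2 \<le> ln (1 + u)" using u by (rule ln_one_plus_pos_lower_bound)
  have "exp (u / 2) \<le> 1 + u / 2 + (u / 2)\<^sup>2" using u by (intro exp_bound) auto
  also have "\<dots> \<le> 1 + u" using u mult_left_le[of u u] by (simp add: power2_eq_square)
  finally have "u / 2 \<le> ln (1 + u)" using u by (intro iffD2[OF ln_ge_iff]) auto
  moreover have "ln (T + t) - ln T = ln (1 + u)"
  proof -
    have "1 + u = (T + t) / T" using assms by (simp add: u_def field_simps)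
    thus ?thesis using assms by (simp add: ln_div)
  qed
  ultimately show ?thesis by (simp add: u_def)
qed

lemma kap_sums:
  fixes V a :: "nat \<Rightarrow> real"
  assumes V: "\<And>i. i < N \<Longrightarrow> V i = V (Suc i) + a i" and a: "\<And>i. i < N \<Longrightarrow> 0 \<le> a i" "\<And>i. i < N \<Longrightarrow> a i \<le> w\<^sup>2"
    and VN: "0 < V N" and V0: "V 0 \<le> 2" and H: "1 \<le> H" and w: "0 < w" "4 * w \<le> 1 / H"
  shows "(\<Sum>i<N. a i * kap H w (V (Suc i)) ^ 3) \<le> 128 * (H ^ 3 + 1 / w)"
    and "(\<Sum>i<N. a i * kap H w (V (Suc i)) ^ 2) \<le> 64 * (H\<^sup>2 + ln (1 / w))"
proof -
  have Vmono: "V N \<le> V i \<and> V i \<le> V 0" if "i \<le> N" for i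
  proof
    from that show "V N \<le> V i"
    proof (induction i rule: inc_induct)
      case (step n)
      thus ?case using V[of n] a(1)[of n] by auto
    qed simp
    from that show "V i \<le> V 0"
    proof (induction i)
      case (Suc i)
      thus ?case using V[of i] a(1)[of i] by auto
    qed simp
  qed
  define T where "T i = V i + w\<^sup>2" for i
  have T: "0 < T (Suc i)" "T i = T (Suc i) + a i" "a i \<le> T (Suc i)" if "i < N" for i
    using Vmono[of "Suc i"] that VN a V[OF that] by (auto simp: T_def add_pos_nonneg intro: order_trans[OF a(2)[OF that]])
  have suma: "(\<Sum>i<N. a i) \<le> 2"
  proof -
    have "(\<Sum>i<N. a i) = (\<Sum>i<N. V i - V (Suc i))" using V by (intro sum.cong) auto
    also have "\<dots> = V 0 - V N" by (rule sum_lessThan_telescope')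
    finally show ?thesis using VN V0 by simp
  qed
  have TN: "w\<^sup>2 \<le> T N" "T N \<le> T 0" "T 0 \<le> 3"
  proof -
    have "w\<^sup>2 \<le> 1" using w width_le[OF H w] by (simp add: power_le_one)
    thus "T 0 \<le> 3" using V0 by (simp add: T_def)
    show "w\<^sup>2 \<le> T N" "T N \<le> T 0" using VN Vmono[of N] by (auto simp: T_def)
  qed
  have TNpos: "0 < T N" using w(1) less_le_trans[OF zero_less_power TN(1)] by blast
  have "(\<Sum>i<N. a i * kap H w (V (Suc i)) ^ 3) \<le> (\<Sum>i<N. 4 * H ^ 3 * a i + 128 * (1 / sqrt (T (Suc i)) - 1 / sqrt (T i)))"
  proof (rule sum_mono)
    fix i assume i': "i \<in> {..<N}"
    hence i: "i < N" by simp
    define z where "z = 2 / sqrt (T (Suc i))"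
    have z: "0 < z" using T[OF i] by (simp add: z_def)
    have kz: "kap H w (V (Suc i)) = H + z" by (simp add: kap_def z_def T_def)
    have "(H + z) ^ 3 \<le> 4 * (H ^ 3 + z ^ 3)"
    proof -
      have "0 \<le> 3 * (H + z) * (H - z)\<^sup>2" using H z by auto
      thus ?thesis by (simp add: power3_eq_cube power2_eq_square algebra_simps)
    qed
    hence "a i * kap H w (V (Suc i)) ^ 3 \<le> a i * (4 * (H ^ 3 + z ^ 3))"
      unfolding kz using a(1)[OF i] by (intro mult_left_mono) auto
    also have "\<dots> = 4 * H ^ 3 * a i + 32 * (a i / sqrt (T (Suc i)) ^ 3)"
      by (simp add: z_def power_divide algebra_simps)
    also have "a i / sqrt (T (Suc i)) ^ 3 \<le> 4 * (1 / sqrt (T (Suc i)) - 1 / sqrt (T i))"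
      using inv_sqrt_telescope[of "T (Suc i)" "a i"] T[OF i] a(1)[OF i] by simp
    finally show "a i * kap H w (V (Suc i)) ^ 3 \<le> 4 * H ^ 3 * a i + 128 * (1 / sqrt (T (Suc i)) - 1 / sqrt (T i))"
      by simp
  qed
  also have "\<dots> = 4 * H ^ 3 * (\<Sum>i<N. a i) + 128 * (1 / sqrt (T N) - 1 / sqrt (T 0))"
    by (simp only: sum.distrib sum_distrib_left[symmetric] sum_lessThan_telescope[of "\<lambda>i. 1 / sqrt (T i)"])
  also have "\<dots> \<le> 4 * H ^ 3 * 2 + 128 * (1 / w)"
  proof (intro add_mono mult_left_mono suma)
    have "w \<le> sqrt (T N)" using TN w by (intro real_le_rsqrt) auto
    hence "1 / sqrt (T N) \<le> 1 / w" using w TNpos by (intro divide_left_mono mult_pos_pos) auto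
    moreover have "0 \<le> 1 / sqrt (T 0)" using TN TNpos by auto
    ultimately show "1 / sqrt (T N) - 1 / sqrt (T 0) \<le> 1 / w" by linarith
  qed (use H in auto)
  also have "\<dots> \<le> 128 * (H ^ 3 + 1 / w)" using H by simp
  finally show "(\<Sum>i<N. a i * kap H w (V (Suc i)) ^ 3) \<le> 128 * (H ^ 3 + 1 / w)" .
  have "(\<Sum>i<N. a i * kap H w (V (Suc i)) ^ 2) \<le> (\<Sum>i<N. 2 * H\<^sup>2 * a i + 16 * (ln (T i) - ln (T (Suc i))))"
  proof (rule sum_mono)
    fix i assume i': "i \<in> {..<N}"
    hence i: "i < N" by simp
    define z where "z = 2 / sqrt (T (Suc i))"
    have z: "0 < z" "z\<^sup>2 = 4 / T (Suc i)" using T[OF i] by (auto simp: z_def power_divide)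
    have kz: "kap H w (V (Suc i)) = H + z" by (simp add: kap_def z_def T_def)
    have "(H + z)\<^sup>2 \<le> 2 * (H\<^sup>2 + z\<^sup>2)"
      using zero_le_power2[of "H - z"] by (simp add: power2_eq_square algebra_simps)
    hence "a i * kap H w (V (Suc i)) ^ 2 \<le> a i * (2 * (H\<^sup>2 + z\<^sup>2))"
      unfolding kz using a(1)[OF i] by (intro mult_left_mono) auto
    also have "\<dots> = 2 * H\<^sup>2 * a i + 8 * (a i / T (Suc i))"
      by (simp add: z algebra_simps)
    also have "a i / T (Suc i) \<le> 2 * (ln (T i) - ln (T (Suc i)))"
      using ln_telescope[of "T (Suc i)" "a i"] T[OF i] a(1)[OF i] by simp
    finally show "a i * kap H w (V (Suc i)) ^ 2 \<le> 2 * H\<^sup>2 * a i + 16 * (ln (T i) - ln (T (Suc i)))" by simp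
  qed
  also have "\<dots> = 2 * H\<^sup>2 * (\<Sum>i<N. a i) + 16 * (ln (T 0) - ln (T N))"
    by (simp only: sum.distrib sum_distrib_left[symmetric] sum_lessThan_telescope'[of "\<lambda>i. ln (T i)"])
  also have "\<dots> \<le> 2 * H\<^sup>2 * 2 + 16 * (2 + 2 * ln (1 / w))"
  proof (intro add_mono mult_left_mono suma)
    have "ln (T 0) \<le> T 0 - 1" using TN TNpos by (intro ln_le_minus_one) auto
    moreover have "ln (w\<^sup>2) \<le> ln (T N)" using TN w TNpos by (subst ln_le_cancel_iff) auto
    moreover have "ln (w\<^sup>2) = - (2 * ln (1 / w))" using w by (simp add: ln_realpow ln_div)
    ultimately show "ln (T 0) - ln (T N) \<le> 2 + 2 * ln (1 / w)" using TN by linarith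
  qed (use H in auto)
  also have "\<dots> \<le> 64 * (H\<^sup>2 + ln (1 / w))"
  proof -
    have "1 \<le> H\<^sup>2" using H by simp
    moreover have "1 \<le> 1 / w" using w H width_le[OF H w] by simp
    hence "0 \<le> ln (1 / w)" by (rule ln_ge_zero)
    ultimately show ?thesis by simp
  qed
  finally show "(\<Sum>i<N. a i * kap H w (V (Suc i)) ^ 2) \<le> 64 * (H\<^sup>2 + ln (1 / w))" .
qed

definition CN :: real where "CN = exp 60 * (64 * CU\<^sup>2 * 256)"

context bivariate_sum
begin

lemma hyb_0: "hyb 0 x y = ud 0 w (VA 0) x * ud 0 w (VB 0) y"
  unfolding hyb_def SA_def SB_def by (simp add: prob_space)

lemma hyb_approx:
  assumes V: "1 \<le> VA 0" "1 \<le> VB 0" and "i \<le> N" "- H \<le> x" "- H \<le> y"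
  shows "\<bar>hyb i x y - hyb 0 x y\<bar> \<le> (exp (exp 60 * (\<Sum>j<i. err j)) - 1) * hyb 0 x y"
  using assms(3-)
proof (induction i arbitrary: x y)
  case (Suc i)
  define s where "s = exp 60 * (\<Sum>j<i. err j)"
  have i: "i < N" using Suc by simp
  have kp: "0 \<le> kap H w (VA (Suc i))" "0 \<le> kap H w (VB (Suc i))"
    by (rule less_imp_le[OF kap_pos[OF VA_pos(1) H]], rule less_imp_le[OF kap_pos[OF VA_pos(2) H]])
  have "0 \<le> \<beta>" using beta_nonneg i by simp
  hence err0: "0 \<le> err i"
    unfolding err_def using va_nonneg[OF i] rho kp by simp
  define x' y' where "x' = x + 2 / H" and "y' = y + 2 / H"
  have xy': "- H \<le> x'" "- H \<le> y'"
  proof -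
    have "0 \<le> 2 / H" using H by simp
    thus "- H \<le> x'" "- H \<le> y'" using Suc.prems unfolding x'_def y'_def by linarith+
  qed
  have h0: "0 \<le> hyb 0 x y" unfolding hyb_0 using VA_pos w by (intro mult_nonneg_nonneg less_imp_le[OF ud_0_pos]) auto
  have IH: "\<bar>hyb i x y - hyb 0 x y\<bar> \<le> (exp s - 1) * hyb 0 x y"
    unfolding s_def using Suc.prems by (intro Suc.IH) auto
  have "\<bar>hyb i x' y' - hyb 0 x' y'\<bar> \<le> (exp s - 1) * hyb 0 x' y'"
    unfolding s_def using Suc.prems xy' by (intro Suc.IH) auto
  hence "hyb i x' y' \<le> exp s * hyb 0 x' y'" by (simp add: abs_le_iff left_diff_distrib)
  also have "hyb 0 x' y' \<le> (exp 30 * ud 0 w (VA 0) x) * (exp 30 * ud 0 w (VB 0) y)"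
    unfolding hyb_0 x'_def y'_def using VA_pos w
      less_imp_le[OF ud_0_pos[OF VA_pos(1) w(1)]] less_imp_le[OF ud_0_pos[OF VA_pos(2) w(1)]]
    by (intro mult_mono ud_shift_le[OF H w] V Suc.prems) simp_all
  hence "exp s * hyb 0 x' y' \<le> exp s * ((exp 30 * ud 0 w (VA 0) x) * (exp 30 * ud 0 w (VB 0) y))"
    by (intro mult_left_mono) auto
  also have "\<dots> = exp s * (exp 60 * hyb 0 x y)"
  proof -
    have "exp 60 = exp 30 * exp (30::real)" by (simp flip: exp_add)
    thus ?thesis unfolding hyb_0 by (simp only: mult_ac)
  qed
  finally have hx': "hyb i x' y' \<le> exp s * (exp 60 * hyb 0 x y)" .
  have "\<bar>hyb (Suc i) x y - hyb i x y\<bar> \<le> err i * hyb i x' y'"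
    unfolding x'_def y'_def by (rule step[OF i])
  also have "\<dots> \<le> err i * (exp s * (exp 60 * hyb 0 x y))"
    using err0 hx' by (intro mult_left_mono)
  finally have "\<bar>hyb (Suc i) x y - hyb 0 x y\<bar> \<le> (exp s - 1) * hyb 0 x y + err i * (exp s * (exp 60 * hyb 0 x y))"
    using IH by (simp only: abs_le_iff) linarith
  also have "\<dots> = (exp s * (1 + exp 60 * err i) - 1) * hyb 0 x y" by (simp add: algebra_simps)
  also have "\<dots> \<le> (exp s * exp (exp 60 * err i) - 1) * hyb 0 x y"
    using h0 exp_ge_add_one_self[of "exp 60 * err i"] by (intro mult_right_mono diff_right_mono mult_left_mono) auto
  also have "exp s * exp (exp 60 * err i) = exp (exp 60 * (\<Sum>j<Suc i. err j))"
    unfolding s_def by (simp add: algebra_simps flip: exp_add)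
  finally show ?case .
qed simp

lemma sum_err_le:
  assumes "VA 0 \<le> 2" "VB 0 \<le> 2" "0 < N"
  shows "exp 60 * (\<Sum>j<N. err j) \<le> CN * (\<beta> * (H ^ 3 + 1 / w) + \<rho> * (H\<^sup>2 + ln (1 / w)))"
proof -
  have "bd \<le> w"
  proof -
    have "bd * (2 / w) \<le> bd * (H + 2 / w)" using bd H by (intro mult_left_mono) auto
    hence "bd * (2 / w) \<le> 1" using bd by linarith
    thus ?thesis using w bd by (simp add: field_simps)
  qed
  hence bw: "bd\<^sup>2 \<le> w\<^sup>2" using bd by (intro power_mono) auto
  have a: "va i \<le> w\<^sup>2" "vb i \<le> w\<^sup>2" if "i < N" for i using va_le[OF that] bw by auto
  note A = kap_sums[of N VA va w H, OF VA_Suc(1) va_nonneg(1) a(1) VA_pos(1) assms(1) H w]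
  note B = kap_sums[of N VB vb w H, OF VA_Suc(2) va_nonneg(2) a(2) VA_pos(2) assms(2) H w]
  define sA3 sB3 sA2 sB2 where "sA3 = (\<Sum>i<N. va i * kap H w (VA (Suc i)) ^ 3)"
    and "sB3 = (\<Sum>i<N. vb i * kap H w (VB (Suc i)) ^ 3)"
    and "sA2 = (\<Sum>i<N. va i * kap H w (VA (Suc i)) ^ 2)"
    and "sB2 = (\<Sum>i<N. vb i * kap H w (VB (Suc i)) ^ 2)"
  have s: "sA3 \<le> 128 * (H ^ 3 + 1 / w)" "sB3 \<le> 128 * (H ^ 3 + 1 / w)"
    "sA2 \<le> 64 * (H\<^sup>2 + ln (1 / w))" "sB2 \<le> 64 * (H\<^sup>2 + ln (1 / w))"
    unfolding sA3_def sB3_def sA2_def sB2_def by (intro A B; assumption)+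
  have hl: "0 \<le> H\<^sup>2 + ln (1 / w)"
  proof -
    have "1 \<le> 1 / w" using w H width_le[OF H w] by simp
    thus ?thesis by (auto intro!: add_nonneg_nonneg ln_ge_zero)
  qed
  have "(\<Sum>j<N. err j) = 64 * CU\<^sup>2 * (\<beta> * (sA3 + sB3) + \<rho> * (sA2 + sB2))"
    unfolding err_def sA3_def sB3_def sA2_def sB2_def
    by (simp add: sum_distrib_left sum.distrib algebra_simps)
  also have "\<dots> \<le> 64 * CU\<^sup>2 * (\<beta> * (256 * (H ^ 3 + 1 / w)) + \<rho> * (256 * (H\<^sup>2 + ln (1 / w))))"
    using s hl beta_nonneg[OF assms(3)] rho
    by (intro mult_left_mono add_mono) auto
  also have "\<dots> = (64 * CU\<^sup>2 * 256) * (\<beta> * (H ^ 3 + 1 / w) + \<rho> * (H\<^sup>2 + ln (1 / w)))"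
    by (simp add: algebra_simps)
  finally show ?thesis unfolding CN_def by (simp add: mult.assoc)
qed

definition rate :: real where
  "rate = CN * (\<beta> * (H ^ 3 + 1 / w) + \<rho> * (H\<^sup>2 + ln (1 / w)))"

lemma indicator_le_ud:
  assumes "0 < v" "h \<le> s"
  shows "1 - exp (- (w\<^sup>2 / (2 * v))) \<le> ud 0 w v (s + (w - h))"
proof -
  have "Phi (- (w / sqrt v)) \<le> exp (- (w / sqrt v)\<^sup>2 / 2)"
    using w assms by (intro Phi_minus_le_exp) auto
  also have "- (w / sqrt v)\<^sup>2 / 2 = - (w\<^sup>2 / (2 * v))" using assms by (simp add: power_divide field_simps)
  finally have "1 - exp (- (w\<^sup>2 / (2 * v))) \<le> Phi (w / sqrt v)" by (simp add: Phi_minus)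
  also have "\<dots> \<le> Phi ((s + (w - h)) / sqrt v)" using assms by (intro Phi_mono divide_right_mono) auto
  also have "\<dots> \<le> ud 0 w v (s + (w - h))" using assms w by (intro ud_0_ge) auto
  finally show ?thesis .
qed

lemma ud_le_indicator:
  assumes "0 < v"
  shows "ud 0 w v (s + (- h - 5 * w)) \<le> (if h \<le> s then 1 else 0) + exp (- (w\<^sup>2 / (2 * v)))"
proof (cases "h \<le> s")
  case True
  thus ?thesis using ud_0_le_1[OF assms w(1), of "s + (- h - 5 * w)"] by (simp add: add_increasing2)
next
  case False
  have "ud 0 w v (s + (- h - 5 * w)) \<le> Phi ((s + (- h - 5 * w) + 4 * w) / sqrt v)"
    using assms w by (intro ud_0_le) auto
  also have "\<dots> \<le> Phi (- (w / sqrt v))"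
  proof (rule Phi_mono)
    have "(s + (- h - 5 * w) + 4 * w) / sqrt v \<le> (- w) / sqrt v"
      using False assms by (intro divide_right_mono) auto
    thus "(s + (- h - 5 * w) + 4 * w) / sqrt v \<le> - (w / sqrt v)" by simp
  qed
  also have "\<dots> \<le> exp (- (w / sqrt v)\<^sup>2 / 2)"
    using w assms by (intro Phi_minus_le_exp) auto
  also have "- (w / sqrt v)\<^sup>2 / 2 = - (w\<^sup>2 / (2 * v))" using assms by (simp add: power_divide field_simps)
  finally show ?thesis using False by simp
qed

lemma ud_initial_le:
  assumes "0 < v" "v \<le> 1" "H * v \<le> w" "0 \<le> h" "h \<le> H"
  shows "ud 0 w (1 + v) (w - h) \<le> exp (60 * w * H) * Phi (- h)"
proof -
  have s: "1 \<le> sqrt (1 + v)" "sqrt (1 + v) \<le> 1 + v" using assms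
    by (auto intro!: real_le_lsqrt simp: power2_eq_square algebra_simps)
  have "ud 0 w (1 + v) (w - h) \<le> Phi ((w - h + 4 * w) / sqrt (1 + v))" using assms w by (intro ud_0_le) auto
  also have "\<dots> \<le> Phi (- h + 6 * w)"
  proof (rule Phi_mono)
    have "5 * w / sqrt (1 + v) \<le> 5 * w / 1" using s w by (intro divide_left_mono) auto
    moreover have "h * (1 - v) \<le> h / sqrt (1 + v)"
    proof -
      have "(1 - v) * sqrt (1 + v) \<le> (1 - v) * (1 + v)" using s assms by (intro mult_left_mono) auto
      also have "\<dots> \<le> 1" using assms by (simp add: algebra_simps)
      finally have "1 - v \<le> 1 / sqrt (1 + v)" using s by (simp add: pos_le_divide_eq)
      from mult_left_mono[OF this assms(4)] show ?thesis by simp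
    qed
    moreover have "h * v \<le> H * v" using assms by (intro mult_right_mono) auto
    moreover have "(w - h + 4 * w) / sqrt (1 + v) = 5 * w / sqrt (1 + v) - h / sqrt (1 + v)"
      by (simp add: diff_divide_distrib[symmetric])
    moreover have "h * (1 - v) = h - h * v" by (simp add: algebra_simps)
    ultimately show "(w - h + 4 * w) / sqrt (1 + v) \<le> - h + 6 * w"
      using assms(3) by linarith
  qed
  also have "\<dots> \<le> Phi (- h) * exp (5 * (6 * w) * (1 + max 0 (- (- h))))"
    using w by (intro Phi_shift_le) auto
  also have "\<dots> \<le> Phi (- h) * exp (60 * w * H)"
  proof -
    have "5 * (6 * w) * (1 + max 0 (- (- h))) \<le> 5 * (6 * w) * (H + H)"
      using assms w H by (intro mult_left_mono add_mono) auto
    also have "\<dots> = 60 * w * H" by simp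
    finally show ?thesis using Phi_pos[of "- h"] by simp
  qed
  finally show ?thesis by (simp add: mult.commute)
qed

lemma ud_initial_ge:
  assumes "0 < v" "0 \<le> h" "h + 5 * w \<le> H"
  shows "exp (- (50 * w * H)) * Phi (- h) \<le> ud 0 w (1 + v) (- h - 5 * w)"
proof -
  have s: "1 \<le> sqrt (1 + v)" using assms by simp
  have "Phi (- h) = Phi ((- h - 5 * w) + 5 * w)" by simp
  also have "\<dots> \<le> Phi (- h - 5 * w) * exp (5 * (5 * w) * (1 + max 0 (- (- h - 5 * w))))"
    using w by (intro Phi_shift_le) auto
  also have "\<dots> \<le> Phi (- h - 5 * w) * exp (50 * w * H)"
  proof -
    have "5 * (5 * w) * (1 + max 0 (- (- h - 5 * w))) \<le> 5 * (5 * w) * (H + H)"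
      using assms w H by (intro mult_left_mono add_mono) auto
    also have "\<dots> = 50 * w * H" by simp
    finally show ?thesis using Phi_pos[of "- h - 5 * w"] by simp
  qed
  finally have "exp (- (50 * w * H)) * Phi (- h) \<le> Phi (- h - 5 * w)"
    by (simp add: exp_minus field_simps)
  also have "\<dots> \<le> Phi ((- h - 5 * w) / sqrt (1 + v))"
  proof (rule Phi_mono)
    have "(h + 5 * w) / sqrt (1 + v) \<le> (h + 5 * w) / 1" using s assms w by (intro divide_left_mono) auto
    hence "- (h + 5 * w) \<le> - ((h + 5 * w) / sqrt (1 + v))" by simp
    moreover have "- ((h + 5 * w) / sqrt (1 + v)) = (- h - 5 * w) / sqrt (1 + v)"
      unfolding minus_divide_left by simp
    ultimately show "- h - 5 * w \<le> (- h - 5 * w) / sqrt (1 + v)" by simp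
  qed
  also have "\<dots> \<le> ud 0 w (1 + v) (- h - 5 * w)" using assms w by (intro ud_0_ge) auto
  finally show ?thesis .
qed

lemma hyb_N_approx:
  assumes "1 \<le> VA 0" "VA 0 \<le> 2" "1 \<le> VB 0" "VB 0 \<le> 2" "0 < N" "- H \<le> x" "- H \<le> y"
  shows "\<bar>hyb N x y - hyb 0 x y\<bar> \<le> (exp rate - 1) * hyb 0 x y"
proof -
  have "\<bar>hyb N x y - hyb 0 x y\<bar> \<le> (exp (exp 60 * (\<Sum>j<N. err j)) - 1) * hyb 0 x y"
    using assms by (intro hyb_approx) auto
  also have "\<dots> \<le> (exp rate - 1) * hyb 0 x y"
    unfolding rate_def using sum_err_le assms less_imp_le[OF ud_0_pos[OF VA_pos(1) w(1)]] less_imp_le[OF ud_0_pos[OF VA_pos(2) w(1)]]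
    by (intro mult_right_mono) (auto simp: hyb_0)
  finally show ?thesis .
qed

lemma meas_ud_S: "i \<le> N \<Longrightarrow> 0 < v \<Longrightarrow> (\<lambda>om. ud 0 w v (SA i om + x)) \<in> borel_measurable M"
  "i \<le> N \<Longrightarrow> 0 < v \<Longrightarrow> (\<lambda>om. ud 0 w v (SB i om + x)) \<in> borel_measurable M"
  by (auto intro!: measurable_compose[OF _ measurable_ud] borel_measurable_add)

lemma joint_tail:
  assumes N: "0 < N" and V: "vA = v" "vB = v" "v \<le> 1" "H * v \<le> w" "(\<Sum>i<N. va i) = 1" "(\<Sum>i<N. vb i) = 1"
    and h: "0 \<le> h" "h \<le> H"
  shows "(1 - exp (- (w\<^sup>2 / (2 * v))))\<^sup>2 * prob {om \<in> space M. h \<le> SA N om \<and> h \<le> SB N om}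
     \<le> exp (rate + 120 * w * H) * (Phi (- h))\<^sup>2"
proof -
  define z where "z = 1 - exp (- (w\<^sup>2 / (2 * v)))"
  have v: "0 < v" using vAB V by simp
  have z: "0 \<le> z" using v by (simp add: z_def)
  have V0: "VA 0 = 1 + v" "VB 0 = 1 + v" "VA N = v" "VB N = v"
    unfolding VA_def VB_def using V by (simp_all add: lessThan_atLeast0)
  define E where "E = {om \<in> space M. h \<le> SA N om \<and> h \<le> SB N om}"
  have [measurable]: "SA N \<in> borel_measurable M" "SB N \<in> borel_measurable M" by simp_all
  have E [measurable]: "E \<in> events" unfolding E_def by measurable
  have iE: "integrable M (indicat_real E)"
    by (rule integrable_real_indicator[OF E]) (simp add: emeasure_eq_measure)
  have "z\<^sup>2 * prob E = expectation (\<lambda>om. z\<^sup>2 * indicator E om)" using iE by simp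
  also have "\<dots> \<le> hyb N (w - h) (w - h)"
    unfolding hyb_def V0
  proof (rule integral_mono)
    show "integrable M (\<lambda>om. z\<^sup>2 * indicator E om)" using iE by simp
    show "integrable M (\<lambda>om. ud 0 w v (SA N om + (w - h)) * ud 0 w v (SB N om + (w - h)))"
    proof (rule integrable_bd[where C = 1])
      show "(\<lambda>om. ud 0 w v (SA N om + (w - h)) * ud 0 w v (SB N om + (w - h))) \<in> borel_measurable M"
        using v by (intro borel_measurable_times meas_ud_S) auto
      show "\<bar>ud 0 w v (SA N om + (w - h)) * ud 0 w v (SB N om + (w - h))\<bar> \<le> 1" for om
        using ud_0_pos[OF v w(1)] ud_0_le_1[OF v w(1)] by (simp add: abs_mult abs_of_pos mult_le_one less_imp_le)
    qed
    fix om
    show "z\<^sup>2 * indicator E om \<le> ud 0 w v (SA N om + (w - h)) * ud 0 w v (SB N om + (w - h))"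
    proof (cases "om \<in> E")
      case True
      hence "h \<le> SA N om" "h \<le> SB N om" by (auto simp: E_def)
      from this[THEN indicator_le_ud[OF v]] show ?thesis using True z
        unfolding z_def[symmetric] by (simp add: power2_eq_square mult_mono')
    next
      case False
      thus ?thesis using ud_0_pos[OF v w(1)] by (simp add: less_imp_le)
    qed
  qed
  also have "\<dots> \<le> exp rate * hyb 0 (w - h) (w - h)"
  proof -
    have "\<bar>hyb N (w - h) (w - h) - hyb 0 (w - h) (w - h)\<bar> \<le> (exp rate - 1) * hyb 0 (w - h) (w - h)"
      using V0 v V h w N by (intro hyb_N_approx) auto
    thus ?thesis by (simp add: abs_le_iff left_diff_distrib)
  qed
  also have "\<dots> \<le> exp rate * ((exp (60 * w * H) * Phi (- h)) * (exp (60 * w * H) * Phi (- h)))"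
    unfolding hyb_0 V0 using ud_initial_le[OF v V(3,4) h] ud_0_pos[OF _ w(1), of "1 + v"] v Phi_pos[of "- h"]
    by (intro mult_left_mono mult_mono) (auto simp: less_imp_le)
  also have "\<dots> = exp (rate + 120 * w * H) * (Phi (- h))\<^sup>2"
  proof -
    have "exp (rate + 120 * w * H) = exp rate * (exp (60 * w * H) * exp (60 * w * H))" by (simp flip: exp_add)
    thus ?thesis by (simp add: power2_eq_square mult_ac)
  qed
  finally show ?thesis unfolding z_def E_def .
qed

lemma marginal_tail:
  assumes N: "0 < N" and V: "vA = v" "vB = 1" "v \<le> 1" "H * v \<le> w" "(\<Sum>i<N. va i) = 1"
    and B: "\<And>i. i < N \<Longrightarrow> vb i = 0" "\<And>i om. B i om = 0"
    and h: "0 \<le> h" "h + 5 * w \<le> H"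
  shows "(1 - exp (- (w\<^sup>2 / (2 * v)))) * prob {om \<in> space M. h \<le> SA N om} \<le> exp (rate + 60 * w * H) * Phi (- h)"
    and "(2 - exp rate) * (exp (- (50 * w * H)) * Phi (- h)) - exp (- (w\<^sup>2 / (2 * v)))
        \<le> prob {om \<in> space M. h \<le> SA N om} \<or> 2 < exp rate"
proof -
  have v: "0 < v" using vAB V by simp
  have V0: "VA 0 = 1 + v" "VB 0 = 1" "VA N = v" "VB N = 1"
    unfolding VA_def VB_def using V B by (simp_all add: lessThan_atLeast0)
  define c where "c = ud 0 w 1 0"
  have c: "0 < c" unfolding c_def using w by (intro ud_0_pos) auto
  define E where "E = {om \<in> space M. h \<le> SA N om}"
  have [measurable]: "SA N \<in> borel_measurable M" by simp
  have E [measurable]: "E \<in> events" unfolding E_def by measurable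
  have iE: "integrable M (indicat_real E)"
    by (rule integrable_real_indicator[OF E]) (simp add: emeasure_eq_measure)
  have SB0: "SB N om = 0" for om unfolding SB_def using B by simp
  define f where "f x = expectation (\<lambda>om. ud 0 w v (SA N om + x))" for x
  have iu: "integrable M (\<lambda>om. ud 0 w v (SA N om + x))" for x
    using ud_0_pos[OF v w(1)] ud_0_le_1[OF v w(1)] v
    by (intro integrable_bd[where C = 1] meas_ud_S) (auto simp: abs_of_pos)
  have hN: "hyb N x 0 = f x * c" for x unfolding hyb_def V0 SB0 f_def c_def by simp
  have h0: "hyb 0 x 0 = ud 0 w (1 + v) x * c" for x unfolding hyb_0 V0 c_def by simp
  have ap: "\<bar>f x - ud 0 w (1 + v) x\<bar> \<le> (exp rate - 1) * ud 0 w (1 + v) x" if "- H \<le> x" for x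
  proof -
    have "\<bar>f x * c - ud 0 w (1 + v) x * c\<bar> \<le> (exp rate - 1) * (ud 0 w (1 + v) x * c)"
      unfolding hN[symmetric] h0[symmetric] using V0 v V N that H by (intro hyb_N_approx) auto
    moreover have "\<bar>f x * c - ud 0 w (1 + v) x * c\<bar> = c * \<bar>f x - ud 0 w (1 + v) x\<bar>"
      using c by (simp add: abs_mult flip: left_diff_distrib)
    moreover have "(exp rate - 1) * (ud 0 w (1 + v) x * c) = c * ((exp rate - 1) * ud 0 w (1 + v) x)" by simp
    ultimately show ?thesis using mult_le_cancel_left_pos[OF c] by metis
  qed
  have hH: "h \<le> H" using h w by simp
  have "(1 - exp (- (w\<^sup>2 / (2 * v)))) * prob E = expectation (\<lambda>om. (1 - exp (- (w\<^sup>2 / (2 * v)))) * indicator E om)" using iE by simp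
  also have "\<dots> \<le> f (w - h)"
    unfolding f_def
  proof (intro integral_mono iu)
    show "integrable M (\<lambda>om. (1 - exp (- (w\<^sup>2 / (2 * v)))) * indicator E om)" using iE by simp
    show "(1 - exp (- (w\<^sup>2 / (2 * v)))) * indicator E om \<le> ud 0 w v (SA N om + (w - h))" for om
      using indicator_le_ud[OF v, of h "SA N om"] ud_0_pos[OF v w(1)]
      by (cases "om \<in> E") (auto simp: E_def less_imp_le)
  qed
  also have "\<dots> \<le> exp rate * ud 0 w (1 + v) (w - h)"
    using ap[of "w - h"] hH w by (simp add: abs_le_iff left_diff_distrib)
  also have "\<dots> \<le> exp rate * (exp (60 * w * H) * Phi (- h))"
    using ud_initial_le[OF v V(3,4) h(1) hH] by (intro mult_left_mono) auto
  finally show "(1 - exp (- (w\<^sup>2 / (2 * v)))) * prob {om \<in> space M. h \<le> SA N om} \<le> exp (rate + 60 * w * H) * Phi (- h)"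
    unfolding E_def by (simp add: exp_add mult.assoc)
  have "f (- h - 5 * w) \<le> expectation (\<lambda>om. indicator E om + exp (- (w\<^sup>2 / (2 * v))))"
    unfolding f_def
  proof (rule integral_mono[OF iu])
    show "integrable M (\<lambda>om. indicator E om + exp (- (w\<^sup>2 / (2 * v))))" using iE by simp
    show "ud 0 w v (SA N om + (- h - 5 * w)) \<le> indicator E om + exp (- (w\<^sup>2 / (2 * v)))" if "om \<in> space M" for om
      using ud_le_indicator[OF v, of "SA N om" h] that by (auto simp: E_def indicator_def split: if_splits)
  qed
  also have "\<dots> = prob E + exp (- (w\<^sup>2 / (2 * v)))" using iE by (simp add: prob_space)
  finally have 1: "f (- h - 5 * w) - exp (- (w\<^sup>2 / (2 * v))) \<le> prob E" by simp
  have 2: "(2 - exp rate) * ud 0 w (1 + v) (- h - 5 * w) \<le> f (- h - 5 * w)"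
    using ap[of "- h - 5 * w"] h by (simp add: abs_le_iff left_diff_distrib)
  have "(2 - exp rate) * (exp (- (50 * w * H)) * Phi (- h)) \<le> (2 - exp rate) * ud 0 w (1 + v) (- h - 5 * w)" if "exp rate \<le> 2"
    using that ud_initial_ge[OF v h] by (intro mult_left_mono) auto
  thus "(2 - exp rate) * (exp (- (50 * w * H)) * Phi (- h)) - exp (- (w\<^sup>2 / (2 * v)))
        \<le> prob {om \<in> space M. h \<le> SA N om} \<or> 2 < exp rate"
    using 1 2 unfolding E_def by linarith
qed

end

section \<open>Tail probabilities of standardised sums\<close>

lemma exp_le_quadratic:
  fixes y :: real
  assumes "\<bar>y\<bar> \<le> 1"
  shows "exp y \<le> 1 + y + y\<^sup>2 / 2 * (1 + \<bar>y\<bar>)"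
proof -
  obtain t where t: "\<bar>t\<bar> \<le> \<bar>y\<bar>" and e: "exp y = (\<Sum>m<3. y ^ m / fact m) + exp t / fact 3 * y ^ 3"
    using Maclaurin_exp_le[of y 3] by auto
  have "exp t \<le> exp 1" using t assms by simp
  hence "exp t \<le> 3" using exp_le by linarith
  have "exp t / fact 3 * y ^ 3 \<le> \<bar>exp t / fact 3 * y ^ 3\<bar>" by (rule abs_ge_self)
  also have "\<dots> = exp t / fact 3 * \<bar>y\<bar> ^ 3" by (simp add: abs_mult power_abs fact_numeral)
  also have "\<dots> \<le> 3 / fact 3 * \<bar>y\<bar> ^ 3"
    using \<open>exp t \<le> 3\<close> by (intro mult_right_mono divide_right_mono) (auto simp: fact_numeral)
  also have "\<dots> = y\<^sup>2 / 2 * \<bar>y\<bar>" by (simp add: fact_numeral power3_eq_cube power2_eq_square)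
  finally show ?thesis unfolding e by (simp add: eval_nat_numeral lessThan_Suc algebra_simps)
qed

lemma (in prob_space) chernoff_bounded:
  fixes \<xi> :: "'i \<Rightarrow> 'a \<Rightarrow> real"
  assumes fin: "finite I" and ind: "indep_vars (\<lambda>_. borel) \<xi> I"
    and b: "\<And>i om. i \<in> I \<Longrightarrow> om \<in> space M \<Longrightarrow> \<bar>\<xi> i om\<bar> \<le> c"
    and m: "\<And>i. i \<in> I \<Longrightarrow> expectation (\<xi> i) = 0"
    and V: "(\<Sum>i\<in>I. expectation (\<lambda>om. (\<xi> i om)\<^sup>2)) \<le> V"
    and l: "0 \<le> \<theta>" "\<theta> * c \<le> 1" and c: "0 \<le> c"
  shows "prob {om \<in> space M. x \<le> (\<Sum>i\<in>I. \<xi> i om)} \<le> exp (- \<theta> * x + \<theta>\<^sup>2 * V / 2 * (1 + \<theta> * c))"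
proof -
  have meas [measurable]: "i \<in> I \<Longrightarrow> \<xi> i \<in> borel_measurable M" for i
    using ind by (auto simp: indep_vars_def)
  have int: "integrable M (\<xi> i)" "integrable M (\<lambda>om. (\<xi> i om)\<^sup>2)" "integrable M (\<lambda>om. exp (\<theta> * \<xi> i om))" if i: "i \<in> I" for i
  proof -
    have lb: "\<theta> * \<xi> i om \<le> \<theta> * c" if "om \<in> space M" for om
      using l b[OF i that] by (intro mult_left_mono) auto
    have sq: "(\<xi> i om)\<^sup>2 \<le> c\<^sup>2" if "om \<in> space M" for om
      using b[OF i that] by (metis abs_ge_zero power2_abs power_mono)
    show "integrable M (\<xi> i)"
      using i b by (intro integrable_const_bound[of _ c] AE_I2) auto
    show "integrable M (\<lambda>om. (\<xi> i om)\<^sup>2)"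
      using i sq by (intro integrable_const_bound[of _ "c\<^sup>2"] AE_I2) auto
    show "integrable M (\<lambda>om. exp (\<theta> * \<xi> i om))"
      using i lb by (intro integrable_const_bound[of _ "exp (\<theta> * c)"] AE_I2) auto
  qed
  have mgf: "expectation (\<lambda>om. exp (\<theta> * \<xi> i om)) \<le> exp (\<theta>\<^sup>2 / 2 * (1 + \<theta> * c) * expectation (\<lambda>om. (\<xi> i om)\<^sup>2))"
    if i: "i \<in> I" for i
  proof -
    have "expectation (\<lambda>om. exp (\<theta> * \<xi> i om)) \<le> expectation (\<lambda>om. 1 + \<theta> * \<xi> i om + (\<theta>\<^sup>2 / 2 * (1 + \<theta> * c)) * (\<xi> i om)\<^sup>2)"
    proof (rule integral_mono)
      fix om assume w: "om \<in> space M"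
      have "\<bar>\<theta> * \<xi> i om\<bar> \<le> \<theta> * c" using l b[OF i w] by (simp add: abs_mult mult_left_mono)
      hence y: "\<bar>\<theta> * \<xi> i om\<bar> \<le> 1" "\<bar>\<theta> * \<xi> i om\<bar> \<le> \<theta> * c" using l by auto
      have "exp (\<theta> * \<xi> i om) \<le> 1 + \<theta> * \<xi> i om + (\<theta> * \<xi> i om)\<^sup>2 / 2 * (1 + \<bar>\<theta> * \<xi> i om\<bar>)"
        by (rule exp_le_quadratic[OF y(1)])
      also have "\<dots> \<le> 1 + \<theta> * \<xi> i om + (\<theta> * \<xi> i om)\<^sup>2 / 2 * (1 + \<theta> * c)"
        using y by (intro add_left_mono mult_left_mono) auto
      finally show "exp (\<theta> * \<xi> i om) \<le> 1 + \<theta> * \<xi> i om + (\<theta>\<^sup>2 / 2 * (1 + \<theta> * c)) * (\<xi> i om)\<^sup>2"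
        by (simp add: power_mult_distrib mult_ac)
    qed (use int[OF i] in auto)
    also have "\<dots> = 1 + \<theta>\<^sup>2 / 2 * (1 + \<theta> * c) * expectation (\<lambda>om. (\<xi> i om)\<^sup>2)"
      using int[OF i] m[OF i] by (simp add: prob_space)
    also have "\<dots> \<le> exp (\<theta>\<^sup>2 / 2 * (1 + \<theta> * c) * expectation (\<lambda>om. (\<xi> i om)\<^sup>2))"
      by (rule exp_ge_add_one_self)
    finally show ?thesis .
  qed
  have indE: "indep_vars (\<lambda>_. borel) (\<lambda>i om. exp (\<theta> * \<xi> i om)) I"
    by (rule indep_vars_compose2[OF ind]) auto
  have intP: "integrable M (\<lambda>om. \<Prod>i\<in>I. exp (\<theta> * \<xi> i om))"
    by (rule indep_vars_integrable[OF fin indE int(3)])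
  define D where "D = {om \<in> space M. x \<le> (\<Sum>i\<in>I. \<xi> i om)}"
  have [measurable]: "D \<in> events" unfolding D_def by measurable
  have "prob D = expectation (indicator D)" by simp
  also have "\<dots> \<le> expectation (\<lambda>om. exp (- \<theta> * x) * (\<Prod>i\<in>I. exp (\<theta> * \<xi> i om)))"
  proof (rule integral_mono)
    show "integrable M (indicat_real D)"
      by (rule integrable_real_indicator) (auto simp: emeasure_eq_measure)
    show "integrable M (\<lambda>om. exp (- \<theta> * x) * (\<Prod>i\<in>I. exp (\<theta> * \<xi> i om)))" using intP by simp
    fix om
    have "exp (- \<theta> * x) * (\<Prod>i\<in>I. exp (\<theta> * \<xi> i om)) = exp (\<theta> * ((\<Sum>i\<in>I. \<xi> i om) - x))"
      using fin by (simp add: exp_sum[symmetric] sum_distrib_left[symmetric] right_diff_distrib exp_diff exp_minus field_simps)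
    moreover have "1 \<le> exp (\<theta> * ((\<Sum>i\<in>I. \<xi> i om) - x))" if "om \<in> D" using that l by (simp add: D_def)
    ultimately show "indicator D om \<le> exp (- \<theta> * x) * (\<Prod>i\<in>I. exp (\<theta> * \<xi> i om))"
      by (cases "om \<in> D") auto
  qed
  also have "\<dots> = exp (- \<theta> * x) * (\<Prod>i\<in>I. expectation (\<lambda>om. exp (\<theta> * \<xi> i om)))"
    using indep_vars_lebesgue_integral[OF fin indE int(3)] by simp
  also have "\<dots> \<le> exp (- \<theta> * x) * (\<Prod>i\<in>I. exp (\<theta>\<^sup>2 / 2 * (1 + \<theta> * c) * expectation (\<lambda>om. (\<xi> i om)\<^sup>2)))"
    using mgf by (intro mult_left_mono prod_mono) (auto intro!: Bochner_Integration.integral_nonneg)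
  also have "\<dots> = exp (- \<theta> * x + \<theta>\<^sup>2 / 2 * (1 + \<theta> * c) * (\<Sum>i\<in>I. expectation (\<lambda>om. (\<xi> i om)\<^sup>2)))"
    using fin by (simp only: exp_add exp_sum sum_distrib_left)
  also have "\<dots> \<le> exp (- \<theta> * x + \<theta>\<^sup>2 / 2 * (1 + \<theta> * c) * V)"
  proof -
    have "\<theta>\<^sup>2 / 2 * (1 + \<theta> * c) * (\<Sum>i\<in>I. expectation (\<lambda>om. (\<xi> i om)\<^sup>2)) \<le> \<theta>\<^sup>2 / 2 * (1 + \<theta> * c) * V"
      using V l c by (intro mult_left_mono) auto
    thus ?thesis by simp
  qed
  finally show ?thesis unfolding D_def by (simp add: mult_ac)
qed

definition gam :: "real \<Rightarrow> real \<Rightarrow> real \<Rightarrow> real \<Rightarrow> real" where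
  "gam \<beta> \<rho> H w = CN * (\<beta> * (H ^ 3 + 1 / w) + \<rho> * (H\<^sup>2 + ln (1 / w))) + 120 * w * H + 4 * exp (- H\<^sup>2)"

lemma CN_pos: "0 < CN"
  unfolding CN_def using CU_ge by simp

lemma exp_neg_le_Phi:
  assumes "8 \<le> H" "0 \<le> h" "h \<le> H"
  shows "exp (- (2 * H\<^sup>2)) \<le> exp (- H\<^sup>2) * Phi (- h)"
proof -
  have "sqrt (2 * pi) \<le> 3" using pi_less_4 by (intro real_le_lsqrt) auto
  have "(H\<^sup>2 / 2) ^ 2 \<le> fact 2 * exp (H\<^sup>2 / 2)" by (rule power_le_exp) simp
  hence "H ^ 4 \<le> 8 * exp (H\<^sup>2 / 2)" by (simp add: fact_numeral power_divide flip: power_mult)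
  moreover have "8 ^ 3 * H \<le> H ^ 3 * H" using assms by (intro mult_right_mono power_mono) auto
  ultimately have "64 * H \<le> exp (H\<^sup>2 / 2)" by (simp add: eval_nat_numeral)
  have "phi h \<le> 5 * (1 + max 0 (- (- h))) * Phi (- h)"
    using phi_le_Phi[of "- h"] by (simp add: phi_eq)
  also have "\<dots> \<le> 5 * (2 * H) * Phi (- h)"
    using assms Phi_pos[of "- h"] by (intro mult_right_mono mult_left_mono) auto
  finally have p: "phi h \<le> 10 * H * Phi (- h)" by simp
  have "exp (- H\<^sup>2 / 2) / 3 \<le> exp (- h\<^sup>2 / 2) / sqrt (2 * pi)"
    using assms \<open>sqrt (2 * pi) \<le> 3\<close> by (intro frac_le) (auto intro!: power_mono)
  also have "\<dots> \<le> 10 * H * Phi (- h)" using p by (simp add: phi_eq)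
  finally have "exp (- H\<^sup>2 / 2) \<le> 30 * H * Phi (- h)" by simp
  also have "\<dots> \<le> exp (H\<^sup>2 / 2) * Phi (- h)"
    using \<open>64 * H \<le> exp (H\<^sup>2 / 2)\<close> assms Phi_pos[of "- h"] by (intro mult_right_mono) auto
  finally have "exp (- H\<^sup>2 / 2) * exp (- (3 / 2 * H\<^sup>2)) \<le> exp (H\<^sup>2 / 2) * Phi (- h) * exp (- (3 / 2 * H\<^sup>2))"
    by (intro mult_right_mono) auto
  moreover have "exp (- H\<^sup>2 / 2) * exp (- (3 / 2 * H\<^sup>2)) = exp (- (2 * H\<^sup>2))" by (simp flip: exp_add)
  moreover have "exp (H\<^sup>2 / 2) * Phi (- h) * exp (- (3 / 2 * H\<^sup>2)) = (exp (H\<^sup>2 / 2) * exp (- (3 / 2 * H\<^sup>2))) * Phi (- h)" by simp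
  moreover have "exp (H\<^sup>2 / 2) * exp (- (3 / 2 * H\<^sup>2)) = exp (- H\<^sup>2)" by (simp flip: exp_add)
  ultimately show ?thesis by metis
qed

locale linear_stats = prob_space +
  fixes E :: "'e set" and N :: nat and Y :: "'e \<Rightarrow> nat \<Rightarrow> 'a \<Rightarrow> real" and s :: "'e \<Rightarrow> nat \<Rightarrow> real"
    and R :: "'e \<Rightarrow> 'e \<Rightarrow> real" and bd \<beta> \<rho>0 H w :: real
  assumes finE: "finite E" and N: "0 < N"
    and ind: "\<And>e e'. e \<in> E \<Longrightarrow> e' \<in> E \<Longrightarrow>
        indep_vars (\<lambda>_. borel \<Otimes>\<^sub>M borel) (\<lambda>i om. (Y e i om, Y e' i om)) {..<N}"
    and bdd: "\<And>e i om. e \<in> E \<Longrightarrow> i < N \<Longrightarrow> om \<in> space M \<Longrightarrow> \<bar>Y e i om\<bar> \<le> bd"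
    and mean0: "\<And>e i. e \<in> E \<Longrightarrow> i < N \<Longrightarrow> expectation (Y e i) = 0"
    and vars: "\<And>e i. e \<in> E \<Longrightarrow> i < N \<Longrightarrow> expectation (\<lambda>om. (Y e i om)\<^sup>2) = s e i"
    and unit: "\<And>e. e \<in> E \<Longrightarrow> (\<Sum>i<N. s e i) = 1"
    and third: "\<And>e i. e \<in> E \<Longrightarrow> i < N \<Longrightarrow> expectation (\<lambda>om. \<bar>Y e i om\<bar> ^ 3) \<le> \<beta> * s e i"
    and sd: "\<And>e i. e \<in> E \<Longrightarrow> i < N \<Longrightarrow> sqrt (s e i) \<le> \<beta>"
    and cov: "\<And>e e' i. e \<in> E \<Longrightarrow> e' \<in> E \<Longrightarrow> e \<noteq> e' \<Longrightarrow> i < N \<Longrightarrow>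
        \<bar>expectation (\<lambda>om. Y e i om * Y e' i om)\<bar> \<le> R e e' * (sqrt (s e i) * sqrt (s e' i))"
    and H: "8 \<le> H" and w: "0 < w" "4 * w \<le> 1 / H" "10 * w \<le> 1"
    and bd: "0 \<le> bd" "bd \<le> 1 / H" "bd * (H + 2 / w) \<le> 1" "4 * H * bd \<le> 1" and rho: "0 \<le> \<rho>0" "0 \<le> \<beta>"
    and gam: "gam \<beta> \<rho>0 H w \<le> 1 / 2"
begin

definition W :: "'e \<Rightarrow> 'a \<Rightarrow> real" where "W e om = (\<Sum>i<N. Y e i om)"

abbreviation g :: real where "g \<equiv> gam \<beta> \<rho>0 H w"

lemma meas_Y [measurable]: "e \<in> E \<Longrightarrow> i < N \<Longrightarrow> Y e i \<in> borel_measurable M"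
proof -
  assume i: "e \<in> E" "i < N"
  have "random_variable (borel \<Otimes>\<^sub>M borel) (\<lambda>om. (Y e i om, Y e i om))"
    using ind[OF i(1) i(1)] i unfolding indep_vars_def by auto
  from measurable_compose[OF this measurable_fst] show ?thesis by simp
qed

lemma meas_W [measurable]: "e \<in> E \<Longrightarrow> W e \<in> borel_measurable M"
  unfolding W_def by measurable

lemma s_nonneg: "e \<in> E \<Longrightarrow> i < N \<Longrightarrow> 0 \<le> s e i"
  using vars[of e i, symmetric] by auto

definition v :: real where "v = w\<^sup>2 / (4 * H\<^sup>2)"

lemma v_props: "0 < v" "v \<le> 1" "H * v \<le> w" "exp (- (w\<^sup>2 / (2 * v))) = exp (- (2 * H\<^sup>2))"
proof -
  have H2: "1 \<le> H\<^sup>2" using H by simp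
  show "0 < v" unfolding v_def using w H by simp
  have w1: "w \<le> 1" using w by simp
  have ww: "w\<^sup>2 \<le> w * 1" unfolding power2_eq_square using w w1 by (intro mult_left_mono) auto
  show "v \<le> 1" unfolding v_def using H2 ww w1 by (simp add: divide_le_eq)
  have "H * v = w\<^sup>2 / (4 * H)" unfolding v_def using H by (simp add: power2_eq_square)
  also have "\<dots> \<le> w / 1" using ww w H by (intro frac_le) auto
  finally show "H * v \<le> w" by simp
  show "exp (- (w\<^sup>2 / (2 * v))) = exp (- (2 * H\<^sup>2))" unfolding v_def using w H by simp
qed

lemma bivariate:
  assumes e: "e \<in> E" "e' \<in> E" "e \<noteq> e'" "R e e' \<le> \<rho>0" and c: "c \<in> {1, -1}" "c' \<in> {1, -1::real}"
  shows "bivariate_sum M N (\<lambda>i om. c * Y e i om) (\<lambda>i om. c' * Y e' i om) (s e) (s e') bd \<beta> \<rho>0 H w v v"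
proof
  have "indep_vars (\<lambda>_. borel \<Otimes>\<^sub>M borel) (\<lambda>i om. (\<lambda>z. (c * fst z, c' * snd z)) (Y e i om, Y e' i om)) {..<N}"
    by (rule indep_vars_compose2[OF ind[OF e(1,2)]]) auto
  thus "indep_vars (\<lambda>_. borel \<Otimes>\<^sub>M borel) (\<lambda>i om. (c * Y e i om, c' * Y e' i om)) {..<N}" by simp
  have c2: "c * c = 1" "c' * c' = 1" "\<bar>c\<bar> = 1" "\<bar>c'\<bar> = 1" using c by auto
  fix i assume i: "i < N"
  show "\<bar>c * Y e i om\<bar> \<le> bd" "\<bar>c' * Y e' i om\<bar> \<le> bd" if "om \<in> space M" for om
    using c2 bdd e i that by (auto simp: abs_mult)
  show "expectation (\<lambda>om. c * Y e i om) = 0" "expectation (\<lambda>om. c' * Y e' i om) = 0"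
    using mean0 e i by auto
  show "expectation (\<lambda>om. (c * Y e i om)\<^sup>2) = s e i" "expectation (\<lambda>om. (c' * Y e' i om)\<^sup>2) = s e' i"
    using vars e i c by (auto simp: power_mult_distrib)
  show "expectation (\<lambda>om. \<bar>c * Y e i om\<bar> ^ 3) \<le> \<beta> * s e i" "expectation (\<lambda>om. \<bar>c' * Y e' i om\<bar> ^ 3) \<le> \<beta> * s e' i"
    using third e i c2 by (auto simp: abs_mult)
  show "sqrt (s e i) \<le> \<beta>" "sqrt (s e' i) \<le> \<beta>" using sd e i by auto
  have "\<bar>expectation (\<lambda>om. c * Y e i om * (c' * Y e' i om))\<bar> = \<bar>(c * c') * expectation (\<lambda>om. Y e i om * Y e' i om)\<bar>"
    by (subst integral_mult_right_zero[symmetric]) (simp add: mult_ac)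
  also have "\<dots> = \<bar>expectation (\<lambda>om. Y e i om * Y e' i om)\<bar>" using c2 by (simp add: abs_mult)
  also have "\<dots> \<le> R e e' * (sqrt (s e i) * sqrt (s e' i))" by (rule cov[OF e(1-3) i])
  also have "\<dots> \<le> \<rho>0 * (sqrt (s e i) * sqrt (s e' i))"
    using e s_nonneg i by (intro mult_right_mono) auto
  finally show "\<bar>expectation (\<lambda>om. c * Y e i om * (c' * Y e' i om))\<bar> \<le> \<rho>0 * (sqrt (s e i) * sqrt (s e' i))" .
qed (use H w bd rho v_props in auto)

lemma univariate:
  assumes e: "e \<in> E" and c: "c \<in> {1, -1::real}"
  shows "bivariate_sum M N (\<lambda>i om. c * Y e i om) (\<lambda>i om. 0) (s e) (\<lambda>_. 0) bd \<beta> \<rho>0 H w v 1"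
proof
  have "indep_vars (\<lambda>_. borel \<Otimes>\<^sub>M borel) (\<lambda>i om. (\<lambda>z. (c * fst z, 0)) (Y e i om, Y e i om)) {..<N}"
    by (rule indep_vars_compose2[OF ind[OF e e]]) auto
  thus "indep_vars (\<lambda>_. borel \<Otimes>\<^sub>M borel) (\<lambda>i om. (c * Y e i om, 0)) {..<N}" by simp
  have c2: "c * c = 1" "\<bar>c\<bar> = 1" using c by auto
  fix i assume i: "i < N"
  show "\<bar>c * Y e i om\<bar> \<le> bd" if "om \<in> space M" for om
    using c2 bdd e i that by (auto simp: abs_mult)
  show "expectation (\<lambda>om. c * Y e i om) = 0"
    using mean0 e i by auto
  show "expectation (\<lambda>om. (c * Y e i om)\<^sup>2) = s e i"
    using vars e i c by (auto simp: power_mult_distrib)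
  show "expectation (\<lambda>om. \<bar>c * Y e i om\<bar> ^ 3) \<le> \<beta> * s e i"
    using third e i c2 by (auto simp: abs_mult)
  show "sqrt (s e i) \<le> \<beta>" using sd e i by auto
  have "0 \<le> sqrt (s e i)" using s_nonneg e i by simp
  thus "sqrt 0 \<le> \<beta>" using sd e i by (metis order_trans real_sqrt_zero)
qed (use H w bd rho v_props in auto)

lemma zeta_half: "exp (- (2 * H\<^sup>2)) \<le> 1 / 2" "exp (- (2 * H\<^sup>2)) \<le> exp (- H\<^sup>2)"
proof -
  have "1 + 2 * H\<^sup>2 \<le> exp (2 * H\<^sup>2)" by (rule exp_ge_add_one_self)
  moreover have "1 \<le> H\<^sup>2" using H by simp
  ultimately have "2 \<le> exp (2 * H\<^sup>2)" by linarith
  thus "exp (- (2 * H\<^sup>2)) \<le> 1 / 2" by (simp add: exp_minus field_simps)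
qed simp

lemma inv_one_minus: "0 \<le> z \<Longrightarrow> z \<le> 1 / 2 \<Longrightarrow> 1 \<le> exp (2 * z) * (1 - z)" for z :: real
proof -
  assume z: "0 \<le> z" "z \<le> 1 / 2"
  have "1 \<le> (1 + 2 * z) * (1 - z)" using z mult_left_mono[OF z(2) z(1)] by (simp add: algebra_simps)
  also have "\<dots> \<le> exp (2 * z) * (1 - z)" using z exp_ge_add_one_self[of "2 * z"] by (intro mult_right_mono) auto
  finally show ?thesis .
qed

lemma hl_nonneg: "0 \<le> H\<^sup>2 + ln (1 / w)"
proof -
  have "1 \<le> 1 / w" using w by simp
  thus ?thesis by (auto intro!: add_nonneg_nonneg ln_ge_zero)
qed

lemma rate_nonneg: "0 \<le> CN * (\<beta> * (H ^ 3 + 1 / w) + \<rho>0 * (H\<^sup>2 + ln (1 / w)))"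
  using CN_pos rho w H hl_nonneg by (intro mult_nonneg_nonneg add_nonneg_nonneg) auto

lemma g_nonneg: "0 \<le> g"
  unfolding gam_def using rate_nonneg w H by (intro add_nonneg_nonneg) auto

lemma exp_g: "exp g \<le> 1 + 2 * g"
proof -
  have "exp g \<le> 1 + g + g\<^sup>2" using g_nonneg gam by (intro exp_bound) auto
  moreover have "g\<^sup>2 \<le> g * 1" unfolding power2_eq_square using g_nonneg gam by (intro mult_left_mono) auto
  ultimately show ?thesis by simp
qed

lemma weak_one_sided:
  assumes e: "e \<in> E" "e' \<in> E" "e \<noteq> e'" "R e e' \<le> \<rho>0" and c: "c \<in> {1, -1}" "c' \<in> {1, -1::real}"
    and h: "0 \<le> h" "h \<le> H"
  shows "prob {om \<in> space M. h \<le> c * W e om \<and> h \<le> c' * W e' om} \<le> (1 + 2 * g) * (Phi (- h))\<^sup>2"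
proof -
  interpret b: bivariate_sum M N "\<lambda>i om. c * Y e i om" "\<lambda>i om. c' * Y e' i om" "s e" "s e'" bd \<beta> \<rho>0 H w v v
    by (rule bivariate[OF e c])
  define z where "z = exp (- (2 * H\<^sup>2))"
  have z: "0 \<le> z" "z \<le> 1 / 2" "z \<le> exp (- H\<^sup>2)" unfolding z_def using zeta_half by auto
  define P where "P = prob {om \<in> space M. h \<le> c * W e om \<and> h \<le> c' * W e' om}"
  have SW: "b.SA N om = c * W e om" "b.SB N om = c' * W e' om" for om
    unfolding b.SA_def b.SB_def W_def by (simp_all add: sum_distrib_left)
  have P0: "0 \<le> P" unfolding P_def by simp
  have "(1 - z)\<^sup>2 * P \<le> exp (b.rate + 120 * w * H) * (Phi (- h))\<^sup>2"
    using b.joint_tail[OF N refl refl v_props(2,3) unit[OF e(1)] unit[OF e(2)] h]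
    unfolding SW v_props(4) z_def P_def .
  hence "(exp (2 * z) * exp (2 * z)) * ((1 - z)\<^sup>2 * P) \<le> (exp (2 * z) * exp (2 * z)) * (exp (b.rate + 120 * w * H) * (Phi (- h))\<^sup>2)"
    by (intro mult_left_mono) auto
  also have "\<dots> = exp (b.rate + 120 * w * H + 4 * z) * (Phi (- h))\<^sup>2"
  proof -
    have "exp (b.rate + 120 * w * H + 4 * z) = exp (2 * z) * exp (2 * z) * exp (b.rate + 120 * w * H)"
      by (simp flip: exp_add)
    thus ?thesis by simp
  qed
  also have "\<dots> \<le> exp g * (Phi (- h))\<^sup>2"
    unfolding gam_def b.rate_def using z by (intro mult_right_mono) auto
  also have "\<dots> \<le> (1 + 2 * g) * (Phi (- h))\<^sup>2" using exp_g by (intro mult_right_mono) auto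
  finally have "(exp (2 * z) * exp (2 * z)) * ((1 - z)\<^sup>2 * P) \<le> (1 + 2 * g) * (Phi (- h))\<^sup>2" .
  moreover have "1 * P \<le> ((exp (2 * z) * (1 - z)) * (exp (2 * z) * (1 - z))) * P"
    using mult_mono[OF inv_one_minus[OF z(1,2)] inv_one_minus[OF z(1,2)]] P0 z by (intro mult_right_mono) auto
  hence "P \<le> (exp (2 * z) * exp (2 * z)) * ((1 - z)\<^sup>2 * P)"
    by (simp add: power2_eq_square mult_ac)
  ultimately show ?thesis unfolding P_def[symmetric] by linarith
qed

lemma weak_joint:
  assumes e: "e \<in> E" "e' \<in> E" "e \<noteq> e'" "R e e' \<le> \<rho>0" and h: "0 \<le> h" "h \<le> H"
  shows "prob {om \<in> space M. h \<le> \<bar>W e om\<bar> \<and> h \<le> \<bar>W e' om\<bar>} \<le> (1 + 2 * g) * (2 * Phi (- h))\<^sup>2"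
proof -
  define D where "D c c' = {om \<in> space M. h \<le> c * W e om \<and> h \<le> c' * W e' om}" for c c' :: real
  have [measurable]: "D c c' \<in> events" for c c' unfolding D_def using e by measurable
  have p: "prob (D c c') \<le> (1 + 2 * g) * (Phi (- h))\<^sup>2" if "c \<in> {1,-1}" "c' \<in> {1,-1}" for c c'
    unfolding D_def by (rule weak_one_sided[OF e that h])
  have "prob {om \<in> space M. h \<le> \<bar>W e om\<bar> \<and> h \<le> \<bar>W e' om\<bar>} \<le> prob ((D 1 1 \<union> D 1 (-1)) \<union> (D (-1) 1 \<union> D (-1) (-1)))"
  proof (intro finite_measure_mono)
    show "{om \<in> space M. h \<le> \<bar>W e om\<bar> \<and> h \<le> \<bar>W e' om\<bar>} \<subseteq> (D 1 1 \<union> D 1 (-1)) \<union> (D (-1) 1 \<union> D (-1) (-1))"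
      unfolding D_def by (auto simp: abs_if split: if_splits)
  qed auto
  also have "\<dots> \<le> (prob (D 1 1) + prob (D 1 (-1))) + (prob (D (-1) 1) + prob (D (-1) (-1)))"
    by (intro order_trans[OF measure_Un_le] add_mono) auto
  also have "\<dots> \<le> 4 * ((1 + 2 * g) * (Phi (- h))\<^sup>2)"
    using p[of 1 1] p[of 1 "-1"] p[of "-1" 1] p[of "-1" "-1"] by simp
  finally show ?thesis by (simp add: power_mult_distrib)
qed

lemma marginal_one_sided:
  assumes e: "e \<in> E" and c: "c \<in> {1, -1::real}" and h: "0 \<le> h" "h \<le> H - 1"
  shows "\<bar>prob {om \<in> space M. h \<le> c * W e om} - Phi (- h)\<bar> \<le> 2 * g * Phi (- h)"
proof -
  interpret b: bivariate_sum M N "\<lambda>i om. c * Y e i om" "\<lambda>i om. 0" "s e" "\<lambda>_. 0" bd \<beta> \<rho>0 H w v 1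
    by (rule univariate[OF e c])
  define z where "z = exp (- (2 * H\<^sup>2))"
  have z: "0 \<le> z" "z \<le> 1 / 2" "z \<le> exp (- H\<^sup>2)" unfolding z_def using zeta_half by auto
  define P where "P = prob {om \<in> space M. h \<le> c * W e om}"
  have SW: "b.SA N om = c * W e om" for om
    unfolding b.SA_def W_def by (simp add: sum_distrib_left)
  have hw: "h + 5 * w \<le> H" using h w by simp
  have P0: "0 \<le> P" unfolding P_def by simp
  note mt = b.marginal_tail[OF N refl refl v_props(2,3) unit[OF e] refl refl h(1) hw, unfolded SW v_props(4) z_def[symmetric] P_def[symmetric]]
  have Ph: "0 < Phi (- h)" by (rule Phi_pos)
  have "P \<le> exp (2 * z) * ((1 - z) * P)"
    using mult_right_mono[OF inv_one_minus[OF z(1,2)] P0] by (simp add: mult_ac)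
  also have "\<dots> \<le> exp (2 * z) * (exp (b.rate + 60 * w * H) * Phi (- h))" using mt(1) by (intro mult_left_mono) auto
  also have "\<dots> = exp (b.rate + 60 * w * H + 2 * z) * Phi (- h)" by (simp add: exp_add)
  also have "\<dots> \<le> exp g * Phi (- h)"
  proof -
    have "0 \<le> 60 * w * H" using w H by simp
    hence "b.rate + 60 * w * H + 2 * z \<le> g" unfolding gam_def b.rate_def using z by simp
    thus ?thesis using Ph by simp
  qed
  also have "\<dots> \<le> (1 + 2 * g) * Phi (- h)" using exp_g Ph by (intro mult_right_mono) auto
  finally have up: "P - Phi (- h) \<le> 2 * g * Phi (- h)" by (simp add: algebra_simps)
  define rt where "rt = b.rate"
  have rt: "0 \<le> rt" "rt + 120 * w * H + 4 * exp (- H\<^sup>2) = g"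
    unfolding rt_def b.rate_def gam_def using rate_nonneg by auto
  have wH: "0 \<le> w * H" using w H by simp
  have ex: "0 \<le> exp (- H\<^sup>2)" by simp
  have rt2: "rt \<le> 1 / 2" using rt wH ex gam by linarith
  have "exp rt \<le> 1 + rt + rt\<^sup>2" using rt rt2 by (intro exp_bound) auto
  moreover have "rt\<^sup>2 \<le> rt * 1" unfolding power2_eq_square using rt rt2 by (intro mult_left_mono) auto
  ultimately have er: "exp rt \<le> 1 + 2 * rt" by simp
  have e50: "1 - 50 * w * H \<le> exp (- (50 * w * H))" using exp_ge_add_one_self[of "- (50 * w * H)"] by simp
  have "(1 - 2 * rt) * (1 - 50 * w * H) \<le> (2 - exp rt) * exp (- (50 * w * H))"
    using er rt2 rt by (intro order_trans[OF mult_left_mono[OF e50] mult_right_mono]) auto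
  moreover have "(1 - 2 * rt) * (1 - 50 * w * H) = 1 - 2 * rt - 50 * w * H + 2 * rt * (50 * w * H)" by (simp add: algebra_simps)
  moreover have "0 \<le> 2 * rt * (50 * w * H)" using rt w H by simp
  ultimately have a: "1 - 2 * rt - 50 * w * H \<le> (2 - exp rt) * exp (- (50 * w * H))" by linarith
  have "z \<le> exp (- H\<^sup>2) * Phi (- h)" unfolding z_def using H h by (intro exp_neg_le_Phi) auto
  moreover have "(2 - exp rt) * (exp (- (50 * w * H)) * Phi (- h)) - z \<le> P"
    using mt(2) er rt2 rt_def by auto
  moreover have "(1 - 2 * rt - 50 * w * H) * Phi (- h) \<le> ((2 - exp rt) * exp (- (50 * w * H))) * Phi (- h)"
    using a Ph by (intro mult_right_mono) auto
  ultimately have "(1 - 2 * rt - 50 * w * H) * Phi (- h) - exp (- H\<^sup>2) * Phi (- h) \<le> P"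
    by (simp only: mult.assoc)
  hence "(1 - 2 * rt - 50 * w * H - exp (- H\<^sup>2)) * Phi (- h) \<le> P" by (simp add: left_diff_distrib)
  moreover have "(1 - 2 * g) * Phi (- h) \<le> (1 - 2 * rt - 50 * w * H - exp (- H\<^sup>2)) * Phi (- h)"
  proof (rule mult_right_mono)
    have a1: "50 * w * H = 50 * (w * H)" "120 * w * H = 120 * (w * H)" by simp_all
    show "1 - 2 * g \<le> 1 - 2 * rt - 50 * w * H - exp (- H\<^sup>2)"
      using rt(2) ex wH unfolding a1 by linarith
  qed (use Ph in auto)
  ultimately have "Phi (- h) - P \<le> 2 * g * Phi (- h)" by (simp add: algebra_simps)
  with up show ?thesis unfolding P_def[symmetric] by (simp add: abs_le_iff)
qed

lemma marginal:
  assumes e: "e \<in> E" and h: "0 \<le> h" "h \<le> H - 1"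
  shows "\<bar>prob {om \<in> space M. h \<le> \<bar>W e om\<bar>} - 2 * Phi (- h)\<bar> \<le> 2 * g * (2 * Phi (- h))"
proof (cases "h = 0")
  case True
  have "{om \<in> space M. h \<le> \<bar>W e om\<bar>} = space M" using True by auto
  thus ?thesis using True g_nonneg by (simp add: prob_space Phi_0)
next
  case False
  have [measurable]: "W e \<in> borel_measurable M" using e by simp
  have "prob {om \<in> space M. h \<le> \<bar>W e om\<bar>} = prob ({om \<in> space M. h \<le> 1 * W e om} \<union> {om \<in> space M. h \<le> (-1) * W e om})"
    by (intro arg_cong[where f = prob]) (auto simp: abs_if split: if_splits)
  also have "\<dots> = prob {om \<in> space M. h \<le> 1 * W e om} + prob {om \<in> space M. h \<le> (-1) * W e om}"
    using False h by (intro finite_measure_Union) auto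
  finally have *: "prob {om \<in> space M. h \<le> \<bar>W e om\<bar>} = prob {om \<in> space M. h \<le> 1 * W e om} + prob {om \<in> space M. h \<le> (-1) * W e om}" .
  have tri: "\<bar>a - p\<bar> \<le> q \<Longrightarrow> \<bar>b - p\<bar> \<le> q \<Longrightarrow> \<bar>a + b - 2 * p\<bar> \<le> 2 * q" for a b p q :: real by auto
  show ?thesis unfolding * using tri[OF marginal_one_sided[OF e _ h, of 1] marginal_one_sided[OF e _ h, of "-1"]] by simp
qed

lemma strong_joint:
  assumes e: "e \<in> E" "e' \<in> E" "e \<noteq> e'" "R e e' \<le> r" and r: "0 \<le> r" and h: "0 \<le> h" "h \<le> H"
  shows "prob {om \<in> space M. h \<le> \<bar>W e om\<bar> \<and> h \<le> \<bar>W e' om\<bar>} \<le> 4 * exp (- (h\<^sup>2 / (1 + r)) * (1 - 2 * H * bd))"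
proof -
  define D where "D c c' = {om \<in> space M. 2 * h \<le> (\<Sum>i<N. c * Y e i om + c' * Y e' i om)}" for c c' :: real
  have [measurable]: "D c c' \<in> events" for c c' unfolding D_def using e by measurable
  define \<theta> where "\<theta> = h / (1 + r)"
  have th: "0 \<le> \<theta>" "\<theta> \<le> H" using h r by (auto simp: \<theta>_def divide_le_eq intro: order_trans[of _ H] simp: mult_left_le algebra_simps)
  have p: "prob (D c c') \<le> exp (- (h\<^sup>2 / (1 + r)) * (1 - 2 * H * bd))" if c: "c \<in> {1,-1}" "c' \<in> {1,-1}" for c c'
  proof -
    have c2: "c * c = 1" "c' * c' = 1" "\<bar>c\<bar> = 1" "\<bar>c'\<bar> = 1" using c by auto
    have "prob (D c c') \<le> exp (- \<theta> * (2 * h) + \<theta>\<^sup>2 * (2 * (1 + r)) / 2 * (1 + \<theta> * (2 * bd)))"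
      unfolding D_def
    proof (rule chernoff_bounded)
      have "indep_vars (\<lambda>_. borel) (\<lambda>i om. (\<lambda>z. c * fst z + c' * snd z) (Y e i om, Y e' i om)) {..<N}"
        by (rule indep_vars_compose2[OF ind[OF e(1,2)]]) auto
      thus "indep_vars (\<lambda>_. borel) (\<lambda>i om. c * Y e i om + c' * Y e' i om) {..<N}" by simp
      fix i assume "i \<in> {..<N}"
      hence i: "i < N" by simp
      show "\<bar>c * Y e i om + c' * Y e' i om\<bar> \<le> 2 * bd" if "om \<in> space M" for om
        using abs_triangle_ineq[of "c * Y e i om" "c' * Y e' i om"] bdd[OF e(1) i that] bdd[OF e(2) i that] c2
        by (simp add: abs_mult)
      have "integrable M (Y e i)" "integrable M (Y e' i)"
        using bdd e i by (auto intro!: integrable_const_bound[of _ bd] AE_I2)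
      thus "expectation (\<lambda>om. c * Y e i om + c' * Y e' i om) = 0"
        using mean0 e i by simp
    next
      have "(\<Sum>i<N. expectation (\<lambda>om. (c * Y e i om + c' * Y e' i om)\<^sup>2)) \<le> (\<Sum>i<N. (1 + r) * (s e i + s e' i))"
      proof (rule sum_mono)
        fix i assume "i \<in> {..<N}"
        hence i: "i < N" by simp
        have sq: "(Y a i om)\<^sup>2 \<le> bd\<^sup>2" if "a \<in> E" "om \<in> space M" for om a
          using bdd[OF that(1) i that(2)] by (metis abs_ge_zero power2_abs power_mono)
        have int: "integrable M (\<lambda>om. (Y e i om)\<^sup>2)" "integrable M (\<lambda>om. (Y e' i om)\<^sup>2)" "integrable M (\<lambda>om. Y e i om * Y e' i om)"
        proof -
          show "integrable M (\<lambda>om. (Y e i om)\<^sup>2)" "integrable M (\<lambda>om. (Y e' i om)\<^sup>2)"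
            using sq e i by (auto intro!: integrable_const_bound[of _ "bd\<^sup>2"] AE_I2)
          show "integrable M (\<lambda>om. Y e i om * Y e' i om)"
            using bdd[OF e(1) i] bdd[OF e(2) i] e i bd
            by (intro integrable_const_bound[of _ "bd * bd"] AE_I2) (auto simp: abs_mult intro!: mult_mono)
        qed
        have "expectation (\<lambda>om. (c * Y e i om + c' * Y e' i om)\<^sup>2)
           = expectation (\<lambda>om. (Y e i om)\<^sup>2 + (Y e' i om)\<^sup>2 + (2 * c * c') * (Y e i om * Y e' i om))"
        proof (rule Bochner_Integration.integral_cong[OF refl])
          fix om
          have "(c * Y e i om + c' * Y e' i om)\<^sup>2 = (c * c) * (Y e i om)\<^sup>2 + (c' * c') * (Y e' i om)\<^sup>2 + (2 * c * c') * (Y e i om * Y e' i om)"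
            by (simp add: power2_eq_square algebra_simps)
          thus "(c * Y e i om + c' * Y e' i om)\<^sup>2 = (Y e i om)\<^sup>2 + (Y e' i om)\<^sup>2 + (2 * c * c') * (Y e i om * Y e' i om)"
            using c2 by simp
        qed
        also have "\<dots> = s e i + s e' i + (2 * c * c') * expectation (\<lambda>om. Y e i om * Y e' i om)"
          using int vars e i by simp
        also have "(2 * c * c') * expectation (\<lambda>om. Y e i om * Y e' i om) \<le> \<bar>(2 * c * c') * expectation (\<lambda>om. Y e i om * Y e' i om)\<bar>" by simp
        also have "\<dots> = 2 * \<bar>expectation (\<lambda>om. Y e i om * Y e' i om)\<bar>" using c2 by (simp add: abs_mult)
        also have "\<dots> \<le> 2 * (R e e' * (sqrt (s e i) * sqrt (s e' i)))" using cov[OF e(1-3) i] by simp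
        also have "\<dots> \<le> 2 * (r * (sqrt (s e i) * sqrt (s e' i)))"
          using e s_nonneg i by (intro mult_left_mono mult_right_mono) auto
        also have "\<dots> = r * (2 * sqrt (s e i) * sqrt (s e' i))" by simp
        also have "\<dots> \<le> r * ((sqrt (s e i))\<^sup>2 + (sqrt (s e' i))\<^sup>2)" using r by (intro mult_left_mono sum_squares_bound) auto
        also have "\<dots> = r * (s e i + s e' i)" using s_nonneg e i by simp
        finally show "expectation (\<lambda>om. (c * Y e i om + c' * Y e' i om)\<^sup>2) \<le> (1 + r) * (s e i + s e' i)"
          by (simp add: algebra_simps)
      qed
      also have "\<dots> = 2 * (1 + r)" using unit e by (simp add: sum_distrib_left[symmetric] sum.distrib)
      finally show "(\<Sum>i<N. expectation (\<lambda>om. (c * Y e i om + c' * Y e' i om)\<^sup>2)) \<le> 2 * (1 + r)" .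
      have "\<theta> * (2 * bd) \<le> H * (2 * bd)" using th bd by (intro mult_right_mono) auto
      moreover have "0 \<le> H * bd" using H bd by simp
      ultimately show "\<theta> * (2 * bd) \<le> 1" using bd(4) by simp
    qed (use th bd in auto)
    also have "\<dots> \<le> exp (- (h\<^sup>2 / (1 + r)) * (1 - 2 * H * bd))"
    proof -
      have t1: "\<theta> * (2 * h) = 2 * (h\<^sup>2 / (1 + r))" by (simp add: \<theta>_def power2_eq_square)
      have t2: "\<theta>\<^sup>2 * (2 * (1 + r)) / 2 = h\<^sup>2 / (1 + r)" using r by (simp add: \<theta>_def power2_eq_square divide_simps)
      have "h\<^sup>2 / (1 + r) * (1 + \<theta> * (2 * bd)) \<le> h\<^sup>2 / (1 + r) * (1 + H * (2 * bd))"
        using th bd r by (intro mult_left_mono add_left_mono mult_right_mono) auto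
      hence "- \<theta> * (2 * h) + \<theta>\<^sup>2 * (2 * (1 + r)) / 2 * (1 + \<theta> * (2 * bd)) \<le> - (2 * (h\<^sup>2 / (1 + r))) + h\<^sup>2 / (1 + r) * (1 + H * (2 * bd))"
        unfolding t2 using t1 by simp
      also have "\<dots> = - (h\<^sup>2 / (1 + r)) * (1 - 2 * H * bd)"
      proof -
        have "- (2 * a) + a * (1 + H * (2 * bd)) = - a * (1 - 2 * H * bd)" for a by (simp add: algebra_simps)
        thus ?thesis .
      qed
      finally show ?thesis by simp
    qed
    finally show ?thesis .
  qed
  have "prob {om \<in> space M. h \<le> \<bar>W e om\<bar> \<and> h \<le> \<bar>W e' om\<bar>} \<le> prob ((D 1 1 \<union> D 1 (-1)) \<union> (D (-1) 1 \<union> D (-1) (-1)))"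
  proof (intro finite_measure_mono)
    have S: "(\<Sum>i<N. c * Y e i om + c' * Y e' i om) = c * W e om + c' * W e' om" for c c' om
      unfolding W_def by (simp add: sum.distrib sum_distrib_left)
    show "{om \<in> space M. h \<le> \<bar>W e om\<bar> \<and> h \<le> \<bar>W e' om\<bar>} \<subseteq> (D 1 1 \<union> D 1 (-1)) \<union> (D (-1) 1 \<union> D (-1) (-1))"
      unfolding D_def S by (auto simp: abs_if split: if_splits)
  qed auto
  also have "\<dots> \<le> (prob (D 1 1) + prob (D 1 (-1))) + (prob (D (-1) 1) + prob (D (-1) (-1)))"
    by (intro order_trans[OF measure_Un_le] add_mono) auto
  also have "\<dots> \<le> 4 * exp (- (h\<^sup>2 / (1 + r)) * (1 - 2 * H * bd))"
    using p[of 1 1] p[of 1 "-1"] p[of "-1" 1] p[of "-1" "-1"] by simp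
  finally show ?thesis .
qed

definition Zc :: "real \<Rightarrow> 'a \<Rightarrow> real" where
  "Zc h om = real (card {e \<in> E. h \<le> \<bar>W e om\<bar>})"

lemma Zc_antimono: "h \<le> h' \<Longrightarrow> Zc h' om \<le> Zc h om"
  unfolding Zc_def using finE by (auto intro!: card_mono)

lemma count_deviation:
  assumes r: "0 \<le> r" "\<And>e e'. e \<in> E \<Longrightarrow> e' \<in> E \<Longrightarrow> e \<noteq> e' \<Longrightarrow> R e e' \<le> r"
    and m: "\<And>e. e \<in> E \<Longrightarrow> real (card {e' \<in> E. e' \<noteq> e \<and> \<rho>0 < R e e'}) \<le> m"
    and h: "0 \<le> h" "h \<le> H - 1" and E: "E \<noteq> {}" and eta: "0 < \<eta>"
  shows "prob {om \<in> space M. \<eta> * (real (card E) * (2 * Phi (- h))) < \<bar>Zc h om - real (card E) * (2 * Phi (- h))\<bar>}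
     \<le> (2 / (real (card E) * (2 * Phi (- h))) + 6 * g
        + m * (4 * exp (- (h\<^sup>2 / (1 + r)) * (1 - 2 * H * bd))) / (real (card E) * (2 * Phi (- h))\<^sup>2)) / \<eta>\<^sup>2"
proof -
  define G where "G = 2 * Phi (- h)"
  define q where "q = real (card E)"
  define B where "B = 4 * exp (- (h\<^sup>2 / (1 + r)) * (1 - 2 * H * bd))"
  have G: "0 < G" unfolding G_def using Phi_pos by simp
  have q: "0 < q" unfolding q_def using E finE by (simp add: card_gt_0_iff)
  have B: "0 \<le> B" unfolding B_def by simp
  have hH: "h \<le> H" using h by simp
  define D where "D e = {om \<in> space M. h \<le> \<bar>W e om\<bar>}" for e
  have D [measurable]: "e \<in> E \<Longrightarrow> D e \<in> events" for e unfolding D_def by measurable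
  have Z: "Zc h om = (\<Sum>e\<in>E. indicator (D e) om)" if "om \<in> space M" for om
  proof -
    have "(\<Sum>e\<in>E. indicat_real (D e) om) = (\<Sum>e\<in>E. if h \<le> \<bar>W e om\<bar> then 1 else 0)"
      using that by (intro sum.cong) (auto simp: D_def indicator_def)
    also have "\<dots> = Zc h om" unfolding Zc_def using finE by (simp add: sum.inter_filter[symmetric])
    finally show ?thesis by simp
  qed
  have iI: "integrable M (indicat_real A)" if "A \<in> events" for A
    using that by (intro integrable_real_indicator) (auto simp: emeasure_eq_measure)
  have P: "\<bar>prob (D e) - G\<bar> \<le> 2 * g * G" if "e \<in> E" for e
    unfolding D_def G_def by (rule marginal[OF that h])
  have P2: "prob (D e) \<le> 2 * G" if "e \<in> E" for e
  proof -
    have "2 * g * G \<le> 1 * G" using gam G by (intro mult_right_mono) auto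
    thus ?thesis using P[OF that] by (simp add: abs_le_iff)
  qed
  have row: "(\<Sum>e'\<in>E. prob (D e \<inter> D e')) \<le> 2 * G + m * B + q * ((1 + 2 * g) * G\<^sup>2)" if e: "e \<in> E" for e
  proof -
    define S where "S = {e' \<in> E. e' \<noteq> e \<and> \<rho>0 < R e e'}"
    have "(\<Sum>e'\<in>E. prob (D e \<inter> D e')) \<le> (\<Sum>e'\<in>E. (if e' = e then 2 * G else 0) + (if e' \<in> S then B else 0) + (1 + 2 * g) * G\<^sup>2)"
    proof (rule sum_mono)
      fix e' assume e': "e' \<in> E"
      have nn: "0 \<le> (1 + 2 * g) * G\<^sup>2" using g_nonneg by simp
      have DD: "D e \<inter> D e' = {om \<in> space M. h \<le> \<bar>W e om\<bar> \<and> h \<le> \<bar>W e' om\<bar>}" by (auto simp: D_def)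
      consider "e' = e" | "e' \<noteq> e" "e' \<in> S" | "e' \<noteq> e" "e' \<notin> S" by blast
      thus "prob (D e \<inter> D e') \<le> (if e' = e then 2 * G else 0) + (if e' \<in> S then B else 0) + (1 + 2 * g) * G\<^sup>2"
      proof cases
        case 1
        thus ?thesis using P2[OF e] nn by (simp add: S_def)
      next
        case 2
        thus ?thesis using strong_joint[OF e e' _ r(2)[OF e e'] r(1) h(1) hH] nn unfolding DD B_def by auto
      next
        case 3
        hence "R e e' \<le> \<rho>0" using e' by (auto simp: S_def)
        thus ?thesis using weak_joint[OF e e' _ _ h(1) hH] 3 unfolding DD G_def by auto
      qed
    qed
    also have "\<dots> = 2 * G + real (card S) * B + q * ((1 + 2 * g) * G\<^sup>2)"
    proof -
      have "E \<inter> S = S" by (auto simp: S_def)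
      thus ?thesis using e finE by (simp add: sum.distrib q_def sum.If_cases Int_def[symmetric] flip: Int_def)
    qed
    also have "\<dots> \<le> 2 * G + m * B + q * ((1 + 2 * g) * G\<^sup>2)"
      using mult_right_mono[OF m[OF e] B] unfolding S_def by simp
    finally show ?thesis .
  qed
  define X where "X om = (\<Sum>e\<in>E. indicat_real (D e) om)" for om
  have iX: "integrable M X" unfolding X_def[abs_def] using D iI by (intro Bochner_Integration.integrable_sum) auto
  have X2: "(X om)\<^sup>2 = (\<Sum>e\<in>E. \<Sum>e'\<in>E. indicat_real (D e \<inter> D e') om)" for om
    unfolding X_def power2_eq_square sum_product by (intro sum.cong refl) (simp add: indicator_inter_arith)
  have iX2: "integrable M (\<lambda>om. (X om)\<^sup>2)" unfolding X2
    using D iI by (intro Bochner_Integration.integrable_sum) auto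
  have EX: "expectation X = (\<Sum>e\<in>E. prob (D e))"
    unfolding X_def[abs_def] using D iI by (subst Bochner_Integration.integral_sum) auto
  have EX2: "expectation (\<lambda>om. (X om)\<^sup>2) = (\<Sum>e\<in>E. \<Sum>e'\<in>E. prob (D e \<inter> D e'))"
    unfolding X2 using D iI
    by (subst Bochner_Integration.integral_sum) (auto intro!: sum.cong Bochner_Integration.integrable_sum simp: Bochner_Integration.integral_sum)
  have EXlow: "q * ((1 - 2 * g) * G) \<le> expectation X"
  proof -
    have "(\<Sum>e\<in>E. (1 - 2 * g) * G) \<le> (\<Sum>e\<in>E. prob (D e))"
    proof (rule sum_mono)
      fix e assume "e \<in> E"
      thus "(1 - 2 * g) * G \<le> prob (D e)" using P[of e] by (simp add: abs_le_iff algebra_simps)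
    qed
    thus ?thesis unfolding EX by (simp add: q_def)
  qed
  have EX2up: "expectation (\<lambda>om. (X om)\<^sup>2) \<le> q * (2 * G + m * B + q * ((1 + 2 * g) * G\<^sup>2))"
  proof -
    have "(\<Sum>e\<in>E. \<Sum>e'\<in>E. prob (D e \<inter> D e')) \<le> (\<Sum>e\<in>E. 2 * G + m * B + q * ((1 + 2 * g) * G\<^sup>2))"
      by (rule sum_mono[OF row])
    thus ?thesis unfolding EX2 by (simp add: q_def)
  qed
  have iV: "integrable M (\<lambda>om. (X om - q * G)\<^sup>2)"
    unfolding power2_diff using iX iX2 by simp
  have "expectation (\<lambda>om. (X om - q * G)\<^sup>2) = expectation (\<lambda>om. (X om)\<^sup>2) - 2 * (q * G) * expectation X + (q * G)\<^sup>2"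
    unfolding power2_diff using iX iX2 by (simp add: prob_space algebra_simps)
  also have "\<dots> \<le> q * (2 * G + m * B + q * ((1 + 2 * g) * G\<^sup>2)) - 2 * (q * G) * (q * ((1 - 2 * g) * G)) + (q * G)\<^sup>2"
    using EX2up EXlow q G by (intro add_mono diff_mono mult_left_mono) auto
  also have "\<dots> = 2 * (q * G) + 6 * g * (q * G)\<^sup>2 + q * (m * B)"
    by (simp add: power2_eq_square algebra_simps)
  finally have Var: "expectation (\<lambda>om. (X om - q * G)\<^sup>2) \<le> 2 * (q * G) + 6 * g * (q * G)\<^sup>2 + q * (m * B)" .
  have t: "0 < \<eta> * (q * G)" using eta q G by simp
  have "prob {om \<in> space M. \<eta> * (q * G) < \<bar>Zc h om - q * G\<bar>} \<le> prob {om \<in> space M. (\<eta> * (q * G))\<^sup>2 \<le> (X om - q * G)\<^sup>2}"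
  proof (rule finite_measure_mono)
    have [measurable]: "X \<in> borel_measurable M" using iX by simp
    show "{om \<in> space M. (\<eta> * (q * G))\<^sup>2 \<le> (X om - q * G)\<^sup>2} \<in> events" by measurable
    show "{om \<in> space M. \<eta> * (q * G) < \<bar>Zc h om - q * G\<bar>} \<subseteq> {om \<in> space M. (\<eta> * (q * G))\<^sup>2 \<le> (X om - q * G)\<^sup>2}"
    proof safe
      fix om assume w: "om \<in> space M" "\<eta> * (q * G) < \<bar>Zc h om - q * G\<bar>"
      hence "\<eta> * (q * G) \<le> \<bar>X om - q * G\<bar>" unfolding X_def using Z by simp
      hence "(\<eta> * (q * G))\<^sup>2 \<le> \<bar>X om - q * G\<bar>\<^sup>2" using t by (intro power_mono) auto
      thus "(\<eta> * (q * G))\<^sup>2 \<le> (X om - q * G)\<^sup>2" by simp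
    qed
  qed
  also have "\<dots> \<le> expectation (\<lambda>om. (X om - q * G)\<^sup>2) / (\<eta> * (q * G))\<^sup>2"
    using t by (intro integral_Markov_inequality_measure[where A = "space M" and u = "\<lambda>om. (X om - q * G)\<^sup>2", simplified] iV) auto
  also have "\<dots> \<le> (2 * (q * G) + 6 * g * (q * G)\<^sup>2 + q * (m * B)) / (\<eta> * (q * G))\<^sup>2"
    using Var by (intro divide_right_mono) auto
  also have "\<dots> = (2 / (q * G) + 6 * g + m * B / (q * G\<^sup>2)) / \<eta>\<^sup>2"
  proof -
    have "2 * (q * G) / (q * G)\<^sup>2 = 2 / (q * G)" using q G by (simp add: power2_eq_square)
    moreover have "6 * g * (q * G)\<^sup>2 / (q * G)\<^sup>2 = 6 * g" using q G by simp
    moreover have "q * (m * B) / (q * G)\<^sup>2 = m * B / (q * G\<^sup>2)" using q G by (simp add: power2_eq_square)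
    ultimately show ?thesis by (simp only: power_mult_distrib[of \<eta>] add_divide_distrib[symmetric] divide_divide_eq_left[symmetric] mult.commute[of "\<eta>\<^sup>2"]) (simp only: add_divide_distrib)
  qed
  finally show ?thesis unfolding q_def G_def B_def .
qed

end

section \<open>Counting exceedances and the data-driven threshold\<close>

definition Gt :: "real \<Rightarrow> real" where "Gt h = 2 * Phi (- h)"

lemma Gt_pos: "0 < Gt h"
  unfolding Gt_def using Phi_pos by simp

lemma Gt_0: "Gt 0 = 1"
  unfolding Gt_def by (simp add: Phi_0)

lemma Gt_strict: "h < h' \<Longrightarrow> Gt h' < Gt h"
  unfolding Gt_def using Phi_strict_mono[of "- h'" "- h"] by simp

lemma Gt_mono: "h \<le> h' \<Longrightarrow> Gt h' \<le> Gt h"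
  unfolding Gt_def using Phi_mono[of "- h'" "- h"] by simp

lemma Gt_le_iff: "Gt h' \<le> Gt h \<longleftrightarrow> h \<le> h'"
  using Gt_strict[of h' h] Gt_mono[of h h'] by linarith

lemma Gt_le_exp: "0 \<le> h \<Longrightarrow> Gt h \<le> 2 * exp (- h\<^sup>2 / 2)"
  unfolding Gt_def using Phi_minus_le_exp[of h] by simp

lemma Gt_shift: "0 \<le> a \<Longrightarrow> 0 \<le> h \<Longrightarrow> Gt (h - a) \<le> Gt h * exp (5 * a * (1 + h))"
  unfolding Gt_def using Phi_shift_le[of a "- h"] by (simp add: algebra_simps)

lemma Gt_inverse: assumes "0 < y" "y \<le> 1" shows "\<exists>x\<ge>0. Gt x = y"
proof -
  define b where "b = 2 / y"
  have b: "2 \<le> b" using assms by (simp add: b_def field_simps)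
  have "Gt b \<le> 2 * exp (- b\<^sup>2 / 2)" using b by (intro Gt_le_exp) auto
  also have "\<dots> \<le> 2 * (1 / b)"
  proof -
    have "b \<le> 1 + b\<^sup>2 / 2" using zero_le_power2[of "b - 1"] by (simp add: power2_eq_square algebra_simps)
    also have "\<dots> \<le> exp (b\<^sup>2 / 2)" by (rule exp_ge_add_one_self)
    finally show ?thesis using b by (simp add: exp_minus field_simps)
  qed
  also have "\<dots> = y" using assms by (simp add: b_def)
  finally have "Gt b \<le> y" .
  moreover have "isCont Gt x" for x unfolding Gt_def[abs_def] by (intro continuous_intros isCont_o2[OF _ isCont_Phi])
  ultimately have "\<exists>x. 0 \<le> x \<and> x \<le> b \<and> Gt x = y"
    using assms b by (intro IVT2) (auto simp: Gt_0)
  thus ?thesis by auto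
qed

definition Ginv :: "real \<Rightarrow> real" where "Ginv y = (SOME x. 0 \<le> x \<and> Gt x = y)"

lemma Ginv: assumes "0 < y" "y \<le> 1" shows "0 \<le> Ginv y" "Gt (Ginv y) = y"
  using someI_ex[of "\<lambda>x. 0 \<le> x \<and> Gt x = y"] Gt_inverse[OF assms] unfolding Ginv_def by auto

context linear_stats
begin

lemma Zc_meas [measurable]: "Zc h \<in> borel_measurable M"
proof -
  have "Zc h = (\<lambda>om. \<Sum>e\<in>E. if h \<le> \<bar>W e om\<bar> then 1 else 0)"
    unfolding Zc_def[abs_def] using finE by (simp add: sum.inter_filter[symmetric])
  also have "\<dots> \<in> borel_measurable M" by (intro borel_measurable_sum) measurable
  finally show ?thesis .
qed

lemma uniform_count:
  assumes r: "0 \<le> r" "\<And>e e'. e \<in> E \<Longrightarrow> e' \<in> E \<Longrightarrow> e \<noteq> e' \<Longrightarrow> R e e' \<le> r"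
    and m: "\<And>e. e \<in> E \<Longrightarrow> real (card {e' \<in> E. e' \<noteq> e \<and> \<rho>0 < R e e'}) \<le> m"
    and E: "E \<noteq> {}" and eta: "0 < \<eta>" "\<eta> < 1"
    and t: "0 \<le> t" "2 * Gt (H - 1) \<le> Gt t"
    and b: "\<And>h. 0 \<le> h \<Longrightarrow> Gt t \<le> 2 * Gt h \<Longrightarrow>
       m * (4 * exp (- (h\<^sup>2 / (1 + r)) * (1 - 2 * H * bd))) / (real (card E) * (Gt h)\<^sup>2) \<le> b"
  shows "\<exists>D\<in>events. prob D \<le> (2 / (real (card E) * Gt t) * (4 / \<eta>) + (ln (1 / Gt t) / ln (1 + \<eta>) + 2) * (6 * g + b)) / \<eta>\<^sup>2
     \<and> (\<forall>om\<in>space M - D. \<forall>h. 0 \<le> h \<and> h \<le> t \<longrightarrow>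
          (1 - \<eta>) / (1 + \<eta>) * (real (card E) * Gt h) \<le> Zc h om \<and> Zc h om \<le> (1 + \<eta>)\<^sup>2 * (real (card E) * Gt h))"
proof -
  define q where "q = real (card E)"
  have q: "0 < q" unfolding q_def using E finE by (simp add: card_gt_0_iff)
  define a where "a = 1 + \<eta>"
  have a: "1 < a" "0 < a" "a \<le> 2" using eta by (auto simp: a_def)
  define x where "x j = Ginv (1 / a ^ j)" for j :: nat
  have x: "0 \<le> x j" "Gt (x j) = 1 / a ^ j" for j
    unfolding x_def using Ginv[of "1 / a ^ j"] a by (auto simp: one_le_power divide_le_eq)
  define J where "J = (LEAST j. 1 / a ^ j \<le> Gt t)"
  have "\<exists>j. 1 / Gt t < a ^ j" using real_arch_pow[OF a(1)] by blast
  then obtain j0 where "1 / Gt t < a ^ j0" by blast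
  hence "1 / a ^ j0 \<le> Gt t" using a Gt_pos[of t] by (simp add: field_simps)
  hence J: "1 / a ^ J \<le> Gt t" unfolding J_def by (rule LeastI)
  have J2: "a ^ J * Gt t \<le> a"
  proof (cases J)
    case 0
    have "Gt t \<le> 1" using Gt_mono[OF t(1)] Gt_0 by simp
    thus ?thesis using 0 a by simp
  next
    case (Suc n)
    hence "\<not> 1 / a ^ n \<le> Gt t" unfolding J_def using not_less_Least[of n] by (metis J_def lessI)
    hence "Gt t * a ^ n \<le> 1" using a by (simp add: field_simps)
    from mult_left_mono[OF this, of a] show ?thesis using Suc a by (simp add: mult_ac)
  qed
  have GxJ: "Gt t \<le> 2 * Gt (x j)" if "j \<le> J" for j
  proof -
    have "a ^ j * Gt t \<le> a ^ J * Gt t" using that a Gt_pos[of t] by (intro mult_right_mono power_increasing) auto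
    hence "a ^ j * Gt t \<le> 2" using J2 a by linarith
    thus ?thesis unfolding x(2) using a by (simp add: pos_le_divide_eq mult.commute)
  qed
  have xH: "x j \<le> H - 1" if "j \<le> J" for j
    using GxJ[OF that] t(2) Gt_le_iff[of "H - 1" "x j"] by linarith
  define D where "D j = {om \<in> space M. \<eta> * (q * Gt (x j)) < \<bar>Zc (x j) om - q * Gt (x j)\<bar>}" for j
  have Dm [measurable]: "D j \<in> events" for j unfolding D_def by measurable
  have pD: "prob (D j) \<le> (2 / q * a ^ j + (6 * g + b)) / \<eta>\<^sup>2" if j: "j \<le> J" for j
  proof -
    have "prob (D j) \<le> (2 / (q * Gt (x j)) + 6 * g + m * (4 * exp (- ((x j)\<^sup>2 / (1 + r)) * (1 - 2 * H * bd))) / (q * (Gt (x j))\<^sup>2)) / \<eta>\<^sup>2"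
      using count_deviation[OF r m x(1) xH[OF j] E eta(1)] unfolding D_def q_def Gt_def .
    also have "\<dots> \<le> (2 / q * a ^ j + (6 * g + b)) / \<eta>\<^sup>2"
    proof (intro divide_right_mono)
      have "2 / (q * Gt (x j)) = 2 / q * a ^ j" using x a q by simp
      thus "2 / (q * Gt (x j)) + 6 * g + m * (4 * exp (- ((x j)\<^sup>2 / (1 + r)) * (1 - 2 * H * bd))) / (q * (Gt (x j))\<^sup>2)
         \<le> 2 / q * a ^ j + (6 * g + b)"
        using b[OF x(1) GxJ[OF j]] unfolding q_def by simp
    qed simp
    finally show ?thesis .
  qed
  have m0: "0 \<le> m" using m E by (metis equals0I of_nat_0_le_iff order_trans)
  have b0: "0 \<le> b"
  proof -
    have "0 \<le> m * (4 * exp (- (0\<^sup>2 / (1 + r)) * (1 - 2 * H * bd))) / (real (card E) * (Gt 0)\<^sup>2)"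
      using m0 by (intro divide_nonneg_nonneg mult_nonneg_nonneg) auto
    also have "\<dots> \<le> b" using Gt_mono[OF t(1)] Gt_pos[of t] by (intro b) (auto simp: Gt_0)
    finally show ?thesis .
  qed
  define DD where "DD = (\<Union>j\<in>{..J}. D j)"
  have "prob DD \<le> (\<Sum>j\<le>J. prob (D j))" unfolding DD_def
    by (intro finite_measure_subadditive_finite) auto
  also have "\<dots> \<le> (\<Sum>j\<le>J. (2 / q * a ^ j + (6 * g + b)) / \<eta>\<^sup>2)" using pD by (intro sum_mono) auto
  also have "\<dots> = (2 / q * (\<Sum>j\<le>J. a ^ j) + real (J + 1) * (6 * g + b)) / \<eta>\<^sup>2"
    by (simp add: sum_divide_distrib[symmetric] sum.distrib sum_distrib_left[symmetric])
  also have "\<dots> \<le> (2 / (q * Gt t) * (4 / \<eta>) + (ln (1 / Gt t) / ln (1 + \<eta>) + 2) * (6 * g + b)) / \<eta>\<^sup>2"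
  proof (intro divide_right_mono add_mono mult_right_mono)
    have "(\<Sum>j\<le>J. a ^ j) = (a ^ Suc J - 1) / \<eta>" using a geometric_sum[of a "Suc J"] by (simp add: a_def lessThan_Suc_atMost)
    also have "\<dots> \<le> a ^ Suc J / \<eta>" using eta by (intro divide_right_mono) auto
    also have "a ^ Suc J \<le> 4 / Gt t"
    proof -
      have "a * (a ^ J * Gt t) \<le> 2 * 2" using J2 a Gt_pos[of t] by (intro mult_mono) auto
      thus ?thesis using Gt_pos[of t] by (simp add: field_simps)
    qed
    hence "a ^ Suc J / \<eta> \<le> 4 / Gt t / \<eta>" using eta by (intro divide_right_mono) auto
    finally have "(\<Sum>j\<le>J. a ^ j) \<le> 4 / Gt t / \<eta>" .
    hence "2 / q * (\<Sum>j\<le>J. a ^ j) \<le> 2 / q * (4 / Gt t / \<eta>)" using q by (intro mult_left_mono) auto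
    thus "2 / q * (\<Sum>j\<le>J. a ^ j) \<le> 2 / (q * Gt t) * (4 / \<eta>)" by (simp add: field_simps)
    have "a ^ J \<le> a / Gt t" using J2 Gt_pos[of t] by (simp add: field_simps)
    hence "ln (a ^ J) \<le> ln (a / Gt t)" using a Gt_pos[of t] by (subst ln_le_cancel_iff) auto
    hence "real J * ln a \<le> ln a + ln (1 / Gt t)" using a Gt_pos[of t] by (simp add: ln_realpow ln_div)
    hence "real J \<le> (ln a + ln (1 / Gt t)) / ln a" using a by (simp add: pos_le_divide_eq)
    also have "\<dots> = 1 + ln (1 / Gt t) / ln a" using a by (simp add: add_divide_distrib)
    finally show "real (J + 1) \<le> ln (1 / Gt t) / ln (1 + \<eta>) + 2" by (simp add: a_def)
  qed (use b0 g_nonneg in auto)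
  finally have pDD: "prob DD \<le> (2 / (q * Gt t) * (4 / \<eta>) + (ln (1 / Gt t) / ln (1 + \<eta>) + 2) * (6 * g + b)) / \<eta>\<^sup>2" .
  have good: "(1 - \<eta>) / a * (q * Gt h) \<le> Zc h om \<and> Zc h om \<le> a\<^sup>2 * (q * Gt h)"
    if w: "om \<in> space M - DD" and h: "0 \<le> h" "h \<le> t" for om h
  proof -
    have ok: "\<bar>Zc (x j) om - q * Gt (x j)\<bar> \<le> \<eta> * (q * Gt (x j))" if "j \<le> J" for j
      using w that unfolding DD_def D_def by force
    define k where "k = (LEAST j. 1 / a ^ j \<le> Gt h)"
    have Jh: "1 / a ^ J \<le> Gt h" using J Gt_mono[OF h(2)] by linarith
    hence k1: "1 / a ^ k \<le> Gt h" unfolding k_def by (rule LeastI)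
    have kJ: "k \<le> J" unfolding k_def using Jh by (rule Least_le)
    have hx: "h \<le> x k" using k1 x Gt_le_iff[of "x k" h] by simp
    have lower: "(1 - \<eta>) / a * (q * Gt h) \<le> Zc h om"
    proof (cases k)
      case 0
      hence "x k = 0" using x[of 0] Gt_0 Gt_le_iff[of 0 "x 0"] by (simp add: order_antisym)
      hence h0: "h = 0" using hx h by simp
      have "(1 - \<eta>) * (q * Gt h) \<le> Zc h om" using ok[OF kJ] \<open>x k = 0\<close> h0 by (simp add: abs_le_iff algebra_simps)
      moreover have "(1 - \<eta>) / a * (q * Gt h) \<le> (1 - \<eta>) / 1 * (q * Gt h)"
        using a eta q Gt_pos[of h] by (intro mult_right_mono divide_left_mono) auto
      ultimately show ?thesis by simp
    next
      case (Suc n)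
      hence "\<not> 1 / a ^ n \<le> Gt h" unfolding k_def using not_less_Least[of n] by (metis k_def lessI)
      hence "Gt h * a ^ n \<le> 1" using a by (simp add: field_simps)
      hence "Gt h / a \<le> 1 / a ^ k" using Suc a by (simp add: field_simps)
      hence gh: "Gt h / a \<le> Gt (x k)" using x by simp
      have "(1 - \<eta>) / a * (q * Gt h) = (1 - \<eta>) * q * (Gt h / a)" by simp
      also have "\<dots> \<le> (1 - \<eta>) * q * Gt (x k)" using gh eta q by (intro mult_left_mono) auto
      also have "\<dots> \<le> Zc (x k) om" using ok[OF kJ] by (simp add: abs_le_iff algebra_simps)
      also have "\<dots> \<le> Zc h om" by (rule Zc_antimono[OF hx])
      finally show ?thesis .
    qed
    have upper: "Zc h om \<le> a\<^sup>2 * (q * Gt h)"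
    proof (cases k)
      case 0
      hence "x k = 0" using x[of 0] Gt_0 Gt_le_iff[of 0 "x 0"] by (simp add: order_antisym)
      hence h0: "h = 0" using hx h by simp
      have "Zc h om \<le> a * (q * Gt h)" using ok[OF kJ] \<open>x k = 0\<close> h0 by (simp add: abs_le_iff a_def algebra_simps)
      also have "\<dots> \<le> a\<^sup>2 * (q * Gt h)" using a q Gt_pos[of h]
        by (intro mult_right_mono) (auto simp: power2_eq_square)
      finally show ?thesis .
    next
      case (Suc n)
      hence n: "\<not> 1 / a ^ n \<le> Gt h" unfolding k_def using not_less_Least[of n] by (metis k_def lessI)
      hence "x n \<le> h" using x[of n] Gt_le_iff[of h "x n"] by simp
      hence "Zc h om \<le> Zc (x n) om" by (rule Zc_antimono)
      also have "\<dots> \<le> a * (q * Gt (x n))" using ok[of n] kJ Suc by (simp add: abs_le_iff a_def algebra_simps)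
      also have "Gt (x n) = a * (1 / a ^ k)" using x Suc a by simp
      also have "a * (q * (a * (1 / a ^ k))) \<le> a * (q * (a * Gt h))" using k1 a q by (intro mult_left_mono) auto
      finally show ?thesis by (simp add: power2_eq_square mult_ac)
    qed
    show ?thesis using lower upper by simp
  qed
  have "DD \<in> events" unfolding DD_def by auto
  thus ?thesis using pDD good unfolding q_def a_def by blast
qed

end

lemma finite_pairs: "finite (pairs p)"
  by (rule finite_subset[of _ "{1..p} \<times> {1..p}"]) (auto simp: pairs_def)

lemma card_pairs: "card (pairs p) = qnum p"
proof -
  have "2 * card (pairs p) = p * (p - 1)"
  proof (induction p)
    case 0
    have "pairs 0 = {}" by (auto simp: pairs_def)
    thus ?case by simp
  next
    case (Suc p)
    have "pairs (Suc p) = pairs p \<union> (\<lambda>i. (i, Suc p)) ` {1..p}" by (auto simp: pairs_def)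
    moreover have "pairs p \<inter> (\<lambda>i. (i, Suc p)) ` {1..p} = {}" by (auto simp: pairs_def)
    ultimately have "card (pairs (Suc p)) = card (pairs p) + p"
      by (simp add: card_Un_disjoint finite_pairs card_image inj_on_def)
    thus ?case using Suc by (cases p) auto
  qed
  thus ?thesis unfolding qnum_def by simp
qed

lemma Rcnt_antimono: "finite E \<Longrightarrow> h \<le> h' \<Longrightarrow> Rcnt E T h' \<le> Rcnt E T h"
  unfolding Rcnt_def by (intro card_mono) auto

lemma Rcnt_le: "finite E \<Longrightarrow> Rcnt E T h \<le> card E"
  unfolding Rcnt_def by (intro card_mono) auto

lemma Min_insert_absorb:
  "finite A \<Longrightarrow> A \<noteq> {} \<Longrightarrow> Min A \<le> c \<Longrightarrow> Min (insert c A) = Min A"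
  by (rule Min_eqI) (auto intro: order_trans)

definition thr :: "nat \<Rightarrow> real \<Rightarrow> nat \<Rightarrow> real" where
  "thr p \<alpha> m = Ginv (\<alpha> * max (real m) 1 / real (qnum p))"

context
  fixes p :: nat and \<alpha> :: real
  assumes q: "1 \<le> qnum p" and al: "0 < \<alpha>" "\<alpha> < 1"
begin

lemma thr: assumes "m \<le> qnum p"
  shows "0 \<le> thr p \<alpha> m" "real (qnum p) * Gt (thr p \<alpha> m) = \<alpha> * max (real m) 1"
proof -
  have "\<alpha> * max (real m) 1 \<le> 1 * real (qnum p)" using assms q al by (intro mult_mono) auto
  hence *: "0 < \<alpha> * max (real m) 1 / real (qnum p)" "\<alpha> * max (real m) 1 / real (qnum p) \<le> 1"
    using al q by (auto simp: divide_le_eq)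
  show "0 \<le> thr p \<alpha> m" "real (qnum p) * Gt (thr p \<alpha> m) = \<alpha> * max (real m) 1"
    unfolding thr_def using Ginv[OF *] q by auto
qed

definition cand :: "(nat \<times> nat \<Rightarrow> real) \<Rightarrow> real set" where
  "cand T = {h. \<exists>m\<le>qnum p. h = thr p \<alpha> m \<and> m \<le> Rcnt (pairs p) T h \<and> h \<le> sqrt (2 * ln (real (qnum p)))}"

definition Bset :: "(nat \<times> nat \<Rightarrow> real) \<Rightarrow> real set" where
  "Bset T = {h. 0 \<le> h \<and> h \<le> sqrt (2 * ln (real (qnum p))) \<and> FDPhat p T h \<le> \<alpha>}"

lemma FDPhat_le_iff: "FDPhat p T h \<le> \<alpha> \<longleftrightarrow> real (qnum p) * Gt h \<le> \<alpha> * max (real (Rcnt (pairs p) T h)) 1"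
proof -
  have "FDPhat p T h = real (qnum p) * Gt h / max (real (Rcnt (pairs p) T h)) 1"
    unfolding FDPhat_def Gt_def by (simp add: Phi_minus)
  moreover have "0 < max (real (Rcnt (pairs p) T h)) 1" by simp
  ultimately show ?thesis by (simp add: pos_divide_le_eq)
qed

lemma finite_cand: "finite (cand T)"
  by (rule finite_subset[of _ "thr p \<alpha> ` {..qnum p}"]) (auto simp: cand_def)

lemma cand_subset: "cand T \<subseteq> Bset T"
proof
  fix h assume "h \<in> cand T"
  then obtain m where m: "m \<le> qnum p" "h = thr p \<alpha> m" "m \<le> Rcnt (pairs p) T h" "h \<le> sqrt (2 * ln (real (qnum p)))"
    by (auto simp: cand_def)
  have "real (qnum p) * Gt h = \<alpha> * max (real m) 1" using thr(2)[OF m(1)] m(2) by simp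
  also have "\<dots> \<le> \<alpha> * max (real (Rcnt (pairs p) T h)) 1" using m(3) al by (intro mult_left_mono) auto
  finally show "h \<in> Bset T" using m thr(1)[OF m(1)] by (simp add: Bset_def FDPhat_le_iff)
qed

lemma Bset_cand: assumes "h \<in> Bset T" shows "\<exists>h'\<in>cand T. h' \<le> h \<and> thr p \<alpha> (Rcnt (pairs p) T h) = h'"
proof -
  define m where "m = Rcnt (pairs p) T h"
  have m: "m \<le> qnum p" unfolding m_def using Rcnt_le[OF finite_pairs] card_pairs by metis
  have "real (qnum p) * Gt h \<le> real (qnum p) * Gt (thr p \<alpha> m)"
    using assms thr(2)[OF m] unfolding Bset_def FDPhat_le_iff m_def by simp
  hence "Gt h \<le> Gt (thr p \<alpha> m)" using q by simp
  hence le: "thr p \<alpha> m \<le> h" by (simp add: Gt_le_iff)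
  have "m \<le> Rcnt (pairs p) T (thr p \<alpha> m)" unfolding m_def
    by (rule Rcnt_antimono[OF finite_pairs]) (use le m_def in simp)
  hence "thr p \<alpha> m \<in> cand T" using m le assms by (auto simp: cand_def Bset_def)
  thus ?thesis using le m_def by auto
qed

lemma hhat_eq: "hhat p \<alpha> T = Min (insert (sqrt (2 * ln (real (qnum p)))) (cand T))"
proof (cases "Bset T = {}")
  case True
  hence "cand T = {}" using cand_subset by auto
  thus ?thesis using True unfolding hhat_def Let_def Bset_def[symmetric] by simp
next
  case False
  hence c: "cand T \<noteq> {}" using Bset_cand by blast
  have "Inf (Bset T) = Min (cand T)"
  proof (rule cInf_eq_minimum)
    show "Min (cand T) \<in> Bset T" using Min_in[OF finite_cand c] cand_subset by auto
    fix h assume "h \<in> Bset T"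
    then obtain h' where "h' \<in> cand T" "h' \<le> h" using Bset_cand by blast
    thus "Min (cand T) \<le> h" using Min_le[OF finite_cand] order_trans by blast
  qed
  moreover have "Min (insert (sqrt (2 * ln (real (qnum p)))) (cand T)) = Min (cand T)"
  proof -
    have "Min (cand T) \<le> sqrt (2 * ln (real (qnum p)))"
      using Min_in[OF finite_cand c] by (auto simp: cand_def)
    thus ?thesis by (rule Min_insert_absorb[OF finite_cand c])
  qed
  ultimately show ?thesis using False unfolding hhat_def Let_def Bset_def[symmetric] by simp
qed

lemma hhat_identity:
  assumes "Bset T \<noteq> {}"
  shows "0 \<le> hhat p \<alpha> T" "hhat p \<alpha> T \<le> sqrt (2 * ln (real (qnum p)))"
    "real (qnum p) * Gt (hhat p \<alpha> T) = \<alpha> * max (real (Rcnt (pairs p) T (hhat p \<alpha> T))) 1"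
proof -
  have c: "cand T \<noteq> {}" using assms Bset_cand by blast
  define h where "h = Min (cand T)"
  have hc: "h \<in> cand T" unfolding h_def by (rule Min_in[OF finite_cand c])
  then obtain m where m: "m \<le> qnum p" "h = thr p \<alpha> m" "m \<le> Rcnt (pairs p) T h" "h \<le> sqrt (2 * ln (real (qnum p)))"
    by (auto simp: cand_def)
  have hh: "hhat p \<alpha> T = h" unfolding hhat_eq h_def by (rule Min_insert_absorb[OF finite_cand c]) (use m(4) h_def in simp)
  show "0 \<le> hhat p \<alpha> T" "hhat p \<alpha> T \<le> sqrt (2 * ln (real (qnum p)))" using hh m thr(1) by auto
  obtain h' where h': "h' \<in> cand T" "h' \<le> h" "thr p \<alpha> (Rcnt (pairs p) T h) = h'"
    using Bset_cand[of h T] hc cand_subset by blast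
  have "h' = h" using h' Min_le[OF finite_cand h'(1)] by (simp add: h_def)
  moreover have "Rcnt (pairs p) T h \<le> qnum p" using Rcnt_le[OF finite_pairs] card_pairs by metis
  ultimately show "real (qnum p) * Gt (hhat p \<alpha> T) = \<alpha> * max (real (Rcnt (pairs p) T (hhat p \<alpha> T))) 1"
    unfolding hh using thr(2) h'(3) by metis
qed

lemma Rcnt_measurable:
  assumes "finite E" "\<And>e. e \<in> E \<Longrightarrow> (\<lambda>om. T om e) \<in> borel_measurable M" "h \<in> borel_measurable M"
  shows "(\<lambda>om. real (Rcnt E (T om) (h om))) \<in> borel_measurable M"
proof -
  have "(\<lambda>om. real (Rcnt E (T om) (h om))) = (\<lambda>om. \<Sum>e\<in>E. if h om \<le> \<bar>T om e\<bar> then 1 else 0)"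
    unfolding Rcnt_def using assms(1) by (simp add: sum.inter_filter[symmetric])
  also have "\<dots> \<in> borel_measurable M"
  proof (rule borel_measurable_sum)
    fix e assume "e \<in> E"
    note [measurable] = assms(2)[OF this] assms(3)
    show "(\<lambda>om. if h om \<le> \<bar>T om e\<bar> then 1 else 0::real) \<in> borel_measurable M" by measurable
  qed
  finally show ?thesis .
qed

lemma hhat_measurable:
  assumes T: "\<And>e. e \<in> pairs p \<Longrightarrow> (\<lambda>om. T om e) \<in> borel_measurable M"
  shows "(\<lambda>om. hhat p \<alpha> (T om)) \<in> borel_measurable M"
proof -
  define cap where "cap = sqrt (2 * ln (real (qnum p)))"
  define f where "f m om = (if real m \<le> real (Rcnt (pairs p) (T om) (thr p \<alpha> m)) \<and> thr p \<alpha> m \<le> cap then thr p \<alpha> m else cap)" for m om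
  have "hhat p \<alpha> (T om) = Min ((\<lambda>m. f m om) ` {..qnum p})" for om
  proof -
    have "Min (insert cap (cand (T om))) = Min ((\<lambda>m. f m om) ` {..qnum p})"
    proof (rule antisym)
      show "Min (insert cap (cand (T om))) \<le> Min ((\<lambda>m. f m om) ` {..qnum p})"
        using finite_cand[of "T om"] by (intro Min.boundedI) (auto simp: f_def cand_def cap_def intro!: Min_le)
      show "Min ((\<lambda>m. f m om) ` {..qnum p}) \<le> Min (insert cap (cand (T om)))"
      proof (rule Min.boundedI)
        fix a assume "a \<in> insert cap (cand (T om))"
        then consider "a = cap" | "a \<in> cand (T om)" by blast
        thus "Min ((\<lambda>m. f m om) ` {..qnum p}) \<le> a"
        proof cases
          case 1
          have "Min ((\<lambda>m. f m om) ` {..qnum p}) \<le> f 0 om" by (intro Min_le) auto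
          also have "\<dots> \<le> cap" by (simp add: f_def)
          finally show ?thesis using 1 by simp
        next
          case 2
          then obtain m where "m \<le> qnum p" "a = thr p \<alpha> m" "m \<le> Rcnt (pairs p) (T om) a" "a \<le> cap"
            by (auto simp: cand_def cap_def)
          hence "a = f m om" by (simp add: f_def)
          thus ?thesis using \<open>m \<le> qnum p\<close> by (intro Min_le) auto
        qed
      qed (use finite_cand in auto)
    qed
    thus ?thesis unfolding hhat_eq cap_def by simp
  qed
  moreover have "(\<lambda>om. Min ((\<lambda>m. f m om) ` {..qnum p})) \<in> borel_measurable M"
  proof (intro borel_measurable_Min)
    fix m
    have [measurable]: "(\<lambda>om. real (Rcnt (pairs p) (T om) (thr p \<alpha> m))) \<in> borel_measurable M"
      by (intro Rcnt_measurable finite_pairs T) auto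
    show "f m \<in> borel_measurable M" unfolding f_def by measurable
  qed auto
  ultimately show ?thesis by simp
qed

lemma FDP_measurable:
  assumes T: "\<And>e. e \<in> pairs p \<Longrightarrow> (\<lambda>om. T om e) \<in> borel_measurable M" and N: "N \<subseteq> pairs p"
  shows "(\<lambda>om. FDP p N \<alpha> (T om)) \<in> borel_measurable M"
proof -
  note [measurable] = hhat_measurable[OF T]
  have [measurable]: "(\<lambda>om. real (Rcnt N (T om) (hhat p \<alpha> (T om)))) \<in> borel_measurable M"
    using N T finite_subset[OF N finite_pairs] by (intro Rcnt_measurable hhat_measurable) auto
  have [measurable]: "(\<lambda>om. real (Rcnt (pairs p) (T om) (hhat p \<alpha> (T om)))) \<in> borel_measurable M"
    using T by (intro Rcnt_measurable hhat_measurable finite_pairs) auto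
  show ?thesis unfolding FDP_def by measurable
qed

end

lemma FDP_bounds: "0 \<le> FDP p N \<alpha> T" "N \<subseteq> pairs p \<Longrightarrow> FDP p N \<alpha> T \<le> 1"
proof -
  show "0 \<le> FDP p N \<alpha> T" unfolding FDP_def by simp
  assume N: "N \<subseteq> pairs p"
  have "Rcnt N T (hhat p \<alpha> T) \<le> Rcnt (pairs p) T (hhat p \<alpha> T)"
    unfolding Rcnt_def using N finite_pairs[of p] by (intro card_mono) auto
  thus "FDP p N \<alpha> T \<le> 1" unfolding FDP_def by (simp add: pos_divide_le_eq less_max_iff_disj le_max_iff_disj)
qed

section \<open>Truncation of the observations\<close>

definition Zst :: "'a measure \<Rightarrow> (nat \<Rightarrow> nat \<Rightarrow> 'a \<Rightarrow> nat \<Rightarrow> nat \<Rightarrow> real) \<Rightarrow> nat \<Rightarrow> nat \<Rightarrow> nat \<times> nat \<Rightarrow> 'a \<Rightarrow> real" where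
  "Zst M X d l e om = (X d l om (fst e) (snd e) - smean M X d e) / sqrt (svar M X d e)"

definition trc :: "real \<Rightarrow> real \<Rightarrow> real" where
  "trc b z = (if \<bar>z\<bar> \<le> b then z else 0)"

definition mut :: "'a measure \<Rightarrow> (nat \<Rightarrow> nat \<Rightarrow> 'a \<Rightarrow> nat \<Rightarrow> nat \<Rightarrow> real) \<Rightarrow> real \<Rightarrow> nat \<Rightarrow> nat \<times> nat \<Rightarrow> real" where
  "mut M X b d e = (\<integral>om. trc b (Zst M X d 1 e om) \<partial>M)"

definition Yst :: "'a measure \<Rightarrow> (nat \<Rightarrow> nat \<Rightarrow> 'a \<Rightarrow> nat \<Rightarrow> nat \<Rightarrow> real) \<Rightarrow> real \<Rightarrow> nat \<Rightarrow> nat \<Rightarrow> nat \<times> nat \<Rightarrow> 'a \<Rightarrow> real" where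
  "Yst M X b d l e om = trc b (Zst M X d l e om) - mut M X b d e"

definition tau2 :: "'a measure \<Rightarrow> (nat \<Rightarrow> nat \<Rightarrow> 'a \<Rightarrow> nat \<Rightarrow> nat \<Rightarrow> real) \<Rightarrow> real \<Rightarrow> nat \<Rightarrow> nat \<times> nat \<Rightarrow> real" where
  "tau2 M X b d e = (\<integral>om. (Yst M X b d 1 e om)\<^sup>2 \<partial>M)"

lemma trc_measurable [measurable]: "trc b \<in> borel_measurable borel"
  unfolding trc_def[abs_def] by measurable

lemma trc_bound: "0 \<le> b \<Longrightarrow> \<bar>trc b z\<bar> \<le> b" "\<bar>trc b z\<bar> \<le> \<bar>z\<bar>" "(trc b z)\<^sup>2 \<le> z\<^sup>2"
  by (auto simp: trc_def)

lemma (in prob_space) indep_vars_reindex: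
  assumes ind: "indep_vars M' X I" and f: "inj_on f L" "f ` L \<subseteq> I"
  shows "indep_vars (\<lambda>j. M' (f j)) (\<lambda>j. X (f j)) L"
proof -
  have "indep_vars (\<lambda>j. PiM {f j} M') (\<lambda>j om. restrict (\<lambda>i. X i om) {f j}) L"
    using f by (intro indep_vars_restrict[OF ind]) (auto simp: disjoint_family_on_def inj_on_def)
  hence "indep_vars (\<lambda>j. M' (f j)) (\<lambda>j om. (\<lambda>h. h (f j)) (restrict (\<lambda>i. X i om) {f j})) L"
    by (rule indep_vars_compose2) auto
  thus ?thesis by simp
qed

locale two_sample = prob_space +
  fixes X :: "nat \<Rightarrow> nat \<Rightarrow> 'a \<Rightarrow> nat \<Rightarrow> nat \<Rightarrow> real" and p n1 n2 :: nat
  assumes indep: "indep_vars (\<lambda>_. mat_space p) (\<lambda>(d, l). mat_rv p X d l) (obs_index n1 n2)"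
    and ident: "\<And>d l. (d, l) \<in> obs_index n1 n2 \<Longrightarrow>
        distr M (mat_space p) (mat_rv p X d l) = distr M (mat_space p) (mat_rv p X d 1)"
    and moments: "\<And>d e. d \<in> {1, 2} \<Longrightarrow> e \<in> pairs p \<Longrightarrow>
        integrable M (\<lambda>om. (X d 1 om (fst e) (snd e))\<^sup>2) \<and> svar M X d e > 0"
    and n_pos: "1 \<le> n1" "1 \<le> n2"
begin

abbreviation obs :: "(nat \<times> nat) set" where "obs \<equiv> obs_index n1 n2"
abbreviation nn :: "nat \<Rightarrow> nat" where "nn \<equiv> nsize n1 n2"

lemma obs_iff: "(d, l) \<in> obs \<longleftrightarrow> d \<in> {1, 2} \<and> 1 \<le> l \<and> l \<le> nn d"
  by (auto simp: obs_index_def nsize_def)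

lemma nn_pos: "1 \<le> nn d" using n_pos by (simp add: nsize_def)

lemma obs_1: "d \<in> {1, 2} \<Longrightarrow> (d, 1) \<in> obs" using nn_pos by (simp add: obs_iff)

lemma mat_rv_meas [measurable]: "(d, l) \<in> obs \<Longrightarrow> mat_rv p X d l \<in> measurable M (mat_space p)"
  using indep unfolding indep_vars_def by force

lemma pairs_grid: "e \<in> pairs p \<Longrightarrow> e \<in> {1..p} \<times> {1..p}"
  by (auto simp: pairs_def)

lemma mat_rv_apply: "e \<in> pairs p \<Longrightarrow> mat_rv p X d l om e = X d l om (fst e) (snd e)"
  using pairs_grid[of e] by (simp add: mat_rv_def)

lemma comp_meas: "e \<in> pairs p \<Longrightarrow> (\<lambda>f. f e) \<in> borel_measurable (mat_space p)"
  unfolding mat_space_def using pairs_grid by (intro measurable_component_singleton) auto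

definition zf :: "nat \<Rightarrow> nat \<times> nat \<Rightarrow> (nat \<times> nat \<Rightarrow> real) \<Rightarrow> real" where
  "zf d e f = (f e - smean M X d e) / sqrt (svar M X d e)"

lemma zf_meas [measurable]: "e \<in> pairs p \<Longrightarrow> zf d e \<in> borel_measurable (mat_space p)"
  unfolding zf_def[abs_def] using comp_meas[of e] by measurable

lemma Zst_eq: "e \<in> pairs p \<Longrightarrow> Zst M X d l e om = zf d e (mat_rv p X d l om)"
  unfolding Zst_def zf_def by (simp add: mat_rv_apply)

lemma Zst_meas: "e \<in> pairs p \<Longrightarrow> (d, l) \<in> obs \<Longrightarrow> Zst M X d l e \<in> borel_measurable M"
  using measurable_compose[OF mat_rv_meas zf_meas, of d l e d] by (subst measurable_cong[OF Zst_eq]) auto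

lemma X_meas: "e \<in> pairs p \<Longrightarrow> (d, l) \<in> obs \<Longrightarrow> (\<lambda>om. X d l om (fst e) (snd e)) \<in> borel_measurable M"
  using measurable_compose[OF mat_rv_meas comp_meas, of d l e] by (simp add: mat_rv_apply)

lemma transfer:
  assumes "(d, l) \<in> obs" and g: "g \<in> borel_measurable (mat_space p)"
  shows "expectation (\<lambda>om. g (mat_rv p X d l om)) = expectation (\<lambda>om. g (mat_rv p X d 1 om) :: real)"
proof -
  have d: "(d, 1) \<in> obs" using assms obs_1 by (simp add: obs_iff)
  have "expectation (\<lambda>om. g (mat_rv p X d l om)) = integral\<^sup>L (distr M (mat_space p) (mat_rv p X d l)) g"
    using assms by (intro integral_distr[symmetric]) auto
  also have "\<dots> = integral\<^sup>L (distr M (mat_space p) (mat_rv p X d 1)) g" using ident[OF assms(1)] by simp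
  also have "\<dots> = expectation (\<lambda>om. g (mat_rv p X d 1 om))" using d g by (intro integral_distr) auto
  finally show ?thesis .
qed

lemma Z_moments:
  assumes "d \<in> {1, 2}" "e \<in> pairs p"
  shows "integrable M (Zst M X d 1 e)" "integrable M (\<lambda>om. (Zst M X d 1 e om)\<^sup>2)"
    "expectation (Zst M X d 1 e) = 0" "expectation (\<lambda>om. (Zst M X d 1 e om)\<^sup>2) = 1"
proof -
  define x where "x om = X d 1 om (fst e) (snd e)" for om
  define s where "s = smean M X d e"
  define v where "v = svar M X d e"
  have v: "0 < v" and ix2: "integrable M (\<lambda>om. (x om)\<^sup>2)" using moments[OF assms] by (auto simp: v_def x_def)
  have [measurable]: "x \<in> borel_measurable M" unfolding x_def[abs_def] using X_meas[OF assms(2) obs_1[OF assms(1)]] .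
  have ix: "integrable M x"
  proof (rule Bochner_Integration.integrable_bound)
    show "integrable M (\<lambda>om. 1 + (x om)\<^sup>2)" using ix2 by simp
    have "\<bar>y\<bar> \<le> 1 + y\<^sup>2" for y :: real using zero_le_power2[of "\<bar>y\<bar> - 1"] by (simp add: power2_eq_square algebra_simps)
    thus "AE om in M. norm (x om) \<le> norm (1 + (x om)\<^sup>2)" by simp
  qed simp
  have s: "s = expectation x" unfolding s_def smean_def mean_def x_def[abs_def] by simp
  have ic: "integrable M (\<lambda>om. (x om - s)\<^sup>2)" unfolding power2_diff using ix ix2 by simp
  have vv: "v = expectation (\<lambda>om. (x om - s)\<^sup>2)"
    unfolding v_def svar_def var_def s_def smean_def x_def[abs_def] by simp
  have Z: "Zst M X d 1 e = (\<lambda>om. (x om - s) / sqrt v)" unfolding Zst_def x_def s_def v_def by (simp add: fun_eq_iff)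
  have Z2: "(Zst M X d 1 e om)\<^sup>2 = (x om - s)\<^sup>2 / v" for om unfolding Z using v by (simp add: power_divide)
  show "integrable M (Zst M X d 1 e)" unfolding Z using ix by simp
  show "integrable M (\<lambda>om. (Zst M X d 1 e om)\<^sup>2)" unfolding Z2 using ic by simp
  show "expectation (Zst M X d 1 e) = 0" unfolding Z using ix s by (simp add: prob_space)
  show "expectation (\<lambda>om. (Zst M X d 1 e om)\<^sup>2) = 1" unfolding Z2 using vv v by simp
qed

lemma rcorr_eq:
  assumes "d \<in> {1, 2}" "e \<in> pairs p" "e' \<in> pairs p"
  shows "rcorr M X d e e' = expectation (\<lambda>om. Zst M X d 1 e om * Zst M X d 1 e' om)"
  unfolding rcorr_def corr_def Zst_def svar_def smean_def by (simp add: real_sqrt_mult)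

end

locale truncated = two_sample +
  fixes b \<kappa> m3 m4 nb :: real
  assumes b: "1 \<le> b" and chi: "0 \<le> \<kappa>" "\<kappa> \<le> 1 / 16"
    and trunc: "\<And>d e. d \<in> {1, 2} \<Longrightarrow> e \<in> pairs p \<Longrightarrow>
       expectation (\<lambda>om. if \<bar>Zst M X d 1 e om\<bar> \<le> b then 0 else (Zst M X d 1 e om)\<^sup>2) \<le> \<kappa>"
    and m3: "1 \<le> m3" "\<And>d e. d \<in> {1, 2} \<Longrightarrow> e \<in> pairs p \<Longrightarrow> expectation (\<lambda>om. \<bar>Yst M X b d 1 e om\<bar> ^ 3) \<le> m3"
    and m4: "\<And>d e. d \<in> {1, 2} \<Longrightarrow> e \<in> pairs p \<Longrightarrow> expectation (\<lambda>om. (Yst M X b d 1 e om) ^ 4) \<le> m4"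
    and nb: "0 < nb" "nb \<le> real n1" "nb \<le> real n2"
begin

abbreviation Z where "Z \<equiv> Zst M X"
abbreviation mu where "mu \<equiv> mut M X b"
abbreviation Ys where "Ys \<equiv> Yst M X b"
abbreviation tau where "tau \<equiv> tau2 M X b"

lemma nb_le: "nb \<le> real (nn d)" using nb by (simp add: nsize_def)

lemma trunc_moment:
  assumes "d \<in> {1, 2}" "e \<in> pairs p"
  shows "integrable M (\<lambda>om. if \<bar>Z d 1 e om\<bar> \<le> b then 0 else (Z d 1 e om)\<^sup>2)"
    and "integrable M (\<lambda>om. trc b (Z d 1 e om))" "integrable M (\<lambda>om. (trc b (Z d 1 e om))\<^sup>2)"
    and "\<bar>mu d e\<bar> \<le> \<kappa> / b" "expectation (\<lambda>om. (trc b (Z d 1 e om))\<^sup>2) \<le> 1" "1 - \<kappa> \<le> expectation (\<lambda>om. (trc b (Z d 1 e om))\<^sup>2)"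
proof -
  note Zm = Z_moments[OF assms]
  have [measurable]: "Z d 1 e \<in> borel_measurable M" using Zst_meas[OF assms(2) obs_1[OF assms(1)]] .
  note [measurable] = this[unfolded One_nat_def]
  show i1: "integrable M (\<lambda>om. if \<bar>Z d 1 e om\<bar> \<le> b then 0 else (Z d 1 e om)\<^sup>2)"
  proof (rule Bochner_Integration.integrable_bound[OF Zm(2)])
    show "(\<lambda>om. if \<bar>Z d 1 e om\<bar> \<le> b then 0 else (Z d 1 e om)\<^sup>2) \<in> borel_measurable M" by measurable
  qed auto
  show i2: "integrable M (\<lambda>om. trc b (Z d 1 e om))"
    using trc_bound(1)[of b] b by (intro integrable_const_bound[of _ b] AE_I2) auto
  show i3: "integrable M (\<lambda>om. (trc b (Z d 1 e om))\<^sup>2)"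
    by (rule Bochner_Integration.integrable_bound[OF Zm(2)]) (auto simp: trc_bound)
  have "\<bar>mu d e\<bar> = \<bar>expectation (\<lambda>om. trc b (Z d 1 e om) - Z d 1 e om)\<bar>"
    unfolding mut_def using i2 Zm by simp
  also have "\<dots> \<le> expectation (\<lambda>om. (if \<bar>Z d 1 e om\<bar> \<le> b then 0 else (Z d 1 e om)\<^sup>2) / b)"
  proof (intro order_trans[OF integral_abs_bound integral_mono])
    fix om
    show "\<bar>trc b (Z d 1 e om) - Z d 1 e om\<bar> \<le> (if \<bar>Z d 1 e om\<bar> \<le> b then 0 else (Z d 1 e om)\<^sup>2) / b"
    proof (cases "\<bar>Z d 1 e om\<bar> \<le> b")
      case False
      hence "b * \<bar>Z d 1 e om\<bar> \<le> \<bar>Z d 1 e om\<bar> * \<bar>Z d 1 e om\<bar>" by (intro mult_right_mono) auto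
      thus ?thesis using False b by (simp add: trc_def field_simps power2_eq_square flip: abs_mult)
    qed (simp add: trc_def)
  qed (use i1 i2 Zm in auto)
  also have "\<dots> \<le> \<kappa> / b" using trunc[OF assms] b by (simp add: divide_right_mono)
  finally show "\<bar>mu d e\<bar> \<le> \<kappa> / b" .
  have eq: "expectation (\<lambda>om. (trc b (Z d 1 e om))\<^sup>2) = 1 - expectation (\<lambda>om. if \<bar>Z d 1 e om\<bar> \<le> b then 0 else (Z d 1 e om)\<^sup>2)"
  proof -
    have "expectation (\<lambda>om. (trc b (Z d 1 e om))\<^sup>2) = expectation (\<lambda>om. (Z d 1 e om)\<^sup>2 - (if \<bar>Z d 1 e om\<bar> \<le> b then 0 else (Z d 1 e om)\<^sup>2))"
      by (intro Bochner_Integration.integral_cong) (auto simp: trc_def)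
    thus ?thesis using Zm i1 by simp
  qed
  have "0 \<le> expectation (\<lambda>om. if \<bar>Z d 1 e om\<bar> \<le> b then 0 else (Z d 1 e om)\<^sup>2)" by (intro Bochner_Integration.integral_nonneg) auto
  thus "expectation (\<lambda>om. (trc b (Z d 1 e om))\<^sup>2) \<le> 1" "1 - \<kappa> \<le> expectation (\<lambda>om. (trc b (Z d 1 e om))\<^sup>2)"
    using eq trunc[OF assms] by auto
qed

lemma mu_le: "d \<in> {1, 2} \<Longrightarrow> e \<in> pairs p \<Longrightarrow> \<bar>mu d e\<bar> \<le> \<kappa>"
proof -
  assume "d \<in> {1, 2}" "e \<in> pairs p"
  hence "\<bar>mu d e\<bar> \<le> \<kappa> / b" by (rule trunc_moment)
  also have "\<dots> \<le> \<kappa> / 1" using b chi by (intro divide_left_mono) auto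
  finally show ?thesis by simp
qed

lemma Ys_bound: "d \<in> {1, 2} \<Longrightarrow> e \<in> pairs p \<Longrightarrow> \<bar>Ys d l e om\<bar> \<le> 2 * b"
  unfolding Yst_def using trc_bound(1)[of b "Z d l e om"] mu_le[of d e] b chi
    abs_triangle_ineq4[of "trc b (Z d l e om)" "mu d e"] by linarith

lemma Ys_meas: "e \<in> pairs p \<Longrightarrow> (d, l) \<in> obs \<Longrightarrow> Ys d l e \<in> borel_measurable M"
proof -
  assume "e \<in> pairs p" "(d, l) \<in> obs"
  note [measurable] = Zst_meas[OF this]
  show ?thesis unfolding Yst_def[abs_def] by measurable
qed

definition yf :: "nat \<Rightarrow> nat \<times> nat \<Rightarrow> (nat \<times> nat \<Rightarrow> real) \<Rightarrow> real" where
  "yf d e f = trc b (zf d e f) - mu d e"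

lemma yf_meas [measurable]: "e \<in> pairs p \<Longrightarrow> yf d e \<in> borel_measurable (mat_space p)"
  unfolding yf_def[abs_def] by measurable

lemma Ys_eq: "e \<in> pairs p \<Longrightarrow> Ys d l e om = yf d e (mat_rv p X d l om)"
  unfolding Yst_def yf_def by (simp add: Zst_eq)

lemma Ys_transfer:
  assumes "(d, l) \<in> obs" "e \<in> pairs p" "e' \<in> pairs p" and g: "(\<lambda>z. g (fst z) (snd z)) \<in> borel_measurable (borel \<Otimes>\<^sub>M borel)"
  shows "expectation (\<lambda>om. g (Ys d l e om) (Ys d l e' om)) = expectation (\<lambda>om. g (Ys d 1 e om) (Ys d 1 e' om) :: real)"
proof -
  have "(\<lambda>f. (yf d e f, yf d e' f)) \<in> measurable (mat_space p) (borel \<Otimes>\<^sub>M borel)" using assms by measurable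
  from measurable_compose[OF this g] have "(\<lambda>f. g (yf d e f) (yf d e' f)) \<in> borel_measurable (mat_space p)" by simp
  from transfer[OF assms(1) this] show ?thesis using assms by (simp add: Ys_eq)
qed

lemma Ys_transfer1:
  assumes "(d, l) \<in> obs" "e \<in> pairs p" and [measurable]: "g \<in> borel_measurable borel"
  shows "expectation (\<lambda>om. g (Ys d l e om)) = expectation (\<lambda>om. g (Ys d 1 e om) :: real)"
  by (rule Ys_transfer[where g = "\<lambda>x y. g x", OF assms(1,2,2)]) measurable

lemma Ys_mean: "(d, l) \<in> obs \<Longrightarrow> e \<in> pairs p \<Longrightarrow> expectation (Ys d l e) = 0"
proof -
  assume a: "(d, l) \<in> obs" "e \<in> pairs p"
  hence d: "d \<in> {1, 2}" by (simp add: obs_iff)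
  have "expectation (Ys d l e) = expectation (Ys d 1 e)" using Ys_transfer1[OF a, of "\<lambda>x. x"] by simp
  also have "\<dots> = 0" unfolding Yst_def using trunc_moment(2)[OF d a(2)] by (simp add: mut_def prob_space)
  finally show ?thesis .
qed

lemma Ys_sq: "(d, l) \<in> obs \<Longrightarrow> e \<in> pairs p \<Longrightarrow> expectation (\<lambda>om. (Ys d l e om)\<^sup>2) = tau d e"
  using Ys_transfer1[of d l e "\<lambda>x. x\<^sup>2"] by (simp add: tau2_def)

lemma tau_bounds: "d \<in> {1, 2} \<Longrightarrow> e \<in> pairs p \<Longrightarrow> tau d e \<le> 1" "d \<in> {1, 2} \<Longrightarrow> e \<in> pairs p \<Longrightarrow> 1 - 2 * \<kappa> \<le> tau d e"
  "d \<in> {1, 2} \<Longrightarrow> e \<in> pairs p \<Longrightarrow> 1 / 2 \<le> tau d e"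
proof -
  assume a: "d \<in> {1, 2}" "e \<in> pairs p"
  note tm = trunc_moment[OF a]
  have "tau d e = expectation (\<lambda>om. (trc b (Z d 1 e om))\<^sup>2) - (mu d e)\<^sup>2"
    unfolding tau2_def Yst_def power2_diff using tm by (simp add: prob_space mut_def power2_eq_square)
  moreover have "(mu d e)\<^sup>2 \<le> \<kappa>"
  proof -
    have "(mu d e)\<^sup>2 \<le> \<kappa>\<^sup>2" using mu_le[OF a] chi by (metis abs_ge_zero power2_abs power_mono)
    also have "\<dots> \<le> \<kappa> * 1" unfolding power2_eq_square using chi by (intro mult_left_mono) auto
    finally show ?thesis by simp
  qed
  moreover have "0 \<le> (mu d e)\<^sup>2" by simp
  ultimately show "tau d e \<le> 1" "1 - 2 * \<kappa> \<le> tau d e" "1 / 2 \<le> tau d e" using tm chi by linarith+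
qed

lemma cov_Ys:
  assumes d: "d \<in> {1, 2}" and e: "e \<in> pairs p" "e' \<in> pairs p"
  shows "\<bar>expectation (\<lambda>om. Ys d 1 e om * Ys d 1 e' om)\<bar> \<le> \<bar>rcorr M X d e e'\<bar> + 3 * sqrt \<kappa>"
proof (cases "\<kappa> = 0")
  case True
  have Y0: "AE om in M. Ys d 1 a om = Z d 1 a om" if a: "a \<in> pairs p" for a
  proof -
    note tm = trunc_moment[OF d a]
    have "expectation (\<lambda>om. if \<bar>Z d 1 a om\<bar> \<le> b then 0 else (Z d 1 a om)\<^sup>2) = 0"
      using trunc[OF d a] True by (intro antisym Bochner_Integration.integral_nonneg) auto
    hence "AE om in M. (if \<bar>Z d 1 a om\<bar> \<le> b then 0 else (Z d 1 a om)\<^sup>2) = 0"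
      using tm(1) by (subst (asm) integral_nonneg_eq_0_iff_AE) auto
    moreover have "mu d a = 0" using mu_le[OF d a] True by simp
    ultimately show ?thesis using b by (auto simp: Yst_def trc_def split: if_splits)
  qed
  have "expectation (\<lambda>om. Ys d 1 e om * Ys d 1 e' om) = rcorr M X d e e'"
    unfolding rcorr_eq[OF d e] using Y0[OF e(1)] Y0[OF e(2)] Zst_meas[OF e(1) obs_1[OF d]] Zst_meas[OF e(2) obs_1[OF d]]
      Ys_meas[OF e(1) obs_1[OF d]] Ys_meas[OF e(2) obs_1[OF d]]
    by (intro integral_cong_AE) auto
  thus ?thesis using True by simp
next
  case False
  define c where "c = sqrt \<kappa>"
  have c: "0 < c" "c\<^sup>2 = \<kappa>" using False chi by (auto simp: c_def)
  have c1: "c \<le> 1" using c chi by (metis c_def less_imp_le linorder_not_le one_le_numeral order_trans real_sqrt_le_1_iff divide_le_eq_1 zero_less_numeral)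
  note Ze = Z_moments[OF d e(1)] and Ze' = Z_moments[OF d e(2)]
  note te = trunc_moment[OF d e(1)] and te' = trunc_moment[OF d e(2)]
  have m [measurable]: "Z d 1 e \<in> borel_measurable M" "Z d 1 e' \<in> borel_measurable M"
    using Zst_meas[OF _ obs_1[OF d]] e by auto
  note [measurable] = this[unfolded One_nat_def]
  define k where "k a om = (if \<bar>Z d 1 a om\<bar> \<le> b then 0 else (Z d 1 a om)\<^sup>2)" for a om
  have amgm: "\<bar>x * y\<bar> \<le> (x\<^sup>2 / c + c * y\<^sup>2) / 2" for x y :: real
  proof -
    have "0 \<le> (\<bar>x\<bar> - c * \<bar>y\<bar>)\<^sup>2 / c" using c by simp
    also have "\<dots> = x\<^sup>2 / c + c * y\<^sup>2 - 2 * \<bar>x * y\<bar>" using c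
      by (simp add: power2_diff power_mult_distrib abs_mult field_simps power2_eq_square[of c])
    finally show ?thesis by simp
  qed
  have pt: "\<bar>trc b (Z d 1 e om) * trc b (Z d 1 e' om) - Z d 1 e om * Z d 1 e' om\<bar>
     \<le> (k e om / c + c * (Z d 1 e' om)\<^sup>2) / 2 + (k e' om / c + c * (Z d 1 e om)\<^sup>2) / 2" for om
  proof -
    have nn: "0 \<le> (k a om / c + c * (Z d 1 a' om)\<^sup>2) / 2" for a a' using c by (simp add: k_def)
    show ?thesis
    proof (cases "\<bar>Z d 1 e om\<bar> \<le> b")
      case True
      show ?thesis
      proof (cases "\<bar>Z d 1 e' om\<bar> \<le> b")
        case True': True
        thus ?thesis using True add_nonneg_nonneg[OF nn[of e e'] nn[of e' e]] by (simp add: trc_def)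
      next
        case False
        have "\<bar>Z d 1 e om * Z d 1 e' om\<bar> \<le> (k e' om / c + c * (Z d 1 e om)\<^sup>2) / 2"
          using amgm[of "Z d 1 e' om" "Z d 1 e om"] False by (simp add: k_def mult.commute)
        moreover have "trc b (Z d 1 e om) * trc b (Z d 1 e' om) - Z d 1 e om * Z d 1 e' om = - (Z d 1 e om * Z d 1 e' om)"
          using False by (simp add: trc_def)
        ultimately show ?thesis using nn[of e e'] by (simp only: abs_minus_cancel)
      qed
    next
      case False
      have "\<bar>Z d 1 e om * Z d 1 e' om\<bar> \<le> (k e om / c + c * (Z d 1 e' om)\<^sup>2) / 2"
        using amgm[of "Z d 1 e om" "Z d 1 e' om"] False by (simp add: k_def)
      moreover have "trc b (Z d 1 e om) * trc b (Z d 1 e' om) - Z d 1 e om * Z d 1 e' om = - (Z d 1 e om * Z d 1 e' om)"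
        using False by (simp add: trc_def)
      ultimately show ?thesis using nn[of e' e] by (simp only: abs_minus_cancel)
    qed
  qed
  have iZZ: "integrable M (\<lambda>om. Z d 1 e om * Z d 1 e' om)"
  proof (rule Bochner_Integration.integrable_bound)
    show "integrable M (\<lambda>om. (Z d 1 e om)\<^sup>2 + (Z d 1 e' om)\<^sup>2)" using Ze Ze' by simp
    have "\<bar>x * y\<bar> \<le> x\<^sup>2 + y\<^sup>2" for x y :: real
    proof -
      have "0 \<le> \<bar>x\<bar> * \<bar>y\<bar>" "2 * (\<bar>x\<bar> * \<bar>y\<bar>) \<le> x\<^sup>2 + y\<^sup>2"
        using sum_squares_bound[of "\<bar>x\<bar>" "\<bar>y\<bar>"] by (simp_all add: mult.assoc)
      thus ?thesis unfolding abs_mult by linarith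
    qed
    thus "AE om in M. norm (Z d 1 e om * Z d 1 e' om) \<le> norm ((Z d 1 e om)\<^sup>2 + (Z d 1 e' om)\<^sup>2)" by simp
  qed simp
  have iTT: "integrable M (\<lambda>om. trc b (Z d 1 e om) * trc b (Z d 1 e' om))"
    using trc_bound(1)[of b] b
    by (intro integrable_const_bound[of _ "b * b"] AE_I2) (auto simp: abs_mult intro!: mult_mono)
  have "\<bar>expectation (\<lambda>om. trc b (Z d 1 e om) * trc b (Z d 1 e' om)) - rcorr M X d e e'\<bar>
     = \<bar>expectation (\<lambda>om. trc b (Z d 1 e om) * trc b (Z d 1 e' om) - Z d 1 e om * Z d 1 e' om)\<bar>"
    unfolding rcorr_eq[OF d e] using iZZ iTT by simp
  also have "\<dots> \<le> expectation (\<lambda>om. (k e om / c + c * (Z d 1 e' om)\<^sup>2) / 2 + (k e' om / c + c * (Z d 1 e om)\<^sup>2) / 2)"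
    using iZZ iTT Ze Ze' te te' pt unfolding k_def
    by (intro order_trans[OF integral_abs_bound integral_mono]) auto
  also have "\<dots> = (expectation (k e) / c + c) / 2 + (expectation (k e') / c + c) / 2"
    using Ze Ze' te te' unfolding k_def by simp
  also have "\<dots> \<le> (\<kappa> / c + c) / 2 + (\<kappa> / c + c) / 2"
    using trunc[OF d e(1)] trunc[OF d e(2)] c unfolding k_def by (intro add_mono divide_right_mono) auto
  also have "\<dots> = 2 * c" using c by (simp add: power2_eq_square field_simps)
  finally have 1: "\<bar>expectation (\<lambda>om. trc b (Z d 1 e om) * trc b (Z d 1 e' om)) - rcorr M X d e e'\<bar> \<le> 2 * c" .
  have 2: "expectation (\<lambda>om. Ys d 1 e om * Ys d 1 e' om)
     = expectation (\<lambda>om. trc b (Z d 1 e om) * trc b (Z d 1 e' om)) - mu d e * mu d e'"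
  proof -
    have "Ys d 1 e om * Ys d 1 e' om = trc b (Z d 1 e om) * trc b (Z d 1 e' om) - mu d e' * trc b (Z d 1 e om)
        - mu d e * trc b (Z d 1 e' om) + mu d e * mu d e'" for om
      unfolding Yst_def by (simp add: algebra_simps)
    thus ?thesis using iTT te te' by (simp add: prob_space mut_def)
  qed
  have "\<bar>mu d e * mu d e'\<bar> \<le> \<kappa> * \<kappa>" unfolding abs_mult using mu_le[OF d] e chi by (intro mult_mono) auto
  also have "\<dots> \<le> \<kappa> * 1" using chi by (intro mult_left_mono) auto
  also have "\<dots> = c * c" using c by (simp add: power2_eq_square)
  also have "\<dots> \<le> c * 1" using c c1 by (intro mult_left_mono) auto
  finally have 3: "\<bar>mu d e * mu d e'\<bar> \<le> c" by simp
  show ?thesis unfolding 2 c_def[symmetric] using 1 3 by linarith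
qed

end

definition sg :: "nat \<Rightarrow> real" where "sg d = (if d = 1 then 1 else - 1)"

context truncated
begin

definition oi :: "nat \<Rightarrow> nat \<times> nat" where
  "oi i = (if i < n1 then (1, i + 1) else (2, i - n1 + 1))"

definition Nn :: nat where "Nn = n1 + n2"

definition theta :: "nat \<times> nat \<Rightarrow> real" where
  "theta e = svar M X 1 e * tau 1 e / real n1 + svar M X 2 e * tau 2 e / real n2"

definition aw :: "nat \<Rightarrow> nat \<times> nat \<Rightarrow> real" where
  "aw d e = sqrt (svar M X d e) / (real (nn d) * sqrt (theta e))"

definition YL :: "nat \<times> nat \<Rightarrow> nat \<Rightarrow> 'a \<Rightarrow> real" where
  "YL e i om = sg (fst (oi i)) * aw (fst (oi i)) e * Ys (fst (oi i)) (snd (oi i)) e om"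

definition sL :: "nat \<times> nat \<Rightarrow> nat \<Rightarrow> real" where
  "sL e i = (aw (fst (oi i)) e)\<^sup>2 * tau (fst (oi i)) e"

definition RL :: "nat \<times> nat \<Rightarrow> nat \<times> nat \<Rightarrow> real" where
  "RL e e' = (max \<bar>rcorr M X 1 e e'\<bar> \<bar>rcorr M X 2 e e'\<bar> + 3 * sqrt \<kappa>) / (1 - 2 * \<kappa>)"

lemma oi_obs: "i < Nn \<Longrightarrow> oi i \<in> obs" "i < Nn \<Longrightarrow> fst (oi i) \<in> {1, 2}" "i < Nn \<Longrightarrow> (fst (oi i), snd (oi i)) \<in> obs"
  by (auto simp: oi_def Nn_def obs_index_def)

lemma oi_inj: "inj_on oi {..<Nn}"
  by (auto simp: inj_on_def oi_def split: if_splits)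

lemma sum_oi: "(\<Sum>i<Nn. f (oi i)) = (\<Sum>l=1..n1. f (1, l)) + (\<Sum>l=1..n2. f (2, l))" for f :: "nat \<times> nat \<Rightarrow> real"
proof -
  have "{..<Nn} = {..<n1} \<union> {n1..<n1 + n2}" by (auto simp: Nn_def)
  moreover have "{..<n1} \<inter> {n1..<n1 + n2} = {}" by auto
  ultimately have "(\<Sum>i<Nn. f (oi i)) = (\<Sum>i<n1. f (oi i)) + (\<Sum>i\<in>{n1..<n1+n2}. f (oi i))"
    by (simp add: sum.union_disjoint)
  also have "(\<Sum>i<n1. f (oi i)) = (\<Sum>l=1..n1. f (1, l))"
    by (rule sum.reindex_bij_witness[of _ "\<lambda>l. l - 1" "\<lambda>i. i + 1"]) (auto simp: oi_def)
  also have "(\<Sum>i\<in>{n1..<n1+n2}. f (oi i)) = (\<Sum>l=1..n2. f (2, l))"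
    by (rule sum.reindex_bij_witness[of _ "\<lambda>l. l - 1 + n1" "\<lambda>i. i - n1 + 1"]) (auto simp: oi_def)
  finally show ?thesis .
qed

lemma svar_pos: "d \<in> {1, 2} \<Longrightarrow> e \<in> pairs p \<Longrightarrow> 0 < svar M X d e"
  using moments by blast

lemma n_real: "0 < real n1" "0 < real n2" using n_pos by auto

lemma theta_part: assumes "d \<in> {1, 2}" "e \<in> pairs p"
  shows "svar M X d e * tau d e / real (nn d) \<le> theta e" "svar M X d e / real (nn d) \<le> 2 * theta e"
proof -
  have nonneg: "0 \<le> svar M X d' e * tau d' e / real n" if "d' \<in> {1, 2}" for d' n
    using svar_pos[OF that assms(2)] tau_bounds(3)[OF that assms(2)] by auto
  show 1: "svar M X d e * tau d e / real (nn d) \<le> theta e"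
    using assms nonneg[of 1] nonneg[of 2] unfolding theta_def nsize_def by auto
  have "svar M X d e / real (nn d) = 2 * (svar M X d e * (1 / 2) / real (nn d))" by simp
  also have "\<dots> \<le> 2 * (svar M X d e * tau d e / real (nn d))"
    using svar_pos[OF assms] tau_bounds(3)[OF assms] by (intro mult_left_mono divide_right_mono) auto
  finally show "svar M X d e / real (nn d) \<le> 2 * theta e" using 1 by linarith
qed

lemma theta_pos: "e \<in> pairs p \<Longrightarrow> 0 < theta e"
proof -
  assume e: "e \<in> pairs p"
  have "0 < svar M X 1 e * tau 1 e / real (nn 1)"
    using svar_pos[of 1 e] tau_bounds(3)[of 1 e] e nn_pos[of 1] by (intro divide_pos_pos mult_pos_pos) auto
  thus ?thesis using theta_part(1)[of 1 e] e by simp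
qed

lemma nnr: "0 < real (nn d)" using nn_pos[of d] by linarith

lemma aw_props: assumes "d \<in> {1, 2}" "e \<in> pairs p"
  shows "0 < aw d e" "(aw d e)\<^sup>2 = svar M X d e / ((real (nn d))\<^sup>2 * theta e)" "aw d e \<le> 2 / sqrt nb"
proof -
  note sv = svar_pos[OF assms] and th = theta_pos[OF assms(2)]
  show pos: "0 < aw d e" unfolding aw_def using sv th nnr by simp
  show eq: "(aw d e)\<^sup>2 = svar M X d e / ((real (nn d))\<^sup>2 * theta e)"
    unfolding aw_def using sv th by (simp add: power_divide power_mult_distrib)
  have "(aw d e)\<^sup>2 = (svar M X d e / real (nn d)) / (real (nn d) * theta e)"
    unfolding eq by (simp add: power2_eq_square)
  also have "\<dots> \<le> (2 * theta e) / (real (nn d) * theta e)"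
    using theta_part(2)[OF assms] th nnr by (intro divide_right_mono) auto
  also have "\<dots> = 2 / real (nn d)" using th by simp
  also have "\<dots> \<le> 2 / nb" using nb_le[of d] nb by (intro divide_left_mono mult_pos_pos) (auto simp: nnr)
  also have "\<dots> \<le> (2 / sqrt nb)\<^sup>2" using nb by (simp add: power_divide divide_right_mono)
  finally show "aw d e \<le> 2 / sqrt nb" using pos nb by (meson less_imp_le power2_le_imp_le zero_le_divide_iff zero_le_numeral real_sqrt_ge_zero)
qed

lemma sg_sq: "sg d * sg d = 1" "\<bar>sg d\<bar> = 1" by (auto simp: sg_def)

lemma linear_stats_inst:
  assumes E: "E \<subseteq> pairs p" and H: "8 \<le> H" and w: "0 < w" "4 * w \<le> 1 / H" "10 * w \<le> 1"
    and bd: "bd = 4 * b / sqrt nb" "bd \<le> 1 / H" "bd * (H + 2 / w) \<le> 1" "4 * H * bd \<le> 1" and rho: "0 \<le> \<rho>0"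
    and be: "\<beta> = 4 * m3 / sqrt nb" and gm: "gam \<beta> \<rho>0 H w \<le> 1 / 2"
  shows "linear_stats M E Nn YL sL RL bd \<beta> \<rho>0 H w"
proof
  show "finite E" using finite_subset[OF E finite_pairs] .
  show "0 < Nn" using n_pos by (simp add: Nn_def)
  have ind1: "indep_vars (\<lambda>_. mat_space p) (\<lambda>i. (\<lambda>(d, l). mat_rv p X d l) (oi i)) {..<Nn}"
    using indep_vars_reindex[OF indep oi_inj] oi_obs by auto
  show "indep_vars (\<lambda>_. borel \<Otimes>\<^sub>M borel) (\<lambda>i om. (YL e i om, YL e' i om)) {..<Nn}" if e: "e \<in> E" "e' \<in> E" for e e'
  proof -
    have ep: "e \<in> pairs p" "e' \<in> pairs p" using e E by auto
    define g where "g i f = (sg (fst (oi i)) * aw (fst (oi i)) e * yf (fst (oi i)) e f,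
        sg (fst (oi i)) * aw (fst (oi i)) e' * yf (fst (oi i)) e' f)" for i f
    have "indep_vars (\<lambda>_. borel \<Otimes>\<^sub>M borel) (\<lambda>i om. g i ((\<lambda>(d, l). mat_rv p X d l) (oi i) om)) {..<Nn}"
      using ep by (intro indep_vars_compose2[OF ind1]) (auto simp: g_def)
    moreover have "g i ((\<lambda>(d, l). mat_rv p X d l) (oi i) om) = (YL e i om, YL e' i om)" for i om
      unfolding g_def YL_def using ep by (simp add: Ys_eq case_prod_beta)
    ultimately show ?thesis by simp
  qed
  fix e i assume e: "e \<in> E" and i: "i < Nn"
  hence ep: "e \<in> pairs p" using E by auto
  define d l where "d = fst (oi i)" and "l = snd (oi i)"
  have d: "d \<in> {1, 2}" and o: "(d, l) \<in> obs" using oi_obs[OF i] by (auto simp: d_def l_def)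
  have Y: "YL e i om = sg d * aw d e * Ys d l e om" for om unfolding YL_def d_def l_def ..
  have s: "sL e i = (aw d e)\<^sup>2 * tau d e" unfolding sL_def d_def ..
  note A = aw_props[OF d ep]
  note T = tau_bounds[OF d ep]
  show "\<bar>YL e i om\<bar> \<le> bd" if "om \<in> space M" for om
  proof -
    have "\<bar>YL e i om\<bar> = aw d e * \<bar>Ys d l e om\<bar>" unfolding Y abs_mult sg_sq using A by simp
    also have "\<dots> \<le> (2 / sqrt nb) * (2 * b)" using A Ys_bound[OF d ep] nb by (intro mult_mono) auto
    finally show ?thesis unfolding bd by simp
  qed
  show "expectation (YL e i) = 0" unfolding Y[abs_def] using Ys_mean[OF o ep] by simp
  have "(YL e i om)\<^sup>2 = (aw d e)\<^sup>2 * (Ys d l e om)\<^sup>2" for om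
    unfolding Y using sg_sq(1)[of d] by (simp add: power2_eq_square mult_ac)
  thus "expectation (\<lambda>om. (YL e i om)\<^sup>2) = sL e i" unfolding s using Ys_sq[OF o ep] by simp
  have "\<bar>YL e i om\<bar> ^ 3 = (aw d e) ^ 3 * \<bar>Ys d l e om\<bar> ^ 3" for om
    unfolding Y abs_mult sg_sq using A by (simp add: power_mult_distrib)
  hence "expectation (\<lambda>om. \<bar>YL e i om\<bar> ^ 3) = (aw d e) ^ 3 * expectation (\<lambda>om. \<bar>Ys d l e om\<bar> ^ 3)" by simp
  also have "expectation (\<lambda>om. \<bar>Ys d l e om\<bar> ^ 3) = expectation (\<lambda>om. \<bar>Ys d 1 e om\<bar> ^ 3)"
    by (rule Ys_transfer1[OF o ep, of "\<lambda>x. \<bar>x\<bar> ^ 3"]) simp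
  also have "(aw d e) ^ 3 * \<dots> \<le> ((aw d e)\<^sup>2 * (2 / sqrt nb)) * m3"
  proof (rule mult_mono)
    have "(aw d e) ^ 3 = (aw d e)\<^sup>2 * aw d e" by (simp add: power3_eq_cube power2_eq_square)
    also have "\<dots> \<le> (aw d e)\<^sup>2 * (2 / sqrt nb)" using A(3) by (rule mult_left_mono) simp
    finally show "(aw d e) ^ 3 \<le> (aw d e)\<^sup>2 * (2 / sqrt nb)" .
  qed (use m3(2)[OF d ep] nb in \<open>auto intro!: Bochner_Integration.integral_nonneg\<close>)
  also have "\<dots> = (4 * m3 / sqrt nb) * ((aw d e)\<^sup>2 * (1 / 2))" by simp
  also have "\<dots> \<le> (4 * m3 / sqrt nb) * ((aw d e)\<^sup>2 * tau d e)"
    using T m3(1) nb by (intro mult_left_mono) auto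
  finally show "expectation (\<lambda>om. \<bar>YL e i om\<bar> ^ 3) \<le> \<beta> * sL e i" unfolding be s .
  have "sqrt (sL e i) = aw d e * sqrt (tau d e)" unfolding s using A(1) by (simp add: real_sqrt_mult)
  also have "\<dots> \<le> (2 / sqrt nb) * 1" using A T nb by (intro mult_mono) auto
  also have "\<dots> \<le> \<beta>" unfolding be using m3(1) nb by (simp add: divide_right_mono)
  finally show "sqrt (sL e i) \<le> \<beta>" .
next
  fix e assume "e \<in> E"
  hence ep: "e \<in> pairs p" using E by auto
  have "(\<Sum>i<Nn. sL e i) = (\<Sum>l=1..n1. (aw 1 e)\<^sup>2 * tau 1 e) + (\<Sum>l=1..n2. (aw 2 e)\<^sup>2 * tau 2 e)"
    unfolding sL_def using sum_oi[of "\<lambda>z. (aw (fst z) e)\<^sup>2 * tau (fst z) e"] by simp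
  also have "\<dots> = (svar M X 1 e * tau 1 e / real n1 + svar M X 2 e * tau 2 e / real n2) / theta e"
  proof -
    have a: "(aw 1 e)\<^sup>2 = svar M X 1 e / ((real n1)\<^sup>2 * theta e)" "(aw 2 e)\<^sup>2 = svar M X 2 e / ((real n2)\<^sup>2 * theta e)"
      using aw_props(2)[OF _ ep, of 1] aw_props(2)[OF _ ep, of 2] by (simp_all add: nsize_def)
    show ?thesis unfolding a using n_real theta_pos[OF ep] by (simp add: power2_eq_square field_simps)
  qed
  also have "\<dots> = 1" using theta_pos[OF ep] unfolding theta_def by simp
  finally show "(\<Sum>i<Nn. sL e i) = 1" .
next
  fix e e' i assume e: "e \<in> E" "e' \<in> E" "e \<noteq> e'" and i: "i < Nn"
  hence ep: "e \<in> pairs p" "e' \<in> pairs p" using E by auto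
  define d l where "d = fst (oi i)" and "l = snd (oi i)"
  have d: "d \<in> {1, 2}" and o: "(d, l) \<in> obs" using oi_obs[OF i] by (auto simp: d_def l_def)
  have Y: "YL a i om = sg d * aw d a * Ys d l a om" for om a unfolding YL_def d_def l_def ..
  have s: "sL a i = (aw d a)\<^sup>2 * tau d a" for a unfolding sL_def d_def ..
  note A = aw_props[OF d ep(1)] aw_props[OF d ep(2)]
  have "YL e i om * YL e' i om = (aw d e * aw d e') * (Ys d l e om * Ys d l e' om)" for om
  proof -
    have "YL e i om * YL e' i om = (sg d * sg d) * ((aw d e * aw d e') * (Ys d l e om * Ys d l e' om))" unfolding Y by (simp add: mult_ac)
    thus ?thesis using sg_sq by simp
  qed
  hence "\<bar>expectation (\<lambda>om. YL e i om * YL e' i om)\<bar> = (aw d e * aw d e') * \<bar>expectation (\<lambda>om. Ys d l e om * Ys d l e' om)\<bar>"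
    using A by (simp add: abs_mult)
  also have "expectation (\<lambda>om. Ys d l e om * Ys d l e' om) = expectation (\<lambda>om. Ys d 1 e om * Ys d 1 e' om)"
    by (rule Ys_transfer[OF o ep, of "\<lambda>x y. x * y"]) measurable
  also have "(aw d e * aw d e') * \<bar>\<dots>\<bar> \<le> (aw d e * aw d e') * (RL e e' * (sqrt (tau d e) * sqrt (tau d e')))"
  proof (intro mult_left_mono)
    define c where "c = max \<bar>rcorr M X 1 e e'\<bar> \<bar>rcorr M X 2 e e'\<bar> + 3 * sqrt \<kappa>"
    have c0: "0 \<le> c" unfolding c_def using chi by (intro add_nonneg_nonneg) auto
    have "\<bar>expectation (\<lambda>om. Ys d 1 e om * Ys d 1 e' om)\<bar> \<le> \<bar>rcorr M X d e e'\<bar> + 3 * sqrt \<kappa>" by (rule cov_Ys[OF d ep])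
    also have "\<dots> \<le> c" using d by (auto simp: c_def)
    also have "c = c / (1 - 2 * \<kappa>) * (1 - 2 * \<kappa>)" using chi by simp
    also have "\<dots> \<le> c / (1 - 2 * \<kappa>) * (sqrt (tau d e) * sqrt (tau d e'))"
    proof (intro mult_left_mono)
      have k: "0 \<le> 1 - 2 * \<kappa>" using chi by simp
      have "1 - 2 * \<kappa> = sqrt (1 - 2 * \<kappa>) * sqrt (1 - 2 * \<kappa>)" using k by simp
      also have "\<dots> \<le> sqrt (tau d e) * sqrt (tau d e')"
        using tau_bounds(2)[OF d ep(1)] tau_bounds(2)[OF d ep(2)] k by (intro mult_mono) auto
      finally show "1 - 2 * \<kappa> \<le> sqrt (tau d e) * sqrt (tau d e')" .
      show "0 \<le> c / (1 - 2 * \<kappa>)" using c0 k by simp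
    qed
    finally show "\<bar>expectation (\<lambda>om. Ys d 1 e om * Ys d 1 e' om)\<bar> \<le> RL e e' * (sqrt (tau d e) * sqrt (tau d e'))"
      unfolding RL_def c_def .
  qed (use A in auto)
  also have "\<dots> = RL e e' * (sqrt (sL e i) * sqrt (sL e' i))"
    unfolding s using A(1,4) by (simp add: real_sqrt_mult)
  finally show "\<bar>expectation (\<lambda>om. YL e i om * YL e' i om)\<bar> \<le> RL e e' * (sqrt (sL e i) * sqrt (sL e' i))" .
qed (use H w bd rho gm b m3 nb be in auto)

lemma bernstein:
  assumes d: "d \<in> {1, 2}" and e: "e \<in> pairs p" and g [measurable]: "g \<in> borel_measurable borel"
    and gb: "\<And>y. \<bar>y\<bar> \<le> 2 * b \<Longrightarrow> \<bar>g y\<bar> \<le> c" and g0: "expectation (\<lambda>om. g (Ys d 1 e om)) = 0"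
    and gv: "expectation (\<lambda>om. (g (Ys d 1 e om))\<^sup>2) \<le> v"
    and l: "0 < \<theta>" "\<theta> * c \<le> 1" "0 \<le> L" and c: "0 \<le> c"
  shows "prob {om \<in> space M. real (nn d) * (\<theta> * v + 6 * L / (nb * \<theta>)) \<le> (\<Sum>l=1..nn d. g (Ys d l e om))} \<le> exp (- 6 * L)"
proof -
  define x where "x = real (nn d) * (\<theta> * v + 6 * L / (nb * \<theta>))"
  have o: "(d, l) \<in> obs" if "l \<in> {1..nn d}" for l using d that by (auto simp: obs_iff)
  have v0: "0 \<le> v" using gv by (rule order_trans[rotated]) (auto intro!: Bochner_Integration.integral_nonneg)
  have ind1: "indep_vars (\<lambda>_. mat_space p) (\<lambda>l. (\<lambda>(d, l). mat_rv p X d l) (d, l)) {1..nn d}"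
  proof -
    have "inj_on (\<lambda>l. (d, l)) {1..nn d}" "(\<lambda>l. (d, l)) ` {1..nn d} \<subseteq> obs" using o by (auto simp: inj_on_def)
    from indep_vars_reindex[OF indep this] show ?thesis .
  qed
  have "indep_vars (\<lambda>_. borel) (\<lambda>l om. g (yf d e ((\<lambda>(d, l). mat_rv p X d l) (d, l) om))) {1..nn d}"
    using e by (intro indep_vars_compose2[OF ind1]) auto
  hence ind: "indep_vars (\<lambda>_. borel) (\<lambda>l om. g (Ys d l e om)) {1..nn d}" using e by (simp add: Ys_eq)
  have "prob {om \<in> space M. x \<le> (\<Sum>l=1..nn d. g (Ys d l e om))} \<le> exp (- \<theta> * x + \<theta>\<^sup>2 * (real (nn d) * v) / 2 * (1 + \<theta> * c))"
  proof (rule chernoff_bounded[OF _ ind])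
    show "\<bar>g (Ys d l e om)\<bar> \<le> c" for l om using gb Ys_bound[OF d e] by auto
    show "expectation (\<lambda>om. g (Ys d l e om)) = 0" if "l \<in> {1..nn d}" for l
      using Ys_transfer1[OF o[OF that] e g] g0 by simp
    have "(\<Sum>l=1..nn d. expectation (\<lambda>om. (g (Ys d l e om))\<^sup>2)) = (\<Sum>l=1..nn d. expectation (\<lambda>om. (g (Ys d 1 e om))\<^sup>2))"
      by (intro sum.cong refl Ys_transfer1[OF o e, of _ "\<lambda>y. (g y)\<^sup>2"]) auto
    also have "\<dots> \<le> (\<Sum>l=1..nn d. v)" using gv by (intro sum_mono) auto
    finally show "(\<Sum>l=1..nn d. expectation (\<lambda>om. (g (Ys d l e om))\<^sup>2)) \<le> real (nn d) * v" by simp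
  qed (use l c in auto)
  also have "\<dots> \<le> exp (- 6 * L)"
  proof -
    have "\<theta>\<^sup>2 * (real (nn d) * v) / 2 * (1 + \<theta> * c) \<le> \<theta>\<^sup>2 * (real (nn d) * v) / 2 * 2"
      using l v0 by (intro mult_left_mono) auto
    hence "- \<theta> * x + \<theta>\<^sup>2 * (real (nn d) * v) / 2 * (1 + \<theta> * c) \<le> - \<theta> * x + \<theta>\<^sup>2 * (real (nn d) * v)" by simp
    also have "\<dots> = - (real (nn d) / nb * (6 * L))" unfolding x_def using l nb by (simp add: field_simps power2_eq_square)
    also have "\<dots> \<le> - (1 * (6 * L))" using nb_le[of d] nb l by (intro le_imp_neg_le mult_right_mono) auto
    finally show ?thesis by simp
  qed
  finally show ?thesis unfolding x_def .
qed

definition good :: "real \<Rightarrow> real \<Rightarrow> 'a set" where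
  "good x y = {om \<in> space M. (\<forall>e\<in>pairs p. (\<forall>(d, l)\<in>obs. \<bar>Z d l e om\<bar> \<le> b)
     \<and> (\<forall>d\<in>{1, 2}. \<bar>\<Sum>l=1..nn d. Ys d l e om\<bar> \<le> real (nn d) * x
        \<and> \<bar>\<Sum>l=1..nn d. (Ys d l e om)\<^sup>2 - tau d e\<bar> \<le> real (nn d) * y))}"

lemma finite_obs: "finite obs" and card_obs: "card obs = Nn"
proof -
  have "obs = oi ` {..<Nn}"
  proof
    show "oi ` {..<Nn} \<subseteq> obs" using oi_obs by auto
    show "obs \<subseteq> oi ` {..<Nn}"
    proof
      fix z assume "z \<in> obs"
      then obtain d l where z: "z = (d, l)" "(d, l) \<in> obs" by (cases z) auto
      show "z \<in> oi ` {..<Nn}"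
      proof (cases "d = 1")
        case True
        thus ?thesis using z by (intro image_eqI[of _ _ "l - 1"]) (auto simp: oi_def obs_index_def Nn_def)
      next
        case False
        thus ?thesis using z by (intro image_eqI[of _ _ "l - 1 + n1"]) (auto simp: oi_def obs_index_def Nn_def)
      qed
    qed
  qed
  thus "finite obs" "card obs = Nn" using card_image[OF oi_inj] by auto
qed

lemma prob_UN_le:
  assumes "finite I" "\<And>i. i \<in> I \<Longrightarrow> A i \<in> events" "\<And>i. i \<in> I \<Longrightarrow> prob (A i) \<le> c"
  shows "prob (\<Union>i\<in>I. A i) \<le> real (card I) * c"
proof -
  have "prob (\<Union>i\<in>I. A i) \<le> (\<Sum>i\<in>I. prob (A i))" using assms by (intro finite_measure_subadditive_finite) auto
  also have "\<dots> \<le> (\<Sum>i\<in>I. c)" using assms by (intro sum_mono) auto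
  finally show ?thesis by simp
qed

lemma good_prob:
  assumes L: "0 < L" "2 * b * sqrt (L / nb) \<le> 1" and t: "0 < t" "4 * b\<^sup>2 * t \<le> 1"
    and tail: "\<And>d l e. (d, l) \<in> obs \<Longrightarrow> e \<in> pairs p \<Longrightarrow> prob {om \<in> space M. b < \<bar>Z d l e om\<bar>} \<le> \<pi>"
  shows "good (7 * sqrt (L / nb)) (t * m4 + 6 * L / (nb * t)) \<in> events"
    and "1 - (real (qnum p) * real Nn * \<pi> + 8 * real (qnum p) * exp (- 6 * L))
       \<le> prob (good (7 * sqrt (L / nb)) (t * m4 + 6 * L / (nb * t)))"
proof -
  define x y where "x = 7 * sqrt (L / nb)" and "y = t * m4 + 6 * L / (nb * t)"
  define B1 where "B1 = (\<lambda>(e, d, l). {om \<in> space M. b < \<bar>Z d l e om\<bar>})"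
  define g :: "nat \<Rightarrow> nat \<Rightarrow> nat \<times> nat \<Rightarrow> real \<Rightarrow> real" where
    "g k d e u = (if k = 0 then u else if k = 1 then - u else if k = 2 then u\<^sup>2 - tau d e else tau d e - u\<^sup>2)" for k d e u
  define z where "z k = (if k < (2::nat) then x else y)" for k
  define B2 where "B2 = (\<lambda>(e, d, k). {om \<in> space M. real (nn d) * z k \<le> (\<Sum>l=1..nn d. g k d e (Ys d l e om))})"
  define I2 where "I2 = pairs p \<times> {1, 2::nat} \<times> {..<4::nat}"
  have gm: "g k d e \<in> borel_measurable borel" for k d e unfolding g_def[abs_def] by measurable
  have B1m: "B1 i \<in> events" if "i \<in> pairs p \<times> obs" for i
  proof -
    obtain e d l where i: "i = (e, d, l)" "e \<in> pairs p" "(d, l) \<in> obs" using \<open>i \<in> _\<close> by auto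
    note [measurable] = Zst_meas[OF i(2,3)]
    show ?thesis unfolding i B1_def by simp
  qed
  have B2m: "B2 i \<in> events" if "i \<in> I2" for i
  proof -
    obtain e d k where i: "i = (e, d, k)" "e \<in> pairs p" "d \<in> {1, 2}" using \<open>i \<in> I2\<close> by (auto simp: I2_def)
    have "(\<lambda>om. \<Sum>l=1..nn d. g k d e (Ys d l e om)) \<in> borel_measurable M"
      using i by (intro borel_measurable_sum measurable_compose[OF Ys_meas gm]) (auto simp: obs_iff)
    thus ?thesis unfolding i B2_def by simp
  qed
  have L0: "0 \<le> L" using L by simp
  have sL: "0 < sqrt (L / nb)" using L nb by simp
  have p2: "prob (B2 i) \<le> exp (- 6 * L)" if "i \<in> I2" for i
  proof -
    obtain e d k where i: "i = (e, d, k)" and e: "e \<in> pairs p" and d: "d \<in> {1, 2}" and k: "k < 4" using \<open>i \<in> I2\<close> by (auto simp: I2_def)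
    have o1: "(d, 1) \<in> obs" by (rule obs_1[OF d])
    note T = tau_bounds[OF d e]
    have iY: "integrable M (\<lambda>om. (Ys d 1 e om) ^ j)" for j
    proof (rule integrable_const_bound[of _ "(2 * b) ^ j"])
      show "AE om in M. norm ((Ys d 1 e om) ^ j) \<le> (2 * b) ^ j"
        unfolding real_norm_def power_abs using Ys_bound[OF d e] by (intro AE_I2 power_mono) auto
      show "(\<lambda>om. (Ys d 1 e om) ^ j) \<in> borel_measurable M" by (intro borel_measurable_power Ys_meas e o1)
    qed
    show ?thesis
    proof (cases "k < 2")
      case True
      hence k': "k = 0 \<or> k = 1" by auto
      have "sqrt (L / nb) * 1 + 6 * L / (nb * sqrt (L / nb)) = 7 * sqrt (L / nb)"
      proof -
        have "6 * L / (nb * sqrt (L / nb)) = 6 * ((L / nb) / sqrt (L / nb))" by simp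
        also have "(L / nb) / sqrt (L / nb) = sqrt (L / nb)" using L nb by (intro real_div_sqrt) auto
        finally show ?thesis by simp
      qed
      hence zz: "z k = sqrt (L / nb) * 1 + 6 * L / (nb * sqrt (L / nb))" unfolding z_def x_def using True by simp
      show ?thesis unfolding i B2_def prod.case zz
      proof (rule bernstein[OF d e gm, where c = "2 * b"])
        show "\<bar>g k d e u\<bar> \<le> 2 * b" if "\<bar>u\<bar> \<le> 2 * b" for u using that k' by (auto simp: g_def)
        show "expectation (\<lambda>om. g k d e (Ys d 1 e om)) = 0" using k' Ys_mean[OF o1 e] by (auto simp: g_def)
        have "(g k d e u)\<^sup>2 = u\<^sup>2" for u using k' by (auto simp: g_def)
        thus "expectation (\<lambda>om. (g k d e (Ys d 1 e om))\<^sup>2) \<le> 1" using Ys_sq[OF o1 e] T by simp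
        show "sqrt (L / nb) * (2 * b) \<le> 1" using L(2) by (simp add: mult_ac)
      qed (use sL L0 b in auto)
    next
      case False
      hence k': "k = 2 \<or> k = 3" using k by auto
      have b4: "1 \<le> 4 * b\<^sup>2" using b one_le_power[of b 2] by linarith
      have zz: "z k = t * m4 + 6 * L / (nb * t)" unfolding z_def y_def using False by simp
      show ?thesis unfolding i B2_def prod.case zz
      proof (rule bernstein[OF d e gm, where c = "4 * b\<^sup>2"])
        show "\<bar>g k d e u\<bar> \<le> 4 * b\<^sup>2" if u: "\<bar>u\<bar> \<le> 2 * b" for u
        proof -
          have "u\<^sup>2 \<le> (2 * b)\<^sup>2" using u by (metis abs_ge_zero power2_abs power_mono)
          hence "u\<^sup>2 \<le> 4 * b\<^sup>2" by (simp add: power_mult_distrib)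
          moreover have "0 \<le> u\<^sup>2" by simp
          ultimately have "\<bar>u\<^sup>2 - tau d e\<bar> \<le> 4 * b\<^sup>2" using T b4 by (simp only: abs_le_iff) linarith
          moreover have "\<bar>tau d e - u\<^sup>2\<bar> = \<bar>u\<^sup>2 - tau d e\<bar>" by (rule abs_minus_commute)
          ultimately show ?thesis using k' by (auto simp: g_def)
        qed
        show "expectation (\<lambda>om. g k d e (Ys d 1 e om)) = 0" using k' Ys_sq[OF o1 e] iY[of 2] by (auto simp: g_def prob_space)
        have "(g k d e u)\<^sup>2 = u ^ 4 - 2 * tau d e * u\<^sup>2 + (tau d e)\<^sup>2" for u
          using k' by (auto simp: g_def power2_eq_square power4_eq_xxxx algebra_simps)
        hence "expectation (\<lambda>om. (g k d e (Ys d 1 e om))\<^sup>2) = expectation (\<lambda>om. (Ys d 1 e om) ^ 4) - (tau d e)\<^sup>2"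
          using iY[of 2] iY[of 4] Ys_sq[OF o1 e] by (simp add: prob_space power2_eq_square)
        also have "\<dots> \<le> m4" using m4[OF d e] zero_le_power2[of "tau d e"] by linarith
        finally show "expectation (\<lambda>om. (g k d e (Ys d 1 e om))\<^sup>2) \<le> m4" .
        show "t * (4 * b\<^sup>2) \<le> 1" using t(2) by (simp add: mult_ac)
      qed (use t L0 in auto)
    qed
  qed
  define Bad where "Bad = (\<Union>i\<in>pairs p \<times> obs. B1 i) \<union> (\<Union>i\<in>I2. B2 i)"
  have fin: "finite (pairs p \<times> obs)" "finite I2" unfolding I2_def using finite_pairs finite_obs by auto
  have BadE: "Bad \<in> events" unfolding Bad_def using B1m B2m fin by (intro sets.Un sets.finite_UN) auto
  have "prob Bad \<le> prob (\<Union>i\<in>pairs p \<times> obs. B1 i) + prob (\<Union>i\<in>I2. B2 i)"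
    unfolding Bad_def using B1m B2m fin by (intro measure_Un_le sets.finite_UN) auto
  also have "\<dots> \<le> real (card (pairs p \<times> obs)) * \<pi> + real (card I2) * exp (- 6 * L)"
  proof (intro add_mono prob_UN_le fin B1m B2m p2)
    show "prob (B1 i) \<le> \<pi>" if "i \<in> pairs p \<times> obs" for i using that tail by (auto simp: B1_def)
  qed
  also have "\<dots> = real (qnum p) * real Nn * \<pi> + 8 * real (qnum p) * exp (- 6 * L)"
    unfolding I2_def by (simp add: card_cartesian_product card_pairs card_obs)
  finally have pB: "prob Bad \<le> real (qnum p) * real Nn * \<pi> + 8 * real (qnum p) * exp (- 6 * L)" .
  have sub: "space M - Bad \<subseteq> good x y"
  proof
    fix om assume w: "om \<in> space M - Bad"
    have 1: "\<bar>Z d l e om\<bar> \<le> b" if "e \<in> pairs p" "(d, l) \<in> obs" for e d l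
      using w that unfolding Bad_def B1_def by force
    have 2: "(\<Sum>l=1..nn d. g k d e (Ys d l e om)) < real (nn d) * z k" if "e \<in> pairs p" "d \<in> {1, 2}" "k < 4" for e d k
    proof -
      have "(e, d, k) \<in> I2" using that by (auto simp: I2_def)
      hence "om \<notin> B2 (e, d, k)" using w by (auto simp: Bad_def)
      thus ?thesis using w by (auto simp: B2_def)
    qed
    show "om \<in> good x y" unfolding good_def
    proof (intro CollectI conjI ballI)
      show "om \<in> space M" using w by simp
      fix e assume e: "e \<in> pairs p"
      show "case dl of (d, l) \<Rightarrow> \<bar>Z d l e om\<bar> \<le> b" if "dl \<in> obs" for dl using 1[OF e] that by (cases dl) auto
      fix d :: nat assume d: "d \<in> {1, 2}"
      have "(\<Sum>l=1..nn d. - Ys d l e om) = - (\<Sum>l=1..nn d. Ys d l e om)" by (simp add: sum_negf)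
      thus "\<bar>\<Sum>l=1..nn d. Ys d l e om\<bar> \<le> real (nn d) * x"
        using 2[OF e d, of 0] 2[OF e d, of 1] by (simp add: g_def z_def abs_le_iff)
      have "(\<Sum>l=1..nn d. tau d e - (Ys d l e om)\<^sup>2) = - (\<Sum>l=1..nn d. (Ys d l e om)\<^sup>2 - tau d e)"
        by (simp add: sum_subtractf)
      thus "\<bar>\<Sum>l=1..nn d. (Ys d l e om)\<^sup>2 - tau d e\<bar> \<le> real (nn d) * y"
        using 2[OF e d, of 2] 2[OF e d, of 3] by (simp add: g_def z_def abs_le_iff)
    qed
  qed
  have gE: "good x y \<in> events"
  proof -
    have m1: "{om \<in> space M. \<bar>Z d l e om\<bar> \<le> b} \<in> events" if "e \<in> pairs p" "(d, l) \<in> obs" for e d l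
      using Zst_meas[OF that] by simp
    have m2: "(\<lambda>om. \<Sum>l=1..nn d. Ys d l e om) \<in> borel_measurable M"
       "(\<lambda>om. \<Sum>l=1..nn d. (Ys d l e om)\<^sup>2 - tau d e) \<in> borel_measurable M" if "e \<in> pairs p" "d \<in> {1, 2}" for e d
      using that by (auto intro!: borel_measurable_sum borel_measurable_diff borel_measurable_power Ys_meas simp: obs_iff)
    have m2': "Measurable.pred M (\<lambda>om. \<bar>\<Sum>l=1..nn d. Ys d l e om\<bar> \<le> real (nn d) * x \<and> \<bar>\<Sum>l=1..nn d. (Ys d l e om)\<^sup>2 - tau d e\<bar> \<le> real (nn d) * y)"
      if "e \<in> pairs p" "d \<in> {1, 2}" for e d
      using m2[OF that] by measurable
    have "Measurable.pred M (\<lambda>om. \<forall>e\<in>pairs p. (\<forall>dl\<in>obs. case dl of (d, l) \<Rightarrow> \<bar>Z d l e om\<bar> \<le> b)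
     \<and> (\<forall>d\<in>{1, 2}. \<bar>\<Sum>l=1..nn d. Ys d l e om\<bar> \<le> real (nn d) * x
        \<and> \<bar>\<Sum>l=1..nn d. (Ys d l e om)\<^sup>2 - tau d e\<bar> \<le> real (nn d) * y))"
    proof (intro pred_intros_finite pred_intros_logic finite_pairs finite_obs)
      fix e dl assume "e \<in> pairs p" "dl \<in> obs"
      thus "Measurable.pred M (\<lambda>om. case dl of (d, l) \<Rightarrow> \<bar>Z d l e om\<bar> \<le> b)"
        using m1[of e "fst dl" "snd dl"] by (cases dl) (auto simp: pred_def)
    next
      fix e and d :: nat assume "e \<in> pairs p" "d \<in> {1, 2}"
      from m2[OF this] show "Measurable.pred M (\<lambda>om. \<bar>\<Sum>l=1..nn d. Ys d l e om\<bar> \<le> real (nn d) * x)"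
        "Measurable.pred M (\<lambda>om. \<bar>\<Sum>l=1..nn d. (Ys d l e om)\<^sup>2 - tau d e\<bar> \<le> real (nn d) * y)" by measurable
    qed auto
    thus ?thesis unfolding good_def pred_def by simp
  qed
  show "good (7 * sqrt (L / nb)) (t * m4 + 6 * L / (nb * t)) \<in> events" using gE unfolding x_def y_def .
  have "1 - prob Bad = prob (space M - Bad)" using BadE by (simp add: prob_compl)
  also have "\<dots> \<le> prob (good x y)" by (intro finite_measure_mono sub gE)
  finally show "1 - (real (qnum p) * real Nn * \<pi> + 8 * real (qnum p) * exp (- 6 * L))
       \<le> prob (good (7 * sqrt (L / nb)) (t * m4 + 6 * L / (nb * t)))"
    using pB unfolding x_def y_def by linarith
qed

end

section \<open>Comparison of the test statistics with standardised sums\<close>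

lemma sum_centered_squares:
  fixes y :: "nat \<Rightarrow> real"
  assumes "0 < n"
  shows "(\<Sum>l=1..n. (y l - (\<Sum>l=1..n. y l) / real n)\<^sup>2) / real n = (\<Sum>l=1..n. (y l)\<^sup>2) / real n - ((\<Sum>l=1..n. y l) / real n)\<^sup>2"
proof -
  define S m where "S = (\<Sum>l=1..n. y l)" and "m = S / real n"
  have "(\<Sum>l=1..n. (y l - m)\<^sup>2) = (\<Sum>l=1..n. (y l)\<^sup>2) - 2 * m * S + real n * m\<^sup>2"
    unfolding S_def power2_diff by (simp add: sum.distrib sum_subtractf sum_distrib_left[symmetric] algebra_simps sum_distrib_right[symmetric])
  moreover have "S = real n * m" using assms by (simp add: m_def)
  ultimately have "(\<Sum>l=1..n. (y l - m)\<^sup>2) = (\<Sum>l=1..n. (y l)\<^sup>2) - real n * m\<^sup>2" by (simp add: power2_eq_square algebra_simps)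
  thus ?thesis using assms by (simp add: m_def S_def diff_divide_distrib)
qed

context truncated
begin

definition WL :: "nat \<times> nat \<Rightarrow> 'a \<Rightarrow> real" where "WL e om = (\<Sum>i<Nn. YL e i om)"

definition sh :: real where "sh = 3 * (\<kappa> / b) * sqrt (real Nn)"

lemma sd_le: assumes "d \<in> {1, 2}" "e \<in> pairs p"
  shows "sqrt (svar M X d e) \<le> 3 / 2 * sqrt (real Nn) * sqrt (theta e)"
proof -
  have "svar M X d e \<le> 2 * theta e * real (nn d)"
    using theta_part(2)[OF assms] nnr[of d] by (simp add: divide_le_eq)
  also have "\<dots> \<le> 2 * theta e * real Nn"
    using theta_pos[OF assms(2)] by (intro mult_left_mono) (auto simp: nsize_def Nn_def)
  also have "\<dots> \<le> (3 / 2 * sqrt (real Nn) * sqrt (theta e))\<^sup>2"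
    using theta_pos[OF assms(2)] by (simp add: power_mult_distrib power_divide field_simps)
  finally have "sqrt (svar M X d e) \<le> sqrt ((3 / 2 * sqrt (real Nn) * sqrt (theta e))\<^sup>2)" by (rule real_sqrt_le_mono)
  thus ?thesis using theta_pos[OF assms(2)] by simp
qed

lemma on_good:
  assumes w: "om \<in> good x y" and e: "e \<in> pairs p" and xy: "0 \<le> x" "y + x\<^sup>2 \<le> \<delta>" "\<delta> \<le> 1 / 4"
  defines "V \<equiv> Vhat X n1 1 om e / real n1 + Vhat X n2 2 om e / real n2"
  shows "\<bar>V - theta e\<bar> \<le> 2 * \<delta> * theta e"
    and "\<exists>u. \<bar>u\<bar> \<le> sh \<and> Sbar X n1 1 om e - Sbar X n2 2 om e = smean M X 1 e - smean M X 2 e + sqrt (theta e) * (WL e om + u)"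
    and "\<bar>WL e om\<bar> \<le> 3 * x * sqrt (real Nn)"
proof -
  define y' where "y' d = (\<Sum>l=1..nn d. Ys d l e om) / real (nn d)" for d
  define \<sigma> where "\<sigma> d = sqrt (svar M X d e)" for d
  have sp: "0 < \<sigma> d" if "d \<in> {1, 2}" for d using svar_pos[OF that e] by (simp add: \<sigma>_def)
  have th: "0 < theta e" by (rule theta_pos[OF e])
  have X: "X d l om (fst e) (snd e) = smean M X d e + \<sigma> d * (Ys d l e om + mu d e)" if "(d, l) \<in> obs" for d l
  proof -
    have "\<bar>Z d l e om\<bar> \<le> b" using w e that by (auto simp: good_def)
    hence "Ys d l e om + mu d e = Z d l e om" by (simp add: Yst_def trc_def)
    moreover have "0 < \<sigma> d" using sp that by (simp add: obs_iff)
    ultimately show ?thesis unfolding Zst_def \<sigma>_def by simp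
  qed
  have Sb: "Sbar X (nn d) d om e = smean M X d e + \<sigma> d * (y' d + mu d e)" if d: "d \<in> {1, 2}" for d
  proof -
    have "(\<Sum>l=1..nn d. X d l om (fst e) (snd e)) = (\<Sum>l=1..nn d. smean M X d e + \<sigma> d * (Ys d l e om + mu d e))"
      using d by (intro sum.cong refl X) (auto simp: obs_iff)
    also have "\<dots> = real (nn d) * smean M X d e + \<sigma> d * ((\<Sum>l=1..nn d. Ys d l e om) + real (nn d) * mu d e)"
      by (simp add: sum.distrib sum_distrib_left[symmetric])
    finally show ?thesis unfolding Sbar_def y'_def using nnr[of d] by (simp add: field_simps)
  qed
  have Vh: "Vhat X (nn d) d om e = svar M X d e * ((\<Sum>l=1..nn d. (Ys d l e om)\<^sup>2) / real (nn d) - (y' d)\<^sup>2)" if d: "d \<in> {1, 2}" for d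
  proof -
    have "(\<Sum>l=1..nn d. (X d l om (fst e) (snd e) - Sbar X (nn d) d om e)\<^sup>2) = (\<Sum>l=1..nn d. svar M X d e * (Ys d l e om - y' d)\<^sup>2)"
    proof (intro sum.cong refl)
      fix l assume "l \<in> {1..nn d}"
      hence "X d l om (fst e) (snd e) - Sbar X (nn d) d om e = \<sigma> d * (Ys d l e om - y' d)"
        using X[of d l] d unfolding Sb[OF d] by (simp add: obs_iff algebra_simps)
      thus "(X d l om (fst e) (snd e) - Sbar X (nn d) d om e)\<^sup>2 = svar M X d e * (Ys d l e om - y' d)\<^sup>2"
        using svar_pos[OF d e] by (simp add: power_mult_distrib \<sigma>_def)
    qed
    also have "\<dots> = svar M X d e * (\<Sum>l=1..nn d. (Ys d l e om - y' d)\<^sup>2)" by (simp add: sum_distrib_left)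
    finally show ?thesis unfolding Vhat_def y'_def
      using sum_centered_squares[of "nn d" "\<lambda>l. Ys d l e om"] nn_pos[of d] by (simp flip: times_divide_eq_right)
  qed
  have yb: "\<bar>y' d\<bar> \<le> x" if d: "d \<in> {1, 2}" for d
  proof -
    have "\<bar>\<Sum>l=1..nn d. Ys d l e om\<bar> \<le> real (nn d) * x" using w e d by (auto simp: good_def)
    thus ?thesis unfolding y'_def abs_divide using nnr[of d] by (simp add: divide_le_eq mult.commute)
  qed
  have Vd: "\<bar>Vhat X (nn d) d om e - svar M X d e * tau d e\<bar> \<le> svar M X d e * \<delta>" if d: "d \<in> {1, 2}" for d
  proof -
    have "\<bar>\<Sum>l=1..nn d. (Ys d l e om)\<^sup>2 - tau d e\<bar> \<le> real (nn d) * y" using w e d by (auto simp: good_def)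
    moreover have "(\<Sum>l=1..nn d. (Ys d l e om)\<^sup>2 - tau d e) = real (nn d) * ((\<Sum>l=1..nn d. (Ys d l e om)\<^sup>2) / real (nn d) - tau d e)"
      using nnr[of d] by (simp add: sum_subtractf field_simps)
    ultimately have "real (nn d) * \<bar>(\<Sum>l=1..nn d. (Ys d l e om)\<^sup>2) / real (nn d) - tau d e\<bar> \<le> real (nn d) * y"
      by (simp add: abs_mult)
    hence 1: "\<bar>(\<Sum>l=1..nn d. (Ys d l e om)\<^sup>2) / real (nn d) - tau d e\<bar> \<le> y" using nnr[of d] by (simp add: mult_le_cancel_left)
    have "\<bar>y' d\<bar>\<^sup>2 \<le> x\<^sup>2" using yb[OF d] by (intro power_mono) auto
    hence 2: "(y' d)\<^sup>2 \<le> x\<^sup>2" "0 \<le> (y' d)\<^sup>2" by auto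
    have tri: "\<bar>a - t\<bar> \<le> y \<Longrightarrow> c \<le> x\<^sup>2 \<Longrightarrow> 0 \<le> c \<Longrightarrow> y + x\<^sup>2 \<le> \<delta> \<Longrightarrow> \<bar>a - c - t\<bar> \<le> \<delta>" for a t c by (simp add: abs_le_iff)
    have "\<bar>((\<Sum>l=1..nn d. (Ys d l e om)\<^sup>2) / real (nn d) - (y' d)\<^sup>2) - tau d e\<bar> \<le> \<delta>"
      by (rule tri[OF 1 2 xy(2)])
    hence "svar M X d e * \<bar>((\<Sum>l=1..nn d. (Ys d l e om)\<^sup>2) / real (nn d) - (y' d)\<^sup>2) - tau d e\<bar> \<le> svar M X d e * \<delta>"
      using svar_pos[OF d e] by (intro mult_left_mono) auto
    thus ?thesis unfolding Vh[OF d] using svar_pos[OF d e] by (simp add: abs_mult flip: right_diff_distrib)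
  qed
  have d0: "0 \<le> \<delta>"
  proof -
    have "0 \<le> svar M X 1 e * \<delta>" using Vd[of 1] abs_ge_zero order_trans by blast
    thus ?thesis using svar_pos[of 1 e] e by (simp add: zero_le_mult_iff)
  qed
  have nnd: "nn 1 = n1" "nn 2 = n2" by (auto simp: nsize_def)
  have "\<bar>V - theta e\<bar> \<le> svar M X 1 e * \<delta> / real n1 + svar M X 2 e * \<delta> / real n2"
  proof -
    have "V - theta e = (Vhat X n1 1 om e - svar M X 1 e * tau 1 e) / real n1 + (Vhat X n2 2 om e - svar M X 2 e * tau 2 e) / real n2"
      unfolding V_def theta_def by (simp add: diff_divide_distrib)
    also have "\<bar>\<dots>\<bar> \<le> \<bar>(Vhat X n1 1 om e - svar M X 1 e * tau 1 e) / real n1\<bar> + \<bar>(Vhat X n2 2 om e - svar M X 2 e * tau 2 e) / real n2\<bar>"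
      by (rule abs_triangle_ineq)
    also have "\<dots> \<le> svar M X 1 e * \<delta> / real n1 + svar M X 2 e * \<delta> / real n2"
      using Vd[of 1] Vd[of 2] unfolding nnd abs_divide by (intro add_mono) (auto intro!: divide_right_mono)
    finally show ?thesis .
  qed
  also have "\<dots> = 2 * \<delta> * (svar M X 1 e * (1/2) / real n1 + svar M X 2 e * (1/2) / real n2)"
    by (simp add: algebra_simps)
  also have "\<dots> \<le> 2 * \<delta> * theta e"
    unfolding theta_def using d0 svar_pos[of 1 e] svar_pos[of 2 e] tau_bounds(3)[of 1 e] tau_bounds(3)[of 2 e] e
    by (intro mult_left_mono add_mono divide_right_mono) auto
  finally show "\<bar>V - theta e\<bar> \<le> 2 * \<delta> * theta e" .
  have W: "sqrt (theta e) * WL e om = \<sigma> 1 * y' 1 - \<sigma> 2 * y' 2"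
  proof -
    have "WL e om = (\<Sum>l=1..n1. aw 1 e * Ys 1 l e om) + (\<Sum>l=1..n2. - (aw 2 e) * Ys 2 l e om)"
      unfolding WL_def YL_def using sum_oi[of "\<lambda>z. sg (fst z) * aw (fst z) e * Ys (fst z) (snd z) e om"] by (simp add: sg_def)
    also have "\<dots> = aw 1 e * (\<Sum>l=1..n1. Ys 1 l e om) - aw 2 e * (\<Sum>l=1..n2. Ys 2 l e om)"
      by (simp add: sum_distrib_left[symmetric] sum_negf)
    finally show ?thesis unfolding aw_def y'_def \<sigma>_def nnd using th n_real by (simp add: field_simps)
  qed
  define u where "u = (\<sigma> 1 * mu 1 e - \<sigma> 2 * mu 2 e) / sqrt (theta e)"
  have su: "sqrt (theta e) * u = \<sigma> 1 * mu 1 e - \<sigma> 2 * mu 2 e" unfolding u_def using th by simp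
  have "Sbar X n1 1 om e - Sbar X n2 2 om e = smean M X 1 e - smean M X 2 e + sqrt (theta e) * (WL e om + u)"
    unfolding distrib_left W su using Sb[of 1] Sb[of 2] unfolding nnd by (simp add: algebra_simps)
  moreover have "\<bar>u\<bar> \<le> sh"
  proof -
    have kb: "0 \<le> \<kappa> / b" using b chi by simp
    have "\<bar>\<sigma> 1 * mu 1 e - \<sigma> 2 * mu 2 e\<bar> \<le> \<bar>\<sigma> 1 * mu 1 e\<bar> + \<bar>\<sigma> 2 * mu 2 e\<bar>" by (rule abs_triangle_ineq4)
    also have "\<dots> \<le> (3 / 2 * sqrt (real Nn) * sqrt (theta e)) * (\<kappa> / b) + (3 / 2 * sqrt (real Nn) * sqrt (theta e)) * (\<kappa> / b)"
      unfolding abs_mult \<sigma>_def using sd_le[of 1 e] sd_le[of 2 e] e trunc_moment(4)[of 1 e] trunc_moment(4)[of 2 e] th kb svar_pos[of 1 e] svar_pos[of 2 e]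
      by (intro add_mono mult_mono) auto
    also have "\<dots> = sqrt (theta e) * sh" by (simp add: sh_def)
    finally show ?thesis unfolding su[symmetric] using th by (simp add: abs_mult)
  qed
  ultimately show "\<exists>u. \<bar>u\<bar> \<le> sh \<and> Sbar X n1 1 om e - Sbar X n2 2 om e = smean M X 1 e - smean M X 2 e + sqrt (theta e) * (WL e om + u)"
    by blast
  have "sqrt (theta e) * \<bar>WL e om\<bar> = \<bar>\<sigma> 1 * y' 1 - \<sigma> 2 * y' 2\<bar>" unfolding W[symmetric] using th by (simp add: abs_mult)
  also have "\<dots> \<le> \<bar>\<sigma> 1 * y' 1\<bar> + \<bar>\<sigma> 2 * y' 2\<bar>" by (rule abs_triangle_ineq4)
  also have "\<dots> \<le> (3 / 2 * sqrt (real Nn) * sqrt (theta e)) * x + (3 / 2 * sqrt (real Nn) * sqrt (theta e)) * x"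
    unfolding abs_mult \<sigma>_def using sd_le[of 1 e] sd_le[of 2 e] e yb[of 1] yb[of 2] th svar_pos[of 1 e] svar_pos[of 2 e]
    by (intro add_mono mult_mono) auto
  also have "\<dots> = sqrt (theta e) * (3 * x * sqrt (real Nn))" by simp
  finally show "\<bar>WL e om\<bar> \<le> 3 * x * sqrt (real Nn)" using th by simp
qed

lemma null_comparison:
  assumes w: "om \<in> good x y" and e: "e \<in> H0 M X p" and xy: "0 \<le> x" "y + x\<^sup>2 \<le> \<delta>" "\<delta> \<le> 1 / 4"
    and h: "0 \<le> h"
  shows "h + 2 * \<delta> * h + sh \<le> \<bar>WL e om\<bar> \<Longrightarrow> h \<le> \<bar>Tstat X n1 n2 om e\<bar>"
    and "h \<le> \<bar>Tstat X n1 n2 om e\<bar> \<Longrightarrow> h - 2 * \<delta> * h - sh \<le> \<bar>WL e om\<bar>"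
proof -
  have ep: "e \<in> pairs p" and eq: "smean M X 1 e = smean M X 2 e" using e by (auto simp: H0_def)
  define V where "V = Vhat X n1 1 om e / real n1 + Vhat X n2 2 om e / real n2"
  note G = on_good[OF w ep xy, folded V_def]
  have th: "0 < theta e" by (rule theta_pos[OF ep])
  define \<rho> where "\<rho> = V / theta e"
  have d0: "0 \<le> \<delta>"
  proof -
    have "0 \<le> 2 * \<delta> * theta e" using G(1) abs_ge_zero order_trans by blast
    thus ?thesis using th by (simp add: zero_le_mult_iff)
  qed
  have "\<bar>\<rho> - 1\<bar> = \<bar>V - theta e\<bar> / theta e"
  proof -
    have "\<rho> - 1 = (V - theta e) / theta e" unfolding \<rho>_def using th by (simp add: diff_divide_distrib)
    thus ?thesis using th by (simp add: abs_divide)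
  qed
  also have "\<dots> \<le> 2 * \<delta>" using G(1) th by (simp add: divide_le_eq)
  finally have r: "1 - 2 * \<delta> \<le> \<rho>" "\<rho> \<le> 1 + 2 * \<delta>" by (auto simp: abs_le_iff)
  hence rp: "0 < \<rho>" using xy by simp
  obtain u where u: "\<bar>u\<bar> \<le> sh" "Sbar X n1 1 om e - Sbar X n2 2 om e = sqrt (theta e) * (WL e om + u)"
    using G(2) eq by auto
  have "sqrt V = sqrt (theta e) * sqrt \<rho>" unfolding \<rho>_def using th by (simp add: real_sqrt_mult[symmetric])
  hence T: "Tstat X n1 n2 om e = (WL e om + u) / sqrt \<rho>"
    unfolding Tstat_def V_def[symmetric] u(2) using th by simp
  have absT: "\<bar>Tstat X n1 n2 om e\<bar> = \<bar>WL e om + u\<bar> / sqrt \<rho>" unfolding T using rp by simp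
  have s1: "sqrt \<rho> \<le> 1 + 2 * \<delta>"
  proof -
    have "\<rho> \<le> (1 + 2 * \<delta>)\<^sup>2" using r d0 by (simp add: power2_eq_square algebra_simps) (smt (verit) mult_nonneg_nonneg)
    thus ?thesis using d0 by (intro real_le_lsqrt) auto
  qed
  have s2: "1 - 2 * \<delta> \<le> sqrt \<rho>"
  proof -
    have "(1 - 2 * \<delta>)\<^sup>2 \<le> 1 - 2 * \<delta>" using d0 xy by (simp add: power2_eq_square mult_left_le)
    thus ?thesis using r by (intro real_le_rsqrt) auto
  qed
  show "h \<le> \<bar>Tstat X n1 n2 om e\<bar>" if "h + 2 * \<delta> * h + sh \<le> \<bar>WL e om\<bar>"
  proof -
    have "h * sqrt \<rho> \<le> h * (1 + 2 * \<delta>)" using h s1 by (intro mult_left_mono)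
    also have "\<dots> \<le> \<bar>WL e om + u\<bar>" using that u(1) by (simp add: algebra_simps)
    finally show ?thesis unfolding absT using rp by (simp add: le_divide_eq)
  qed
  show "h - 2 * \<delta> * h - sh \<le> \<bar>WL e om\<bar>" if "h \<le> \<bar>Tstat X n1 n2 om e\<bar>"
  proof -
    have "h * (1 - 2 * \<delta>) \<le> h * sqrt \<rho>" using h s2 by (intro mult_left_mono)
    also have "\<dots> \<le> \<bar>WL e om + u\<bar>" using that rp unfolding absT by (simp add: le_divide_eq)
    also have "\<dots> \<le> \<bar>WL e om\<bar> + sh" using u(1) by linarith
    finally show ?thesis by (simp add: algebra_simps)
  qed
qed

lemma alternative_large:
  assumes w: "om \<in> good x y" and e: "e \<in> Sset M X p n1 n2 \<rho>" and xy: "0 \<le> x" "y + x\<^sup>2 \<le> \<delta>" "\<delta> \<le> 1 / 4"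
  shows "(ln (real (qnum p)) powr (1 / 2 + \<rho>) - 3 * x * sqrt (real Nn) - sh) / 2 \<le> \<bar>Tstat X n1 n2 om e\<bar>"
proof (cases "ln (real (qnum p)) powr (1 / 2 + \<rho>) - 3 * x * sqrt (real Nn) - sh \<le> 0")
  case True
  thus ?thesis by (smt (verit) abs_ge_zero divide_nonpos_pos)
next
  case False
  define A where "A = ln (real (qnum p)) powr (1 / 2 + \<rho>)"
  have ep: "e \<in> pairs p" using e by (auto simp: Sset_def)
  define v where "v = svar M X 1 e / real n1 + svar M X 2 e / real n2"
  define V where "V = Vhat X n1 1 om e / real n1 + Vhat X n2 2 om e / real n2"
  note G = on_good[OF w ep xy, folded V_def]
  have th: "0 < theta e" by (rule theta_pos[OF ep])
  have thv: "theta e \<le> v"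
    unfolding theta_def v_def using svar_pos[of 1 e] svar_pos[of 2 e] tau_bounds(1)[of 1 e] tau_bounds(1)[of 2 e] ep
    by (intro add_mono divide_right_mono) (auto simp: mult_left_le)
  have v: "0 < v" using th thv by simp
  obtain u where u: "\<bar>u\<bar> \<le> sh" "Sbar X n1 1 om e - Sbar X n2 2 om e = smean M X 1 e - smean M X 2 e + sqrt (theta e) * (WL e om + u)"
    using G(2) by auto
  have A: "A * sqrt v \<le> \<bar>smean M X 1 e - smean M X 2 e\<bar>"
    using e v unfolding Sset_def A_def v_def by (simp add: le_divide_eq)
  have "\<bar>sqrt (theta e) * (WL e om + u)\<bar> \<le> sqrt v * (3 * x * sqrt (real Nn) + sh)"
    unfolding abs_mult using thv th G(3) u(1) by (intro mult_mono) auto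
  hence "A * sqrt v - sqrt v * (3 * x * sqrt (real Nn) + sh) \<le> \<bar>Sbar X n1 1 om e - Sbar X n2 2 om e\<bar>"
    unfolding u(2) using A by linarith
  hence num: "sqrt v * (A - 3 * x * sqrt (real Nn) - sh) \<le> \<bar>Sbar X n1 1 om e - Sbar X n2 2 om e\<bar>"
    by (simp add: algebra_simps)
  have dth: "2 * \<delta> * theta e \<le> 1 / 2 * theta e" using xy(3) th by (intro mult_right_mono) auto
  have V: "0 < V" "V \<le> 4 * v" using G(1) dth th thv unfolding abs_le_iff by linarith+
  have sV: "sqrt V \<le> 2 * sqrt v" using real_sqrt_le_mono[OF V(2)] by (simp add: real_sqrt_mult)
  define B where "B = A - 3 * x * sqrt (real Nn) - sh"
  have B: "0 < B" using False by (simp add: B_def A_def)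
  have "B / 2 * sqrt V \<le> B / 2 * (2 * sqrt v)" using B sV by (intro mult_left_mono) auto
  also have "\<dots> = sqrt v * B" by simp
  also have "\<dots> \<le> \<bar>Sbar X n1 1 om e - Sbar X n2 2 om e\<bar>" using num by (simp add: B_def)
  finally have "B / 2 \<le> \<bar>Sbar X n1 1 om e - Sbar X n2 2 om e\<bar> / sqrt V" using V by (simp add: pos_le_divide_eq)
  moreover have "\<bar>Tstat X n1 n2 om e\<bar> = \<bar>Sbar X n1 1 om e - Sbar X n2 2 om e\<bar> / sqrt V"
    unfolding Tstat_def V_def[symmetric] using V by simp
  ultimately show ?thesis by (simp add: B_def A_def)
qed

lemma Tstat_measurable: "e \<in> pairs p \<Longrightarrow> (\<lambda>om. Tstat X n1 n2 om e) \<in> borel_measurable M"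
proof -
  assume e: "e \<in> pairs p"
  have [measurable]: "(\<lambda>om. Sbar X (nn d) d om e) \<in> borel_measurable M" if "d \<in> {1, 2}" for d
    unfolding Sbar_def using that e by (auto intro!: borel_measurable_divide borel_measurable_sum X_meas simp: obs_iff)
  have Vm: "(\<lambda>om. Vhat X (nn d) d om e) \<in> borel_measurable M" if "d \<in> {1, 2}" for d
    unfolding Vhat_def using that e
    by (auto intro!: borel_measurable_divide borel_measurable_sum borel_measurable_power borel_measurable_diff X_meas simp: obs_iff)
  have nnd: "nn 1 = n1" "nn 2 = n2" by (auto simp: nsize_def)
  have [measurable]: "(\<lambda>om. Sbar X n1 1 om e) \<in> borel_measurable M" "(\<lambda>om. Sbar X n2 2 om e) \<in> borel_measurable M"
    "(\<lambda>om. Vhat X n1 1 om e) \<in> borel_measurable M" "(\<lambda>om. Vhat X n2 2 om e) \<in> borel_measurable M"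
    using \<open>\<And>d. d \<in> {1, 2} \<Longrightarrow> (\<lambda>om. Sbar X (nn d) d om e) \<in> borel_measurable M\<close>[of 1]
      \<open>\<And>d. d \<in> {1, 2} \<Longrightarrow> (\<lambda>om. Sbar X (nn d) d om e) \<in> borel_measurable M\<close>[of 2] Vm[of 1] Vm[of 2]
    unfolding nnd by auto
  show ?thesis unfolding Tstat_def by measurable
qed

end

lemma fdp_ratio_bounds:
  fixes W :: "nat \<times> nat \<Rightarrow> real"
  assumes q: "1 \<le> qnum p" and al: "0 < \<alpha>" "\<alpha> < 1" and N: "N \<subseteq> pairs p" "N \<noteq> {}"
    and cap: "cap = sqrt (2 * ln (real (qnum p)))"
    and S: "S \<subseteq> pairs p" "\<And>e. e \<in> S \<Longrightarrow> cap \<le> \<bar>T e\<bar>" "A \<le> real (card S)" "2 \<le> \<alpha> * A"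
    and t0: "0 \<le> t0" "real (qnum p) * Gt t0 = \<alpha> * A"
    and tau: "0 \<le> \<tau>" "\<tau> \<le> 1"
    and up: "\<And>e h. e \<in> N \<Longrightarrow> 0 \<le> h \<Longrightarrow> h \<le> cap \<Longrightarrow> h + \<tau> \<le> \<bar>W e\<bar> \<Longrightarrow> h \<le> \<bar>T e\<bar>"
    and dn: "\<And>e h. e \<in> N \<Longrightarrow> 0 \<le> h \<Longrightarrow> h \<le> cap \<Longrightarrow> h \<le> \<bar>T e\<bar> \<Longrightarrow> h - \<tau> \<le> \<bar>W e\<bar>"
    and Z: "\<And>h. 0 \<le> h \<Longrightarrow> h \<le> t0 + \<tau> \<Longrightarrow> lo * (real (card N) * Gt h) \<le> real (card {e \<in> N. h \<le> \<bar>W e\<bar>})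
       \<and> real (card {e \<in> N. h \<le> \<bar>W e\<bar>}) \<le> hi * (real (card N) * Gt h)"
    and lohi: "0 \<le> lo" "1 \<le> hi"
  defines "u \<equiv> 5 * \<tau> * (2 + cap)"
  shows "lo * exp (- u) \<le> FDP p N \<alpha> T / (\<alpha> * real (card N) / real (qnum p))"
    and "FDP p N \<alpha> T / (\<alpha> * real (card N) / real (qnum p)) \<le> hi * exp u"
proof -
  have fN: "finite N" by (rule finite_subset[OF N(1) finite_pairs])
  define q0 where "q0 = real (card N)"
  have q0: "0 < q0" unfolding q0_def using fN N by (simp add: card_gt_0_iff)
  have Q: "0 < real (qnum p)" using q by simp
  have cap0: "0 \<le> cap" unfolding cap using q by simp
  have "card S \<le> Rcnt (pairs p) T cap" unfolding Rcnt_def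
    using S finite_pairs[of p] by (intro card_mono) auto
  hence RA: "A \<le> real (Rcnt (pairs p) T cap)" using S(3) by linarith
  have "real (qnum p) * Gt cap \<le> real (qnum p) * (2 * exp (- cap\<^sup>2 / 2))"
    using Q cap0 by (intro mult_left_mono Gt_le_exp) auto
  also have "\<dots> = 2" unfolding cap using q by (simp add: exp_minus)
  also have "\<dots> \<le> \<alpha> * max (real (Rcnt (pairs p) T cap)) 1"
    using S(4) mult_left_mono[OF RA, of \<alpha>] al by (smt (verit) mult_left_mono max.cobounded1)
  finally have "cap \<in> Bset p \<alpha> T"
    using cap0 by (simp add: Bset_def[OF q al] FDPhat_le_iff[OF q al] cap)
  hence ne: "Bset p \<alpha> T \<noteq> {}" by auto
  define h where "h = hhat p \<alpha> T"
  have h: "0 \<le> h" "h \<le> cap" "real (qnum p) * Gt h = \<alpha> * max (real (Rcnt (pairs p) T h)) 1"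
    using hhat_identity[OF q al ne] unfolding h_def cap by auto
  have "real (Rcnt (pairs p) T cap) \<le> real (Rcnt (pairs p) T h)"
    using Rcnt_antimono[OF finite_pairs h(2)] by simp
  hence "\<alpha> * A \<le> \<alpha> * max (real (Rcnt (pairs p) T h)) 1" using RA al by (intro mult_left_mono) auto
  hence "real (qnum p) * Gt t0 \<le> real (qnum p) * Gt h" using t0(2) h(3) by simp
  hence ht: "h \<le> t0" using Q by (simp add: Gt_le_iff)
  define r where "r = real (Rcnt N T h)"
  have ratio: "FDP p N \<alpha> T / (\<alpha> * real (card N) / real (qnum p)) = r / (q0 * Gt h)"
  proof -
    define m where "m = max (real (Rcnt (pairs p) T h)) 1"
    have m: "0 < m" unfolding m_def by simp
    have "Gt h = \<alpha> * m / real (qnum p)" using h(3) Q by (simp add: m_def field_simps)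
    thus ?thesis unfolding FDP_def h_def[symmetric] m_def[symmetric] r_def q0_def using Q al m by simp
  qed
  have G: "0 < Gt h" by (rule Gt_pos)
  have qG: "0 < q0 * Gt h" using q0 G by simp
  have u1: "5 * \<tau> * (1 + h) \<le> u" "5 * \<tau> * (1 + (h + \<tau>)) \<le> u"
    unfolding u_def using tau h cap0 by (intro mult_left_mono; simp)+
  have "r \<le> hi * exp u * (q0 * Gt h)"
  proof (cases "\<tau> \<le> h")
    case True
    have "r \<le> real (card {e \<in> N. h - \<tau> \<le> \<bar>W e\<bar>})"
      unfolding r_def Rcnt_def using fN dn h by (auto intro!: card_mono)
    also have "\<dots> \<le> hi * (q0 * Gt (h - \<tau>))" unfolding q0_def using Z[of "h - \<tau>"] True ht tau by auto
    also have "\<dots> \<le> hi * (q0 * (Gt h * exp (5 * \<tau> * (1 + h))))"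
      using lohi q0 tau h by (intro mult_left_mono Gt_shift) auto
    also have "\<dots> \<le> hi * (q0 * (Gt h * exp u))"
      using lohi q0 G u1 by (intro mult_left_mono) auto
    finally show ?thesis by (simp add: mult_ac)
  next
    case False
    have "r \<le> q0" unfolding r_def q0_def using Rcnt_le[OF fN] by simp
    also have "q0 = 1 * (q0 * Gt (h - h))" by (simp add: Gt_0)
    also have "\<dots> \<le> hi * (q0 * (Gt h * exp (5 * h * (1 + h))))"
      using lohi q0 h by (intro mult_mono mult_left_mono Gt_shift) (auto simp: Gt_0)
    also have "\<dots> \<le> hi * (q0 * (Gt h * exp u))"
    proof -
      have "5 * h * (1 + h) \<le> 5 * \<tau> * (1 + h)" using False h by (intro mult_right_mono) auto
      hence "5 * h * (1 + h) \<le> u" using u1 by linarith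
      thus ?thesis using lohi q0 G by (intro mult_left_mono) auto
    qed
    finally show ?thesis by (simp add: mult_ac)
  qed
  thus "FDP p N \<alpha> T / (\<alpha> * real (card N) / real (qnum p)) \<le> hi * exp u"
    unfolding ratio using qG by (simp add: pos_divide_le_eq)
  have "Gt h \<le> Gt (h + \<tau>) * exp (5 * \<tau> * (1 + (h + \<tau>)))" using Gt_shift[of \<tau> "h + \<tau>"] tau h by simp
  also have "\<dots> \<le> Gt (h + \<tau>) * exp u" using u1 Gt_pos[of "h + \<tau>"] by (intro mult_left_mono) auto
  finally have Gl: "Gt h * exp (- u) \<le> Gt (h + \<tau>)" by (simp add: exp_minus field_simps)
  have "lo * exp (- u) * (q0 * Gt h) = lo * (q0 * (Gt h * exp (- u)))" by (simp add: mult_ac)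
  also have "\<dots> \<le> lo * (q0 * Gt (h + \<tau>))" using lohi q0 Gl by (intro mult_left_mono) auto
  also have "\<dots> \<le> real (card {e \<in> N. h + \<tau> \<le> \<bar>W e\<bar>})" unfolding q0_def using Z[of "h + \<tau>"] ht tau h by auto
  also have "\<dots> \<le> r" unfolding r_def Rcnt_def using fN up h by (auto intro!: card_mono)
  finally show "lo * exp (- u) \<le> FDP p N \<alpha> T / (\<alpha> * real (card N) / real (qnum p))"
    unfolding ratio using qG by (simp add: pos_le_divide_eq)
qed

context truncated
begin

lemma fdp_concentration:
  fixes \<alpha> L t A t0 H w r m bb \<eta> \<rho> \<rho>0 \<pi> :: real
  defines "bd \<equiv> 4 * b / sqrt nb" and "\<beta> \<equiv> 4 * m3 / sqrt nb"
    and "x \<equiv> 7 * sqrt (L / nb)" and "y \<equiv> t * m4 + 6 * L / (nb * t)"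
  defines "\<delta> \<equiv> y + x\<^sup>2"
  defines "\<tau> \<equiv> 2 * \<delta> * sqrt (2 * L) + sh"
  assumes L: "L = ln (real (qnum p))" "0 < L" and q: "1 \<le> qnum p" and al: "0 < \<alpha>" "\<alpha> < 1"
    and Lb: "2 * b * sqrt (L / nb) \<le> 1" and t: "0 < t" "4 * b\<^sup>2 * t \<le> 1"
    and tail: "\<And>d l e. (d, l) \<in> obs \<Longrightarrow> e \<in> pairs p \<Longrightarrow> prob {om \<in> space M. b < \<bar>Z d l e om\<bar>} \<le> \<pi>"
    and H: "8 \<le> H" and w: "0 < w" "4 * w \<le> 1 / H" "10 * w \<le> 1"
    and bd: "bd \<le> 1 / H" "bd * (H + 2 / w) \<le> 1" "4 * H * bd \<le> 1" and rho: "0 \<le> \<rho>0"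
    and gm: "gam \<beta> \<rho>0 H w \<le> 1 / 2"
    and dl: "\<delta> \<le> 1 / 4" "\<tau> \<le> 1"
    and alt: "2 * sqrt (2 * L) \<le> L powr (1 / 2 + \<rho>) - 3 * x * sqrt (real Nn) - sh"
    and S: "A \<le> real (card (Sset M X p n1 n2 \<rho>))" "2 \<le> \<alpha> * A"
    and t0: "0 \<le> t0" "real (qnum p) * Gt t0 = \<alpha> * A"
    and null: "H0 M X p \<noteq> {}"
    and r: "0 \<le> r" "\<And>e e'. e \<in> H0 M X p \<Longrightarrow> e' \<in> H0 M X p \<Longrightarrow> e \<noteq> e' \<Longrightarrow> RL e e' \<le> r"
    and m: "\<And>e. e \<in> H0 M X p \<Longrightarrow> real (card {e' \<in> H0 M X p. e' \<noteq> e \<and> \<rho>0 < RL e e'}) \<le> m"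
    and eta: "0 < \<eta>" "\<eta> < 1" and tH: "2 * Gt (H - 1) \<le> Gt (t0 + \<tau>)"
    and bb: "\<And>h. 0 \<le> h \<Longrightarrow> Gt (t0 + \<tau>) \<le> 2 * Gt h \<Longrightarrow>
       m * (4 * exp (- (h\<^sup>2 / (1 + r)) * (1 - 2 * H * bd))) / (real (card (H0 M X p)) * (Gt h)\<^sup>2) \<le> bb"
  shows "\<exists>D\<in>events. prob D \<le> real (qnum p) * real Nn * \<pi> + 8 * real (qnum p) * exp (- 6 * L)
       + (2 / (real (card (H0 M X p)) * Gt (t0 + \<tau>)) * (4 / \<eta>)
         + (ln (1 / Gt (t0 + \<tau>)) / ln (1 + \<eta>) + 2) * (6 * gam \<beta> \<rho>0 H w + bb)) / \<eta>\<^sup>2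
     \<and> (\<forall>om\<in>space M - D.
         (1 - \<eta>) / (1 + \<eta>) * exp (- (5 * \<tau> * (2 + sqrt (2 * L))))
           \<le> FDP p (H0 M X p) \<alpha> (Tstat X n1 n2 om) / (\<alpha> * real (card (H0 M X p)) / real (qnum p))
       \<and> FDP p (H0 M X p) \<alpha> (Tstat X n1 n2 om) / (\<alpha> * real (card (H0 M X p)) / real (qnum p))
           \<le> (1 + \<eta>)\<^sup>2 * exp (5 * \<tau> * (2 + sqrt (2 * L))))"
proof -
  define E where "E = H0 M X p"
  have E: "E \<subseteq> pairs p" unfolding E_def H0_def by auto
  interpret ls: linear_stats M E Nn YL sL RL bd \<beta> \<rho>0 H w
    by (rule linear_stats_inst[OF E H w _ bd rho _ gm]) (simp_all add: bd_def \<beta>_def)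
  have x0: "0 \<le> x" unfolding x_def using L nb by simp
  have m40: "0 \<le> m4"
  proof -
    obtain e where "e \<in> pairs p" using null E_def E by blast
    thus ?thesis using m4[of 1 e] by (intro order_trans[OF Bochner_Integration.integral_nonneg m4]) auto
  qed
  have sh0: "0 \<le> sh" unfolding sh_def using b chi by simp
  have y0: "0 \<le> y" unfolding y_def using m40 t L nb by simp
  have d0: "0 \<le> \<delta>" unfolding \<delta>_def using y0 by simp
  have tau0: "0 \<le> \<tau>" unfolding \<tau>_def using d0 sh0 L by simp
  have tp: "0 \<le> t0 + \<tau>" using t0 tau0 by simp
  obtain D where D: "D \<in> events" and pD: "prob D \<le> (2 / (real (card E) * Gt (t0 + \<tau>)) * (4 / \<eta>)
         + (ln (1 / Gt (t0 + \<tau>)) / ln (1 + \<eta>) + 2) * (6 * gam \<beta> \<rho>0 H w + bb)) / \<eta>\<^sup>2"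
    and Dz: "\<And>om h. om \<in> space M - D \<Longrightarrow> 0 \<le> h \<Longrightarrow> h \<le> t0 + \<tau> \<Longrightarrow>
      (1 - \<eta>) / (1 + \<eta>) * (real (card E) * Gt h) \<le> ls.Zc h om \<and> ls.Zc h om \<le> (1 + \<eta>)\<^sup>2 * (real (card E) * Gt h)"
    using ls.uniform_count[OF r(1) r(2)[folded E_def] m[folded E_def] null[folded E_def] eta tp tH bb[folded E_def]] by blast
  have gE: "good x y \<in> events" and gp: "1 - (real (qnum p) * real Nn * \<pi> + 8 * real (qnum p) * exp (- 6 * L)) \<le> prob (good x y)"
    unfolding x_def y_def by (rule good_prob[OF L(2) Lb t tail]; assumption)+
  define D' where "D' = (space M - good x y) \<union> D"
  have D': "D' \<in> events" unfolding D'_def using D gE by auto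
  have "prob D' \<le> prob (space M - good x y) + prob D" unfolding D'_def using D gE by (intro measure_Un_le) auto
  also have "prob (space M - good x y) = 1 - prob (good x y)" using gE by (rule prob_compl)
  finally have pD': "prob D' \<le> real (qnum p) * real Nn * \<pi> + 8 * real (qnum p) * exp (- 6 * L)
       + (2 / (real (card E) * Gt (t0 + \<tau>)) * (4 / \<eta>)
         + (ln (1 / Gt (t0 + \<tau>)) / ln (1 + \<eta>) + 2) * (6 * gam \<beta> \<rho>0 H w + bb)) / \<eta>\<^sup>2"
    using gp pD by linarith
  have ratio: "(1 - \<eta>) / (1 + \<eta>) * exp (- (5 * \<tau> * (2 + sqrt (2 * L))))
           \<le> FDP p E \<alpha> (Tstat X n1 n2 om) / (\<alpha> * real (card E) / real (qnum p))
       \<and> FDP p E \<alpha> (Tstat X n1 n2 om) / (\<alpha> * real (card E) / real (qnum p))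
           \<le> (1 + \<eta>)\<^sup>2 * exp (5 * \<tau> * (2 + sqrt (2 * L)))" if w: "om \<in> space M - D'" for om
  proof -
    have wg: "om \<in> good x y" and wD: "om \<in> space M - D" using w by (auto simp: D'_def)
    have xy: "0 \<le> x" "y + x\<^sup>2 \<le> \<delta>" "\<delta> \<le> 1 / 4" using x0 dl by (auto simp: \<delta>_def)
    have tle: "2 * \<delta> * h + sh \<le> \<tau>" if "0 \<le> h" "h \<le> sqrt (2 * L)" for h
      unfolding \<tau>_def using that d0 by (intro add_right_mono mult_left_mono) auto
    have ZW: "ls.Zc h om = real (card {e \<in> E. h \<le> \<bar>WL e om\<bar>})" for h
      unfolding ls.Zc_def ls.W_def WL_def ..
    have capL: "sqrt (2 * L) = sqrt (2 * ln (real (qnum p)))" using L by simp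
    show ?thesis
    proof (rule conjI)
      note args = fdp_ratio_bounds[OF q al E null[folded E_def] capL, where S = "Sset M X p n1 n2 \<rho>" and T = "Tstat X n1 n2 om" and A = A
          and ?t0.0 = t0 and \<tau> = \<tau> and W = "\<lambda>e. WL e om" and lo = "(1 - \<eta>) / (1 + \<eta>)" and hi = "(1 + \<eta>)\<^sup>2"]
      have 1: "Sset M X p n1 n2 \<rho> \<subseteq> pairs p" by (auto simp: Sset_def)
      have 2: "sqrt (2 * L) \<le> \<bar>Tstat X n1 n2 om e\<bar>" if "e \<in> Sset M X p n1 n2 \<rho>" for e
      proof -
        have "sqrt (2 * L) \<le> (L powr (1 / 2 + \<rho>) - 3 * x * sqrt (real Nn) - sh) / 2"
          using alt by (simp add: pos_le_divide_eq mult.commute)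
        also have "\<dots> \<le> \<bar>Tstat X n1 n2 om e\<bar>" using alternative_large[OF wg that xy] unfolding L(1)[symmetric] .
        finally show ?thesis .
      qed
      have 3: "h \<le> \<bar>Tstat X n1 n2 om e\<bar>" if "e \<in> E" "0 \<le> h" "h \<le> sqrt (2 * L)" "h + \<tau> \<le> \<bar>WL e om\<bar>" for e h
        using null_comparison(1)[OF wg that(1)[unfolded E_def] xy that(2)] tle[OF that(2,3)] that(4) by linarith
      have 4: "h - \<tau> \<le> \<bar>WL e om\<bar>" if "e \<in> E" "0 \<le> h" "h \<le> sqrt (2 * L)" "h \<le> \<bar>Tstat X n1 n2 om e\<bar>" for e h
        using null_comparison(2)[OF wg that(1)[unfolded E_def] xy that(2) that(4)] tle[OF that(2,3)] by linarith
      have 5: "(1 - \<eta>) / (1 + \<eta>) * (real (card E) * Gt h) \<le> real (card {e \<in> E. h \<le> \<bar>WL e om\<bar>})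
        \<and> real (card {e \<in> E. h \<le> \<bar>WL e om\<bar>}) \<le> (1 + \<eta>)\<^sup>2 * (real (card E) * Gt h)" if "0 \<le> h" "h \<le> t0 + \<tau>" for h
        using Dz[OF wD that] unfolding ZW .
      have 6: "0 \<le> (1 - \<eta>) / (1 + \<eta>)" "1 \<le> (1 + \<eta>)\<^sup>2" using eta by (auto simp: one_le_power)
      show "(1 - \<eta>) / (1 + \<eta>) * exp (- (5 * \<tau> * (2 + sqrt (2 * L))))
           \<le> FDP p E \<alpha> (Tstat X n1 n2 om) / (\<alpha> * real (card E) / real (qnum p))"
        by (rule args(1)[OF 1 2 S t0 tau0 dl(2) 3 4 5 6])
      show "FDP p E \<alpha> (Tstat X n1 n2 om) / (\<alpha> * real (card E) / real (qnum p))
           \<le> (1 + \<eta>)\<^sup>2 * exp (5 * \<tau> * (2 + sqrt (2 * L)))"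
        by (rule args(2)[OF 1 2 S t0 tau0 dl(2) 3 4 5 6])
    qed
  qed
  show ?thesis using D' pD' ratio unfolding E_def[symmetric] by blast
qed

end

section \<open>Asymptotics\<close>

lemma div_le_of_le_sq: "a \<le> z\<^sup>2 \<Longrightarrow> 0 < z \<Longrightarrow> a / z \<le> z" for a z :: real
  by (simp add: divide_le_eq power2_eq_square)

locale fdp_asymptotics =
  fixes M :: "nat \<Rightarrow> 'a measure"
    and X :: "nat \<Rightarrow> nat \<Rightarrow> nat \<Rightarrow> 'a \<Rightarrow> nat \<Rightarrow> nat \<Rightarrow> real"
    and p n1 n2 :: "nat \<Rightarrow> nat"
    and \<alpha> r \<xi> \<nu> c1 c2 \<rho> Cn :: real
    and b ka m3 m4 t \<pi> :: "nat \<Rightarrow> real"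
  assumes lim_q: "filterlim (\<lambda>k. qnum (p k)) at_top sequentially"
    and alpha: "0 < \<alpha>" "\<alpha> < 1"
    and A2: "0 < r" "r < 1"
      "\<And>k d e e'. d \<in> {1, 2} \<Longrightarrow> e \<in> pairs (p k) \<Longrightarrow> e' \<in> pairs (p k) \<Longrightarrow> e \<noteq> e' \<Longrightarrow>
          \<bar>rcorr (M k) (X k) d e e'\<bar> < r"
    and B1: "0 < c2" "0 < \<rho>" "\<And>k. c2 * sqrt (ln (real (qnum (p k)))) \<le> real (card (Sset (M k) (X k) (p k) (n1 k) (n2 k) \<rho>))"
    and B2: "0 < \<xi>" "0 < \<nu>" "\<nu> < (1 - r) / (1 + r)"
      "(\<lambda>k. Max ((\<lambda>e. real (card (Aset (M k) (X k) (p k) \<xi> e))) ` pairs (p k))) \<in> o(\<lambda>k. real (qnum (p k)) powr \<nu>)"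
    and B3: "0 < c1" "\<And>k. c1 * real (qnum (p k)) \<le> real (card (H0 (M k) (X k) (p k)))"
    and trunc: "\<forall>\<^sub>F k in sequentially. truncated (M k) (X k) (p k) (n1 k) (n2 k) (b k) (ka k) (m3 k) (m4 k)
        (real (n1 k) * real (n2 k) / real (n1 k + n2 k))"
    and tail: "\<forall>\<^sub>F k in sequentially. \<forall>d l e. (d, l) \<in> obs_index (n1 k) (n2 k) \<longrightarrow> e \<in> pairs (p k) \<longrightarrow>
        measure (M k) {om \<in> space (M k). b k < \<bar>Zst (M k) (X k) d l e om\<bar>} \<le> \<pi> k"
    and nbd: "\<forall>\<^sub>F k in sequentially. real (n1 k + n2 k) \<le> Cn * (real (n1 k) * real (n2 k) / real (n1 k + n2 k))" "0 < Cn"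
    and s1: "(\<lambda>k. ln (real (qnum (p k))) powr (5/2) * m3 k / sqrt (real (n1 k) * real (n2 k) / real (n1 k + n2 k))) \<longlonglongrightarrow> 0"
    and s2: "(\<lambda>k. ln (real (qnum (p k))) powr (3/2) * b k / sqrt (real (n1 k) * real (n2 k) / real (n1 k + n2 k))) \<longlonglongrightarrow> 0"
    and s3: "\<forall>\<^sub>F k in sequentially. 0 < t k \<and> 4 * (b k)\<^sup>2 * t k \<le> 1"
      "(\<lambda>k. ln (real (qnum (p k))) * (t k * m4 k + 6 * ln (real (qnum (p k))) / ((real (n1 k) * real (n2 k) / real (n1 k + n2 k)) * t k))) \<longlonglongrightarrow> 0"
    and s4: "(\<lambda>k. ln (real (qnum (p k))) ^ 4 * ka k) \<longlonglongrightarrow> 0"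
    and s5: "(\<lambda>k. sqrt (ln (real (qnum (p k)))) * (ka k / b k * sqrt (real (n1 k + n2 k)))) \<longlonglongrightarrow> 0"
    and s6: "(\<lambda>k. real (qnum (p k)) * real (n1 k + n2 k) * \<pi> k) \<longlonglongrightarrow> 0"
begin

definition L :: "nat \<Rightarrow> real" where "L k = ln (real (qnum (p k)))"
definition nb :: "nat \<Rightarrow> real" where "nb k = real (n1 k) * real (n2 k) / real (n1 k + n2 k)"
definition Nt :: "nat \<Rightarrow> real" where "Nt k = real (n1 k + n2 k)"
definition g :: "nat \<Rightarrow> real" where
  "g k = sqrt (L k powr (5/2) * m3 k / sqrt (nb k) + L k powr (3/2) * b k / sqrt (nb k) + 1 / L k)"
definition w :: "nat \<Rightarrow> real" where "w k = L k powr (-3/2) * g k"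
definition H :: "nat \<Rightarrow> real" where "H k = 2 * sqrt (L k)"
definition bd :: "nat \<Rightarrow> real" where "bd k = 4 * b k / sqrt (nb k)"
definition \<beta> :: "nat \<Rightarrow> real" where "\<beta> k = 4 * m3 k / sqrt (nb k)"
definition \<rho>0 :: "nat \<Rightarrow> real" where "\<rho>0 k = 2 * (L k powr (-2 - \<xi>) + 3 * sqrt (ka k))"
definition x :: "nat \<Rightarrow> real" where "x k = 7 * sqrt (L k / nb k)"
definition y :: "nat \<Rightarrow> real" where "y k = t k * m4 k + 6 * L k / (nb k * t k)"
definition \<delta> :: "nat \<Rightarrow> real" where "\<delta> k = y k + (x k)\<^sup>2"
definition shk :: "nat \<Rightarrow> real" where "shk k = 3 * (ka k / b k) * sqrt (Nt k)"
definition \<tau> :: "nat \<Rightarrow> real" where "\<tau> k = 2 * \<delta> k * sqrt (2 * L k) + shk k"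
definition A :: "nat \<Rightarrow> real" where "A k = c2 * sqrt (L k)"
definition t0 :: "nat \<Rightarrow> real" where "t0 k = Ginv (\<alpha> * A k / real (qnum (p k)))"

abbreviation N0 :: "nat \<Rightarrow> (nat \<times> nat) set" where "N0 k \<equiv> H0 (M k) (X k) (p k)"
abbreviation Q :: "nat \<Rightarrow> real" where "Q k \<equiv> real (qnum (p k))"
abbreviation gk :: "nat \<Rightarrow> real" where "gk k \<equiv> gam (\<beta> k) (\<rho>0 k) (H k) (w k)"

lemma q_top: "filterlim (\<lambda>k. Q k) at_top sequentially"
  by (rule filterlim_compose[OF filterlim_real_sequentially lim_q])

lemma L_top: "filterlim L at_top sequentially"
  unfolding L_def[abs_def] by (rule filterlim_compose[OF ln_at_top q_top])

lemma L_ge: "\<forall>\<^sub>F k in sequentially. c \<le> L k"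
  using L_top by (auto simp: filterlim_at_top)

lemma L_comp: "(f \<longlongrightarrow> l) at_top \<Longrightarrow> (\<lambda>k. f (L k)) \<longlonglongrightarrow> l" for f :: "real \<Rightarrow> real"
  using filterlim_compose[OF _ L_top] by blast

lemma nb_eq: "real (n1 k) * real (n2 k) / real (n1 k + n2 k) = nb k"
  by (simp add: nb_def)

lemmas seqs = s1[unfolded nb_eq L_def[symmetric]] s2[unfolded nb_eq L_def[symmetric]] s3(2)[unfolded nb_eq L_def[symmetric]]
  s4[unfolded L_def[symmetric]] s5[unfolded Nt_def[symmetric] L_def[symmetric]] s6[unfolded Nt_def[symmetric]]

lemma basic: "\<forall>\<^sub>F k in sequentially. 1 \<le> b k \<and> 1 \<le> m3 k \<and> 0 \<le> ka k \<and> ka k \<le> 1/16 \<and> 0 < nb k \<and> 1 \<le> L k \<and> 0 < Nt k"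
  using trunc L_ge[of 1]
proof eventually_elim
  case (elim k)
  interpret truncated "M k" "X k" "p k" "n1 k" "n2 k" "b k" "ka k" "m3 k" "m4 k" "real (n1 k) * real (n2 k) / real (n1 k + n2 k)"
    by (rule elim(1))
  show ?case using b m3 chi nb elim n_pos unfolding nb_eq Nt_def by auto
qed

lemma g_lim: "g \<longlonglongrightarrow> 0"
proof -
  have "(\<lambda>k. 1 / L k) \<longlonglongrightarrow> 0" by (rule L_comp) real_asymp
  from tendsto_real_sqrt[OF tendsto_add[OF tendsto_add[OF seqs(1,2)] this]]
  show ?thesis unfolding g_def[abs_def] by simp
qed

lemma g_props: "\<forall>\<^sub>F k in sequentially. 0 < g k \<and> L k powr (5/2) * m3 k / sqrt (nb k) \<le> (g k)\<^sup>2
    \<and> L k powr (3/2) * b k / sqrt (nb k) \<le> (g k)\<^sup>2 \<and> 1 / L k \<le> (g k)\<^sup>2"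
  using basic
proof eventually_elim
  case (elim k)
  have a: "0 \<le> L k powr (5/2) * m3 k / sqrt (nb k)" "0 \<le> L k powr (3/2) * b k / sqrt (nb k)" "0 < 1 / L k"
    using elim by auto
  hence "(g k)\<^sup>2 = L k powr (5/2) * m3 k / sqrt (nb k) + L k powr (3/2) * b k / sqrt (nb k) + 1 / L k"
    unfolding g_def by (subst real_sqrt_pow2) auto
  moreover have "0 < g k" unfolding g_def using a by (intro real_sqrt_gt_zero add_nonneg_pos) auto
  ultimately show ?case using a by auto
qed

lemma wH_lim: "(\<lambda>k. w k * H k * L k) \<longlonglongrightarrow> 0"
proof -
  have "\<forall>\<^sub>F k in sequentially. w k * H k * L k = 2 * g k"
    using basic
  proof eventually_elim
    case (elim k)
    have "L k powr (-3/2) * sqrt (L k) * L k = L k powr (-3/2) * L k powr (1/2) * L k powr 1"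
      using elim by (simp add: powr_half_sqrt)
    also have "\<dots> = 1" using elim by (simp flip: powr_add)
    finally have "L k powr (-3/2) * sqrt (L k) * L k = 1" .
    thus ?case unfolding w_def H_def by (simp add: algebra_simps)
  qed
  moreover have "(\<lambda>k. 2 * g k) \<longlonglongrightarrow> 0" using tendsto_mult[OF tendsto_const[of 2] g_lim] by simp
  ultimately show ?thesis by (simp add: tendsto_cong)
qed

lemma inv_w: "\<forall>\<^sub>F k in sequentially. 0 < w k \<and> 1 / w k = L k powr (3/2) / g k \<and> ln (1 / w k) \<le> 2 * L k"
  using basic g_props
proof eventually_elim
  case (elim k)
  have L: "1 \<le> L k" "0 < g k" "1 / L k \<le> (g k)\<^sup>2" using elim by auto
  have wp: "0 < w k" unfolding w_def using L by simp
  have iw: "1 / w k = L k powr (3/2) / g k" unfolding w_def using L by (simp add: powr_minus field_simps)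
  have "ln (1 / L k) \<le> ln ((g k)\<^sup>2)" using L by (subst ln_le_cancel_iff) auto
  hence "- ln (L k) \<le> 2 * ln (g k)" using L by (simp add: ln_div ln_realpow)
  moreover have "ln (1 / w k) = 3/2 * ln (L k) - ln (g k)" unfolding iw using L by (simp add: ln_div ln_powr)
  ultimately have "ln (1 / w k) \<le> 2 * ln (L k)" by linarith
  also have "\<dots> \<le> 2 * L k" using L ln_le_minus_one[of "L k"] by linarith
  finally show ?case using wp iw by simp
qed

lemma rho_lim: "(\<lambda>k. \<rho>0 k * L k * L k) \<longlonglongrightarrow> 0"
proof -
  have "(\<lambda>k. sqrt (L k ^ 4 * ka k)) \<longlonglongrightarrow> 0" using tendsto_real_sqrt[OF seqs(4)] by simp
  moreover have "(\<lambda>k. L k powr (-2 - \<xi>) * L k * L k) \<longlonglongrightarrow> 0" using B2(1) by (intro L_comp) real_asymp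
  ultimately have "(\<lambda>k. 2 * (L k powr (-2 - \<xi>) * L k * L k) + 6 * sqrt (L k ^ 4 * ka k)) \<longlonglongrightarrow> 2 * 0 + 6 * 0"
    by (intro tendsto_intros)
  moreover have "\<forall>\<^sub>F k in sequentially. 2 * (L k powr (-2 - \<xi>) * L k * L k) + 6 * sqrt (L k ^ 4 * ka k) = \<rho>0 k * L k * L k"
    using basic
  proof eventually_elim
    case (elim k)
    have "sqrt (L k ^ 4) = L k * L k" using elim by (intro real_sqrt_unique) (auto simp: power2_eq_square power4_eq_xxxx)
    thus ?case unfolding \<rho>0_def by (simp add: real_sqrt_mult algebra_simps)
  qed
  ultimately show ?thesis by (simp add: tendsto_cong)
qed

lemma w_small: "0 < c \<Longrightarrow> \<forall>\<^sub>F k in sequentially. w k * H k \<le> c \<and> w k \<le> c"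
proof -
  assume "0 < c"
  hence "\<forall>\<^sub>F k in sequentially. w k * H k * L k < c" using wH_lim by (intro order_tendstoD) auto
  thus ?thesis using basic inv_w
  proof eventually_elim
    case (elim k)
    have L: "1 \<le> L k" "0 < w k" using elim by auto
    have H2: "2 \<le> H k" unfolding H_def using L by simp
    have "w k * H k * 1 \<le> w k * H k * L k" using L H2 by (intro mult_left_mono) auto
    moreover have "w k * 1 \<le> w k * H k" using L H2 by (intro mult_left_mono) auto
    ultimately show ?case using elim by linarith
  qed
qed

lemma gam_nonneg: "\<forall>\<^sub>F k in sequentially. 0 \<le> gk k"
  using basic inv_w w_small[of 1, simplified]
proof eventually_elim
  case (elim k)
  have "0 < w k" "w k \<le> 1" using elim by blast+
  hence "1 \<le> 1 / w k" by simp
  hence "0 \<le> ln (1 / w k)" by (rule ln_ge_zero)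
  moreover have "0 \<le> \<beta> k" "0 \<le> \<rho>0 k" "0 \<le> H k" unfolding \<beta>_def \<rho>0_def H_def using elim by auto
  moreover have "0 \<le> 1 / w k" using \<open>0 < w k\<close> by simp
  ultimately show ?case unfolding gam_def using CN_pos \<open>0 < w k\<close>
    by (intro add_nonneg_nonneg mult_nonneg_nonneg) auto
qed

lemma gam_lim: "(\<lambda>k. L k * gk k) \<longlonglongrightarrow> 0"
proof (rule tendsto_sandwich[where f = "\<lambda>_. 0" and h = "\<lambda>k. CN * (32 * (L k powr (5/2) * m3 k / sqrt (nb k)) + 4 * g k + 6 * (\<rho>0 k * L k * L k))
     + 120 * (w k * H k * L k) + 4 * (L k * exp (- (4 * L k)))"])
  have "(\<lambda>k. L k * exp (- (4 * L k))) \<longlonglongrightarrow> 0" by (rule L_comp) real_asymp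
  hence "(\<lambda>k. CN * (32 * (L k powr (5/2) * m3 k / sqrt (nb k)) + 4 * g k + 6 * (\<rho>0 k * L k * L k)) + 120 * (w k * H k * L k) + 4 * (L k * exp (- (4 * L k))))
      \<longlonglongrightarrow> CN * (32 * 0 + 4 * 0 + 6 * 0) + 120 * 0 + 4 * 0"
    by (intro tendsto_intros seqs(1) g_lim rho_lim wH_lim)
  thus "(\<lambda>k. CN * (32 * (L k powr (5/2) * m3 k / sqrt (nb k)) + 4 * g k + 6 * (\<rho>0 k * L k * L k)) + 120 * (w k * H k * L k) + 4 * (L k * exp (- (4 * L k)))) \<longlonglongrightarrow> 0"
    by simp
  show "\<forall>\<^sub>F k in sequentially. 0 \<le> L k * gk k"
    using basic gam_nonneg by eventually_elim simp
  show "\<forall>\<^sub>F k in sequentially. L k * gk k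
     \<le> CN * (32 * (L k powr (5/2) * m3 k / sqrt (nb k)) + 4 * g k + 6 * (\<rho>0 k * L k * L k)) + 120 * (w k * H k * L k) + 4 * (L k * exp (- (4 * L k)))"
    using basic inv_w g_props
  proof eventually_elim
    case (elim k)
    have L: "1 \<le> L k" "0 < g k" and b0: "0 < sqrt (nb k)" "1 \<le> m3 k" "0 \<le> ka k" and iw: "1 / w k = L k powr (3/2) / g k" "ln (1 / w k) \<le> 2 * L k" "0 < w k"
      and g2: "L k powr (5/2) * m3 k / sqrt (nb k) \<le> (g k)\<^sup>2" using elim by auto
    have H3: "H k ^ 3 * L k = 8 * L k powr (5/2)"
    proof -
      have "sqrt (L k) ^ 3 * L k = (L k powr (1/2)) ^ 3 * L k powr 1" using L by (simp add: powr_half_sqrt)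
      also have "\<dots> = L k powr (3/2) * L k powr 1" using L by (simp add: powr_power)
      also have "\<dots> = L k powr (5/2)" unfolding powr_add[symmetric] by simp
      finally show ?thesis unfolding H_def by (simp add: power_mult_distrib)
    qed
    have H2: "(H k)\<^sup>2 = 4 * L k" unfolding H_def using L by (simp add: power_mult_distrib)
    have "\<beta> k * (H k ^ 3 + 1 / w k) * L k = 32 * (L k powr (5/2) * m3 k / sqrt (nb k)) + 4 * ((L k powr (5/2) * m3 k / sqrt (nb k)) / g k)"
    proof -
      have "L k powr (3/2) * L k = L k powr (5/2)" using L powr_add[of "L k" "3/2" 1] by simp
      hence "1 / w k * L k = L k powr (5/2) / g k" unfolding iw by (metis times_divide_eq_left)
      have "\<beta> k * (H k ^ 3 + 1 / w k) * L k = \<beta> k * (H k ^ 3 * L k) + \<beta> k * (1 / w k * L k)" by (simp only: distrib_left distrib_right mult.assoc)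
      also have "\<dots> = \<beta> k * (8 * L k powr (5/2)) + \<beta> k * (L k powr (5/2) / g k)" unfolding H3 \<open>1 / w k * L k = _\<close> ..
      finally show ?thesis unfolding \<beta>_def by (simp add: mult_ac)
    qed
    also have "(L k powr (5/2) * m3 k / sqrt (nb k)) / g k \<le> g k" by (rule div_le_of_le_sq[OF g2 L(2)])
    finally have 1: "\<beta> k * (H k ^ 3 + 1 / w k) * L k \<le> 32 * (L k powr (5/2) * m3 k / sqrt (nb k)) + 4 * g k" by simp
    have r0: "0 \<le> \<rho>0 k" unfolding \<rho>0_def using b0 by simp
    have "\<rho>0 k * ((H k)\<^sup>2 + ln (1 / w k)) * L k \<le> \<rho>0 k * (4 * L k + 2 * L k) * L k"
      unfolding H2 using r0 iw L by (intro mult_right_mono mult_left_mono) auto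
    also have "\<dots> = 6 * (\<rho>0 k * L k * L k)" by simp
    finally have 2: "\<rho>0 k * ((H k)\<^sup>2 + ln (1 / w k)) * L k \<le> 6 * (\<rho>0 k * L k * L k)" .
    have "L k * gk k = CN * (\<beta> k * (H k ^ 3 + 1 / w k) * L k + \<rho>0 k * ((H k)\<^sup>2 + ln (1 / w k)) * L k)
       + 120 * (w k * H k * L k) + 4 * (L k * exp (- (4 * L k)))"
      unfolding gam_def H2[symmetric] by (simp add: distrib_left distrib_right mult_ac)
    also have "\<dots> \<le> CN * (32 * (L k powr (5/2) * m3 k / sqrt (nb k)) + 4 * g k + 6 * (\<rho>0 k * L k * L k)) + 120 * (w k * H k * L k) + 4 * (L k * exp (- (4 * L k)))"
      using 1 2 CN_pos by (intro add_right_mono mult_left_mono add_mono) auto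
    finally show ?case .
  qed
qed simp

lemma bd_small: "0 < c \<Longrightarrow> \<forall>\<^sub>F k in sequentially. 0 \<le> bd k \<and> bd k * H k \<le> c \<and> bd k * (H k + 2 / w k) \<le> c"
proof -
  assume c: "0 < c"
  have "(\<lambda>k. 8 * (L k powr (3/2) * b k / sqrt (nb k)) + 8 * g k) \<longlonglongrightarrow> 8 * 0 + 8 * 0"
    by (intro tendsto_intros seqs(2) g_lim)
  hence "\<forall>\<^sub>F k in sequentially. 8 * (L k powr (3/2) * b k / sqrt (nb k)) + 8 * g k < c" using c by (intro order_tendstoD) auto
  thus ?thesis using basic inv_w g_props
  proof eventually_elim
    case (elim k)
    have L: "1 \<le> L k" "0 < g k" and b0: "0 < sqrt (nb k)" "1 \<le> b k" and iw: "1 / w k = L k powr (3/2) / g k" "0 < w k"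
      and g2: "L k powr (3/2) * b k / sqrt (nb k) \<le> (g k)\<^sup>2" using elim by auto
    have bd0: "0 \<le> bd k" unfolding bd_def using b0 by simp
    have "sqrt (L k) \<le> L k powr (3/2)" using L by (simp add: powr_half_sqrt[symmetric] powr_mono)
    hence "sqrt (L k) * b k / sqrt (nb k) \<le> L k powr (3/2) * b k / sqrt (nb k)"
      using b0 by (intro divide_right_mono mult_right_mono) auto
    moreover have "bd k * H k = 8 * (sqrt (L k) * b k / sqrt (nb k))" unfolding bd_def H_def by simp
    ultimately have 1: "bd k * H k \<le> 8 * (L k powr (3/2) * b k / sqrt (nb k))" by linarith
    have "bd k * (2 / w k) = 8 * (L k powr (3/2) * b k / sqrt (nb k) / g k)"
    proof -
      have "2 / w k = 2 * (L k powr (3/2) / g k)" using iw(1) by (simp add: field_simps)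
      thus ?thesis unfolding bd_def by (simp add: mult_ac)
    qed
    also have "L k powr (3/2) * b k / sqrt (nb k) / g k \<le> g k" by (rule div_le_of_le_sq[OF g2 L(2)])
    finally have "bd k * (2 / w k) \<le> 8 * g k" by simp
    hence "bd k * (H k + 2 / w k) \<le> 8 * (L k powr (3/2) * b k / sqrt (nb k)) + 8 * g k" using 1 by (simp add: distrib_left)
    moreover have "0 \<le> 8 * g k" using L by simp
    ultimately show ?case using elim(1) 1 bd0 by linarith
  qed
qed

lemma Lb_small: "\<forall>\<^sub>F k in sequentially. 2 * b k * sqrt (L k / nb k) \<le> 1"
proof -
  have "\<forall>\<^sub>F k in sequentially. L k powr (3/2) * b k / sqrt (nb k) < 1/2" using seqs(2) by (intro order_tendstoD) auto
  thus ?thesis using basic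
  proof eventually_elim
    case (elim k)
    have "sqrt (L k) \<le> L k powr (3/2)" using elim by (simp add: powr_half_sqrt[symmetric] powr_mono)
    hence "sqrt (L k) * b k / sqrt (nb k) \<le> L k powr (3/2) * b k / sqrt (nb k)"
      using elim by (intro divide_right_mono mult_right_mono) auto
    hence "sqrt (L k) * b k / sqrt (nb k) \<le> 1/2" using elim by linarith
    thus ?case by (simp add: real_sqrt_divide mult_ac)
  qed
qed

lemma delta_lim: "(\<lambda>k. \<delta> k * L k) \<longlonglongrightarrow> 0"
proof -
  have "(\<lambda>k. L k * L k / nb k) \<longlonglongrightarrow> 0"
  proof (rule tendsto_sandwich[where f = "\<lambda>_. 0" and h = "\<lambda>k. (L k powr (3/2) * b k / sqrt (nb k))\<^sup>2"])
    show "(\<lambda>k. (L k powr (3/2) * b k / sqrt (nb k))\<^sup>2) \<longlonglongrightarrow> 0" using tendsto_power[OF seqs(2), of 2] by simp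
    show "\<forall>\<^sub>F k in sequentially. 0 \<le> L k * L k / nb k" using basic by eventually_elim auto
    show "\<forall>\<^sub>F k in sequentially. L k * L k / nb k \<le> (L k powr (3/2) * b k / sqrt (nb k))\<^sup>2"
      using basic
    proof eventually_elim
      case (elim k)
      have "L k powr 1 \<le> L k powr (3/2)" using elim by (intro powr_mono) auto
      hence "L k \<le> L k powr (3/2)" using elim by simp
      hence "L k * 1 \<le> L k powr (3/2) * b k" using elim by (intro mult_mono) auto
      hence "(L k * 1) * (L k * 1) \<le> (L k powr (3/2) * b k) * (L k powr (3/2) * b k)" using elim by (intro power_mono[of "L k * 1" _ 2, unfolded power2_eq_square]) auto
      thus ?case using elim by (simp add: power_divide power2_eq_square divide_right_mono)
    qed
  qed simp
  hence "(\<lambda>k. L k * (t k * m4 k + 6 * L k / (nb k * t k)) + 49 * (L k * L k / nb k)) \<longlonglongrightarrow> 0 + 49 * 0"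
    by (intro tendsto_intros seqs(3))
  moreover have "\<forall>\<^sub>F k in sequentially. L k * (t k * m4 k + 6 * L k / (nb k * t k)) + 49 * (L k * L k / nb k) = \<delta> k * L k"
    using basic
  proof eventually_elim
    case (elim k)
    have "(x k)\<^sup>2 = 49 * (L k / nb k)" unfolding x_def using elim by (simp add: power_mult_distrib)
    thus ?case unfolding \<delta>_def y_def by (simp add: algebra_simps)
  qed
  ultimately show ?thesis by (simp add: tendsto_cong)
qed

lemma delta_small: "\<forall>\<^sub>F k in sequentially. \<delta> k \<le> 1/4"
proof -
  have "\<forall>\<^sub>F k in sequentially. \<delta> k * L k < 1/4" using delta_lim by (intro order_tendstoD) auto
  thus ?thesis using basic
  proof eventually_elim
    case (elim k)
    show ?case
    proof (cases "0 \<le> \<delta> k")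
      case True
      hence "\<delta> k * 1 \<le> \<delta> k * L k" using elim by (intro mult_left_mono) auto
      thus ?thesis using elim by linarith
    qed simp
  qed
qed

lemma tau_lim: "(\<lambda>k. \<tau> k * sqrt (L k)) \<longlonglongrightarrow> 0"
proof -
  have "(\<lambda>k. (2 * sqrt 2) * (\<delta> k * L k) + 3 * (sqrt (L k) * (ka k / b k * sqrt (Nt k)))) \<longlonglongrightarrow> (2 * sqrt 2) * 0 + 3 * 0"
    by (intro tendsto_intros delta_lim seqs(5))
  moreover have "\<forall>\<^sub>F k in sequentially. (2 * sqrt 2) * (\<delta> k * L k) + 3 * (sqrt (L k) * (ka k / b k * sqrt (Nt k))) = \<tau> k * sqrt (L k)"
    using basic
  proof eventually_elim
    case (elim k)
    have "sqrt (L k) * sqrt (L k) = L k" using elim by simp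
    hence "sqrt (2 * L k) * sqrt (L k) = sqrt 2 * L k" by (simp add: real_sqrt_mult)
    hence "2 * \<delta> k * sqrt (2 * L k) * sqrt (L k) = 2 * \<delta> k * (sqrt 2 * L k)" by (simp only: mult.assoc)
    moreover have "\<tau> k * sqrt (L k) = 2 * \<delta> k * sqrt (2 * L k) * sqrt (L k) + 3 * (sqrt (L k) * (ka k / b k * sqrt (Nt k)))"
      unfolding \<tau>_def shk_def distrib_right by (simp add: mult_ac)
    ultimately show ?case by (simp only:) (simp add: mult_ac)
  qed
  ultimately show ?thesis by (simp add: tendsto_cong)
qed

definition u :: "nat \<Rightarrow> real" where "u k = 5 * \<tau> k * (2 + sqrt (2 * L k))"

lemma tau_nonneg: "\<forall>\<^sub>F k in sequentially. 0 \<le> \<tau> k \<and> 0 \<le> shk k"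
  using basic trunc s3(1)
proof eventually_elim
  case (elim k)
  interpret T: truncated "M k" "X k" "p k" "n1 k" "n2 k" "b k" "ka k" "m3 k" "m4 k" "real (n1 k) * real (n2 k) / real (n1 k + n2 k)"
    by (rule elim(2))
  have "0 < qnum (p k)"
  proof (rule ccontr)
    assume "\<not> 0 < qnum (p k)"
    thus False using elim(1) by (simp add: L_def)
  qed
  hence "pairs (p k) \<noteq> {}" using card_pairs[of "p k"] by auto
  then obtain e where e: "e \<in> pairs (p k)" by auto
  have "0 \<le> m4 k" using T.m4[of 1 e] e by (intro order_trans[OF Bochner_Integration.integral_nonneg T.m4[of 1 e]]) auto
  hence "0 \<le> y k" unfolding y_def using elim by simp
  hence "0 \<le> \<delta> k" unfolding \<delta>_def by simp
  thus ?case unfolding \<tau>_def shk_def using elim by simp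
qed

lemma u_lim: "u \<longlonglongrightarrow> 0"
proof (rule tendsto_sandwich[where f = "\<lambda>_. 0" and h = "\<lambda>k. 20 * (\<tau> k * sqrt (L k))"])
  show "(\<lambda>k. 20 * (\<tau> k * sqrt (L k))) \<longlonglongrightarrow> 0" using tendsto_mult[OF tendsto_const[of 20] tau_lim] by simp
  show "\<forall>\<^sub>F k in sequentially. 0 \<le> u k" using tau_nonneg basic by eventually_elim (auto simp: u_def)
  show "\<forall>\<^sub>F k in sequentially. u k \<le> 20 * (\<tau> k * sqrt (L k))" using tau_nonneg basic
  proof eventually_elim
    case (elim k)
    have "1 \<le> sqrt (L k)" using elim by simp
    moreover have "sqrt (2 * L k) \<le> 2 * sqrt (L k)"
      using real_sqrt_le_mono[of "2 * L k" "4 * L k"] elim by (simp add: real_sqrt_mult)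
    ultimately have "2 + sqrt (2 * L k) \<le> 4 * sqrt (L k)" by linarith
    hence "5 * \<tau> k * (2 + sqrt (2 * L k)) \<le> 5 * \<tau> k * (4 * sqrt (L k))" using elim by (intro mult_left_mono) auto
    thus ?case unfolding u_def by simp
  qed
qed simp

lemma tau_small: "\<forall>\<^sub>F k in sequentially. \<tau> k \<le> 1 \<and> shk k \<le> 1"
proof -
  have "\<forall>\<^sub>F k in sequentially. \<tau> k * sqrt (L k) < 1" using tau_lim by (intro order_tendstoD) auto
  moreover have "\<forall>\<^sub>F k in sequentially. sqrt (L k) * (ka k / b k * sqrt (Nt k)) < 1/3" using seqs(5) by (intro order_tendstoD) auto
  ultimately show ?thesis using basic tau_nonneg
  proof eventually_elim
    case (elim k)
    have s: "1 \<le> sqrt (L k)" using elim by simp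
    have "\<tau> k * 1 \<le> \<tau> k * sqrt (L k)" using elim s by (intro mult_left_mono) auto
    moreover have "1 * shk k \<le> sqrt (L k) * shk k" using elim s by (intro mult_right_mono) auto
    moreover have "sqrt (L k) * shk k = 3 * (sqrt (L k) * (ka k / b k * sqrt (Nt k)))" by (simp add: shk_def)
    ultimately show ?case using elim by linarith
  qed
qed

lemma alt_ev: "\<forall>\<^sub>F k in sequentially. 2 * sqrt (2 * L k) \<le> L k powr (1/2 + \<rho>) - 3 * x k * sqrt (Nt k) - shk k"
proof -
  define C where "C = 5 + 21 * sqrt Cn"
  have "filterlim (\<lambda>z::real. z powr \<rho>) at_top at_top" using B1(2) by real_asymp
  from filterlim_compose[OF this L_top] have "\<forall>\<^sub>F k in sequentially. C \<le> L k powr \<rho>" by (auto simp: filterlim_at_top)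
  thus ?thesis using basic tau_small nbd(1)
  proof eventually_elim
    case (elim k)
    have L: "1 \<le> L k" "0 < nb k" "0 < Nt k" using elim by auto
    have "Nt k \<le> Cn * nb k" unfolding nb_def Nt_def by (rule elim(4))
    note L = L this
    have s: "1 \<le> sqrt (L k)" using L by simp
    have "sqrt (2 * L k) \<le> 2 * sqrt (L k)"
      using real_sqrt_le_mono[of "2 * L k" "4 * L k"] L by (simp add: real_sqrt_mult)
    moreover have "3 * x k * sqrt (Nt k) \<le> 21 * sqrt Cn * sqrt (L k)"
    proof -
      have "3 * x k * sqrt (Nt k) = 21 * sqrt (L k / nb k * Nt k)" unfolding x_def by (simp only: real_sqrt_mult[of "L k / nb k"])
      also have "\<dots> \<le> 21 * sqrt (L k / nb k * (Cn * nb k))"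
        using L by (intro mult_left_mono real_sqrt_le_mono) auto
      also have "L k / nb k * (Cn * nb k) = Cn * L k" using L by simp
      finally show ?thesis by (simp add: real_sqrt_mult)
    qed
    moreover have "C * sqrt (L k) \<le> L k powr (1/2 + \<rho>)"
    proof -
      have "C * sqrt (L k) \<le> L k powr \<rho> * sqrt (L k)" using elim s by (intro mult_right_mono) auto
      also have "\<dots> = L k powr (1/2 + \<rho>)" using L by (simp add: powr_add powr_half_sqrt mult.commute)
      finally show ?thesis .
    qed
    moreover have "C * sqrt (L k) = 5 * sqrt (L k) + 21 * sqrt Cn * sqrt (L k)" by (simp add: C_def algebra_simps)
    ultimately show ?case using elim(3) s by linarith
  qed
qed

lemma A_ev: "\<forall>\<^sub>F k in sequentially. 2 \<le> \<alpha> * A k \<and> \<alpha> * A k \<le> Q k \<and> 1 \<le> qnum (p k) \<and> exp (L k) = Q k"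
proof -
  have "filterlim (\<lambda>z::real. \<alpha> * (c2 * sqrt z)) at_top at_top" using alpha B1(1) by real_asymp
  from filterlim_compose[OF this L_top] have 1: "\<forall>\<^sub>F k in sequentially. 2 \<le> \<alpha> * (c2 * sqrt (L k))" by (auto simp: filterlim_at_top)
  have "((\<lambda>z::real. \<alpha> * (c2 * sqrt z) / exp z) \<longlongrightarrow> 0) at_top" by real_asymp
  from L_comp[OF this] have 2: "\<forall>\<^sub>F k in sequentially. \<alpha> * (c2 * sqrt (L k)) / exp (L k) < 1" by (intro order_tendstoD) auto
  have 3: "\<forall>\<^sub>F k in sequentially. 1 \<le> qnum (p k)" using lim_q by (auto simp: filterlim_at_top)
  show ?thesis using 1 2 3
  proof eventually_elim
    case (elim k)
    have "exp (L k) = Q k" unfolding L_def using elim by simp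
    thus ?case using elim by (simp add: A_def divide_less_eq)
  qed
qed

lemma t0_ev: "\<forall>\<^sub>F k in sequentially. 0 \<le> t0 k \<and> Q k * Gt (t0 k) = \<alpha> * A k \<and> t0 k \<le> sqrt (2 * L k)
    \<and> \<alpha> * A k / (2 * Q k) \<le> Gt (t0 k + \<tau> k)"
proof -
  have "\<forall>\<^sub>F k in sequentially. u k < ln 2" using u_lim by (intro order_tendstoD) auto
  thus ?thesis using A_ev basic tau_nonneg tau_small
  proof eventually_elim
    case (elim k)
    define q where "q = Q k"
    have q: "1 \<le> q" "exp (L k) = q" "2 \<le> \<alpha> * A k" "\<alpha> * A k \<le> q" using elim by (auto simp: q_def)
    have *: "0 < \<alpha> * A k / q" "\<alpha> * A k / q \<le> 1" using q by (auto simp: divide_le_eq)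
    have t0: "0 \<le> t0 k" "Gt (t0 k) = \<alpha> * A k / q" unfolding t0_def q_def[symmetric] using Ginv[OF *] by auto
    hence qt: "q * Gt (t0 k) = \<alpha> * A k" using q by simp
    have "Gt (sqrt (2 * L k)) \<le> 2 * exp (- (sqrt (2 * L k))\<^sup>2 / 2)" by (rule Gt_le_exp) (use elim in auto)
    also have "\<dots> = 2 / q" using elim q by (simp add: exp_minus field_simps)
    also have "\<dots> \<le> Gt (t0 k)" unfolding t0 using q by (intro divide_right_mono) auto
    finally have tc: "t0 k \<le> sqrt (2 * L k)" by (simp add: Gt_le_iff)
    have "Gt (t0 k) \<le> Gt (t0 k + \<tau> k) * exp (5 * \<tau> k * (1 + (t0 k + \<tau> k)))" using Gt_shift[of "\<tau> k" "t0 k + \<tau> k"] elim t0 by simp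
    also have "\<dots> \<le> Gt (t0 k + \<tau> k) * exp (u k)"
    proof -
      have "5 * \<tau> k * (1 + (t0 k + \<tau> k)) \<le> u k" unfolding u_def using elim tc by (intro mult_left_mono) auto
      thus ?thesis using Gt_pos[of "t0 k + \<tau> k"] by simp
    qed
    also have "\<dots> \<le> Gt (t0 k + \<tau> k) * 2"
    proof -
      have "exp (u k) \<le> exp (ln 2)" using elim by (subst exp_le_cancel_iff) simp
      thus ?thesis using Gt_pos[of "t0 k + \<tau> k"] by simp
    qed
    finally have "\<alpha> * A k / (2 * q) \<le> Gt (t0 k + \<tau> k)" unfolding t0 using q by (simp add: field_simps)
    thus ?case using t0 qt tc unfolding q_def by simp
  qed
qed

end

lemma exp_le_Gt: assumes "0 \<le> h" shows "exp (- (h\<^sup>2 / 2)) \<le> 8 * (1 + h) * Gt h"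
proof -
  have "phi (- h) = exp (- (h\<^sup>2 / 2)) / sqrt (2 * pi)" by (simp add: std_normal_density_def)
  moreover have "phi (- h) \<le> 5 / 2 * (1 + h) * Gt h" using phi_le_Phi[of "- h"] assms by (simp add: Gt_def)
  ultimately have "exp (- (h\<^sup>2 / 2)) \<le> 5 / 2 * (1 + h) * Gt h * sqrt (2 * pi)" by (simp add: divide_le_eq)
  also have "\<dots> \<le> 5 / 2 * (1 + h) * Gt h * (16 / 5)"
  proof (rule mult_left_mono)
    have "2 * pi \<le> (16/5)\<^sup>2" using pi_less_4 by (simp add: power2_eq_square)
    thus "sqrt (2 * pi) \<le> 16 / 5" by (rule real_le_lsqrt[rotated]) simp
    show "0 \<le> 5 / 2 * (1 + h) * Gt h" using assms Gt_pos[of h] by simp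
  qed
  also have "\<dots> = 8 * (1 + h) * Gt h" by (simp add: algebra_simps)
  finally show ?thesis .
qed

lemma pair_term_bound:
  fixes h L q m q0 c1 r z s \<nu> :: real
  assumes h: "0 \<le> h" and q: "1 \<le> q" "exp L = q" and G: "1 / q \<le> 2 * Gt h"
    and m: "0 \<le> m" "m \<le> exp (\<nu> * L)" and c: "0 < c1" "c1 * q \<le> q0" and r: "0 \<le> r" "0 \<le> z" "2 * (r + z) \<le> s * (1 + r)"
  shows "m * (4 * exp (- (h\<^sup>2 / (1 + r)) * (1 - z))) / (q0 * (Gt h)\<^sup>2)
     \<le> 256 / c1 * (2 + 4 * (L + ln 4)) * exp (s * (L + ln 4) + (\<nu> - 1) * L)"
proof -
  have s0: "0 \<le> s"
  proof (rule ccontr)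
    assume "\<not> 0 \<le> s"
    hence "s * (1 + r) < 0" using r by (intro mult_neg_pos) auto
    moreover have "0 \<le> 2 * (r + z)" using r by simp
    ultimately show False using r by linarith
  qed
  have "1 / q \<le> 4 * exp (- (h\<^sup>2 / 2))" using G Gt_le_exp[OF h] by simp
  hence "exp (h\<^sup>2 / 2) \<le> 4 * exp L" unfolding q using q by (simp add: exp_minus field_simps)
  also have "\<dots> = exp (L + ln 4)" by (simp add: exp_add)
  finally have h2: "h\<^sup>2 / 2 \<le> L + ln 4" by simp
  have e1: "exp (- (h\<^sup>2 / (1 + r)) * (1 - z)) \<le> exp (s * (L + ln 4)) * (exp (- (h\<^sup>2 / 2)))\<^sup>2"
  proof -
    have "- (h\<^sup>2 / (1 + r)) * (1 - z) + h\<^sup>2 = h\<^sup>2 / 2 * (2 * (r + z) / (1 + r))" using r by (simp add: field_simps)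
    also have "\<dots> \<le> h\<^sup>2 / 2 * s" using r by (intro mult_left_mono) (auto simp: divide_le_eq)
    also have "\<dots> \<le> (L + ln 4) * s" using h2 s0 by (rule mult_right_mono)
    finally have "- (h\<^sup>2 / (1 + r)) * (1 - z) \<le> s * (L + ln 4) - h\<^sup>2" by (simp add: mult.commute)
    hence "exp (- (h\<^sup>2 / (1 + r)) * (1 - z)) \<le> exp (s * (L + ln 4) - h\<^sup>2)" by simp
    also have "\<dots> = exp (s * (L + ln 4)) * (exp (- (h\<^sup>2 / 2)))\<^sup>2"
      by (simp add: power2_eq_square flip: exp_add)
    finally show ?thesis .
  qed
  have "(exp (- (h\<^sup>2 / 2)))\<^sup>2 \<le> (8 * (1 + h) * Gt h)\<^sup>2" by (intro power_mono exp_le_Gt h) simp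
  also have "\<dots> = 64 * (1 + h)\<^sup>2 * (Gt h)\<^sup>2" by (simp add: power2_eq_square algebra_simps)
  also have "\<dots> \<le> 64 * (2 + 4 * (L + ln 4)) * (Gt h)\<^sup>2"
  proof -
    have "0 \<le> (1 - h)\<^sup>2" by simp
    hence "(1 + h)\<^sup>2 \<le> 2 + 2 * h\<^sup>2" by (simp add: power2_eq_square algebra_simps)
    thus ?thesis using h2 by (intro mult_right_mono mult_left_mono) auto
  qed
  finally have e2: "(exp (- (h\<^sup>2 / 2)))\<^sup>2 \<le> 64 * (2 + 4 * (L + ln 4)) * (Gt h)\<^sup>2" .
  have G2: "0 < (Gt h)\<^sup>2" using Gt_pos[of h] by simp
  have P: "0 \<le> 2 + 4 * (L + ln 4)" using order_trans[OF _ h2, of 0] by simp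
  have "m * (4 * exp (- (h\<^sup>2 / (1 + r)) * (1 - z))) \<le> exp (\<nu> * L) * (4 * (exp (s * (L + ln 4)) * (64 * (2 + 4 * (L + ln 4)) * (Gt h)\<^sup>2)))"
    using m order_trans[OF e1 mult_left_mono[OF e2]] by (intro mult_mono) auto
  also have "\<dots> = 256 * (2 + 4 * (L + ln 4)) * exp (s * (L + ln 4) + \<nu> * L) * (Gt h)\<^sup>2" by (simp add: exp_add)
  finally have num: "m * (4 * exp (- (h\<^sup>2 / (1 + r)) * (1 - z))) \<le> 256 * (2 + 4 * (L + ln 4)) * exp (s * (L + ln 4) + \<nu> * L) * (Gt h)\<^sup>2" .
  have "m * (4 * exp (- (h\<^sup>2 / (1 + r)) * (1 - z))) / (q0 * (Gt h)\<^sup>2)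
      \<le> 256 * (2 + 4 * (L + ln 4)) * exp (s * (L + ln 4) + \<nu> * L) * (Gt h)\<^sup>2 / (c1 * exp L * (Gt h)\<^sup>2)"
    using num P G2 c q by (intro frac_le mult_right_mono) auto
  also have "\<dots> = 256 / c1 * (2 + 4 * (L + ln 4)) * (exp (s * (L + ln 4) + \<nu> * L) / exp L)" using G2 c by (simp add: field_simps)
  also have "exp (s * (L + ln 4) + \<nu> * L) / exp L = exp (s * (L + ln 4) + (\<nu> - 1) * L)"
    by (simp add: exp_diff[symmetric] algebra_simps)
  finally show ?thesis .
qed

context fdp_asymptotics
begin

definition dd :: real where "dd = 1 - \<nu> - 2 * r / (1 + r)"
definition r' :: real where "r' = r + dd / 8"
definition s0 :: real where "s0 = 2 * r / (1 + r) + dd / 2"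
definition bb :: "nat \<Rightarrow> real" where
  "bb k = 256 / c1 * (2 + 4 * (L k + ln 4)) * exp (s0 * (L k + ln 4) + (\<nu> - 1) * L k)"

lemma dd_pos: "0 < dd"
proof -
  have "(1 - r) / (1 + r) = 1 - 2 * r / (1 + r)" using A2 by (simp add: field_simps)
  thus ?thesis using B2(3) by (simp add: dd_def)
qed

lemma s0_bound: "2 * (r' + dd / 16) \<le> s0 * (1 + r')"
proof -
  have "2 * (r' + dd / 16) = 2 * r + 3 / 8 * dd" by (simp add: r'_def)
  also have "\<dots> \<le> (2 * r / (1 + r) + dd / 2) * (1 + r)" using A2 dd_pos by (simp add: field_simps)
  also have "\<dots> \<le> s0 * (1 + r')" unfolding s0_def r'_def using A2 dd_pos by (intro mult_left_mono) auto
  finally show ?thesis .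
qed

lemma ka_lim: "ka \<longlonglongrightarrow> 0"
proof (rule tendsto_sandwich[where f = "\<lambda>_. 0" and h = "\<lambda>k. L k ^ 4 * ka k"])
  show "\<forall>\<^sub>F k in sequentially. 0 \<le> ka k" using basic by eventually_elim simp
  show "\<forall>\<^sub>F k in sequentially. ka k \<le> L k ^ 4 * ka k" using basic
  proof eventually_elim
    case (elim k)
    have "1 * ka k \<le> L k ^ 4 * ka k" using elim by (intro mult_right_mono one_le_power) auto
    thus ?case by simp
  qed
qed (use seqs(4) in auto)

lemma corr_small: "\<forall>\<^sub>F k in sequentially. (r + 3 * sqrt (ka k)) / (1 - 2 * ka k) \<le> r'"
proof -
  have "(\<lambda>k. (r + 3 * sqrt (ka k)) / (1 - 2 * ka k)) \<longlonglongrightarrow> (r + 3 * sqrt 0) / (1 - 2 * 0)"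
    by (intro tendsto_intros ka_lim) simp
  moreover have "(r + 3 * sqrt 0) / (1 - 2 * 0) < r'" using dd_pos by (simp add: r'_def)
  ultimately have "\<forall>\<^sub>F k in sequentially. (r + 3 * sqrt (ka k)) / (1 - 2 * ka k) < r'" by (rule order_tendstoD)
  thus ?thesis by eventually_elim simp
qed

lemma RL_bound: "\<forall>\<^sub>F k in sequentially. \<forall>e\<in>N0 k. \<forall>e'\<in>N0 k. e \<noteq> e' \<longrightarrow>
    truncated.RL (M k) (X k) (ka k) e e' \<le> r'"
  using basic trunc corr_small
proof eventually_elim
  case (elim k)
  interpret T: truncated "M k" "X k" "p k" "n1 k" "n2 k" "b k" "ka k" "m3 k" "m4 k" "real (n1 k) * real (n2 k) / real (n1 k + n2 k)"
    by (rule elim(2))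
  show ?case
  proof (intro ballI impI)
    fix e e' assume e: "e \<in> N0 k" "e' \<in> N0 k" "e \<noteq> e'"
    hence "max \<bar>rcorr (M k) (X k) 1 e e'\<bar> \<bar>rcorr (M k) (X k) 2 e e'\<bar> \<le> r"
      using A2(3)[of 1 e k e'] A2(3)[of 2 e k e'] by (simp add: H0_def)
    hence "T.RL e e' \<le> (r + 3 * sqrt (ka k)) / (1 - 2 * ka k)" unfolding T.RL_def using elim by (intro divide_right_mono) auto
    thus "T.RL e e' \<le> r'" using elim by simp
  qed
qed

lemma strong_count: "\<forall>\<^sub>F k in sequentially. \<forall>e\<in>N0 k.
    real (card {e' \<in> N0 k. e' \<noteq> e \<and> \<rho>0 k < truncated.RL (M k) (X k) (ka k) e e'}) \<le> exp (\<nu> * L k)"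
  using basic trunc landau_o.smallD[OF B2(4), of 1, simplified] A_ev
proof eventually_elim
  case (elim k)
  interpret T: truncated "M k" "X k" "p k" "n1 k" "n2 k" "b k" "ka k" "m3 k" "m4 k" "real (n1 k) * real (n2 k) / real (n1 k + n2 k)"
    by (rule elim(2))
  show ?case
  proof
    fix e assume e: "e \<in> N0 k"
    hence ep: "e \<in> pairs (p k)" by (simp add: H0_def)
    have "{e' \<in> N0 k. e' \<noteq> e \<and> \<rho>0 k < T.RL e e'} \<subseteq> Aset (M k) (X k) (p k) \<xi> e"
    proof
      fix e' assume e': "e' \<in> {e' \<in> N0 k. e' \<noteq> e \<and> \<rho>0 k < T.RL e e'}"
      define mx where "mx = max \<bar>rcorr (M k) (X k) 1 e e'\<bar> \<bar>rcorr (M k) (X k) 2 e e'\<bar>"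
      have mx0: "0 \<le> mx" by (simp add: mx_def le_max_iff_disj)
      have "T.RL e e' \<le> 2 * (mx + 3 * sqrt (ka k))"
      proof -
        have "T.RL e e' = (mx + 3 * sqrt (ka k)) / (1 - 2 * ka k)" unfolding T.RL_def mx_def ..
        also have "\<dots> \<le> (mx + 3 * sqrt (ka k)) / (1 / 2)" using elim mx0 by (intro divide_left_mono) auto
        finally show ?thesis by simp
      qed
      hence "\<rho>0 k < 2 * (mx + 3 * sqrt (ka k))" using e' by auto
      hence "L k powr (-2 - \<xi>) \<le> mx" unfolding \<rho>0_def by simp
      thus "e' \<in> Aset (M k) (X k) (p k) \<xi> e" using e' unfolding Aset_def mx_def L_def by (simp add: H0_def)
    qed
    moreover have "finite (Aset (M k) (X k) (p k) \<xi> e)" unfolding Aset_def using finite_pairs by simp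
    ultimately have "card {e' \<in> N0 k. e' \<noteq> e \<and> \<rho>0 k < T.RL e e'} \<le> card (Aset (M k) (X k) (p k) \<xi> e)"
      by (intro card_mono)
    hence "real (card {e' \<in> N0 k. e' \<noteq> e \<and> \<rho>0 k < T.RL e e'}) \<le> real (card (Aset (M k) (X k) (p k) \<xi> e))" by simp
    also have "\<dots> \<le> Max ((\<lambda>e. real (card (Aset (M k) (X k) (p k) \<xi> e))) ` pairs (p k))"
      using ep finite_pairs by (intro Max_ge) auto
    also have "\<dots> \<le> Q k powr \<nu>" using elim(3) by linarith
    also have "\<dots> = exp (\<nu> * L k)" using elim(4) by (simp add: powr_def L_def)
    finally show "real (card {e' \<in> N0 k. e' \<noteq> e \<and> \<rho>0 k < T.RL e e'}) \<le> exp (\<nu> * L k)" .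
  qed
qed

lemma bb_lim: "(\<lambda>k. L k * bb k) \<longlonglongrightarrow> 0"
proof -
  define c where "c = 1 - \<nu> - s0"
  have "c = 1 - \<nu> - 2 * r / (1 + r) - dd / 2" by (simp add: c_def s0_def)
  hence c: "0 < c" using dd_pos unfolding dd_def[symmetric] by simp
  have eq: "z * (256 / c1 * (2 + 4 * (z + ln 4)) * exp (s0 * (z + ln 4) + (\<nu> - 1) * z))
     = 256 / c1 * exp (s0 * ln 4) * (z * (2 + 4 * (z + ln 4)) * exp (- c * z))" for z
  proof -
    have "s0 * (z + ln 4) + (\<nu> - 1) * z = s0 * ln 4 + - c * z" by (simp add: c_def algebra_simps)
    thus ?thesis by (simp only: exp_add) simp
  qed
  have "((\<lambda>z::real. z * (2 + 4 * (z + ln 4)) * exp (- c * z)) \<longlongrightarrow> 0) at_top" using c by real_asymp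
  from tendsto_mult[OF tendsto_const[of "256 / c1 * exp (s0 * ln 4)"] L_comp[OF this]]
  show ?thesis unfolding bb_def eq by simp
qed

lemma bb_nonneg: "\<forall>\<^sub>F k in sequentially. 0 \<le> bb k"
  using basic by eventually_elim (use B3(1) in \<open>auto simp: bb_def\<close>)

lemma pair_term_ev: "\<forall>\<^sub>F k in sequentially. \<forall>h\<ge>0. Gt (t0 k + \<tau> k) \<le> 2 * Gt h \<longrightarrow>
   exp (\<nu> * L k) * (4 * exp (- (h\<^sup>2 / (1 + r')) * (1 - 2 * H k * bd k))) / (real (card (N0 k)) * (Gt h)\<^sup>2) \<le> bb k"
  using A_ev t0_ev bd_small[of "dd / 32", simplified, OF dd_pos] basic
proof eventually_elim
  case (elim k)
  show ?case
  proof (intro allI impI)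
    fix h :: real assume h: "0 \<le> h" "Gt (t0 k + \<tau> k) \<le> 2 * Gt h"
    have "1 / Q k \<le> \<alpha> * A k / (2 * Q k)" using elim by (simp add: field_simps)
    hence G: "1 / Q k \<le> 2 * Gt h" using elim h by linarith
    have z: "0 \<le> 2 * H k * bd k" using elim by (simp add: H_def)
    have "2 * (r' + 2 * H k * bd k) \<le> 2 * (r' + dd / 16)" using elim(3) by (simp add: mult.commute)
    also have "\<dots> \<le> s0 * (1 + r')" by (rule s0_bound)
    finally have rz: "2 * (r' + 2 * H k * bd k) \<le> s0 * (1 + r')" .
    show "exp (\<nu> * L k) * (4 * exp (- (h\<^sup>2 / (1 + r')) * (1 - 2 * H k * bd k))) / (real (card (N0 k)) * (Gt h)\<^sup>2) \<le> bb k"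
      unfolding bb_def
      by (rule pair_term_bound[OF h(1) _ _ G _ _ B3 _ z rz]) (use elim A2 dd_pos in \<open>auto simp: r'_def\<close>)
  qed
qed

definition bound :: "real \<Rightarrow> nat \<Rightarrow> real" where
  "bound \<eta> k = Q k * Nt k * \<pi> k + 8 * exp (- 5 * L k)
     + (16 / (c1 * \<eta> * (\<alpha> * A k)) + (L k / ln (1 + \<eta>) + 2) * (6 * gk k + bb k)) / \<eta>\<^sup>2"

lemma bound_lim: assumes eta: "0 < \<eta>" shows "bound \<eta> \<longlonglongrightarrow> 0"
proof -
  define G where "G k = 6 * gk k + bb k" for k
  have LG: "(\<lambda>k. L k * G k) \<longlonglongrightarrow> 0"
    using tendsto_add[OF tendsto_mult[OF tendsto_const[of 6] gam_lim] bb_lim] by (simp add: G_def algebra_simps)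
  have G: "G \<longlonglongrightarrow> 0"
  proof (rule tendsto_sandwich[where f = "\<lambda>_. 0" and h = "\<lambda>k. L k * G k"])
    show n: "\<forall>\<^sub>F k in sequentially. 0 \<le> G k" using gam_nonneg bb_nonneg by eventually_elim (simp add: G_def)
    show "\<forall>\<^sub>F k in sequentially. G k \<le> L k * G k" using n basic
    proof eventually_elim
      case (elim k)
      thus ?case using mult_right_mono[of 1 "L k" "G k"] by simp
    qed
  qed (use LG in auto)
  have e: "(\<lambda>k. exp (- 5 * L k)) \<longlonglongrightarrow> 0" by (rule L_comp) real_asymp
  have "((\<lambda>z. 16 / (c1 * \<eta> * (\<alpha> * (c2 * sqrt z)))) \<longlongrightarrow> 0) at_top" using eta alpha B1(1) B3(1) by real_asymp
  from L_comp[OF this] have a: "(\<lambda>k. 16 / (c1 * \<eta> * (\<alpha> * A k))) \<longlonglongrightarrow> 0" by (simp add: A_def)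
  have "(\<lambda>k. Q k * Nt k * \<pi> k + 8 * exp (- 5 * L k)
     + (16 / (c1 * \<eta> * (\<alpha> * A k)) + (1 / ln (1 + \<eta>) * (L k * G k) + 2 * G k)) / \<eta>\<^sup>2) \<longlonglongrightarrow> 0 + 8 * 0 + (0 + (1 / ln (1 + \<eta>) * 0 + 2 * 0)) / \<eta>\<^sup>2"
    using eta by (intro tendsto_add tendsto_divide tendsto_mult tendsto_const seqs(6) e a LG G) auto
  moreover have "(\<lambda>k. Q k * Nt k * \<pi> k + 8 * exp (- 5 * L k)
     + (16 / (c1 * \<eta> * (\<alpha> * A k)) + (1 / ln (1 + \<eta>) * (L k * G k) + 2 * G k)) / \<eta>\<^sup>2) = bound \<eta>"
    unfolding bound_def[abs_def] G_def by (simp add: distrib_right)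
  ultimately show ?thesis by simp
qed

lemma Gt_H: "\<forall>\<^sub>F k in sequentially. 2 * Gt (H k - 1) \<le> Gt (t0 k + \<tau> k)"
proof -
  have "((\<lambda>z::real. 4 * exp (- (2 * sqrt z - 1)\<^sup>2 / 2) * exp z) \<longlongrightarrow> 0) at_top" by real_asymp
  from L_comp[OF this] have "\<forall>\<^sub>F k in sequentially. 4 * exp (- (2 * sqrt (L k) - 1)\<^sup>2 / 2) * exp (L k) < 1" by (intro order_tendstoD) auto
  thus ?thesis using A_ev t0_ev basic
  proof eventually_elim
    case (elim k)
    have "1 \<le> sqrt (L k)" using elim by simp
    hence "2 * Gt (H k - 1) \<le> 4 * exp (- (2 * sqrt (L k) - 1)\<^sup>2 / 2)" using Gt_le_exp[of "2 * sqrt (L k) - 1"] unfolding H_def by linarith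
    also have "\<dots> \<le> 1 / Q k" using elim by (simp add: field_simps)
    also have "\<dots> \<le> \<alpha> * A k / (2 * Q k)" using elim by (simp add: field_simps)
    finally show ?case using elim by linarith
  qed
qed

abbreviation ratio :: "nat \<Rightarrow> 'a \<Rightarrow> real" where
  "ratio k om \<equiv> FDP (p k) (N0 k) \<alpha> (Tstat (X k) (n1 k) (n2 k) om) / (\<alpha> * real (card (N0 k)) / Q k)"

lemma concentration_ev:
  assumes eta: "0 < \<eta>" "\<eta> < 1"
  shows "\<forall>\<^sub>F k in sequentially. \<exists>D\<in>sets (M k). measure (M k) D \<le> bound \<eta> k \<and>
     (\<forall>om\<in>space (M k) - D. (1 - \<eta>) / (1 + \<eta>) * exp (- u k) \<le> ratio k om \<and> ratio k om \<le> (1 + \<eta>)\<^sup>2 * exp (u k))"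
proof -
  have gm: "\<forall>\<^sub>F k in sequentially. L k * gk k < 1/2" using gam_lim by (intro order_tendstoD) auto
  from eventually_conj[OF trunc eventually_conj[OF basic eventually_conj[OF tail eventually_conj[OF s3(1) eventually_conj[OF L_ge[of 16]
    eventually_conj[OF gam_nonneg gm]]]]]]
  have E1: "\<forall>\<^sub>F k in sequentially. truncated (M k) (X k) (p k) (n1 k) (n2 k) (b k) (ka k) (m3 k) (m4 k) (nb k)
    \<and> (1 \<le> b k \<and> 1 \<le> m3 k \<and> 0 \<le> ka k \<and> ka k \<le> 1/16 \<and> 0 < nb k \<and> 1 \<le> L k \<and> 0 < Nt k)
    \<and> (\<forall>d l e. (d, l) \<in> obs_index (n1 k) (n2 k) \<longrightarrow> e \<in> pairs (p k) \<longrightarrow>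
        measure (M k) {om \<in> space (M k). b k < \<bar>Zst (M k) (X k) d l e om\<bar>} \<le> \<pi> k)
    \<and> 0 < t k \<and> 4 * (b k)\<^sup>2 * t k \<le> 1 \<and> 16 \<le> L k \<and> 0 \<le> gk k \<and> L k * gk k < 1/2"
    unfolding nb_eq by (simp add: conj_ac)
  show ?thesis
    using E1 inv_w w_small[of "1/10", simplified] bd_small[of "1/4", simplified] delta_small tau_small tau_nonneg alt_ev Lb_small
      A_ev t0_ev RL_bound strong_count pair_term_ev Gt_H bb_nonneg
  proof eventually_elim
    case (elim k)
    interpret T: truncated "M k" "X k" "p k" "n1 k" "n2 k" "b k" "ka k" "m3 k" "m4 k" "nb k"
      using elim(1) by blast
    have L16: "16 \<le> L k" and gm: "0 \<le> gk k" "L k * gk k < 1/2"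
      and ts: "0 < t k" "4 * (b k)\<^sup>2 * t k \<le> 1" using elim(1) by blast+
    have tl: "measure (M k) {om \<in> space (M k). b k < \<bar>Zst (M k) (X k) d l e om\<bar>} \<le> \<pi> k"
      if "(d, l) \<in> obs_index (n1 k) (n2 k)" "e \<in> pairs (p k)" for d l e using elim(1) that by blast
    have gam2: "gk k \<le> 1/2"
      using mult_right_mono[of 1 "L k" "gk k"] gm L16 by simp
    have "sqrt 16 \<le> sqrt (L k)" using L16 by (rule real_sqrt_le_mono)
    hence H8: "8 \<le> H k" unfolding H_def by simp
    have w0: "0 < w k" using elim(2) by blast
    have wk: "4 * w k \<le> 1 / H k" "10 * w k \<le> 1" using elim(3) H8 by (auto simp: field_simps)
    have bdH: "bd k \<le> 1 / H k" "bd k * (H k + 2 / w k) \<le> 1" "4 * H k * bd k \<le> 1"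
    proof -
      have *: "bd k * H k * 4 \<le> 1" "bd k * (H k + 2 / w k) * 4 \<le> 1" using elim(4) by blast+
      show "bd k \<le> 1 / H k" using * H8 by (simp add: field_simps)
      have imp: "z * 4 \<le> 1 \<Longrightarrow> z \<le> 1" for z :: real by simp
      show "bd k * (H k + 2 / w k) \<le> 1" by (rule imp[OF *(2)])
      show "4 * H k * bd k \<le> 1" using * by (simp add: mult_ac)
    qed
    have sh: "T.sh = shk k" unfolding T.sh_def shk_def Nt_def T.Nn_def ..
    have NN: "real T.Nn = Nt k" unfolding T.Nn_def Nt_def ..
    have q: "1 \<le> qnum (p k)" "exp (L k) = Q k" "2 \<le> \<alpha> * A k" using elim(10) by auto
    have A: "A k \<le> real (card (Sset (M k) (X k) (p k) (n1 k) (n2 k) \<rho>))" unfolding A_def L_def by (rule B1(3))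
    have c0: "0 < c1 * Q k" using B3(1) q by simp
    have null: "N0 k \<noteq> {}" using B3(2)[of k] c0 by auto
    have rho: "0 \<le> \<rho>0 k" unfolding \<rho>0_def using T.chi by simp
    have r0: "0 \<le> r'" unfolding r'_def using A2 dd_pos by simp
    have "\<exists>D\<in>sets (M k). measure (M k) D \<le> Q k * real T.Nn * \<pi> k + 8 * Q k * exp (- 6 * L k)
       + (2 / (real (card (N0 k)) * Gt (t0 k + \<tau> k)) * (4 / \<eta>)
         + (ln (1 / Gt (t0 k + \<tau> k)) / ln (1 + \<eta>) + 2) * (6 * gk k + bb k)) / \<eta>\<^sup>2
     \<and> (\<forall>om\<in>space (M k) - D. (1 - \<eta>) / (1 + \<eta>) * exp (- u k) \<le> ratio k om \<and> ratio k om \<le> (1 + \<eta>)\<^sup>2 * exp (u k))"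
      unfolding u_def \<tau>_def \<delta>_def y_def x_def \<beta>_def sh[symmetric]
      apply (rule T.fdp_concentration[where A = "A k" and \<rho> = \<rho> and r = r' and m = "exp (\<nu> * L k)", OF _ _ q(1) alpha _ ts tl H8 w0 wk])
      subgoal by (simp add: L_def)
      subgoal using L16 by simp
      subgoal using elim(9) .
      subgoal .
      subgoal .
      subgoal using bdH(1) unfolding bd_def .
      subgoal using bdH(2) unfolding bd_def .
      subgoal using bdH(3) unfolding bd_def .
      subgoal by (rule rho)
      subgoal using gam2 unfolding \<beta>_def .
      subgoal using elim(5) unfolding \<delta>_def y_def x_def .
      subgoal using elim(6) unfolding \<tau>_def \<delta>_def y_def x_def sh by blast
      subgoal using elim(8) unfolding x_def NN sh .
      subgoal by (rule A)
      subgoal by (rule q)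
      subgoal using elim(11) by blast
      subgoal using elim(11) by blast
      subgoal by (rule null)
      subgoal by (rule r0)
      subgoal using elim(12) by blast
      subgoal using elim(13) by blast
      subgoal by (rule eta)
      subgoal by (rule eta)
      subgoal using elim(15) unfolding \<tau>_def \<delta>_def y_def x_def sh .
      subgoal using elim(14) unfolding \<tau>_def \<delta>_def y_def x_def sh bd_def by blast
      done
    then obtain D where D: "D \<in> sets (M k)" "measure (M k) D \<le> Q k * real T.Nn * \<pi> k + 8 * Q k * exp (- 6 * L k)
       + (2 / (real (card (N0 k)) * Gt (t0 k + \<tau> k)) * (4 / \<eta>)
         + (ln (1 / Gt (t0 k + \<tau> k)) / ln (1 + \<eta>) + 2) * (6 * gk k + bb k)) / \<eta>\<^sup>2"
      "\<forall>om\<in>space (M k) - D. (1 - \<eta>) / (1 + \<eta>) * exp (- u k) \<le> ratio k om \<and> ratio k om \<le> (1 + \<eta>)\<^sup>2 * exp (u k)" by blast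
    have "Q k * real T.Nn * \<pi> k + 8 * Q k * exp (- 6 * L k)
       + (2 / (real (card (N0 k)) * Gt (t0 k + \<tau> k)) * (4 / \<eta>)
         + (ln (1 / Gt (t0 k + \<tau> k)) / ln (1 + \<eta>) + 2) * (6 * gk k + bb k)) / \<eta>\<^sup>2 \<le> bound \<eta> k"
    proof -
      have G1: "\<alpha> * A k / (2 * Q k) \<le> Gt (t0 k + \<tau> k)" using elim(11) by blast
      have "c1 * (\<alpha> * A k) / 2 = c1 * Q k * (\<alpha> * A k / (2 * Q k))" using q by simp
      also have "\<dots> \<le> real (card (N0 k)) * Gt (t0 k + \<tau> k)"
        using G1 B3(2)[of k] c0 q by (intro mult_mono) auto
      finally have "2 / (real (card (N0 k)) * Gt (t0 k + \<tau> k)) \<le> 2 / (c1 * (\<alpha> * A k) / 2)"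
        using mult_pos_pos[of c1 "\<alpha> * A k"] B3(1) q(3) by (intro frac_le) auto
      hence "2 / (real (card (N0 k)) * Gt (t0 k + \<tau> k)) * (4 / \<eta>) \<le> 2 / (c1 * (\<alpha> * A k) / 2) * (4 / \<eta>)"
        using eta by (intro mult_right_mono) auto
      also have "\<dots> = 16 / (c1 * \<eta> * (\<alpha> * A k))" by simp
      finally have b1: "2 / (real (card (N0 k)) * Gt (t0 k + \<tau> k)) * (4 / \<eta>) \<le> 16 / (c1 * \<eta> * (\<alpha> * A k))" .
      have "1 / Q k \<le> \<alpha> * A k / (2 * Q k)" using q by (simp add: field_simps)
      hence "1 / Q k \<le> Gt (t0 k + \<tau> k)" using G1 by linarith
      hence "1 / Gt (t0 k + \<tau> k) \<le> exp (L k)" using q Gt_pos[of "t0 k + \<tau> k"] by (simp add: field_simps)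
      hence "ln (1 / Gt (t0 k + \<tau> k)) \<le> L k" using ln_mono[of "1 / Gt (t0 k + \<tau> k)" "exp (L k)"] Gt_pos[of "t0 k + \<tau> k"] by simp
      hence b2: "(ln (1 / Gt (t0 k + \<tau> k)) / ln (1 + \<eta>) + 2) * (6 * gk k + bb k)
         \<le> (L k / ln (1 + \<eta>) + 2) * (6 * gk k + bb k)"
        using eta gm elim(16) by (intro mult_right_mono add_right_mono divide_right_mono) auto
      have b3: "8 * Q k * exp (- 6 * L k) = 8 * exp (- 5 * L k)"
        unfolding q(2)[symmetric] by (simp flip: exp_add)
      show ?thesis unfolding bound_def b3 NN using b1 b2 by (intro add_left_mono divide_right_mono add_mono) auto
    qed
    with D show ?case by (meson order_trans)
  qed
qed

lemma in_probability:
  assumes eps: "0 < \<epsilon>"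
  shows "(\<lambda>k. measure (M k) {om \<in> space (M k). \<bar>ratio k om - 1\<bar> > \<epsilon>}) \<longlonglongrightarrow> 0"
proof -
  have "((\<lambda>z::real. (1 - z) / (1 + z)) \<longlongrightarrow> (1 - 0) / (1 + 0)) (at_right 0)"
    by (intro tendsto_intros) auto
  hence e1: "\<forall>\<^sub>F z in at_right (0::real). 1 - \<epsilon> < (1 - z) / (1 + z)" using eps by (intro order_tendstoD) auto
  have "((\<lambda>z::real. (1 + z)\<^sup>2) \<longlongrightarrow> (1 + 0)\<^sup>2) (at_right 0)"
    by (intro tendsto_intros)
  hence e2: "\<forall>\<^sub>F z in at_right (0::real). (1 + z)\<^sup>2 < 1 + \<epsilon>" using eps by (intro order_tendstoD) auto
  have e3: "\<forall>\<^sub>F z in at_right (0::real). 0 < z \<and> z < 1" unfolding eventually_at_right_field by (auto intro: exI[of _ 1])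
  obtain \<eta> where eta: "0 < \<eta>" "\<eta> < 1" "1 - \<epsilon> < (1 - \<eta>) / (1 + \<eta>)" "(1 + \<eta>)\<^sup>2 < 1 + \<epsilon>"
    using eventually_happens[OF eventually_conj[OF e1 eventually_conj[OF e2 e3]]] by auto
  have "(\<lambda>k. (1 - \<eta>) / (1 + \<eta>) * exp (- u k)) \<longlonglongrightarrow> (1 - \<eta>) / (1 + \<eta>) * exp (- 0)" by (intro tendsto_intros u_lim)
  hence l1: "\<forall>\<^sub>F k in sequentially. 1 - \<epsilon> < (1 - \<eta>) / (1 + \<eta>) * exp (- u k)" using eta by (intro order_tendstoD) auto
  have "(\<lambda>k. (1 + \<eta>)\<^sup>2 * exp (u k)) \<longlonglongrightarrow> (1 + \<eta>)\<^sup>2 * exp 0" by (intro tendsto_intros u_lim)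
  hence l2: "\<forall>\<^sub>F k in sequentially. (1 + \<eta>)\<^sup>2 * exp (u k) < 1 + \<epsilon>" using eta by (intro order_tendstoD) auto
  show ?thesis
  proof (rule tendsto_sandwich[where f = "\<lambda>_. 0" and h = "bound \<eta>"])
    show "\<forall>\<^sub>F k in sequentially. measure (M k) {om \<in> space (M k). \<bar>ratio k om - 1\<bar> > \<epsilon>} \<le> bound \<eta> k"
      using concentration_ev[OF eta(1,2)] l1 l2 trunc
    proof eventually_elim
      case (elim k)
      interpret T: truncated "M k" "X k" "p k" "n1 k" "n2 k" "b k" "ka k" "m3 k" "m4 k" "real (n1 k) * real (n2 k) / real (n1 k + n2 k)"
        by (rule elim(4))
      obtain D where D: "D \<in> sets (M k)" "measure (M k) D \<le> bound \<eta> k"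
        "\<forall>om\<in>space (M k) - D. (1 - \<eta>) / (1 + \<eta>) * exp (- u k) \<le> ratio k om \<and> ratio k om \<le> (1 + \<eta>)\<^sup>2 * exp (u k)" using elim(1) by blast
      have "{om \<in> space (M k). \<bar>ratio k om - 1\<bar> > \<epsilon>} \<subseteq> D"
      proof
        fix om assume w: "om \<in> {om \<in> space (M k). \<bar>ratio k om - 1\<bar> > \<epsilon>}"
        show "om \<in> D"
        proof (rule ccontr)
          assume "om \<notin> D"
          hence "(1 - \<eta>) / (1 + \<eta>) * exp (- u k) \<le> ratio k om" "ratio k om \<le> (1 + \<eta>)\<^sup>2 * exp (u k)" using D(3) w by blast+
          hence "\<bar>ratio k om - 1\<bar> \<le> \<epsilon>" using elim(2,3) by linarith
          thus False using w by (simp only: mem_Collect_eq) linarith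
        qed
      qed
      hence "measure (M k) {om \<in> space (M k). \<bar>ratio k om - 1\<bar> > \<epsilon>} \<le> measure (M k) D" using D(1) by (rule T.finite_measure_mono)
      thus ?case using D(2) by linarith
    qed
  qed (use bound_lim[OF eta(1)] in auto)
qed

lemma ratio_meas: "\<forall>\<^sub>F k in sequentially. prob_space (M k) \<and> (\<lambda>om. ratio k om) \<in> borel_measurable (M k)
    \<and> (\<forall>om. 0 \<le> ratio k om \<and> ratio k om \<le> 1 / (\<alpha> * c1))"
  using trunc A_ev
proof eventually_elim
  case (elim k)
  interpret T: truncated "M k" "X k" "p k" "n1 k" "n2 k" "b k" "ka k" "m3 k" "m4 k" "real (n1 k) * real (n2 k) / real (n1 k + n2 k)"
    by (rule elim(1))
  have sub: "N0 k \<subseteq> pairs (p k)" by (auto simp: H0_def)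
  have [measurable]: "(\<lambda>om. FDP (p k) (N0 k) \<alpha> (Tstat (X k) (n1 k) (n2 k) om)) \<in> borel_measurable (M k)"
    by (rule FDP_measurable[OF _ alpha T.Tstat_measurable sub]) (use elim in auto)
  have q: "0 < Q k" using elim by auto
  have c: "c1 \<le> real (card (N0 k)) / Q k" using B3(2)[of k] q by (simp add: field_simps)
  have "\<alpha> * c1 \<le> \<alpha> * real (card (N0 k)) / Q k" using mult_left_mono[OF c, of \<alpha>] alpha by simp
  moreover have "0 < \<alpha> * c1" using alpha B3 by simp
  ultimately have "0 \<le> ratio k om \<and> ratio k om \<le> 1 / (\<alpha> * c1)" for om
    using FDP_bounds(1) FDP_bounds(2)[OF sub] alpha by (intro conjI frac_le divide_nonneg_nonneg) auto
  moreover have "(\<lambda>om. ratio k om) \<in> borel_measurable (M k)" by measurable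
  ultimately show ?case using T.prob_space_axioms by blast
qed

lemma mean_ratio: "(\<lambda>k. \<integral>om. ratio k om \<partial>M k) \<longlonglongrightarrow> 1"
proof (rule tendstoI)
  fix e :: real assume e: "0 < e"
  define B where "B = 1 / (\<alpha> * c1) + 1"
  have B: "0 < B" unfolding B_def using alpha B3 by (simp add: add_pos_pos)
  have "(\<lambda>k. e / 2 + B * measure (M k) {om \<in> space (M k). \<bar>ratio k om - 1\<bar> > e / 2}) \<longlonglongrightarrow> e / 2 + B * 0"
    using e by (intro tendsto_intros in_probability) simp
  hence "\<forall>\<^sub>F k in sequentially. e / 2 + B * measure (M k) {om \<in> space (M k). \<bar>ratio k om - 1\<bar> > e / 2} < e"
    by (rule order_tendstoD(2)) (use e in simp)
  thus "\<forall>\<^sub>F k in sequentially. dist (\<integral>om. ratio k om \<partial>M k) 1 < e" using ratio_meas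
  proof eventually_elim
    case (elim k)
    interpret prob_space "M k" using elim(2) by blast
    have m[measurable]: "(\<lambda>om. ratio k om) \<in> borel_measurable (M k)" using elim(2) by blast
    have bnd: "0 \<le> ratio k om" "ratio k om \<le> 1 / (\<alpha> * c1)" for om using elim(2) by blast+
    define F where "F om = ratio k om" for om
    note F = m[folded F_def] bnd[folded F_def]
    define E where "E = {om \<in> space (M k). \<bar>F om - 1\<bar> > e / 2}"
    have E: "E \<in> events" unfolding E_def using F(1) by measurable
    have int: "integrable (M k) F" using F by (intro integrable_const_bound[of _ "1 / (\<alpha> * c1)"]) auto
    have "\<bar>expectation F - 1\<bar> = \<bar>expectation (\<lambda>om. F om - 1)\<bar>" using int by (simp add: prob_space)
    also have "\<dots> \<le> expectation (\<lambda>om. \<bar>F om - 1\<bar>)" by (rule integral_abs_bound)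
    also have "\<dots> \<le> expectation (\<lambda>om. e / 2 + B * indicator E om)"
    proof (rule integral_mono)
      show "integrable (M k) (\<lambda>om. \<bar>F om - 1\<bar>)" using int by simp
      show "integrable (M k) (\<lambda>om. e / 2 + B * indicator E om)" using E by (simp add: emeasure_eq_measure)
      fix om assume w: "om \<in> space (M k)"
      show "\<bar>F om - 1\<bar> \<le> e / 2 + B * indicator E om"
      proof (cases "om \<in> E")
        case True
        have "\<bar>F om - 1\<bar> \<le> B" using F(2,3)[of om] unfolding B_def by linarith
        thus ?thesis using True e by simp
      qed (use w in \<open>auto simp: E_def\<close>)
    qed
    also have "\<dots> = e / 2 + B * prob E" using E by (simp add: emeasure_eq_measure prob_space)
    also have "\<dots> < e" unfolding E_def F_def by (rule elim(1))
    finally show ?case unfolding dist_real_def F_def .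
  qed
qed

theorem fdr_fdp_limits:
  "(\<lambda>k. mean (M k) (\<lambda>om. FDP (p k) (N0 k) \<alpha> (Tstat (X k) (n1 k) (n2 k) om))
            / (\<alpha> * real (card (N0 k)) / Q k)) \<longlonglongrightarrow> 1"
  "0 < \<epsilon> \<Longrightarrow> (\<lambda>k. measure (M k) {om \<in> space (M k). \<bar>ratio k om - 1\<bar> > \<epsilon>}) \<longlonglongrightarrow> 0"
  using mean_ratio in_probability unfolding mean_def by simp_all

end

section \<open>Moment conditions\<close>

lemma (in prob_space) integrable_nn_bound:
  fixes f :: "'a \<Rightarrow> real"
  assumes m [measurable]: "f \<in> borel_measurable M" and f: "\<And>om. 0 \<le> f om" and K: "(\<integral>\<^sup>+om. ennreal (f om) \<partial>M) \<le> ennreal K" "0 \<le> K"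
  shows "integrable M f" "expectation f \<le> K"
proof -
  have "(\<integral>\<^sup>+om. ennreal (norm (f om)) \<partial>M) < \<infinity>" using le_less_trans[OF K(1), of \<infinity>] f by simp
  thus i: "integrable M f" by (intro integrableI_bounded m)
  have "ennreal (expectation f) \<le> ennreal K" using K nn_integral_eq_integral[OF i] f by simp
  thus "expectation f \<le> K" using K by simp
qed

lemma sum1_pow: fixes a :: real assumes "0 \<le> a"
  shows "(a + 1) ^ 3 \<le> 4 * (a ^ 3 + 1)" "(a + 1) ^ 4 \<le> 8 * (a ^ 4 + 1)"
proof -
  have "4 * (a ^ 3 + 1) - (a + 1) ^ 3 = 3 * (a + 1) * (a - 1)\<^sup>2" by (simp add: power2_eq_square power3_eq_cube algebra_simps)
  moreover have "0 \<le> 3 * (a + 1) * (a - 1)\<^sup>2" using assms by simp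
  ultimately show "(a + 1) ^ 3 \<le> 4 * (a ^ 3 + 1)" by linarith
  have "8 * (a ^ 4 + 1) - (a + 1) ^ 4 = (a - 1)\<^sup>2 * (7 * a\<^sup>2 + 10 * a + 7)" by (simp add: power2_eq_square power4_eq_xxxx algebra_simps)
  moreover have "0 \<le> (a - 1)\<^sup>2 * (7 * a\<^sup>2 + 10 * a + 7)" using assms by simp
  ultimately show "(a + 1) ^ 4 \<le> 8 * (a ^ 4 + 1)" by linarith
qed

context two_sample
begin

lemma mut_le_1: assumes "d \<in> {1, 2}" "e \<in> pairs p" shows "\<bar>mut M X b d e\<bar> \<le> 1"
proof -
  note Zm = Z_moments[OF assms]
  have "\<bar>mut M X b d e\<bar> \<le> expectation (\<lambda>om. \<bar>trc b (Zst M X d 1 e om)\<bar>)" unfolding mut_def by (rule integral_abs_bound)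
  also have "\<dots> \<le> expectation (\<lambda>om. (1 + (Zst M X d 1 e om)\<^sup>2) / 2)"
  proof (rule integral_mono')
    show "integrable M (\<lambda>om. (1 + (Zst M X d 1 e om)\<^sup>2) / 2)" using Zm(2) by simp
    fix om
    have "0 \<le> (\<bar>Zst M X d 1 e om\<bar> - 1)\<^sup>2" by simp
    hence "\<bar>Zst M X d 1 e om\<bar> \<le> (1 + (Zst M X d 1 e om)\<^sup>2) / 2" by (simp add: power2_diff)
    thus "\<bar>trc b (Zst M X d 1 e om)\<bar> \<le> (1 + (Zst M X d 1 e om)\<^sup>2) / 2" using trc_bound(2) order_trans by blast
  qed simp
  also have "\<dots> = 1" using Zm by (simp add: prob_space)
  finally show ?thesis .
qed

lemma majorant:
  fixes f :: "real \<Rightarrow> real"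
  assumes f: "f \<in> borel_measurable borel" "\<And>z. 0 \<le> f z"
    and K: "\<And>d l e. (d, l) \<in> obs \<Longrightarrow> e \<in> pairs p \<Longrightarrow> (\<integral>\<^sup>+om. ennreal (f (Zst M X d l e om)) \<partial>M) \<le> ennreal K" "0 \<le> K"
    and d: "d \<in> {1, 2}" "e \<in> pairs p" and c: "0 \<le> a" "0 \<le> u" "0 \<le> v"
    and g: "\<And>om. g om \<le> a + u * (Zst M X d 1 e om)\<^sup>2 + v * f (Zst M X d 1 e om)"
  shows "expectation g \<le> a + u + v * K"
proof -
  note Zm = Z_moments[OF d]
  note Kd = integrable_nn_bound[OF measurable_compose[OF Zst_meas[OF d(2) obs_1[OF d(1)]] f(1)] f(2) K(1)[OF obs_1[OF d(1)] d(2)] K(2)]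
  have "expectation g \<le> expectation (\<lambda>om. a + u * (Zst M X d 1 e om)\<^sup>2 + v * f (Zst M X d 1 e om))"
    using Zm(2) Kd(1) c f(2) by (intro integral_mono' g) auto
  also have "\<dots> = a + u + v * expectation (\<lambda>om. f (Zst M X d 1 e om))" using Zm Kd(1) by (simp add: prob_space)
  also have "\<dots> \<le> a + u + v * K" using Kd(2) c by (intro add_left_mono mult_left_mono) auto
  finally show ?thesis .
qed

lemma truncatedI:
  fixes f :: "real \<Rightarrow> real"
  assumes f: "f \<in> borel_measurable borel" "\<And>z. 0 \<le> f z"
    and K: "\<And>d l e. (d, l) \<in> obs \<Longrightarrow> e \<in> pairs p \<Longrightarrow> (\<integral>\<^sup>+om. ennreal (f (Zst M X d l e om)) \<partial>M) \<le> ennreal K" "0 \<le> K"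
    and b: "1 \<le> b" and nb: "0 < nb" "nb \<le> real n1" "nb \<le> real n2"
    and c: "0 \<le> c" "c * K \<le> 1 / 16" "\<And>z. b < \<bar>z\<bar> \<Longrightarrow> z\<^sup>2 \<le> c * f z"
    and u: "0 \<le> u3" "0 \<le> v3" "\<And>z. \<bar>trc b z\<bar> ^ 3 \<le> u3 * z\<^sup>2 + v3 * f z" "0 \<le> u4" "0 \<le> v4" "\<And>z. \<bar>trc b z\<bar> ^ 4 \<le> u4 * z\<^sup>2 + v4 * f z"
  shows "truncated M X p n1 n2 b (c * K) (4 * (u3 + v3 * K + 1)) (8 * (u4 + v4 * K + 1)) nb"
proof unfold_locales
  fix d e assume de: "d \<in> {1::nat, 2}" "e \<in> pairs p"
  note maj = majorant[OF f K de]
  have "expectation (\<lambda>om. if \<bar>Zst M X d 1 e om\<bar> \<le> b then 0 else (Zst M X d 1 e om)\<^sup>2) \<le> 0 + 0 + c * K"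
    using c f(2) by (intro maj) auto
  thus "expectation (\<lambda>om. if \<bar>Zst M X d 1 e om\<bar> \<le> b then 0 else (Zst M X d 1 e om)\<^sup>2) \<le> c * K" by simp
  have Y: "\<bar>Yst M X b d 1 e om\<bar> \<le> \<bar>trc b (Zst M X d 1 e om)\<bar> + 1" for om
    unfolding Yst_def using mut_le_1[OF de, of b] by linarith
  have "expectation (\<lambda>om. \<bar>Yst M X b d 1 e om\<bar> ^ 3) \<le> 4 + 4 * u3 + (4 * v3) * K"
  proof (rule maj)
    fix om
    have "\<bar>Yst M X b d 1 e om\<bar> ^ 3 \<le> (\<bar>trc b (Zst M X d 1 e om)\<bar> + 1) ^ 3" by (intro power_mono Y) simp
    also have "\<dots> \<le> 4 * (\<bar>trc b (Zst M X d 1 e om)\<bar> ^ 3 + 1)" by (rule sum1_pow) simp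
    also have "\<dots> \<le> 4 * ((u3 * (Zst M X d 1 e om)\<^sup>2 + v3 * f (Zst M X d 1 e om)) + 1)" using u(3) by (intro mult_left_mono add_right_mono) auto
    finally show "\<bar>Yst M X b d 1 e om\<bar> ^ 3 \<le> 4 + 4 * u3 * (Zst M X d 1 e om)\<^sup>2 + 4 * v3 * f (Zst M X d 1 e om)" by simp
  qed (use u in auto)
  thus "expectation (\<lambda>om. \<bar>Yst M X b d 1 e om\<bar> ^ 3) \<le> 4 * (u3 + v3 * K + 1)" by simp
  have "expectation (\<lambda>om. Yst M X b d 1 e om ^ 4) \<le> 8 + 8 * u4 + (8 * v4) * K"
  proof (rule maj)
    fix om
    have "Yst M X b d 1 e om ^ 4 = \<bar>Yst M X b d 1 e om\<bar> ^ 4" by simp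
    also have "\<dots> \<le> (\<bar>trc b (Zst M X d 1 e om)\<bar> + 1) ^ 4" by (intro power_mono Y) simp
    also have "\<dots> \<le> 8 * (\<bar>trc b (Zst M X d 1 e om)\<bar> ^ 4 + 1)" by (rule sum1_pow) simp
    also have "\<dots> \<le> 8 * ((u4 * (Zst M X d 1 e om)\<^sup>2 + v4 * f (Zst M X d 1 e om)) + 1)" using u(6) by (intro mult_left_mono add_right_mono) auto
    finally show "Yst M X b d 1 e om ^ 4 \<le> 8 + 8 * u4 * (Zst M X d 1 e om)\<^sup>2 + 8 * v4 * f (Zst M X d 1 e om)" by simp
  qed (use u in auto)
  thus "expectation (\<lambda>om. Yst M X b d 1 e om ^ 4) \<le> 8 * (u4 + v4 * K + 1)" by simp
next
  have "0 \<le> v3 * K" using u K by simp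
  thus "1 \<le> 4 * (u3 + v3 * K + 1)" using u by simp
qed (use b nb c K in auto)

lemma tail_le:
  fixes f :: "real \<Rightarrow> real"
  assumes f: "f \<in> borel_measurable borel" "\<And>z. 0 \<le> f z"
    and K: "\<And>d l e. (d, l) \<in> obs \<Longrightarrow> e \<in> pairs p \<Longrightarrow> (\<integral>\<^sup>+om. ennreal (f (Zst M X d l e om)) \<partial>M) \<le> ennreal K" "0 \<le> K"
    and d: "(d, l) \<in> obs" "e \<in> pairs p" and c: "0 \<le> c" "\<And>z. b < \<bar>z\<bar> \<Longrightarrow> 1 \<le> c * f z"
  shows "prob {om \<in> space M. b < \<bar>Zst M X d l e om\<bar>} \<le> c * K"
proof -
  note m [measurable] = Zst_meas[OF d(2,1)]
  note Kd = integrable_nn_bound[OF measurable_compose[OF m f(1)] f(2) K(1)[OF d] K(2)]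
  have A: "{om \<in> space M. b < \<bar>Zst M X d l e om\<bar>} \<in> events" by measurable
  have "prob {om \<in> space M. b < \<bar>Zst M X d l e om\<bar>} = expectation (indicator {om \<in> space M. b < \<bar>Zst M X d l e om\<bar>})"
    using A by (simp add: Int_absorb1)
  also have "\<dots> \<le> expectation (\<lambda>om. c * f (Zst M X d l e om))"
    using Kd(1) c f(2) by (intro integral_mono') (auto simp: indicator_def)
  also have "\<dots> \<le> c * K" using Kd(2) c by (simp add: mult_left_mono)
  finally show ?thesis .
qed

end

lemma lim0_sandwich:
  fixes f :: "real \<Rightarrow> real" and z g :: "nat \<Rightarrow> real"
  assumes "(f \<longlongrightarrow> 0) at_top" "filterlim z at_top sequentially"
    "\<forall>\<^sub>F k in sequentially. 0 \<le> g k" "\<forall>\<^sub>F k in sequentially. g k \<le> f (z k)"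
  shows "g \<longlonglongrightarrow> 0"
  by (rule tendsto_sandwich[OF assms(3,4) tendsto_const filterlim_compose[OF assms(1,2)]])

lemma sub_gaussian_rates:
  fixes L z N q :: "nat \<Rightarrow> real" and \<eta> K Cn m3 m4 :: real
  defines "ka \<equiv> \<lambda>k. 2 / \<eta> * exp (- (\<eta> / 2 * (z k powr (1/10))\<^sup>2)) * K"
    and "b \<equiv> \<lambda>k. z k powr (1/10)" and "t \<equiv> \<lambda>k. z k powr (-1/2)"
  assumes z: "filterlim z at_top sequentially" and L: "\<forall>\<^sub>F k in sequentially. 1 \<le> L k" "(\<lambda>k. L k / z k powr (1/5)) \<longlonglongrightarrow> 0"
    and N: "\<forall>\<^sub>F k in sequentially. 0 \<le> N k \<and> N k \<le> Cn * z k" and q: "\<forall>\<^sub>F k in sequentially. q k = exp (L k)"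
    and c: "0 < \<eta>" "0 < K" "0 < Cn" "0 < m3" "0 < m4"
  shows "\<forall>\<^sub>F k in sequentially. 1 \<le> b k \<and> 0 \<le> ka k \<and> ka k \<le> 1 / 16 \<and> 0 < t k \<and> 4 * (b k)\<^sup>2 * t k \<le> 1"
    "(\<lambda>k. L k powr (5/2) * m3 / sqrt (z k)) \<longlonglongrightarrow> 0"
    "(\<lambda>k. L k powr (3/2) * b k / sqrt (z k)) \<longlonglongrightarrow> 0"
    "(\<lambda>k. L k * (t k * m4 + 6 * L k / (z k * t k))) \<longlonglongrightarrow> 0"
    "(\<lambda>k. L k ^ 4 * ka k) \<longlonglongrightarrow> 0"
    "(\<lambda>k. sqrt (L k) * (ka k / b k * sqrt (N k))) \<longlonglongrightarrow> 0"
    "(\<lambda>k. q k * N k * (exp (- (\<eta> * (b k)\<^sup>2)) * K)) \<longlonglongrightarrow> 0"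
proof -
  have z1: "\<forall>\<^sub>F k in sequentially. 1 \<le> z k" using z by (simp add: filterlim_at_top)
  have "\<forall>\<^sub>F k in sequentially. L k / z k powr (1/5) < min 1 (\<eta> / 4)" by (rule order_tendstoD(2)[OF L(2)]) (use c in simp)
  hence E: "\<forall>\<^sub>F k in sequentially. 1 \<le> z k \<and> 1 \<le> L k \<and> L k \<le> z k powr (1/5) \<and> L k \<le> \<eta> / 4 * z k powr (1/5) \<and> 0 \<le> N k \<and> N k \<le> Cn * z k \<and> q k = exp (L k)"
    using z1 L(1) N q
  proof eventually_elim
    case (elim k)
    have zp: "0 < z k powr (1/5)" using elim by simp
    have "L k / z k powr (1/5) < 1" "L k / z k powr (1/5) < \<eta> / 4" using elim(1) by auto
    hence "L k \<le> z k powr (1/5)" "L k \<le> \<eta> / 4 * z k powr (1/5)" using zp by (auto simp: divide_less_eq)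
    thus ?case using elim by blast
  qed
  have k0: "0 \<le> ka k" for k unfolding ka_def using c by simp
  define kf where "kf x = 2 / \<eta> * exp (- (\<eta> / 2 * (x powr (1/10))\<^sup>2)) * K" for x
  have kf: "ka k = kf (z k)" for k by (simp add: ka_def kf_def)
  have kf0: "0 \<le> kf x" for x unfolding kf_def using c by simp
  have "((\<lambda>x::real. 2 / \<eta> * exp (- (\<eta> / 2 * (x powr (1/10))\<^sup>2)) * K) \<longlongrightarrow> 0) at_top" using c by real_asymp
  from filterlim_compose[OF this z] have ka: "ka \<longlonglongrightarrow> 0" unfolding ka_def .
  hence e1: "\<forall>\<^sub>F k in sequentially. ka k < 1/16" by (rule order_tendstoD) simp
  have "((\<lambda>x::real. 4 * (x powr (1/10))\<^sup>2 * x powr (-1/2)) \<longlongrightarrow> 0) at_top" by real_asymp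
  from filterlim_compose[OF this z] have "(\<lambda>k. 4 * (b k)\<^sup>2 * t k) \<longlonglongrightarrow> 0" unfolding b_def t_def .
  hence e2: "\<forall>\<^sub>F k in sequentially. 4 * (b k)\<^sup>2 * t k < 1" by (rule order_tendstoD) simp
  show "\<forall>\<^sub>F k in sequentially. 1 \<le> b k \<and> 0 \<le> ka k \<and> ka k \<le> 1 / 16 \<and> 0 < t k \<and> 4 * (b k)\<^sup>2 * t k \<le> 1"
    using e1 e2 E
  proof eventually_elim
    case (elim k)
    have "1 \<le> b k" "0 < t k" unfolding b_def t_def using elim(3) by (auto intro: ge_one_powr_ge_zero)
    thus ?case using elim k0 by auto
  qed
  have u2: "\<forall>\<^sub>F k in sequentially. L k powr (5/2) * m3 / sqrt (z k) \<le> m3 * (L k / z k powr (1/5))"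
    using E
  proof eventually_elim
    case (elim k)
    define y where "y = L k / z k powr (1/5)"
    have zp: "0 < z k powr (1/5)" using elim by simp
    have y: "0 \<le> y" "y \<le> 1" unfolding y_def using elim zp by (auto simp: divide_le_eq)
    have "L k = y * z k powr (1/5)" using zp by (simp add: y_def)
    hence "L k powr (5/2) = y powr (5/2) * (z k powr (1/5)) powr (5/2)" using y zp by (simp only: powr_mult)
    also have "(z k powr (1/5)) powr (5/2) = sqrt (z k)" using elim by (simp add: powr_powr powr_half_sqrt)
    finally have "L k powr (5/2) * m3 / sqrt (z k) = m3 * y powr (5/2)" using elim by simp
    also have "\<dots> \<le> m3 * y"
    proof -
      have "y powr (5/2) \<le> y powr 1" using y by (intro powr_mono') auto
      thus ?thesis using y c by simp
    qed
    finally show ?case unfolding y_def .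
  qed
  have u1: "\<forall>\<^sub>F k in sequentially. 0 \<le> L k powr (5/2) * m3 / sqrt (z k)" using E by eventually_elim (use c in simp)
  have u3: "(\<lambda>k. m3 * (L k / z k powr (1/5))) \<longlonglongrightarrow> 0" using tendsto_mult[OF tendsto_const[of m3] L(2)] by simp
  show "(\<lambda>k. L k powr (5/2) * m3 / sqrt (z k)) \<longlonglongrightarrow> 0" by (rule tendsto_sandwich[OF u1 u2 tendsto_const u3])
  show "(\<lambda>k. L k powr (3/2) * b k / sqrt (z k)) \<longlonglongrightarrow> 0"
  proof (rule lim0_sandwich[OF _ z])
    show "((\<lambda>x::real. (x powr (1/5)) powr (3/2) * x powr (1/10) / sqrt x) \<longlongrightarrow> 0) at_top" by real_asymp
    show "\<forall>\<^sub>F k in sequentially. 0 \<le> L k powr (3/2) * b k / sqrt (z k)" using E by eventually_elim (simp add: b_def)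
    show "\<forall>\<^sub>F k in sequentially. L k powr (3/2) * b k / sqrt (z k) \<le> (z k powr (1/5)) powr (3/2) * z k powr (1/10) / sqrt (z k)"
      using E
    proof eventually_elim
      case (elim k)
      thus ?case unfolding b_def by (intro divide_right_mono mult_right_mono powr_mono2) auto
    qed
  qed
  show "(\<lambda>k. L k * (t k * m4 + 6 * L k / (z k * t k))) \<longlonglongrightarrow> 0"
  proof (rule lim0_sandwich[OF _ z])
    show "((\<lambda>x::real. x powr (1/5) * (x powr (-1/2) * m4 + 6 * x powr (1/5) / (x * x powr (-1/2)))) \<longlongrightarrow> 0) at_top" using c by real_asymp
    show "\<forall>\<^sub>F k in sequentially. 0 \<le> L k * (t k * m4 + 6 * L k / (z k * t k))" using E by eventually_elim (use c in \<open>simp add: t_def\<close>)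
    show "\<forall>\<^sub>F k in sequentially. L k * (t k * m4 + 6 * L k / (z k * t k)) \<le> z k powr (1/5) * (z k powr (-1/2) * m4 + 6 * z k powr (1/5) / (z k * z k powr (-1/2)))"
      using E
    proof eventually_elim
      case (elim k)
      have "6 * L k / (z k * t k) \<le> 6 * z k powr (1/5) / (z k * t k)" using elim by (intro divide_right_mono) (auto simp: t_def)
      moreover have "0 \<le> t k * m4 + 6 * L k / (z k * t k)" using elim c by (simp add: t_def)
      ultimately show ?case unfolding t_def using elim by (intro mult_mono[of "L k"] add_left_mono) auto
    qed
  qed
  show "(\<lambda>k. L k ^ 4 * ka k) \<longlonglongrightarrow> 0"
  proof (rule lim0_sandwich[OF _ z])
    show "((\<lambda>x::real. (x powr (1/5)) ^ 4 * kf x) \<longlongrightarrow> 0) at_top" unfolding kf_def using c by real_asymp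
    show "\<forall>\<^sub>F k in sequentially. 0 \<le> L k ^ 4 * ka k" using k0 by simp
    show "\<forall>\<^sub>F k in sequentially. L k ^ 4 * ka k \<le> (z k powr (1/5)) ^ 4 * kf (z k)"
      using E
    proof eventually_elim
      case (elim k)
      thus ?case unfolding kf by (intro mult_right_mono power_mono kf0) auto
    qed
  qed
  show "(\<lambda>k. sqrt (L k) * (ka k / b k * sqrt (N k))) \<longlonglongrightarrow> 0"
  proof (rule lim0_sandwich[OF _ z])
    show "((\<lambda>x::real. sqrt (x powr (1/5)) * (kf x / x powr (1/10) * sqrt (Cn * x))) \<longlongrightarrow> 0) at_top" unfolding kf_def using c by real_asymp
    show "\<forall>\<^sub>F k in sequentially. 0 \<le> sqrt (L k) * (ka k / b k * sqrt (N k))" using E by eventually_elim (use k0 in \<open>simp add: b_def\<close>)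
    show "\<forall>\<^sub>F k in sequentially. sqrt (L k) * (ka k / b k * sqrt (N k)) \<le> sqrt (z k powr (1/5)) * (kf (z k) / z k powr (1/10) * sqrt (Cn * z k))"
      using E
    proof eventually_elim
      case (elim k)
      have "kf (z k) / z k powr (1/10) * sqrt (N k) \<le> kf (z k) / z k powr (1/10) * sqrt (Cn * z k)"
        using elim kf0[of "z k"] by (intro mult_left_mono) auto
      thus ?case unfolding kf b_def using elim kf0[of "z k"] by (intro mult_mono[of "sqrt (L k)"]) auto
    qed
  qed
  show "(\<lambda>k. q k * N k * (exp (- (\<eta> * (b k)\<^sup>2)) * K)) \<longlonglongrightarrow> 0"
  proof (rule lim0_sandwich[OF _ z])
    show "((\<lambda>x::real. Cn * K * (x * exp (- (3 / 4 * \<eta> * x powr (1/5))))) \<longlongrightarrow> 0) at_top" using c by real_asymp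
    show "\<forall>\<^sub>F k in sequentially. 0 \<le> q k * N k * (exp (- (\<eta> * (b k)\<^sup>2)) * K)" using E by eventually_elim (use c in simp)
    show "\<forall>\<^sub>F k in sequentially. q k * N k * (exp (- (\<eta> * (b k)\<^sup>2)) * K) \<le> Cn * K * (z k * exp (- (3 / 4 * \<eta> * z k powr (1/5))))"
      using E
    proof eventually_elim
      case (elim k)
      have b2: "(b k)\<^sup>2 = z k powr (1/5)" unfolding b_def power2_eq_square powr_add[symmetric] by simp
      have "q k * N k * (exp (- (\<eta> * (b k)\<^sup>2)) * K) \<le> exp (\<eta> / 4 * z k powr (1/5)) * (Cn * z k) * (exp (- (\<eta> * (b k)\<^sup>2)) * K)"
        using elim c by (intro mult_right_mono mult_mono) auto
      also have "\<dots> = Cn * K * (z k * (exp (\<eta> / 4 * z k powr (1/5)) * exp (- (\<eta> * z k powr (1/5)))))" unfolding b2 by simp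
      also have "exp (\<eta> / 4 * z k powr (1/5)) * exp (- (\<eta> * z k powr (1/5))) = exp (- (3 / 4 * \<eta> * z k powr (1/5)))"
        unfolding exp_add[symmetric] by simp
      finally show ?case .
    qed
  qed
qed

lemma polynomial_rates:
  fixes L z N q :: "nat \<Rightarrow> real" and \<gamma> \<epsilon> c K Cn :: real
  defines "P \<equiv> 4 * \<gamma> + 2 + \<epsilon>"
  defines "h \<equiv> 1 / 2 - \<epsilon> / (4 * P)"
  defines "b \<equiv> \<lambda>k. z k powr h" and "ka \<equiv> \<lambda>k. (z k powr h) powr (2 - P) * K"
    and "t \<equiv> \<lambda>k. z k powr (\<epsilon> / (4 * P) - 1)"
  assumes z: "filterlim z at_top sequentially" and L: "\<forall>\<^sub>F k in sequentially. 1 \<le> L k"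
    and N: "\<forall>\<^sub>F k in sequentially. 0 \<le> N k \<and> N k \<le> Cn * z k" and q: "\<forall>\<^sub>F k in sequentially. q k = exp (L k) \<and> q k \<le> c * z k powr (2 * \<gamma>)"
    and c: "0 < \<gamma>" "0 < \<epsilon>" "0 < K" "0 < Cn" "0 < c"
  shows "\<forall>\<^sub>F k in sequentially. 1 \<le> b k \<and> 0 \<le> ka k \<and> ka k \<le> 1 / 16 \<and> 0 < t k \<and> 4 * (b k)\<^sup>2 * t k \<le> 1"
    "(\<lambda>k. L k powr (5/2) * (4 * (b k + 1)) / sqrt (z k)) \<longlonglongrightarrow> 0"
    "(\<lambda>k. L k powr (3/2) * b k / sqrt (z k)) \<longlonglongrightarrow> 0"
    "(\<lambda>k. L k * (t k * (8 * ((b k)\<^sup>2 + 1)) + 6 * L k / (z k * t k))) \<longlonglongrightarrow> 0"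
    "(\<lambda>k. L k ^ 4 * ka k) \<longlonglongrightarrow> 0"
    "(\<lambda>k. sqrt (L k) * (ka k / b k * sqrt (N k))) \<longlonglongrightarrow> 0"
    "(\<lambda>k. q k * N k * ((b k) powr (- P) * K)) \<longlonglongrightarrow> 0"
proof -
  define s where "s = \<epsilon> / (4 * P)"
  have P2: "2 < P" unfolding P_def using c by simp
  have s0: "0 < s" unfolding s_def using c P2 by simp
  have sP: "s * P = \<epsilon> / 4" unfolding s_def using P2 by simp
  have s8: "s < \<epsilon> / 8" unfolding s_def using P2 c by (simp add: field_simps)
  have s4: "s < 1 / 4" unfolding s_def using P2 c by (simp add: field_simps P_def)
  have h: "h = 1 / 2 - s" unfolding h_def s_def ..
  define C where "C = 2 * \<gamma> + 1"
  have C0: "0 < C" using c by (simp add: C_def)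
  define a where "a = h * (P - 2)"
  have a: "s < a"
  proof -
    have "1 / 4 * (P - 2) \<le> h * (P - 2)" using P2 s4 h by (intro mult_right_mono) auto
    moreover have "\<epsilon> / 4 \<le> 1 / 4 * (P - 2)" unfolding P_def using c by simp
    ultimately show ?thesis using s8 c unfolding a_def by linarith
  qed
  have z1: "\<forall>\<^sub>F k in sequentially. max 3 c \<le> z k" using z unfolding filterlim_at_top by blast
  have E: "\<forall>\<^sub>F k in sequentially. 1 \<le> z k \<and> 1 \<le> L k \<and> L k \<le> C * ln (z k) \<and> 0 \<le> N k \<and> N k \<le> Cn * z k \<and> 0 \<le> q k \<and> q k \<le> c * z k powr (2 * \<gamma>)"
    using z1 L N q
  proof eventually_elim
    case (elim k)
    have "L k = ln (q k)" using elim by simp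
    also have "\<dots> \<le> ln (z k * z k powr (2 * \<gamma>))"
    proof (rule ln_mono)
      have "c * z k powr (2 * \<gamma>) \<le> z k * z k powr (2 * \<gamma>)" using elim by (intro mult_right_mono) auto
      thus "q k \<le> z k * z k powr (2 * \<gamma>)" using elim by linarith
    qed (use elim in auto)
    also have "\<dots> = C * ln (z k)" using elim by (simp add: ln_mult ln_powr C_def algebra_simps)
    finally show ?case using elim by auto
  qed
  have ka_eq: "ka k = z k powr (- a) * K" for k unfolding ka_def powr_powr a_def by (simp add: algebra_simps)
  have k0: "0 \<le> ka k" for k unfolding ka_def using c by simp
  have a0: "0 < a" using a s0 by simp
  have "((\<lambda>x::real. x powr (- a) * K) \<longlongrightarrow> 0) at_top" using a0 by real_asymp
  from filterlim_compose[OF this z] have ka: "ka \<longlonglongrightarrow> 0" unfolding ka_eq[abs_def] .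
  hence e1: "\<forall>\<^sub>F k in sequentially. ka k < 1/16" by (rule order_tendstoD) simp
  have bt: "\<forall>\<^sub>F k in sequentially. 1 \<le> b k \<and> b k / sqrt (z k) = z k powr (- s) \<and> (b k)\<^sup>2 * t k = z k powr (- s) \<and> z k * t k = z k powr s \<and> 0 < t k"
    using E
  proof eventually_elim
    case (elim k)
    have zp: "0 < z k" using elim by simp
    have "b k / sqrt (z k) = z k powr (h - 1/2)" unfolding b_def powr_diff using zp by (simp add: powr_half_sqrt)
    hence 1: "b k / sqrt (z k) = z k powr (- s)" by (simp add: h)
    have "(b k)\<^sup>2 * t k = z k powr (h + h + (s - 1))" unfolding b_def t_def s_def[symmetric] power2_eq_square powr_add ..
    hence 2: "(b k)\<^sup>2 * t k = z k powr (- s)" by (simp add: h)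
    have "z k powr 1 * t k = z k powr (1 + (s - 1))" unfolding t_def s_def[symmetric] powr_add ..
    hence 3: "z k * t k = z k powr s" using zp by simp
    have "1 \<le> b k" unfolding b_def using elim h s4 by (intro ge_one_powr_ge_zero) auto
    moreover have "0 < t k" unfolding t_def using zp by simp
    ultimately show ?case using 1 2 3 by blast
  qed
  have "((\<lambda>x::real. 4 * x powr (- s)) \<longlongrightarrow> 0) at_top" using s0 by real_asymp
  from filterlim_compose[OF this z] have e2: "\<forall>\<^sub>F k in sequentially. 4 * z k powr (- s) < 1" by (rule order_tendstoD) simp
  show "\<forall>\<^sub>F k in sequentially. 1 \<le> b k \<and> 0 \<le> ka k \<and> ka k \<le> 1 / 16 \<and> 0 < t k \<and> 4 * (b k)\<^sup>2 * t k \<le> 1"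
    using e1 e2 bt
  proof eventually_elim
    case (elim k)
    have "4 * (b k)\<^sup>2 * t k = 4 * z k powr (- s)" using elim(3) by (simp only: mult.assoc)
    thus ?case using elim k0 by auto
  qed
  show "(\<lambda>k. L k powr (5/2) * (4 * (b k + 1)) / sqrt (z k)) \<longlonglongrightarrow> 0"
  proof (rule lim0_sandwich[OF _ z])
    show "((\<lambda>x::real. (C * ln x) powr (5/2) * (8 * x powr (- s))) \<longlongrightarrow> 0) at_top" using s0 C0 by real_asymp
    show "\<forall>\<^sub>F k in sequentially. 0 \<le> L k powr (5/2) * (4 * (b k + 1)) / sqrt (z k)" using E by eventually_elim (simp add: b_def)
    show "\<forall>\<^sub>F k in sequentially. L k powr (5/2) * (4 * (b k + 1)) / sqrt (z k) \<le> (C * ln (z k)) powr (5/2) * (8 * z k powr (- s))"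
      using E bt
    proof eventually_elim
      case (elim k)
      have "L k powr (5/2) * (4 * (b k + 1)) / sqrt (z k) \<le> L k powr (5/2) * (8 * b k) / sqrt (z k)"
        using elim by (intro divide_right_mono mult_left_mono) auto
      also have "\<dots> = L k powr (5/2) * (8 * (b k / sqrt (z k)))" by simp
      also have "\<dots> = L k powr (5/2) * (8 * z k powr (- s))" using elim by (simp only:)
      also have "\<dots> \<le> (C * ln (z k)) powr (5/2) * (8 * z k powr (- s))" using elim by (intro mult_right_mono powr_mono2) auto
      finally show ?case .
    qed
  qed
  show "(\<lambda>k. L k powr (3/2) * b k / sqrt (z k)) \<longlonglongrightarrow> 0"
  proof (rule lim0_sandwich[OF _ z])
    show "((\<lambda>x::real. (C * ln x) powr (3/2) * x powr (- s)) \<longlongrightarrow> 0) at_top" using s0 C0 by real_asymp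
    show "\<forall>\<^sub>F k in sequentially. 0 \<le> L k powr (3/2) * b k / sqrt (z k)" using E by eventually_elim (simp add: b_def)
    show "\<forall>\<^sub>F k in sequentially. L k powr (3/2) * b k / sqrt (z k) \<le> (C * ln (z k)) powr (3/2) * z k powr (- s)"
      using E bt
    proof eventually_elim
      case (elim k)
      have "L k powr (3/2) * b k / sqrt (z k) = L k powr (3/2) * (b k / sqrt (z k))" by simp
      also have "\<dots> = L k powr (3/2) * z k powr (- s)" using elim by (simp only:)
      also have "\<dots> \<le> (C * ln (z k)) powr (3/2) * z k powr (- s)" using elim by (intro mult_right_mono powr_mono2) auto
      finally show ?case .
    qed
  qed
  show "(\<lambda>k. L k * (t k * (8 * ((b k)\<^sup>2 + 1)) + 6 * L k / (z k * t k))) \<longlonglongrightarrow> 0"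
  proof (rule lim0_sandwich[OF _ z])
    show "((\<lambda>x::real. (C * ln x) * (16 * x powr (- s) + 6 * (C * ln x) / x powr s)) \<longlongrightarrow> 0) at_top" using s0 C0 by real_asymp
    show "\<forall>\<^sub>F k in sequentially. 0 \<le> L k * (t k * (8 * ((b k)\<^sup>2 + 1)) + 6 * L k / (z k * t k))" using E by eventually_elim (simp add: t_def)
    show "\<forall>\<^sub>F k in sequentially. L k * (t k * (8 * ((b k)\<^sup>2 + 1)) + 6 * L k / (z k * t k)) \<le> (C * ln (z k)) * (16 * z k powr (- s) + 6 * (C * ln (z k)) / z k powr s)"
      using E bt
    proof eventually_elim
      case (elim k)
      have "1 \<le> (b k)\<^sup>2" using elim by simp
      hence "t k * (8 * ((b k)\<^sup>2 + 1)) \<le> t k * (16 * (b k)\<^sup>2)" using elim by (intro mult_left_mono) auto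
      also have "\<dots> = 16 * ((b k)\<^sup>2 * t k)" by simp
      also have "\<dots> = 16 * z k powr (- s)" using elim by (simp only:)
      finally have 1: "t k * (8 * ((b k)\<^sup>2 + 1)) \<le> 16 * z k powr (- s)" .
      have zt: "z k * t k = z k powr s" using elim by blast
      have 2: "6 * L k / (z k * t k) \<le> 6 * (C * ln (z k)) / z k powr s" unfolding zt using elim by (intro divide_right_mono) auto
      have "0 \<le> t k * (8 * ((b k)\<^sup>2 + 1)) + 6 * L k / (z k * t k)" using elim by simp
      thus ?case using elim by (intro mult_mono[OF _ add_mono[OF 1 2]]) auto
    qed
  qed
  show "(\<lambda>k. L k ^ 4 * ka k) \<longlonglongrightarrow> 0"
  proof (rule lim0_sandwich[OF _ z])
    show "((\<lambda>x::real. (C * ln x) ^ 4 * (x powr (- a) * K)) \<longlongrightarrow> 0) at_top" using a0 C0 c by real_asymp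
    show "\<forall>\<^sub>F k in sequentially. 0 \<le> L k ^ 4 * ka k" using k0 by simp
    show "\<forall>\<^sub>F k in sequentially. L k ^ 4 * ka k \<le> (C * ln (z k)) ^ 4 * (z k powr (- a) * K)"
      using E by eventually_elim (use c in \<open>auto simp: ka_eq intro!: mult_right_mono power_mono\<close>)
  qed
  show "(\<lambda>k. sqrt (L k) * (ka k / b k * sqrt (N k))) \<longlonglongrightarrow> 0"
  proof (rule lim0_sandwich[OF _ z])
    have as: "0 < a - s" using a by simp
    have "((\<lambda>x::real. sqrt (C * ln x) * (K * sqrt Cn * x powr (- (a - s)))) \<longlongrightarrow> 0) at_top" using as C0 c by real_asymp
    thus "((\<lambda>x::real. sqrt (C * ln x) * (K * sqrt Cn * x powr (s - a))) \<longlongrightarrow> 0) at_top" by simp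
    show "\<forall>\<^sub>F k in sequentially. 0 \<le> sqrt (L k) * (ka k / b k * sqrt (N k))" using E by eventually_elim (use k0 in \<open>simp add: b_def\<close>)
    show "\<forall>\<^sub>F k in sequentially. sqrt (L k) * (ka k / b k * sqrt (N k)) \<le> sqrt (C * ln (z k)) * (K * sqrt Cn * z k powr (s - a))"
      using E
    proof eventually_elim
      case (elim k)
      have "ka k / b k * sqrt (N k) \<le> ka k / b k * sqrt (Cn * z k)" using elim k0 by (intro mult_left_mono) (auto simp: b_def)
      also have "\<dots> = K * sqrt Cn * (z k powr (- a) / z k powr h * z k powr (1/2))"
        using elim by (simp add: ka_eq b_def real_sqrt_mult powr_half_sqrt)
      also have "z k powr (- a) / z k powr h * z k powr (1/2) = z k powr (- a - h + 1/2)" by (simp only: powr_add powr_diff)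
      also have "- a - h + 1/2 = s - a" by (simp add: h)
      finally have 1: "ka k / b k * sqrt (N k) \<le> K * sqrt Cn * z k powr (s - a)" .
      have "0 \<le> ka k / b k * sqrt (N k)" using elim k0 by (simp add: b_def)
      thus ?case using elim by (intro mult_mono[OF _ 1]) auto
    qed
  qed
  show "(\<lambda>k. q k * N k * ((b k) powr (- P) * K)) \<longlonglongrightarrow> 0"
  proof (rule lim0_sandwich[OF _ z])
    show "((\<lambda>x::real. c * Cn * K * x powr (- \<epsilon> / 4)) \<longlongrightarrow> 0) at_top" using c by real_asymp
    show "\<forall>\<^sub>F k in sequentially. 0 \<le> q k * N k * ((b k) powr (- P) * K)" using E by eventually_elim (use c in simp)
    show "\<forall>\<^sub>F k in sequentially. q k * N k * ((b k) powr (- P) * K) \<le> c * Cn * K * z k powr (- \<epsilon> / 4)"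
      using E
    proof eventually_elim
      case (elim k)
      have "q k * N k * ((b k) powr (- P) * K) \<le> (c * z k powr (2 * \<gamma>)) * (Cn * z k) * ((b k) powr (- P) * K)"
        using elim c by (intro mult_right_mono mult_mono) auto
      also have "\<dots> = c * Cn * K * (z k powr (2 * \<gamma>) * z k powr 1 * z k powr (h * (- P)))" using elim by (simp add: b_def powr_powr)
      also have "z k powr (2 * \<gamma>) * z k powr 1 * z k powr (h * (- P)) = z k powr (2 * \<gamma> + 1 + h * (- P))" by (simp only: powr_add)
      also have "2 * \<gamma> + 1 + h * (- P) = 2 * \<gamma> + 1 - P / 2 + s * P" by (simp add: h algebra_simps)
      also have "\<dots> = - \<epsilon> / 4" unfolding sP by (simp add: P_def field_simps)
      finally show ?case .
    qed
  qed
qed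

lemma sub_gaussian_majorants:
  fixes b z \<eta> :: real
  assumes "0 < \<eta>" "0 \<le> b"
  shows "b < \<bar>z\<bar> \<Longrightarrow> z\<^sup>2 \<le> 2 / \<eta> * exp (- (\<eta> / 2 * b\<^sup>2)) * exp (\<eta> * z\<^sup>2)"
    and "b < \<bar>z\<bar> \<Longrightarrow> 1 \<le> exp (- (\<eta> * b\<^sup>2)) * exp (\<eta> * z\<^sup>2)"
    and "\<bar>trc b z\<bar> ^ 3 \<le> 1 * z\<^sup>2 + 2 / \<eta>\<^sup>2 * exp (\<eta> * z\<^sup>2)" and "\<bar>trc b z\<bar> ^ 4 \<le> 0 * z\<^sup>2 + 2 / \<eta>\<^sup>2 * exp (\<eta> * z\<^sup>2)"
proof -
  have e0: "0 \<le> \<eta> * z\<^sup>2" using assms by simp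
  have sq: "b\<^sup>2 \<le> z\<^sup>2" if "b < \<bar>z\<bar>" using that assms power_mono[of b "\<bar>z\<bar>" 2] by simp
  show "z\<^sup>2 \<le> 2 / \<eta> * exp (- (\<eta> / 2 * b\<^sup>2)) * exp (\<eta> * z\<^sup>2)" if b: "b < \<bar>z\<bar>"
  proof -
    have "\<eta> / 2 * z\<^sup>2 \<le> exp (\<eta> / 2 * z\<^sup>2)" using exp_ge_add_one_self[of "\<eta> / 2 * z\<^sup>2"] by linarith
    also have "\<dots> \<le> exp (- (\<eta> / 2 * b\<^sup>2)) * exp (\<eta> * z\<^sup>2)"
    proof -
      have "\<eta> / 2 * b\<^sup>2 \<le> \<eta> / 2 * z\<^sup>2" using sq[OF b] assms by (intro mult_left_mono) auto
      hence "\<eta> / 2 * z\<^sup>2 \<le> - (\<eta> / 2 * b\<^sup>2) + \<eta> * z\<^sup>2" by simp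
      thus ?thesis unfolding exp_add[symmetric] by simp
    qed
    finally show ?thesis using assms by (simp add: field_simps)
  qed
  show "1 \<le> exp (- (\<eta> * b\<^sup>2)) * exp (\<eta> * z\<^sup>2)" if b: "b < \<bar>z\<bar>"
    unfolding exp_add[symmetric] using sq[OF b] assms by simp
  have "1 + \<eta> * z\<^sup>2 + (\<eta> * z\<^sup>2)\<^sup>2 / 2 \<le> exp (\<eta> * z\<^sup>2)" by (rule exp_lower_Taylor_quadratic[OF e0])
  hence "(\<eta> * z\<^sup>2)\<^sup>2 / 2 \<le> exp (\<eta> * z\<^sup>2)" using e0 by linarith
  hence z4: "\<bar>z\<bar> ^ 4 \<le> 2 / \<eta>\<^sup>2 * exp (\<eta> * z\<^sup>2)" using assms by (simp add: field_simps power_mult_distrib)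
  have "\<bar>trc b z\<bar> ^ 4 \<le> \<bar>z\<bar> ^ 4" by (intro power_mono trc_bound) simp
  thus "\<bar>trc b z\<bar> ^ 4 \<le> 0 * z\<^sup>2 + 2 / \<eta>\<^sup>2 * exp (\<eta> * z\<^sup>2)" using z4 by simp
  have "\<bar>trc b z\<bar> ^ 3 \<le> \<bar>z\<bar> ^ 3" by (intro power_mono trc_bound) simp
  also have "\<bar>z\<bar> ^ 3 \<le> z\<^sup>2 + \<bar>z\<bar> ^ 4"
  proof (cases "\<bar>z\<bar> \<le> 1")
    case True
    have "\<bar>z\<bar> ^ 3 \<le> \<bar>z\<bar>\<^sup>2" using True by (intro power_decreasing) auto
    moreover have "0 \<le> \<bar>z\<bar> ^ 4" by simp
    ultimately show ?thesis unfolding power2_abs by linarith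
  next
    case False
    have "\<bar>z\<bar> ^ 3 \<le> \<bar>z\<bar> ^ 4" using False by (intro power_increasing) auto
    thus ?thesis using zero_le_power2[of z] by linarith
  qed
  finally show "\<bar>trc b z\<bar> ^ 3 \<le> 1 * z\<^sup>2 + 2 / \<eta>\<^sup>2 * exp (\<eta> * z\<^sup>2)" using z4 by simp
qed

lemma polynomial_majorants:
  fixes b z P :: real
  assumes "2 \<le> P" "1 \<le> b"
  shows "b < \<bar>z\<bar> \<Longrightarrow> z\<^sup>2 \<le> b powr (2 - P) * \<bar>z\<bar> powr P"
    and "b < \<bar>z\<bar> \<Longrightarrow> 1 \<le> b powr (- P) * \<bar>z\<bar> powr P"
    and "\<bar>trc b z\<bar> ^ 3 \<le> b * z\<^sup>2 + 0 * \<bar>z\<bar> powr P" and "\<bar>trc b z\<bar> ^ 4 \<le> b\<^sup>2 * z\<^sup>2 + 0 * \<bar>z\<bar> powr P"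
proof -
  show "z\<^sup>2 \<le> b powr (2 - P) * \<bar>z\<bar> powr P" if "b < \<bar>z\<bar>"
  proof -
    have "z\<^sup>2 = \<bar>z\<bar> powr (2 - P) * \<bar>z\<bar> powr P" using that assms unfolding powr_add[symmetric] by (simp add: powr_numeral)
    also have "\<dots> \<le> b powr (2 - P) * \<bar>z\<bar> powr P" using that assms by (intro mult_right_mono powr_mono2') auto
    finally show ?thesis .
  qed
  show "1 \<le> b powr (- P) * \<bar>z\<bar> powr P" if "b < \<bar>z\<bar>"
  proof -
    have "1 = b powr (- P) * b powr P" using assms unfolding powr_add[symmetric] by simp
    also have "\<dots> \<le> b powr (- P) * \<bar>z\<bar> powr P" using that assms by (intro mult_left_mono powr_mono2) auto
    finally show ?thesis .
  qed
  have tb: "\<bar>trc b z\<bar> \<le> b" and tz: "\<bar>trc b z\<bar>\<^sup>2 \<le> z\<^sup>2" using trc_bound(1)[of b z] trc_bound(3)[of b z] assms by auto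
  have "\<bar>trc b z\<bar> * \<bar>trc b z\<bar>\<^sup>2 \<le> b * z\<^sup>2" using tb tz assms by (intro mult_mono) auto
  thus "\<bar>trc b z\<bar> ^ 3 \<le> b * z\<^sup>2 + 0 * \<bar>z\<bar> powr P" by (simp add: power3_eq_cube power2_eq_square mult.assoc)
  have "\<bar>trc b z\<bar>\<^sup>2 * \<bar>trc b z\<bar>\<^sup>2 \<le> b\<^sup>2 * z\<^sup>2" using power_mono[OF tb, of 2] tz by (intro mult_mono) auto
  thus "\<bar>trc b z\<bar> ^ 4 \<le> b\<^sup>2 * z\<^sup>2 + 0 * \<bar>z\<bar> powr P" by (simp add: power4_eq_xxxx power2_eq_square mult.assoc)
qed

lemma effective_size:
  fixes x y a c :: real
  assumes "0 < a" "0 < c" "1 \<le> x" "1 \<le> y" "a * x \<le> y" "y \<le> c * x"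
  shows "0 < x * y / (x + y)" "x * y / (x + y) \<le> x" "x * y / (x + y) \<le> y" "x + y \<le> (1 + c) * (1 + 1 / a) * (x * y / (x + y))"
proof -
  show "0 < x * y / (x + y)" "x * y / (x + y) \<le> x" "x * y / (x + y) \<le> y" using assms by (auto simp: divide_le_eq algebra_simps)
  have "x \<le> y / a" using assms by (simp add: field_simps)
  hence "x + y \<le> (1 + 1 / a) * y" by (simp add: algebra_simps)
  moreover have "x + y \<le> (1 + c) * x" using assms by (simp add: algebra_simps)
  ultimately have "(x + y) * (x + y) \<le> ((1 + c) * x) * ((1 + 1 / a) * y)" using assms by (intro mult_mono) auto
  thus "x + y \<le> (1 + c) * (1 + 1 / a) * (x * y / (x + y))" using assms by (simp add: le_divide_eq mult_ac)
qed

lemma qnum_le_sq: "real (qnum p) \<le> (real p)\<^sup>2"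
proof -
  have "qnum p \<le> p * p" unfolding qnum_def by (meson div_le_dividend le_trans mult_le_mono2 diff_le_self)
  thus ?thesis by (metis of_nat_le_iff of_nat_mult power2_eq_square)
qed

theorem theorem3p3:
  fixes M :: "nat \<Rightarrow> 'a measure"
    and X :: "nat \<Rightarrow> nat \<Rightarrow> nat \<Rightarrow> 'a \<Rightarrow> nat \<Rightarrow> nat \<Rightarrow> real"
    and p n1 n2 :: "nat \<Rightarrow> nat"
    and \<alpha> r \<xi> \<nu> c1 :: real
  assumes prob: "\<And>k. prob_space (M k)"
    and indep: "\<And>k. prob_space.indep_vars (M k) (\<lambda>_. mat_space (p k))
                  (\<lambda>(d, l). mat_rv (p k) (X k) d l) (obs_index (n1 k) (n2 k))"
    and ident: "\<And>k d l. (d, l) \<in> obs_index (n1 k) (n2 k) \<Longrightarrow>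
                  distr (M k) (mat_space (p k)) (mat_rv (p k) (X k) d l)
                  = distr (M k) (mat_space (p k)) (mat_rv (p k) (X k) d 1)"
    and symm: "\<And>k d l \<omega> i j. (d, l) \<in> obs_index (n1 k) (n2 k) \<Longrightarrow> \<omega> \<in> space (M k) \<Longrightarrow>
                  i \<in> {1..p k} \<Longrightarrow> j \<in> {1..p k} \<Longrightarrow> X k d l \<omega> i j = X k d l \<omega> j i"
    and moments: "\<And>k d e. d \<in> {1, 2} \<Longrightarrow> e \<in> pairs (p k) \<Longrightarrow>
                  integrable (M k) (\<lambda>\<omega>. (X k d 1 \<omega> (fst e) (snd e))\<^sup>2) \<and> svar (M k) (X k) d e > 0"
    and balanced: "\<exists>a b. 0 < a \<and> 0 < b \<and>
                  (\<forall>k. a * real (n1 k) \<le> real (n2 k) \<and> real (n2 k) \<le> b * real (n1 k))"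
    and lim_n1: "filterlim n1 at_top sequentially"
    and lim_n2: "filterlim n2 at_top sequentially"
    and lim_q: "filterlim (\<lambda>k. qnum (p k)) at_top sequentially"
    and alpha: "0 < \<alpha>" "\<alpha> < 1"
    and A2: "0 < r" "r < 1"
      "\<And>k d e e'. d \<in> {1, 2} \<Longrightarrow> e \<in> pairs (p k) \<Longrightarrow> e' \<in> pairs (p k) \<Longrightarrow> e \<noteq> e' \<Longrightarrow>
          \<bar>rcorr (M k) (X k) d e e'\<bar> < r"
    and B1: "\<exists>\<delta> > 0. \<exists>\<rho>0 > 0. \<forall>\<rho>. 0 < \<rho> \<and> \<rho> < \<rho>0 \<longrightarrow> (\<forall>k.
              real (card (Sset (M k) (X k) (p k) (n1 k) (n2 k) \<rho>))
                \<ge> (1 / (sqrt pi * \<alpha>) + \<delta>) * sqrt (ln (real (qnum (p k)))))"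
    and B2: "0 < \<xi>" "0 < \<nu>" "\<nu> < (1 - r) / (1 + r)"
      "(\<lambda>k. Max ((\<lambda>e. real (card (Aset (M k) (X k) (p k) \<xi> e))) ` pairs (p k)))
         \<in> o(\<lambda>k. real (qnum (p k)) powr \<nu>)"
    and B3: "0 < c1" "\<And>k. real (card (H0 (M k) (X k) (p k))) \<ge> c1 * real (qnum (p k))"
    and C: "(\<lambda>k. ln (real (p k))) \<in> o(\<lambda>k. (real (n1 k) * real (n2 k) / real (n1 k + n2 k)) powr (1/5))
            \<and> (\<exists>\<eta> > 0. \<exists>K > 0. \<forall>k d l e. (d, l) \<in> obs_index (n1 k) (n2 k) \<longrightarrow> e \<in> pairs (p k) \<longrightarrow>
                (\<integral>\<^sup>+\<omega>. ennreal (exp (\<eta> * (X k d l \<omega> (fst e) (snd e) - smean (M k) (X k) d e)\<^sup>2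
                                       / svar (M k) (X k) d e)) \<partial>M k) \<le> ennreal K)
          \<or> (\<exists>\<gamma>0 > 0. \<exists>c > 0.
              (\<forall>k. real (p k) \<le> c * (real (n1 k) * real (n2 k) / real (n1 k + n2 k)) powr \<gamma>0)
            \<and> (\<exists>\<epsilon> > 0. \<exists>K > 0. \<forall>k d l e. (d, l) \<in> obs_index (n1 k) (n2 k) \<longrightarrow> e \<in> pairs (p k) \<longrightarrow>
                (\<integral>\<^sup>+\<omega>. ennreal (\<bar>(X k d l \<omega> (fst e) (snd e) - smean (M k) (X k) d e)
                                       / sqrt (svar (M k) (X k) d e)\<bar> powr (4 * \<gamma>0 + 2 + \<epsilon>)) \<partial>M k)
                  \<le> ennreal K))"
  shows "(\<lambda>k. mean (M k) (\<lambda>\<omega>. FDP (p k) (H0 (M k) (X k) (p k)) \<alpha> (Tstat (X k) (n1 k) (n2 k) \<omega>))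
            / (\<alpha> * real (card (H0 (M k) (X k) (p k))) / real (qnum (p k)))) \<longlonglongrightarrow> 1
        \<and> (\<forall>\<epsilon> > 0.
          (\<lambda>k. measure (M k) {\<omega> \<in> space (M k).
              \<bar>FDP (p k) (H0 (M k) (X k) (p k)) \<alpha> (Tstat (X k) (n1 k) (n2 k) \<omega>)
                / (\<alpha> * real (card (H0 (M k) (X k) (p k))) / real (qnum (p k))) - 1\<bar> > \<epsilon>})
          \<longlonglongrightarrow> 0)"
proof -
  obtain a bc where bal: "0 < a" "0 < bc" "\<And>k. a * real (n1 k) \<le> real (n2 k) \<and> real (n2 k) \<le> bc * real (n1 k)"
    using balanced by blast
  define z where "z k = real (n1 k) * real (n2 k) / real (n1 k + n2 k)" for k
  define L where "L k = ln (real (qnum (p k)))" for k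
  define q where "q k = real (qnum (p k))" for k
  define N where "N k = real (n1 k + n2 k)" for k
  define Cn where "Cn = (1 + bc) * (1 + 1 / a)"
  have Cn: "0 < Cn" unfolding Cn_def using bal by (intro mult_pos_pos add_pos_pos) auto
  have "\<forall>\<^sub>F k in sequentially. 1 \<le> n1 k" "\<forall>\<^sub>F k in sequentially. 1 \<le> n2 k" using lim_n1 lim_n2 by (auto simp: filterlim_at_top)
  hence size: "\<forall>\<^sub>F k in sequentially. 1 \<le> n1 k \<and> 1 \<le> n2 k \<and> 0 < z k \<and> z k \<le> real (n1 k) \<and> z k \<le> real (n2 k) \<and> N k \<le> Cn * z k"
  proof eventually_elim
    case (elim k)
    thus ?case using effective_size[of a bc "real (n1 k)" "real (n2 k)"] bal(1,2) bal(3)[of k]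
      unfolding z_def N_def Cn_def of_nat_add by simp
  qed
  have z_top: "filterlim z at_top sequentially"
  proof (rule filterlim_at_top_mono)
    have "filterlim (\<lambda>k. real (n1 k)) at_top sequentially" by (rule filterlim_compose[OF filterlim_real_sequentially lim_n1])
    moreover have "filterlim (\<lambda>x::real. x / Cn) at_top at_top" using Cn by real_asymp
    ultimately show "filterlim (\<lambda>k. real (n1 k) / Cn) at_top sequentially" by (rule filterlim_compose[rotated])
    show "\<forall>\<^sub>F k in sequentially. real (n1 k) / Cn \<le> z k" using size
    proof eventually_elim
      case (elim k)
      have "real (n1 k) \<le> Cn * z k" using elim unfolding N_def by simp
      thus ?case using Cn by (simp add: divide_le_eq mult.commute)
    qed
  qed
  have ts: "\<forall>\<^sub>F k in sequentially. two_sample (M k) (X k) (p k) (n1 k) (n2 k)" using size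
  proof eventually_elim
    case (elim k)
    interpret prob_space "M k" by (rule prob)
    show ?case by unfold_locales (use indep ident moments elim in blast)+
  qed
  have "filterlim (\<lambda>k. real (qnum (p k))) at_top sequentially" by (rule filterlim_compose[OF filterlim_real_sequentially lim_q])
  from filterlim_compose[OF ln_at_top this] have L1: "\<forall>\<^sub>F k in sequentially. 1 \<le> L k" unfolding L_def by (auto simp: filterlim_at_top)
  have "\<forall>\<^sub>F k in sequentially. 1 \<le> qnum (p k)" using lim_q by (auto simp: filterlim_at_top)
  hence qe: "\<forall>\<^sub>F k in sequentially. q k = exp (L k)" by eventually_elim (simp add: q_def L_def)
  have NC: "\<forall>\<^sub>F k in sequentially. 0 \<le> N k \<and> N k \<le> Cn * z k" using size by eventually_elim (simp add: N_def)
  obtain \<delta> \<rho>0 where dr: "0 < \<delta>" "0 < \<rho>0" "\<And>\<rho> k. 0 < \<rho> \<Longrightarrow> \<rho> < \<rho>0 \<Longrightarrow>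
      real (card (Sset (M k) (X k) (p k) (n1 k) (n2 k) \<rho>)) \<ge> (1 / (sqrt pi * \<alpha>) + \<delta>) * sqrt (ln (real (qnum (p k))))"
    using B1 by blast
  define c2 where "c2 = 1 / (sqrt pi * \<alpha>) + \<delta>"
  have c2: "0 < c2" unfolding c2_def using dr alpha by (simp add: add_pos_pos)
  have rho: "0 < \<rho>0 / 2" using dr by simp
  have S: "\<And>k. c2 * sqrt (ln (real (qnum (p k)))) \<le> real (card (Sset (M k) (X k) (p k) (n1 k) (n2 k) (\<rho>0 / 2)))"
    using dr(3)[of "\<rho>0 / 2"] dr(2) unfolding c2_def by simp
  have concl: ?thesis
    if trunc: "\<forall>\<^sub>F k in sequentially. truncated (M k) (X k) (p k) (n1 k) (n2 k) (b k) (ka k) (m3 k) (m4 k) (z k)"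
      and tail: "\<forall>\<^sub>F k in sequentially. \<forall>d l e. (d, l) \<in> obs_index (n1 k) (n2 k) \<longrightarrow> e \<in> pairs (p k) \<longrightarrow>
        measure (M k) {\<omega> \<in> space (M k). b k < \<bar>Zst (M k) (X k) d l e \<omega>\<bar>} \<le> \<pi> k"
      and s: "(\<lambda>k. L k powr (5/2) * m3 k / sqrt (z k)) \<longlonglongrightarrow> 0" "(\<lambda>k. L k powr (3/2) * b k / sqrt (z k)) \<longlonglongrightarrow> 0"
        "\<forall>\<^sub>F k in sequentially. 0 < t k \<and> 4 * (b k)\<^sup>2 * t k \<le> 1"
        "(\<lambda>k. L k * (t k * m4 k + 6 * L k / (z k * t k))) \<longlonglongrightarrow> 0"
        "(\<lambda>k. L k ^ 4 * ka k) \<longlonglongrightarrow> 0" "(\<lambda>k. sqrt (L k) * (ka k / b k * sqrt (N k))) \<longlonglongrightarrow> 0" "(\<lambda>k. q k * N k * \<pi> k) \<longlonglongrightarrow> 0"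
    for b ka m3 m4 t \<pi>
  proof -
    have nbd: "\<forall>\<^sub>F k in sequentially. real (n1 k + n2 k) \<le> Cn * (real (n1 k) * real (n2 k) / real (n1 k + n2 k))"
      using NC unfolding N_def z_def by eventually_elim blast
    interpret F: fdp_asymptotics M X p n1 n2 \<alpha> r \<xi> \<nu> c1 c2 "\<rho>0 / 2" Cn b ka m3 m4 t \<pi>
      by (rule fdp_asymptotics.intro[OF lim_q alpha A2 c2 rho S B2 B3 trunc[unfolded z_def] tail nbd Cn
        s(1,2)[unfolded z_def L_def] s(3) s(4-7)[unfolded z_def L_def N_def q_def]])
    show ?thesis using F.fdr_fdp_limits by blast
  qed
  show ?thesis
    using C
  proof (elim disjE conjE exE)
    fix \<eta> K :: real
    assume o: "(\<lambda>k. ln (real (p k))) \<in> o(\<lambda>k. (real (n1 k) * real (n2 k) / real (n1 k + n2 k)) powr (1/5))"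
      and eta: "0 < \<eta>" and K: "0 < K" and mom: "\<forall>k d l e. (d, l) \<in> obs_index (n1 k) (n2 k) \<longrightarrow> e \<in> pairs (p k) \<longrightarrow>
                (\<integral>\<^sup>+\<omega>. ennreal (exp (\<eta> * (X k d l \<omega> (fst e) (snd e) - smean (M k) (X k) d e)\<^sup>2
                                       / svar (M k) (X k) d e)) \<partial>M k) \<le> ennreal K"
    have mom': "(\<integral>\<^sup>+\<omega>. ennreal (exp (\<eta> * (Zst (M k) (X k) d l e \<omega>)\<^sup>2)) \<partial>M k) \<le> ennreal K"
      if "(d, l) \<in> obs_index (n1 k) (n2 k)" "e \<in> pairs (p k)" for k d l e
    proof -
      have "d \<in> {1, 2}" using that by (auto simp: obs_index_def)
      hence "0 < svar (M k) (X k) d e" using moments that by blast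
      hence eq: "\<eta> * (Zst (M k) (X k) d l e \<omega>)\<^sup>2 = \<eta> * (X k d l \<omega> (fst e) (snd e) - smean (M k) (X k) d e)\<^sup>2 / svar (M k) (X k) d e" for \<omega>
        unfolding Zst_def by (simp add: power_divide)
      show ?thesis unfolding eq using mom that by blast
    qed
    have Lz: "(\<lambda>k. L k / z k powr (1/5)) \<longlonglongrightarrow> 0"
    proof (rule tendsto_sandwich[where f = "\<lambda>_. 0" and h = "\<lambda>k. 2 * (ln (real (p k)) / z k powr (1/5))"])
      show "(\<lambda>k. 2 * (ln (real (p k)) / z k powr (1/5))) \<longlonglongrightarrow> 0"
        using tendsto_mult[OF tendsto_const[of 2] smalloD_tendsto[OF o[folded z_def]]] by simp
      show "\<forall>\<^sub>F k in sequentially. 0 \<le> L k / z k powr (1/5)" using L1 by eventually_elim simp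
      show "\<forall>\<^sub>F k in sequentially. L k / z k powr (1/5) \<le> 2 * (ln (real (p k)) / z k powr (1/5))" using L1 qe
      proof eventually_elim
        case (elim k)
        have q0: "0 < real (qnum (p k))" using elim(2) unfolding q_def by simp
        have "0 < real (p k)" using q0 qnum_le_sq[of "p k"] by (cases "p k = 0") auto
        moreover have "L k \<le> ln ((real (p k))\<^sup>2)" unfolding L_def using q0 by (intro ln_mono qnum_le_sq)
        ultimately have "L k \<le> 2 * ln (real (p k))" by (simp add: ln_realpow)
        thus ?case using divide_right_mono[of "L k" "2 * ln (real (p k))" "z k powr (1/5)"] by simp
      qed
    qed simp
    define m3 where "m3 = 4 * (1 + 2 / \<eta>\<^sup>2 * K + 1)"
    define m4 where "m4 = 8 * (0 + 2 / \<eta>\<^sup>2 * K + 1)"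
    have m: "0 < m3" "0 < m4" unfolding m3_def m4_def using eta K by (auto intro!: add_pos_pos)
    note R = sub_gaussian_rates[OF z_top L1 Lz NC qe eta K Cn m]
    have fm: "(\<lambda>z::real. exp (\<eta> * z\<^sup>2)) \<in> borel_measurable borel" by measurable
    show ?thesis
    proof (rule concl[OF _ _ R(2,3) _ R(4-7)])
      show "\<forall>\<^sub>F k in sequentially. truncated (M k) (X k) (p k) (n1 k) (n2 k) (z k powr (1/10))
          (2 / \<eta> * exp (- (\<eta> / 2 * (z k powr (1/10))\<^sup>2)) * K) m3 m4 (z k)"
        using R(1) ts size
      proof eventually_elim
        case (elim k)
        interpret two_sample "M k" "X k" "p k" "n1 k" "n2 k" by (rule elim)
        have b0: "0 \<le> z k powr (1/10)" by simp
        show ?case unfolding m3_def m4_def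
          by (rule truncatedI[where f = "\<lambda>z. exp (\<eta> * z\<^sup>2)", OF fm _ mom'])
            (use elim eta K sub_gaussian_majorants[OF eta b0] in auto)
      qed
      show "\<forall>\<^sub>F k in sequentially. \<forall>d l e. (d, l) \<in> obs_index (n1 k) (n2 k) \<longrightarrow> e \<in> pairs (p k) \<longrightarrow>
        measure (M k) {\<omega> \<in> space (M k). z k powr (1/10) < \<bar>Zst (M k) (X k) d l e \<omega>\<bar>} \<le> exp (- (\<eta> * (z k powr (1/10))\<^sup>2)) * K"
        using ts
      proof eventually_elim
        case (elim k)
        interpret two_sample "M k" "X k" "p k" "n1 k" "n2 k" by (rule elim)
        have b0: "0 \<le> z k powr (1/10)" by simp
        show ?case
          by (intro allI impI, rule tail_le[where f = "\<lambda>z. exp (\<eta> * z\<^sup>2)", OF fm _ mom'])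
            (use K sub_gaussian_majorants(2)[OF eta b0] in auto)
      qed
      show "\<forall>\<^sub>F k in sequentially. 0 < z k powr (-1/2) \<and> 4 * (z k powr (1/10))\<^sup>2 * z k powr (-1/2) \<le> 1"
        using R(1) by eventually_elim blast
    qed
  next
    fix \<gamma>0 c \<epsilon> K :: real
    assume gc: "0 < \<gamma>0" "0 < c" and pc: "\<forall>k. real (p k) \<le> c * (real (n1 k) * real (n2 k) / real (n1 k + n2 k)) powr \<gamma>0"
      and eK: "0 < \<epsilon>" "0 < K" and mom: "\<forall>k d l e. (d, l) \<in> obs_index (n1 k) (n2 k) \<longrightarrow> e \<in> pairs (p k) \<longrightarrow>
                (\<integral>\<^sup>+\<omega>. ennreal (\<bar>(X k d l \<omega> (fst e) (snd e) - smean (M k) (X k) d e)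
                                       / sqrt (svar (M k) (X k) d e)\<bar> powr (4 * \<gamma>0 + 2 + \<epsilon>)) \<partial>M k)
                  \<le> ennreal K"
    define P where "P = 4 * \<gamma>0 + 2 + \<epsilon>"
    define h where "h = 1 / 2 - \<epsilon> / (4 * P)"
    have P2: "2 \<le> P" unfolding P_def using gc eK by simp
    have mom': "(\<integral>\<^sup>+\<omega>. ennreal (\<bar>Zst (M k) (X k) d l e \<omega>\<bar> powr P) \<partial>M k) \<le> ennreal K"
      if "(d, l) \<in> obs_index (n1 k) (n2 k)" "e \<in> pairs (p k)" for k d l e
      unfolding Zst_def P_def using mom that by blast
    have qe': "\<forall>\<^sub>F k in sequentially. q k = exp (L k) \<and> q k \<le> c\<^sup>2 * z k powr (2 * \<gamma>0)"
      using qe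
    proof eventually_elim
      case (elim k)
      have "q k \<le> (real (p k))\<^sup>2" unfolding q_def by (rule qnum_le_sq)
      also have "\<dots> \<le> (c * z k powr \<gamma>0)\<^sup>2" using pc unfolding z_def by (intro power_mono) auto
      also have "\<dots> = c\<^sup>2 * z k powr (2 * \<gamma>0)" by (simp add: power_mult_distrib power2_eq_square flip: powr_add)
      finally show ?case using elim by simp
    qed
    have c2': "0 < c\<^sup>2" using gc by simp
    note R = polynomial_rates[OF z_top L1 NC qe' gc(1) eK Cn c2', folded P_def, folded h_def]
    have fm: "(\<lambda>z::real. \<bar>z\<bar> powr P) \<in> borel_measurable borel" by measurable
    show ?thesis
    proof (rule concl[OF _ _ R(2,3) _ R(4-7)])
      show "\<forall>\<^sub>F k in sequentially. truncated (M k) (X k) (p k) (n1 k) (n2 k) (z k powr h)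
          ((z k powr h) powr (2 - P) * K) (4 * (z k powr h + 1)) (8 * ((z k powr h)\<^sup>2 + 1)) (z k)"
        using R(1) ts size
      proof eventually_elim
        case (elim k)
        interpret two_sample "M k" "X k" "p k" "n1 k" "n2 k" by (rule elim)
        have b0: "1 \<le> z k powr h" using elim by blast
        have "truncated (M k) (X k) (p k) (n1 k) (n2 k) (z k powr h)
          ((z k powr h) powr (2 - P) * K) (4 * (z k powr h + 0 * K + 1)) (8 * ((z k powr h)\<^sup>2 + 0 * K + 1)) (z k)"
          by (rule truncatedI[where f = "\<lambda>z. \<bar>z\<bar> powr P", OF fm _ mom'])
            (use elim eK polynomial_majorants[OF P2 b0] in auto)
        thus ?case by simp
      qed
      show "\<forall>\<^sub>F k in sequentially. \<forall>d l e. (d, l) \<in> obs_index (n1 k) (n2 k) \<longrightarrow> e \<in> pairs (p k) \<longrightarrow>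
        measure (M k) {\<omega> \<in> space (M k). z k powr h < \<bar>Zst (M k) (X k) d l e \<omega>\<bar>} \<le> (z k powr h) powr (- P) * K"
        using ts R(1)
      proof eventually_elim
        case (elim k)
        interpret two_sample "M k" "X k" "p k" "n1 k" "n2 k" by (rule elim)
        have b0: "1 \<le> z k powr h" using elim by blast
        show ?case
          by (intro allI impI, rule tail_le[where f = "\<lambda>z. \<bar>z\<bar> powr P", OF fm _ mom'])
            (use eK polynomial_majorants(2)[OF P2 b0] in auto)
      qed
      show "\<forall>\<^sub>F k in sequentially. 0 < z k powr (\<epsilon> / (4 * P) - 1) \<and> 4 * (z k powr h)\<^sup>2 * z k powr (\<epsilon> / (4 * P) - 1) \<le> 1"
        using R(1) by eventually_elim blast
    qed
  qed
qed

end
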